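(* Let $\alpha\in\{0,1\}$. (1) The functor $\mathrm{Mix}_{\alpha,1}$ is infinite. (2) The subfunctor $\Sigma_{\alpha,1}$ of $\mathrm{Mix}_{\alpha,1}$ fits into a short exact sequence in $\mathcal{F}_{quad}$ $$0\to\Sigma_{\alpha,1}\to\mathrm{Mix}_{\alpha,1}\to\Sigma_{\alpha,1}\to 0.$$ (3) The functor $\Sigma_{\alpha,1}$ is uniserial, with unique composition series given by the decreasing filtration by the subfunctors $k_d\Sigma_{\alpha,1}$: $$\cdots\subset k_d\Sigma_{\alpha,1}\subset\cdots\subset k_1\Sigma_{\alpha,1}\subset k_0\Sigma_{\alpha,1}=\Sigma_{\alpha,1}.$$ (a) The head $\Sigma_{\alpha,1}/k_1\Sigma_{\alpha,1}$ of $\Sigma_{\alpha,1}$ is isomorphic to $\kappa(iso_{(x,\alpha)})$, where $iso_{(x,\alpha)}$ is a simple object of $\mathcal{F}_{iso}$. (b) For every integer $d>0$, $$k_d\Sigma_{\alpha,1}/k_{d+1}\Sigma_{\alpha,1}\simeq L_\alpha^{d+1},$$ where $L_\alpha^{d+1}$ is a simple object of $\mathcal{F}_{quad}$ that is neither in the (essential) image of $\iota$ nor in the (essential) image of $\kappa$. The functor $L_\alpha^{d+1}$ is a subfunctor of $\iota(\Lambda^{d+1})\otimes\kappa(iso_{(x,\alpha)})$, where $\Lambda^{d+1}$ is the $(d+1)$-st exterior power functor.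
   Context: $\mathcal{E}$ is the category of $\mathbb{F}_2$-vector spaces, $\mathcal{E}^f$ its full subcategory of finite-dimensional spaces. A quadratic space is a finite-dimensional $\mathbb{F}_2$-vector space $V$ with a quadratic form $q$; its bilinear form is $B(x,y)=q(x+y)+q(x)+q(y)$ (alternating); $V$ is nondegenerate if $B$ is. $\mathcal{E}_q^{\mathrm{deg}}$ is the category of (possibly degenerate) quadratic spaces with injective linear maps preserving quadratic forms; $\mathcal{E}_q$ is its full subcategory of nondegenerate spaces. $\mathcal{T}_q$ has the objects of $\mathcal{E}_q$; $\mathrm{Hom}_{\mathcal{T}_q}(V,W)$ is the set of classes $[V\xrightarrow{f}X\xleftarrow{g}W]$ of diagrams in $\mathcal{E}_q$, for the equivalence relation generated by: $(V\xrightarrow{f}X_1\xleftarrow{g}W)\sim(V\xrightarrow{u}X_2\xleftarrow{v}W)$ if there is a morphism $a:X_1\to X_2$ of $\mathcal{E}_q$ with $a f=u$, $a g=v$. The composite of $[V\to X_1\xleftarrow{g}W]$ and $[W\xrightarrow{f'}X_2\leftarrow Y]$ is $[V\to X\leftarrow Y]$, where, writing $X_1\simeq W\perp W'$ (via $g$) and $X_2\simeq W\perp W''$ (via $f'$), one takes $X=W\perp W'\perp W''$ with the evident inclusions of $X_1$ and $X_2$. $\mathcal{F}_{quad}$ is the (abelian) category of functors $\mathcal{T}_q\to\mathcal{E}$; tensor products and exactness are pointwise. $\mathcal{F}$ is the category of functors $\mathcal{E}^f\to\mathcal{E}$. The functor $\epsilon:\mathcal{T}_q\to\mathcal{E}^f$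 sends $V$ to its underlying space and $[V\xrightarrow{f}X\xleftarrow{g}W]$ to $p_g\circ f$, where $p_g:X\to W$ is the orthogonal projection ($p_g g=\mathrm{Id}$, $p_g=0$ on $g(W)^\perp$). The functor $\iota:\mathcal{F}\to\mathcal{F}_{quad}$ is $F\mapsto F\circ\epsilon$. $\mathrm{Sp}(\mathcal{E}_q^{\mathrm{deg}})$ is the category of spans in $\mathcal{E}_q^{\mathrm{deg}}$: same objects, morphisms $V\to W$ are isomorphism classes of diagrams $V\leftarrow A\to W$, composed by pullback. $\mathcal{F}_{iso}$ is the category of functors $\mathrm{Sp}(\mathcal{E}_q^{\mathrm{deg}})\to\mathcal{E}$. The functor $\kappa:\mathcal{F}_{iso}\to\mathcal{F}_{quad}$ is precomposition with the functor $\mathcal{T}_q\to\mathrm{Sp}(\mathcal{E}_q^{\mathrm{deg}})$ which is the identity on objects and sends $[V\to X\leftarrow W]$ to the span $V\leftarrow V\times_X W\to W$. For $D\in\mathcal{E}_q^{\mathrm{deg}}$, $iso_D\in\mathcal{F}_{iso}$ is the functor with $iso_D(W)=\mathbb{F}_2[\mathrm{Hom}_{\mathcal{E}_q^{\mathrm{deg}}}(D,W)]$, a span $W\xleftarrow{a}A\xrightarrow{b}X$ sending $[h]$ to $[b h']$ if $h=a h'$ for some $h':D\to A$, and to $0$ otherwise. Hence $\kappa(iso_D)([W\xrightarrow{f}Y\xleftarrow{g}X])[h]=[h']$ if $f h(D)\subset g(X)$, where $g h'=f h$, and $0$ otherwise. $(x,\alpha)$ is the one-dimensional quadratic space generated by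 $x$ with $q(x)=\alpha$. $P_{\mathbb{F}}\in\mathcal{F}$ is $W\mapsto\mathbb{F}_2[W]$. $\mathrm{Mix}_{\alpha,1}$ is the subfunctor of $\iota(P_{\mathbb{F}})\otimes\kappa(iso_{(x,\alpha)})$ such that $\mathrm{Mix}_{\alpha,1}(W)$ is spanned by the $[w]\otimes[h]$ with $B(w,h(x))=1$. For $w_1,w_2\in W$ with $q(w_1+w_2)=\alpha$, $B(w_1,w_2)=1$, write $[(w_1,w_2)]=[w_2]\otimes[h]$ with $h(x)=w_1+w_2$; these form a basis of $\mathrm{Mix}_{\alpha,1}(W)$. The group $\mathfrak{S}_2$ acts naturally by $[(w_1,w_2)]\mapsto[(w_2,w_1)]$, and $\Sigma_{\alpha,1}$ is the subfunctor of invariants. Put $[\{w_1,w_2\}]=[(w_1,w_2)]+[(w_2,w_1)]\in\Sigma_{\alpha,1}(W)$. For $d\ge0$, $k_d\Sigma_{\alpha,1}(V)$ is the subspace of $\Sigma_{\alpha,1}(V)$ spanned by the elements $\sum_{z\in\mathcal{L}}[\{v+z,w+z\}]$ with $[\{v,w\}]\in\Sigma_{\alpha,1}(V)$ and $\mathcal{L}$ a $d$-dimensional linear subspace of $\mathrm{Vect}(v+w)^\perp$ ($\mathrm{Vect}$ denotes linear span). Write $\Lambda^n\otimes iso_\alpha$ for $\iota(\Lambda^n)\otimes\kappa(iso_{(x,\alpha)})$. Let $\mu_n:\Lambda^n\otimes iso_\alpha\to\Lambda^{n+1}\otimes iso_\alpha$, $z\otimes[h]\mapsto z\wedge h(x)\otimes[h]$,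 and $\nu_n:\Lambda^{n+1}\otimes iso_\alpha\to\Lambda^n\otimes iso_\alpha$, $v_1\wedge\dots\wedge v_{n+1}\otimes[h]\mapsto\sum_i B(v_i,h(x))\,v_1\wedge\dots\wedge\widehat{v_i}\wedge\dots\wedge v_{n+1}\otimes[h]$. Let $K_\alpha^n=\ker\mu_n$; $\nu_{n}$ restricts to $\nu_n^K:K_\alpha^{n+1}\to K_\alpha^n$ for $n\geq 1$. For $n\ge2$, $L_\alpha^n=\ker(\nu_{n-1}^K:K_\alpha^n\to K_\alpha^{n-1})$. Terminology: a functor is infinite if it does not have a finite composition series; uniserial means that the lattice of subfunctors is totally ordered; a composition series of $\Sigma_{\alpha,1}$ here is a (possibly infinite) decreasing filtration by subfunctors, with zero intersection and simple successive quotients. *)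

theory Defs
  imports
    "HOL-Algebra.AbelCoset"
    "HOL-Algebra.Module"
    "HOL-Library.FuncSet"
    "HOL-Library.Z2"
    "HOL-Library.Extended_Nat"
    "HOL-Library.Infinite_Typeclass"
begin

section \<open>Vector spaces over the field with two elements\<close>

text \<open>
  Vector spaces are modules, in the sense of HOL-Algebra, over the field \<open>F2\<close> carried by the
  type \<open>bit\<close>. The record fields \<open>mult\<close> and \<open>one\<close> of a module are not used by the
  library locale \<open>module\<close>; they are \<open>undefined\<close> in the constructions below.
\<close>

definition F2 :: "bit ring" where
  "F2 = \<lparr>carrier = UNIV, monoid.mult = (*), one = 1, ring.zero = 0, add = (+)\<rparr>"

definition lin_maps ::
    "(bit, 'a, 'x) module_scheme \<Rightarrow> (bit, 'b, 'y) module_scheme \<Rightarrow> ('a \<Rightarrow> 'b) set" where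
  "lin_maps M N = {f \<in> carrier M \<rightarrow> carrier N.
     (\<forall>u\<in>carrier M. \<forall>v\<in>carrier M. f (u \<oplus>\<^bsub>M\<^esub> v) = f u \<oplus>\<^bsub>N\<^esub> f v) \<and>
     (\<forall>c. \<forall>v\<in>carrier M. f (c \<odot>\<^bsub>M\<^esub> v) = c \<odot>\<^bsub>N\<^esub> f v)}"

definition vspan :: "(bit, 'a, 'x) module_scheme \<Rightarrow> 'a set \<Rightarrow> 'a set" where
  "vspan M S = \<Inter>{N. submodule N F2 M \<and> S \<subseteq> N}"

definition fin_dim :: "(bit, 'a, 'x) module_scheme \<Rightarrow> bool" where
  "fin_dim M \<longleftrightarrow> (\<exists>S. finite S \<and> S \<subseteq> carrier M \<and> vspan M S = carrier M)"

definition has_dim :: "(bit, 'a, 'x) module_scheme \<Rightarrow> 'a set \<Rightarrow> nat \<Rightarrow> bool" where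
  "has_dim M U d \<longleftrightarrow> (\<exists>B. finite B \<and> card B = d \<and> B \<subseteq> carrier M \<and>
     vspan M B = U \<and> (\<forall>b\<in>B. b \<notin> vspan M (B - {b})))"

definition quot_mod :: "(bit, 'a, 'x) module_scheme \<Rightarrow> 'a set \<Rightarrow> (bit, 'a set) module" where
  "quot_mod M N = \<lparr>carrier = a_rcosets\<^bsub>M\<^esub> N, monoid.mult = undefined, one = undefined,
     ring.zero = N, add = (<+>\<^bsub>M\<^esub>),
     smult = (\<lambda>c K. \<Union>v\<in>K. N +>\<^bsub>M\<^esub> (c \<odot>\<^bsub>M\<^esub> v))\<rparr>"

text \<open>The map on cosets induced by \<open>f\<close>, with values in the quotient of \<open>M'\<close> by \<open>N'\<close>.\<close>

definition quot_map :: "(bit, 'b, 'y) module_scheme \<Rightarrow> 'b set \<Rightarrow> ('a \<Rightarrow> 'b) \<Rightarrow> 'a set \<Rightarrow> 'b set" where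
  "quot_map M' N' f K = (\<Union>v\<in>K. N' +>\<^bsub>M'\<^esub> f v)"

text \<open>The space freely generated by a set: finitely supported functions on it.\<close>

definition free_mod :: "'s set \<Rightarrow> (bit, 's \<Rightarrow> bit) module" where
  "free_mod S = \<lparr>carrier = {v. finite {s. v s \<noteq> 0} \<and> {s. v s \<noteq> 0} \<subseteq> S},
     monoid.mult = undefined, one = undefined,
     ring.zero = (\<lambda>s. 0), add = (\<lambda>u v s. u s + v s), smult = (\<lambda>c v s. c * v s)\<rparr>"

definition gen :: "'s \<Rightarrow> 's \<Rightarrow> bit" where
  "gen s = (\<lambda>t. if t = s then 1 else 0)"

text \<open>Linear extension of a partial map on generators; generators without image go to \<open>0\<close>.\<close>

definition free_map :: "('s \<Rightarrow> 't option) \<Rightarrow> ('s \<Rightarrow> bit) \<Rightarrow> 't \<Rightarrow> bit" where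
  "free_map \<phi> v = (\<lambda>t. \<Sum>s | v s \<noteq> 0 \<and> \<phi> s = Some t. v s)"

definition presented :: "'s set \<Rightarrow> ('s \<Rightarrow> bit) set \<Rightarrow> (bit, ('s \<Rightarrow> bit) set) module" where
  "presented S R = quot_mod (free_mod S) (vspan (free_mod S) R)"

definition pres_gen :: "'s set \<Rightarrow> ('s \<Rightarrow> bit) set \<Rightarrow> 's \<Rightarrow> ('s \<Rightarrow> bit) set" where
  "pres_gen S R s = vspan (free_mod S) R +>\<^bsub>free_mod S\<^esub> gen s"

definition pres_map ::
    "'t set \<Rightarrow> ('t \<Rightarrow> bit) set \<Rightarrow> ('s \<Rightarrow> 't) \<Rightarrow> ('s \<Rightarrow> bit) set \<Rightarrow> ('t \<Rightarrow> bit) set" where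
  "pres_map S' R' \<phi> = quot_map (free_mod S') (vspan (free_mod S') R') (free_map (Some \<circ> \<phi>))"

definition tensor_rel ::
    "(bit, 'a, 'x) module_scheme \<Rightarrow> (bit, 'b, 'y) module_scheme \<Rightarrow> ('a \<times> 'b \<Rightarrow> bit) set" where
  "tensor_rel M N =
     {gen (u \<oplus>\<^bsub>M\<^esub> u', v) - gen (u, v) - gen (u', v) | u u' v.
        u \<in> carrier M \<and> u' \<in> carrier M \<and> v \<in> carrier N} \<union>
     {gen (u, v \<oplus>\<^bsub>N\<^esub> v') - gen (u, v) - gen (u, v') | u v v'.
        u \<in> carrier M \<and> v \<in> carrier N \<and> v' \<in> carrier N} \<union>
     {gen (c \<odot>\<^bsub>M\<^esub> u, v) - (\<lambda>s. c * gen (u, v) s) | c u v.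
        u \<in> carrier M \<and> v \<in> carrier N} \<union>
     {gen (u, c \<odot>\<^bsub>N\<^esub> v) - (\<lambda>s. c * gen (u, v) s) | c u v.
        u \<in> carrier M \<and> v \<in> carrier N}"

definition tensor_mod ::
    "(bit, 'a, 'x) module_scheme \<Rightarrow> (bit, 'b, 'y) module_scheme \<Rightarrow>
     (bit, ('a \<times> 'b \<Rightarrow> bit) set) module" where
  "tensor_mod M N = presented (carrier M \<times> carrier N) (tensor_rel M N)"

definition tens ::
    "(bit, 'a, 'x) module_scheme \<Rightarrow> (bit, 'b, 'y) module_scheme \<Rightarrow> 'a \<Rightarrow> 'b \<Rightarrow>
     ('a \<times> 'b \<Rightarrow> bit) set" where
  "tens M N u v = pres_gen (carrier M \<times> carrier N) (tensor_rel M N) (u, v)"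

definition tuples :: "nat \<Rightarrow> (bit, 'a, 'x) module_scheme \<Rightarrow> 'a list set" where
  "tuples n M = {vs. length vs = n \<and> set vs \<subseteq> carrier M}"

definition ext_rel :: "nat \<Rightarrow> (bit, 'a, 'x) module_scheme \<Rightarrow> ('a list \<Rightarrow> bit) set" where
  "ext_rel n M =
     {gen (vs[i := u \<oplus>\<^bsub>M\<^esub> v]) - gen (vs[i := u]) - gen (vs[i := v]) | vs i u v.
        vs \<in> tuples n M \<and> i < n \<and> u \<in> carrier M \<and> v \<in> carrier M} \<union>
     {gen (vs[i := c \<odot>\<^bsub>M\<^esub> u]) - (\<lambda>s. c * gen (vs[i := u]) s) | vs i c u.
        vs \<in> tuples n M \<and> i < n \<and> u \<in> carrier M} \<union>
     {gen vs | vs. vs \<in> tuples n M \<and> (\<exists>i j. i < j \<and> j < n \<and> vs ! i = vs ! j)}"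

definition ext_mod ::
    "nat \<Rightarrow> (bit, 'a, 'x) module_scheme \<Rightarrow> (bit, ('a list \<Rightarrow> bit) set) module" where
  "ext_mod n M = presented (tuples n M) (ext_rel n M)"

text \<open>\<open>wedge n M [v1, ..., vn]\<close> is the decomposable element given by \<open>v1, ..., vn\<close>.\<close>

definition wedge :: "nat \<Rightarrow> (bit, 'a, 'x) module_scheme \<Rightarrow> 'a list \<Rightarrow> ('a list \<Rightarrow> bit) set" where
  "wedge n M vs = pres_gen (tuples n M) (ext_rel n M) vs"


section \<open>Categories and functors to vector spaces\<close>

text \<open>Composition \<open>Comp C X Y Z n m\<close> is \<open>m : X \<rightarrow> Y\<close> followed by \<open>n : Y \<rightarrow> Z\<close>.\<close>

record ('o, 'm) cat =
  Obj :: "'o set"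
  Hom :: "'o \<Rightarrow> 'o \<Rightarrow> 'm set"
  Idm :: "'o \<Rightarrow> 'm"
  Comp :: "'o \<Rightarrow> 'o \<Rightarrow> 'o \<Rightarrow> 'm \<Rightarrow> 'm \<Rightarrow> 'm"

record ('o, 'm, 'u) vfun =
  fob :: "'o \<Rightarrow> (bit, 'u) module"
  fmor :: "'o \<Rightarrow> 'o \<Rightarrow> 'm \<Rightarrow> 'u \<Rightarrow> 'u"

definition is_functor :: "('o, 'm) cat \<Rightarrow> ('o, 'm, 'u) vfun \<Rightarrow> bool" where
  "is_functor C F \<longleftrightarrow>
     (\<forall>X\<in>Obj C. Module.module F2 (fob F X)) \<and>
     (\<forall>X\<in>Obj C. \<forall>Y\<in>Obj C. \<forall>m\<in>Hom C X Y. fmor F X Y m \<in> lin_maps (fob F X) (fob F Y)) \<and>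
     (\<forall>X\<in>Obj C. \<forall>z\<in>carrier (fob F X). fmor F X X (Idm C X) z = z) \<and>
     (\<forall>X\<in>Obj C. \<forall>Y\<in>Obj C. \<forall>Z\<in>Obj C. \<forall>m\<in>Hom C X Y. \<forall>n\<in>Hom C Y Z. \<forall>z\<in>carrier (fob F X).
        fmor F X Z (Comp C X Y Z n m) z = fmor F Y Z n (fmor F X Y m z))"

definition nat_trans ::
    "('o, 'm) cat \<Rightarrow> ('o, 'm, 'u) vfun \<Rightarrow> ('o, 'm, 'v) vfun \<Rightarrow> ('o \<Rightarrow> 'u \<Rightarrow> 'v) \<Rightarrow> bool" where
  "nat_trans C F G \<eta> \<longleftrightarrow> is_functor C F \<and> is_functor C G \<and>
     (\<forall>X\<in>Obj C. \<eta> X \<in> lin_maps (fob F X) (fob G X)) \<and>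
     (\<forall>X\<in>Obj C. \<forall>Y\<in>Obj C. \<forall>m\<in>Hom C X Y. \<forall>z\<in>carrier (fob F X).
        \<eta> Y (fmor F X Y m z) = fmor G X Y m (\<eta> X z))"

definition fun_iso :: "('o, 'm) cat \<Rightarrow> ('o, 'm, 'u) vfun \<Rightarrow> ('o, 'm, 'v) vfun \<Rightarrow> bool" where
  "fun_iso C F G \<longleftrightarrow> (\<exists>\<eta>. nat_trans C F G \<eta> \<and>
     (\<forall>X\<in>Obj C. bij_betw (\<eta> X) (carrier (fob F X)) (carrier (fob G X))))"

definition short_exact ::
    "('o, 'm) cat \<Rightarrow> ('o, 'm, 'u) vfun \<Rightarrow> ('o, 'm, 'v) vfun \<Rightarrow> ('o, 'm, 'w) vfun \<Rightarrow>
     ('o \<Rightarrow> 'u \<Rightarrow> 'v) \<Rightarrow> ('o \<Rightarrow> 'v \<Rightarrow> 'w) \<Rightarrow> bool" where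
  "short_exact C F G H i p \<longleftrightarrow> nat_trans C F G i \<and> nat_trans C G H p \<and>
     (\<forall>X\<in>Obj C. inj_on (i X) (carrier (fob F X)) \<and>
        i X ` carrier (fob F X) = {z \<in> carrier (fob G X). p X z = \<zero>\<^bsub>fob H X\<^esub>} \<and>
        p X ` carrier (fob G X) = carrier (fob H X))"

text \<open>A subfunctor of \<open>F\<close> is given by its underlying family of subspaces.\<close>

definition subfunctor :: "('o, 'm) cat \<Rightarrow> ('o, 'm, 'u) vfun \<Rightarrow> ('o \<Rightarrow> 'u set) \<Rightarrow> bool" where
  "subfunctor C F S \<longleftrightarrow> (\<forall>X\<in>Obj C. submodule (S X) F2 (fob F X)) \<and>
     (\<forall>X\<in>Obj C. \<forall>Y\<in>Obj C. \<forall>m\<in>Hom C X Y. fmor F X Y m ` S X \<subseteq> S Y)"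

definition sub_le :: "('o, 'm) cat \<Rightarrow> ('o \<Rightarrow> 'u set) \<Rightarrow> ('o \<Rightarrow> 'u set) \<Rightarrow> bool" where
  "sub_le C S T \<longleftrightarrow> (\<forall>X\<in>Obj C. S X \<subseteq> T X)"

definition sub_eq :: "('o, 'm) cat \<Rightarrow> ('o \<Rightarrow> 'u set) \<Rightarrow> ('o \<Rightarrow> 'u set) \<Rightarrow> bool" where
  "sub_eq C S T \<longleftrightarrow> (\<forall>X\<in>Obj C. S X = T X)"

definition sub_zero :: "('o, 'm, 'u) vfun \<Rightarrow> 'o \<Rightarrow> 'u set" where
  "sub_zero F X = {\<zero>\<^bsub>fob F X\<^esub>}"

definition sub_top :: "('o, 'm, 'u) vfun \<Rightarrow> 'o \<Rightarrow> 'u set" where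
  "sub_top F X = carrier (fob F X)"

definition subfun :: "('o, 'm, 'u) vfun \<Rightarrow> ('o \<Rightarrow> 'u set) \<Rightarrow> ('o, 'm, 'u) vfun" where
  "subfun F S = F\<lparr>fob := (\<lambda>X. (fob F X)\<lparr>carrier := S X\<rparr>)\<rparr>"

definition quotfun :: "('o, 'm, 'u) vfun \<Rightarrow> ('o \<Rightarrow> 'u set) \<Rightarrow> ('o, 'm, 'u set) vfun" where
  "quotfun F S = \<lparr>fob = (\<lambda>X. quot_mod (fob F X) (S X)),
     fmor = (\<lambda>X Y m. quot_map (fob F Y) (S Y) (fmor F X Y m))\<rparr>"

definition tensor_fun ::
    "('o, 'm, 'u) vfun \<Rightarrow> ('o, 'm, 'v) vfun \<Rightarrow> ('o, 'm, ('u \<times> 'v \<Rightarrow> bit) set) vfun" where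
  "tensor_fun F G = \<lparr>fob = (\<lambda>X. tensor_mod (fob F X) (fob G X)),
     fmor = (\<lambda>X Y m. pres_map (carrier (fob F Y) \<times> carrier (fob G Y))
        (tensor_rel (fob F Y) (fob G Y)) (map_prod (fmor F X Y m) (fmor G X Y m)))\<rparr>"

definition simple_functor :: "('o, 'm) cat \<Rightarrow> ('o, 'm, 'u) vfun \<Rightarrow> bool" where
  "simple_functor C F \<longleftrightarrow> is_functor C F \<and> \<not> sub_eq C (sub_top F) (sub_zero F) \<and>
     (\<forall>S. subfunctor C F S \<longrightarrow> sub_eq C S (sub_zero F) \<or> sub_eq C S (sub_top F))"

definition uniserial :: "('o, 'm) cat \<Rightarrow> ('o, 'm, 'u) vfun \<Rightarrow> bool" where
  "uniserial C F \<longleftrightarrow> is_functor C F \<and>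
     (\<forall>S T. subfunctor C F S \<longrightarrow> subfunctor C F T \<longrightarrow> sub_le C S T \<or> sub_le C T S)"

text \<open>
  A composition series \<open>S 0 \<supseteq> S 1 \<supseteq> \<dots>\<close> of length \<open>N\<close>, finite or not. For finite \<open>N\<close>,
  the condition on the intersection says that \<open>S N\<close> is zero.
\<close>

definition composition_series ::
    "('o, 'm) cat \<Rightarrow> ('o, 'm, 'u) vfun \<Rightarrow> enat \<Rightarrow> (nat \<Rightarrow> 'o \<Rightarrow> 'u set) \<Rightarrow> bool" where
  "composition_series C F N S \<longleftrightarrow>
     sub_eq C (S 0) (sub_top F) \<and>
     (\<forall>i. enat i \<le> N \<longrightarrow> subfunctor C F (S i)) \<and>
     (\<forall>i. enat i < N \<longrightarrow> sub_le C (S (Suc i)) (S i) \<and>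
        simple_functor C (quotfun (subfun F (S i)) (S (Suc i)))) \<and>
     sub_eq C (\<lambda>X. \<Inter>i\<in>{i. enat i \<le> N}. S i X) (sub_zero F)"

definition infinite_functor :: "('o, 'm) cat \<Rightarrow> ('o, 'm, 'u) vfun \<Rightarrow> bool" where
  "infinite_functor C F \<longleftrightarrow> is_functor C F \<and> \<not> (\<exists>n S. composition_series C F (enat n) S)"

definition maximal_subfunctor :: "('o, 'm) cat \<Rightarrow> ('o, 'm, 'u) vfun \<Rightarrow> ('o \<Rightarrow> 'u set) \<Rightarrow> bool" where
  "maximal_subfunctor C F S \<longleftrightarrow> subfunctor C F S \<and> \<not> sub_eq C S (sub_top F) \<and>
     (\<forall>T. subfunctor C F T \<longrightarrow> sub_le C S T \<longrightarrow> sub_eq C T S \<or> sub_eq C T (sub_top F))"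

text \<open>The head of \<open>F\<close> is the quotient of \<open>F\<close> by its radical.\<close>

definition radical :: "('o, 'm) cat \<Rightarrow> ('o, 'm, 'u) vfun \<Rightarrow> 'o \<Rightarrow> 'u set" where
  "radical C F X = carrier (fob F X) \<inter> (\<Inter>{S X | S. maximal_subfunctor C F S})"


section \<open>Quadratic spaces\<close>

text \<open>
  The universe is an infinite type \<open>'a\<close>: objects are the spaces whose underlying set is a set
  of elements of \<open>'a\<close>. Finite-dimensional spaces being finite sets, each of them has an
  isomorphic copy in this universe. Linear maps between objects are taken extensional, so that
  they are determined by their values on the source.
\<close>

record ('r, 'a) qspace = "('r, 'a) module" +
  qf :: "'a \<Rightarrow> 'r"

type_synonym 'a qsp = "(bit, 'a) qspace"
type_synonym 'a fsp = "(bit, 'a) module"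

definition bil :: "'a qsp \<Rightarrow> 'a \<Rightarrow> 'a \<Rightarrow> bit" where
  "bil V u v = qf V (u \<oplus>\<^bsub>V\<^esub> v) + qf V u + qf V v"

definition quadratic_space :: "'a qsp \<Rightarrow> bool" where
  "quadratic_space V \<longleftrightarrow> Module.module F2 V \<and> fin_dim V \<and>
     (\<forall>c. \<forall>v\<in>carrier V. qf V (c \<odot>\<^bsub>V\<^esub> v) = c\<^sup>2 * qf V v) \<and>
     (\<forall>u\<in>carrier V. \<forall>v\<in>carrier V. \<forall>w\<in>carrier V.
        bil V (u \<oplus>\<^bsub>V\<^esub> v) w = bil V u w + bil V v w \<and>
        bil V w (u \<oplus>\<^bsub>V\<^esub> v) = bil V w u + bil V w v) \<and>
     (\<forall>c. \<forall>v\<in>carrier V. \<forall>w\<in>carrier V.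
        bil V (c \<odot>\<^bsub>V\<^esub> v) w = c * bil V v w \<and> bil V w (c \<odot>\<^bsub>V\<^esub> v) = c * bil V w v)"

definition perp :: "'a qsp \<Rightarrow> 'a set \<Rightarrow> 'a set" where
  "perp V U = {v \<in> carrier V. \<forall>u\<in>U. bil V v u = 0}"

definition nondegenerate :: "'a qsp \<Rightarrow> bool" where
  "nondegenerate V \<longleftrightarrow> quadratic_space V \<and> perp V (carrier V) = {\<zero>\<^bsub>V\<^esub>}"

definition qhom :: "'a qsp \<Rightarrow> 'a qsp \<Rightarrow> ('a \<Rightarrow> 'a) set" where
  "qhom V W = {f \<in> lin_maps V W. f \<in> extensional (carrier V) \<and> inj_on f (carrier V) \<and>
     (\<forall>v\<in>carrier V. qf W (f v) = qf V v)}"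

text \<open>\<open>line_qspace D x \<alpha>\<close>: \<open>D\<close> is the one-dimensional space \<open>(x, \<alpha>)\<close> generated by \<open>x\<close>.\<close>

definition line_qspace :: "'a qsp \<Rightarrow> 'a \<Rightarrow> bit \<Rightarrow> bool" where
  "line_qspace D x \<alpha> \<longleftrightarrow> quadratic_space D \<and> x \<in> carrier D \<and> x \<noteq> \<zero>\<^bsub>D\<^esub> \<and>
     vspan D {x} = carrier D \<and> qf D x = \<alpha>"


section \<open>The categories of finite-dimensional spaces, of cospans and of spans\<close>

definition Ef :: "('a fsp, 'a \<Rightarrow> 'a) cat" where
  "Ef = \<lparr>Obj = {V. Module.module F2 V \<and> fin_dim V},
     Hom = (\<lambda>V W. lin_maps V W \<inter> extensional (carrier V)),
     Idm = (\<lambda>V. restrict id (carrier V)),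
     Comp = (\<lambda>U V W g f. compose (carrier U) g f)\<rparr>"

text \<open>
  A triple \<open>(X, f, g)\<close> stands for the cospan \<open>V \<rightarrow> X \<leftarrow> W\<close> or for the span \<open>V \<leftarrow> X \<rightarrow> W\<close>.
  Morphisms of the categories below are sets of such triples, namely equivalence classes.
\<close>

type_synonym 'a triple = "'a qsp \<times> ('a \<Rightarrow> 'a) \<times> ('a \<Rightarrow> 'a)"

definition rep :: "'b set \<Rightarrow> 'b" where
  "rep K = (SOME c. c \<in> K)"

definition cospans :: "'a qsp \<Rightarrow> 'a qsp \<Rightarrow> 'a triple set" where
  "cospans V W = {(X, f, g). nondegenerate X \<and> f \<in> qhom V X \<and> g \<in> qhom W X}"

definition cospan_step :: "'a qsp \<Rightarrow> 'a qsp \<Rightarrow> 'a triple \<Rightarrow> 'a triple \<Rightarrow> bool" where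
  "cospan_step V W = (\<lambda>(X1, f, g) (X2, u, v).
     (X1, f, g) \<in> cospans V W \<and> (X2, u, v) \<in> cospans V W \<and>
     (\<exists>a\<in>qhom X1 X2. compose (carrier V) a f = u \<and> compose (carrier W) a g = v))"

definition cospan_class :: "'a qsp \<Rightarrow> 'a qsp \<Rightarrow> 'a triple \<Rightarrow> 'a triple set" where
  "cospan_class V W c = {c'. equivclp (cospan_step V W) c c'}"

text \<open>
  \<open>X\<close> with \<open>i1\<close>, \<open>i2\<close> is the orthogonal sum of \<open>W\<close>, \<open>W'\<close> and \<open>W''\<close>, where \<open>W'\<close> and \<open>W''\<close> are
  the orthogonals of \<open>W\<close> in \<open>X1\<close> and \<open>X2\<close>, embedded by \<open>g\<close> and \<open>f\<close> respectively.
\<close>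

definition amalgam ::
    "'a qsp \<Rightarrow> 'a qsp \<Rightarrow> ('a \<Rightarrow> 'a) \<Rightarrow> 'a qsp \<Rightarrow> ('a \<Rightarrow> 'a) \<Rightarrow> 'a triple \<Rightarrow> bool" where
  "amalgam W X1 g X2 f = (\<lambda>(X, i1, i2).
     nondegenerate X \<and> i1 \<in> qhom X1 X \<and> i2 \<in> qhom X2 X \<and>
     (\<forall>w\<in>carrier W. i1 (g w) = i2 (f w)) \<and>
     (\<forall>s\<in>perp X1 (g ` carrier W). \<forall>t\<in>perp X2 (f ` carrier W). bil X (i1 s) (i2 t) = 0) \<and>
     bij_betw (\<lambda>(w, s, t). i1 (g w) \<oplus>\<^bsub>X\<^esub> i1 s \<oplus>\<^bsub>X\<^esub> i2 t)
       (carrier W \<times> perp X1 (g ` carrier W) \<times> perp X2 (f ` carrier W)) (carrier X))"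

definition cospan_comp ::
    "'a qsp \<Rightarrow> 'a qsp \<Rightarrow> 'a qsp \<Rightarrow> 'a triple set \<Rightarrow> 'a triple set \<Rightarrow> 'a triple set" where
  "cospan_comp V W Y t s =
     (case rep s of (X1, f, g) \<Rightarrow> case rep t of (X2, f', g') \<Rightarrow>
        case SOME A. amalgam W X1 g X2 f' A of (X, i1, i2) \<Rightarrow>
          cospan_class V Y (X, compose (carrier V) i1 f, compose (carrier Y) i2 g'))"

definition Tq :: "('a qsp, 'a triple set) cat" where
  "Tq = \<lparr>Obj = {V. nondegenerate V},
     Hom = (\<lambda>V W. cospan_class V W ` cospans V W),
     Idm = (\<lambda>V. cospan_class V V (V, restrict id (carrier V), restrict id (carrier V))),
     Comp = cospan_comp\<rparr>"

definition spans :: "'a qsp \<Rightarrow> 'a qsp \<Rightarrow> 'a triple set" where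
  "spans V W = {(A, a, b). quadratic_space A \<and> a \<in> qhom A V \<and> b \<in> qhom A W}"

definition span_class :: "'a qsp \<Rightarrow> 'a qsp \<Rightarrow> 'a triple \<Rightarrow> 'a triple set" where
  "span_class V W = (\<lambda>(A, a, b). {(A', a', b'). (A', a', b') \<in> spans V W \<and>
     (\<exists>\<phi>\<in>qhom A A'. \<phi> ` carrier A = carrier A' \<and>
        compose (carrier A) a' \<phi> = a \<and> compose (carrier A) b' \<phi> = b)})"

text \<open>
  The pullback of \<open>f : V \<rightarrow> X\<close> and \<open>g : W \<rightarrow> X\<close> with its two projections. As \<open>g\<close> is injective,
  the set of pairs \<open>(v, w)\<close> with \<open>f v = g w\<close> is identified with its first projection.
\<close>

definition qpullback :: "'a qsp \<Rightarrow> ('a \<Rightarrow> 'a) \<Rightarrow> 'a qsp \<Rightarrow> ('a \<Rightarrow> 'a) \<Rightarrow> 'a triple" where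
  "qpullback V f W g = (let P = {v \<in> carrier V. f v \<in> g ` carrier W} in
     (V\<lparr>carrier := P\<rparr>, restrict id P, restrict (\<lambda>v. inv_into (carrier W) g (f v)) P))"

definition span_comp ::
    "'a qsp \<Rightarrow> 'a qsp \<Rightarrow> 'a qsp \<Rightarrow> 'a triple set \<Rightarrow> 'a triple set \<Rightarrow> 'a triple set" where
  "span_comp V W Y t s =
     (case rep s of (A, a, b) \<Rightarrow> case rep t of (A', a', b') \<Rightarrow>
        case qpullback A b A' a' of (P, p, p') \<Rightarrow>
          span_class V Y (P, compose (carrier P) a p, compose (carrier P) b' p'))"

definition Sp :: "('a qsp, 'a triple set) cat" where
  "Sp = \<lparr>Obj = {V. quadratic_space V},
     Hom = (\<lambda>V W. span_class V W ` spans V W),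
     Idm = (\<lambda>V. span_class V V (V, restrict id (carrier V), restrict id (carrier V))),
     Comp = span_comp\<rparr>"


section \<open>The functors iota and kappa\<close>

definition orth_proj :: "'a qsp \<Rightarrow> 'a qsp \<Rightarrow> ('a \<Rightarrow> 'a) \<Rightarrow> 'a \<Rightarrow> 'a" where
  "orth_proj X W g y = (THE w. w \<in> carrier W \<and>
     (\<exists>u\<in>perp X (g ` carrier W). y = g w \<oplus>\<^bsub>X\<^esub> u))"

definition eps_mor :: "'a qsp \<Rightarrow> 'a qsp \<Rightarrow> 'a triple set \<Rightarrow> 'a \<Rightarrow> 'a" where
  "eps_mor V W t = (case rep t of (X, f, g) \<Rightarrow> compose (carrier V) (orth_proj X W g) f)"

definition eps_obj :: "'a qsp \<Rightarrow> 'a fsp" where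
  "eps_obj V = module.truncate V"

definition iota :: "('a fsp, 'a \<Rightarrow> 'a, 'u) vfun \<Rightarrow> ('a qsp, 'a triple set, 'u) vfun" where
  "iota F = \<lparr>fob = (\<lambda>V. fob F (eps_obj V)),
     fmor = (\<lambda>V W t. fmor F (eps_obj V) (eps_obj W) (eps_mor V W t))\<rparr>"

definition cospan_to_span :: "'a qsp \<Rightarrow> 'a qsp \<Rightarrow> 'a triple set \<Rightarrow> 'a triple set" where
  "cospan_to_span V W t = (case rep t of (X, f, g) \<Rightarrow> span_class V W (qpullback V f W g))"

definition kappa ::
    "('a qsp, 'a triple set, 'u) vfun \<Rightarrow> ('a qsp, 'a triple set, 'u) vfun" where
  "kappa F = \<lparr>fob = fob F, fmor = (\<lambda>V W t. fmor F V W (cospan_to_span V W t))\<rparr>"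

definition iso_act :: "'a qsp \<Rightarrow> 'a triple \<Rightarrow> ('a \<Rightarrow> 'a) \<Rightarrow> ('a \<Rightarrow> 'a) option" where
  "iso_act D = (\<lambda>(A, a, b) h.
     if \<exists>h'\<in>qhom D A. h = compose (carrier D) a h'
     then Some (compose (carrier D) b (SOME h'. h' \<in> qhom D A \<and> h = compose (carrier D) a h'))
     else None)"

definition iso_fun :: "'a qsp \<Rightarrow> ('a qsp, 'a triple set, ('a \<Rightarrow> 'a) \<Rightarrow> bit) vfun" where
  "iso_fun D = \<lparr>fob = (\<lambda>W. free_mod (qhom D W)), fmor = (\<lambda>W X s. free_map (iso_act D (rep s)))\<rparr>"

definition PF :: "('a fsp, 'a \<Rightarrow> 'a, 'a \<Rightarrow> bit) vfun" where
  "PF = \<lparr>fob = (\<lambda>W. free_mod (carrier W)), fmor = (\<lambda>V W f. free_map (Some \<circ> f))\<rparr>"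

definition Ext :: "nat \<Rightarrow> ('a fsp, 'a \<Rightarrow> 'a, ('a list \<Rightarrow> bit) set) vfun" where
  "Ext n = \<lparr>fob = ext_mod n, fmor = (\<lambda>V W f. pres_map (tuples n W) (ext_rel n W) (map f))\<rparr>"


section \<open>The functors Mix, Sigma and the filtration of Sigma\<close>

text \<open>
  Here and below \<open>D\<close> is the line generated by \<open>x\<close>, and \<open>\<alpha>\<close> is \<open>qf D x\<close>.
\<close>

definition PF_iso ::
    "'a qsp \<Rightarrow> ('a qsp, 'a triple set, (('a \<Rightarrow> bit) \<times> (('a \<Rightarrow> 'a) \<Rightarrow> bit) \<Rightarrow> bit) set) vfun" where
  "PF_iso D = tensor_fun (iota PF) (kappa (iso_fun D))"

definition mix_gen ::
    "'a qsp \<Rightarrow> 'a qsp \<Rightarrow> 'a \<Rightarrow> ('a \<Rightarrow> 'a) \<Rightarrow> (('a \<Rightarrow> bit) \<times> (('a \<Rightarrow> 'a) \<Rightarrow> bit) \<Rightarrow> bit) set" where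
  "mix_gen D V w h = tens (fob (iota PF) V) (fob (kappa (iso_fun D)) V) (gen w) (gen h)"

definition Mix_sub ::
    "'a qsp \<Rightarrow> 'a \<Rightarrow> 'a qsp \<Rightarrow> (('a \<Rightarrow> bit) \<times> (('a \<Rightarrow> 'a) \<Rightarrow> bit) \<Rightarrow> bit) set set" where
  "Mix_sub D x V = vspan (fob (PF_iso D) V)
     {mix_gen D V w h | w h. w \<in> carrier V \<and> h \<in> qhom D V \<and> bil V w (h x) = 1}"

definition Mix where "Mix D x = subfun (PF_iso D) (Mix_sub D x)"

text \<open>The pairs \<open>(w1, w2)\<close> indexing the basis of \<open>Mix\<close>.\<close>

definition mix_pairs :: "'a qsp \<Rightarrow> 'a \<Rightarrow> 'a qsp \<Rightarrow> ('a \<times> 'a) set" where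
  "mix_pairs D x V = {(w1, w2). w1 \<in> carrier V \<and> w2 \<in> carrier V \<and>
     qf V (w1 \<oplus>\<^bsub>V\<^esub> w2) = qf D x \<and> bil V w1 w2 = 1}"

definition line_map :: "'a qsp \<Rightarrow> 'a \<Rightarrow> 'a qsp \<Rightarrow> 'a \<Rightarrow> 'a \<Rightarrow> 'a" where
  "line_map D x V v = (\<lambda>d\<in>carrier D. if d = x then v else \<zero>\<^bsub>V\<^esub>)"

definition pair_elt ::
    "'a qsp \<Rightarrow> 'a \<Rightarrow> 'a qsp \<Rightarrow> 'a \<Rightarrow> 'a \<Rightarrow> (('a \<Rightarrow> bit) \<times> (('a \<Rightarrow> 'a) \<Rightarrow> bit) \<Rightarrow> bit) set" where
  "pair_elt D x V w1 w2 = mix_gen D V w2 (line_map D x V (w1 \<oplus>\<^bsub>V\<^esub> w2))"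

text \<open>
  The action of the transposition, given on a basis (\<open>SOME\<close>: the values on \<open>Mix\<close> are uniquely
  determined).
\<close>

definition swap_map ::
    "'a qsp \<Rightarrow> 'a \<Rightarrow> 'a qsp \<Rightarrow> (('a \<Rightarrow> bit) \<times> (('a \<Rightarrow> 'a) \<Rightarrow> bit) \<Rightarrow> bit) set \<Rightarrow>
     (('a \<Rightarrow> bit) \<times> (('a \<Rightarrow> 'a) \<Rightarrow> bit) \<Rightarrow> bit) set" where
  "swap_map D x V = (SOME \<tau>. \<tau> \<in> lin_maps (fob (Mix D x) V) (fob (Mix D x) V) \<and>
     (\<forall>(w1, w2)\<in>mix_pairs D x V. \<tau> (pair_elt D x V w1 w2) = pair_elt D x V w2 w1))"

definition Sigma_sub ::
    "'a qsp \<Rightarrow> 'a \<Rightarrow> 'a qsp \<Rightarrow> (('a \<Rightarrow> bit) \<times> (('a \<Rightarrow> 'a) \<Rightarrow> bit) \<Rightarrow> bit) set set" where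
  "Sigma_sub D x V = {z \<in> Mix_sub D x V. swap_map D x V z = z}"

definition Sigma_fun where "Sigma_fun D x = subfun (Mix D x) (Sigma_sub D x)"

definition upair_elt ::
    "'a qsp \<Rightarrow> 'a \<Rightarrow> 'a qsp \<Rightarrow> 'a \<Rightarrow> 'a \<Rightarrow> (('a \<Rightarrow> bit) \<times> (('a \<Rightarrow> 'a) \<Rightarrow> bit) \<Rightarrow> bit) set" where
  "upair_elt D x V v w = pair_elt D x V v w \<oplus>\<^bsub>fob (Mix D x) V\<^esub> pair_elt D x V w v"

definition k_sub ::
    "nat \<Rightarrow> 'a qsp \<Rightarrow> 'a \<Rightarrow> 'a qsp \<Rightarrow> (('a \<Rightarrow> bit) \<times> (('a \<Rightarrow> 'a) \<Rightarrow> bit) \<Rightarrow> bit) set set" where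
  "k_sub d D x V = vspan (fob (Sigma_fun D x) V)
     {finsum (fob (Sigma_fun D x) V) (\<lambda>z. upair_elt D x V (v \<oplus>\<^bsub>V\<^esub> z) (w \<oplus>\<^bsub>V\<^esub> z)) L | v w L.
        (v, w) \<in> mix_pairs D x V \<and> submodule L F2 V \<and> has_dim V L d \<and>
        L \<subseteq> perp V (vspan V {v \<oplus>\<^bsub>V\<^esub> w})}"


section \<open>The functors L\<close>

definition Ext_iso ::
    "nat \<Rightarrow> 'a qsp \<Rightarrow>
     ('a qsp, 'a triple set, (('a list \<Rightarrow> bit) set \<times> (('a \<Rightarrow> 'a) \<Rightarrow> bit) \<Rightarrow> bit) set) vfun" where
  "Ext_iso n D = tensor_fun (iota (Ext n)) (kappa (iso_fun D))"

definition ext_gen ::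
    "nat \<Rightarrow> 'a qsp \<Rightarrow> 'a qsp \<Rightarrow> 'a list \<Rightarrow> ('a \<Rightarrow> 'a) \<Rightarrow>
     (('a list \<Rightarrow> bit) set \<times> (('a \<Rightarrow> 'a) \<Rightarrow> bit) \<Rightarrow> bit) set" where
  "ext_gen n D V vs h = tens (fob (iota (Ext n)) V) (fob (kappa (iso_fun D)) V)
     (wedge n (eps_obj V) vs) (gen h)"

text \<open>
  The linear maps \<open>\<mu>\<close> and \<open>\<nu>\<close> are given by their values on the generators
  \<open>v1 \<and> \<dots> \<and> vn \<otimes> [h]\<close>, which determine them on the whole space (hence \<open>SOME\<close>).
\<close>

definition mu ::
    "nat \<Rightarrow> 'a qsp \<Rightarrow> 'a \<Rightarrow> 'a qsp \<Rightarrow>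
     (('a list \<Rightarrow> bit) set \<times> (('a \<Rightarrow> 'a) \<Rightarrow> bit) \<Rightarrow> bit) set \<Rightarrow>
     (('a list \<Rightarrow> bit) set \<times> (('a \<Rightarrow> 'a) \<Rightarrow> bit) \<Rightarrow> bit) set" where
  "mu n D x V = (SOME \<mu>. \<mu> \<in> lin_maps (fob (Ext_iso n D) V) (fob (Ext_iso (Suc n) D) V) \<and>
     (\<forall>vs\<in>tuples n V. \<forall>h\<in>qhom D V. \<mu> (ext_gen n D V vs h) = ext_gen (Suc n) D V (vs @ [h x]) h))"

definition nu ::
    "nat \<Rightarrow> 'a qsp \<Rightarrow> 'a \<Rightarrow> 'a qsp \<Rightarrow>
     (('a list \<Rightarrow> bit) set \<times> (('a \<Rightarrow> 'a) \<Rightarrow> bit) \<Rightarrow> bit) set \<Rightarrow>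
     (('a list \<Rightarrow> bit) set \<times> (('a \<Rightarrow> 'a) \<Rightarrow> bit) \<Rightarrow> bit) set" where
  "nu n D x V = (SOME \<nu>. \<nu> \<in> lin_maps (fob (Ext_iso (Suc n) D) V) (fob (Ext_iso n D) V) \<and>
     (\<forall>vs\<in>tuples (Suc n) V. \<forall>h\<in>qhom D V. \<nu> (ext_gen (Suc n) D V vs h) =
        finsum (fob (Ext_iso n D) V)
          (\<lambda>i. bil V (vs ! i) (h x) \<odot>\<^bsub>fob (Ext_iso n D) V\<^esub>
             ext_gen n D V (take i vs @ drop (Suc i) vs) h) {..n}))"

definition K_sub ::
    "nat \<Rightarrow> 'a qsp \<Rightarrow> 'a \<Rightarrow> 'a qsp \<Rightarrow>
     (('a list \<Rightarrow> bit) set \<times> (('a \<Rightarrow> 'a) \<Rightarrow> bit) \<Rightarrow> bit) set set" where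
  "K_sub n D x V = {z \<in> carrier (fob (Ext_iso n D) V). mu n D x V z = \<zero>\<^bsub>fob (Ext_iso (Suc n) D) V\<^esub>}"

text \<open>Only used for \<open>n \<ge> 2\<close>.\<close>

definition L_sub ::
    "nat \<Rightarrow> 'a qsp \<Rightarrow> 'a \<Rightarrow> 'a qsp \<Rightarrow>
     (('a list \<Rightarrow> bit) set \<times> (('a \<Rightarrow> 'a) \<Rightarrow> bit) \<Rightarrow> bit) set set" where
  "L_sub n D x V = {z \<in> K_sub n D x V. nu (n - 1) D x V z = \<zero>\<^bsub>fob (Ext_iso (n - 1) D) V\<^esub>}"

definition L_fun where "L_fun n D x = subfun (Ext_iso n D) (L_sub n D x)"

end

theory Submission
  imports Defs
begin

text \<open>
  Over a vector \<open>a\<close> with \<open>q a = \<alpha>\<close> the fibre of \<open>Mix V\<close> is the space of functions supported on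
  \<open>{w. B w a = 1}\<close>, and the transposition is the translation by \<open>a\<close>; so an element of \<open>\<Sigma> V\<close> is a family of
  functions \<open>f a\<close> invariant under \<open>a\<close>, and \<open>k_d \<Sigma>\<close> turns out to consist of the families whose pairings with all
  products of \<open>d\<close> linear forms \<open>B(-, u)\<close> vanish. By Taylor expansion in a basis dual for \<open>B\<close>, this
  space is spanned by the indicators of affine cubes with directions \<open>a, l1, \<dots>, ld\<close>. A morphism \<open>V \<rightarrow> W\<close> of
  \<open>Tq\<close> amounts to a linear map \<open>p\<close> and a subspace \<open>dm\<close> of \<open>V\<close> on which \<open>p\<close> is isometric
  and orthogonality-preserving; sufficiently many such pairs are realized. Combining linear maps that differ by rank
  one maps, an element of \<open>\<Sigma> V\<close> with a nonzero pairing of degree \<open>d + 1\<close> generates every \<open>d\<close>-dimensional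
  cube, hence all of \<open>k_d \<Sigma>\<close>: every subfunctor of \<open>\<Sigma>\<close> is zero or some \<open>k_d \<Sigma>\<close>. The pairings of degree \<open>d + 1\<close>,
  which are alternating on \<open>k_d \<Sigma>\<close>, identify \<open>k_d \<Sigma> / k_(d+1) \<Sigma>\<close> with \<open>L\<close>.\<close>

text \<open>Classes of cospans are never compared through zigzags. Two things survive a step, the
  pairings \<open>B (f v) (g w)\<close> and the subspace \<open>dm\<close>; they determine all
  values of \<open>iota\<close> and \<open>kappa\<close> on morphisms, so a morphism is handled
  through \<open>eps_mor\<close> and \<open>dm\<close> only, and representatives may be chosen by
  \<open>SOME\<close>. In return every morphism that is wanted must be realized by an actual
  nondegenerate space inside the universe; such spaces are built on product types and copied along a
  bijection. The obstacle in the filtration is that cubes are no basis: they satisfy many relations,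
  so neither membership in \<open>k_d\<close> nor a map sending cubes to wedges can be read off from
  generators. Both are tested by pairings with products of linear forms, and the isomorphisms with
  the quotients are defined as relations between pairings. A vector \<open>c\<close> with
  \<open>B a c = 1\<close> recurs because each fibre is invariant under translation by
  \<open>a\<close>: it picks one point from every pair, and it accounts for the shift by one between
  the number \<open>d\<close> of directions and the degree \<open>d + 1\<close> of the first nonzero
  pairing.\<close>

abbreviation mem :: "'a \<Rightarrow> ('a, 'b) partial_object_scheme \<Rightarrow> bool" (infix "<:" 50) where
  "v <: M \<equiv> v \<in> carrier M"

section \<open>Arithmetic in the field with two elements\<close>

declare add_bit_eq_xor [simp del] mult_bit_eq_and [simp del]

lemma bit_add_self [simp]: "(b::bit) + b = 0"
 by (cases "b = 0") auto

lemma bit_add_left_self [simp]: "(b::bit) + (b + c) = c"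
 by (simp flip: add.assoc)

lemma bit_minus [simp]: "(a::bit) - b = a + b"
 by (cases "a = 0"; cases "b = 0") auto

lemma bit_uminus [simp]: "- (a::bit) = a"
 by (cases "a = 0") auto

lemma bit_add_eq_0_iff [simp]: "(a::bit) + b = 0 \<longleftrightarrow> a = b"
 by (cases "a = 0"; cases "b = 0") auto

lemma bit_mult_idem [simp]: "(b::bit) * b = b" "(b::bit) * (b * c) = b * c"
 by (cases "b = 0"; simp)+

lemma F2_simps [simp]:
 "carrier F2 = UNIV" "add F2 = (+)" "monoid.mult F2 = (*)" "\<one>\<^bsub>F2\<^esub> = 1" "\<zero>\<^bsub>F2\<^esub> = 0"
 by (auto simp: F2_def)

lemma cring_F2: "cring F2"
proof (intro cringI abelian_groupI comm_monoidI)
 show "EX y:carrier F2. y \<oplus>\<^bsub>F2\<^esub> x = \<zero>\<^bsub>F2\<^esub>" for x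
  by (auto intro: exI[of _ x])
qed (auto simp: algebra_simps)

section \<open>Vector spaces over \<open>F2\<close>: subspaces, finite sums and spans\<close>

locale f2v =
 fixes M :: "(bit, 'a, 'x) module_scheme" (structure)
 assumes module_F2: "Module.module F2 M"

sublocale f2v \<subseteq> abelian_group M
 using module_F2 by (rule Module.module.axioms)

context f2v
begin

lemma smult_bit: "x <: M ==> c \<odot> x = (if c = 1 then x else \<zero>)"
 using Module.module.smult_l_null[OF module_F2, of x] Module.module.smult_one[OF module_F2, of x]
 by auto

lemma smult_0 [simp]: "x <: M ==> 0 \<odot> x = \<zero>"
 and smult_1 [simp]: "x <: M ==> 1 \<odot> x = x"
 and smult_zero [simp]: "c \<odot> \<zero> = \<zero>"
 and smult_mem [simp]: "x <: M ==> c \<odot> x <: M"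
 by (simp_all add: smult_bit)

lemma add_self [simp]: "x <: M ==> x \<oplus> x = \<zero>"
 using Module.module.smult_l_distr[OF module_F2, of 1 1 x] by simp

lemma add_left_self [simp]: "x <: M ==> y <: M ==> x \<oplus> (x \<oplus> y) = y"
 by (simp flip: a_assoc)

lemma minus_eq [simp]: "x <: M ==> \<ominus> x = x"
 by (simp add: minus_equality)

lemma add_eq_zero_iff [simp]: "x <: M ==> y <: M ==> x \<oplus> y = \<zero> \<longleftrightarrow> x = y"
 by (metis add_left_self add_self r_zero)

lemma add_eq_iff: "x <: M ==> y <: M ==> z <: M ==> x \<oplus> y = z \<longleftrightarrow> x = y \<oplus> z"
 by (metis a_comm add_left_self)

lemmas ac = a_assoc a_comm a_lcomm

lemma smult_plus: "x <: M ==> (c + d) \<odot> x = c \<odot> x \<oplus> d \<odot> x"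
 by (cases "c = 0"; cases "d = 0") auto

text \<open>The only scalars are 0 and 1, and every vector is its own negative; so a subspace is a
  subset containing zero and closed under addition.\<close>

lemma sub_iff: "submodule N F2 M \<longleftrightarrow> N \<subseteq> carrier M & \<zero>\<in>N & (ALL x:N. ALL y:N. x \<oplus> y\<in>N)"
proof
 assume *: "submodule N F2 M"
 note E = Module.module.submoduleE[OF module_F2 *]
 obtain x where x: "x\<in>N" using E(2) by auto
 have "x \<oplus> x\<in>N" using E(5) x by auto
 moreover have "x \<oplus> x = \<zero>" using x E(1) by auto
 ultimately show "N \<subseteq> carrier M & \<zero>\<in>N & (ALL x:N. ALL y:N. x \<oplus> y\<in>N)"
  using E by auto
next
 assume "N \<subseteq> carrier M & \<zero>\<in>N & (ALL x:N. ALL y:N. x \<oplus> y\<in>N)"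
 then show "submodule N F2 M"
  by (intro Module.module.submoduleI[OF module_F2]) (auto simp: smult_bit subset_iff)
qed

lemma f2v_sub: "submodule N F2 M ==> f2v (M\<lparr>carrier := N\<rparr>)"
 unfolding f2v_def by (rule submodule.submodule_is_module[OF _ module_F2])

lemma sub_finsum: "submodule N F2 M ==> f\<in>A \<rightarrow> N ==> finsum M f A\<in>N"
proof (induction A rule: infinite_finite_induct)
 case (insert x F)
 then have "f\<in>F \<rightarrow> carrier M" "f x <: M" by (auto simp: sub_iff)
 with insert show ?case by (auto simp: finsum_insert sub_iff)
qed (auto simp: sub_iff finsum_infinite)

text \<open>\<open>k_sub\<close> forms its sums in a record whose carrier is cut down to
  \<open>\<Sigma>\<close>, while computations take place in the ambient tensor product. This lemma
  passes between the two.\<close>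

lemma finsum_sub: "submodule N F2 M ==> f\<in>A \<rightarrow> N ==> finsum (M\<lparr>carrier := N\<rparr>) f A = finsum M f A"
proof (induction A rule: infinite_finite_induct)
 case (infinite A)
 interpret N: f2v "M\<lparr>carrier := N\<rparr>" using infinite by (intro f2v_sub)
 show ?case using infinite by (simp add: finsum_infinite N.finsum_infinite)
next
 case empty
 interpret N: f2v "M\<lparr>carrier := N\<rparr>" using empty by (intro f2v_sub)
 show ?case by simp
next
 case (insert x F)
 interpret N: f2v "M\<lparr>carrier := N\<rparr>" using insert by (intro f2v_sub)
 have 1: "f\<in>F \<rightarrow> carrier M" "f x <: M" using insert by (auto simp: sub_iff)
 have 2: "f\<in>F \<rightarrow> N" "f x\<in>N" using insert by auto
 have "finsum (M\<lparr>carrier := N\<rparr>) f (insert x F) = f x \<oplus> finsum (M\<lparr>carrier := N\<rparr>) f F"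
  using N.finsum_insert[of F x f] insert 2 by simp
 also have "\<dots> = finsum M f (insert x F)" using insert 1 2 by (simp add: finsum_insert)
 finally show ?case .
qed

lemma vspan_sub: "S \<subseteq> carrier M ==> submodule (vspan M S) F2 M"
 unfolding vspan_def using Module.module.carrier_is_submodule[OF module_F2]
 by (subst sub_iff) (auto simp: sub_iff)

lemma vspan_incl: "S \<subseteq> vspan M S"
 unfolding vspan_def by auto

lemma vspan_least: "submodule N F2 M ==> S \<subseteq> N ==> vspan M S \<subseteq> N"
 unfolding vspan_def by auto

lemma vspan_carrier: "S \<subseteq> carrier M ==> vspan M S \<subseteq> carrier M"
 using vspan_sub[of S] by (simp add: sub_iff)

lemma vspan_mono: "S \<subseteq> T ==> vspan M S \<subseteq> vspan M T"
 unfolding vspan_def by auto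

lemma vspan_in_sub:
 assumes "submodule N F2 M" "S \<subseteq> N"
 shows "vspan (M\<lparr>carrier := N\<rparr>) S = vspan M S"
proof -
 interpret N: f2v "M\<lparr>carrier := N\<rparr>" by (rule f2v_sub[OF assms(1)])
 note n = assms(1)[unfolded sub_iff]
 have "submodule (vspan M S) F2 M" by (rule vspan_sub) (use assms n in auto)
 moreover have "vspan M S \<subseteq> N" by (rule vspan_least[OF assms])
 ultimately have 1: "submodule (vspan M S) F2 (M\<lparr>carrier := N\<rparr>)" by (simp add: sub_iff N.sub_iff)
 have "submodule (vspan (M\<lparr>carrier := N\<rparr>) S) F2 (M\<lparr>carrier := N\<rparr>)" by (rule N.vspan_sub) (use assms in simp)
 then have 2: "submodule (vspan (M\<lparr>carrier := N\<rparr>) S) F2 M" using n by (auto simp: sub_iff N.sub_iff)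
 show ?thesis
  using N.vspan_least[OF 1 vspan_incl] vspan_least[OF 2 N.vspan_incl] by blast
qed

text \<open>The vectors of the span whose addition preserves \<open>P\<close> form a subspace
  containing \<open>S\<close>, hence are the whole span; adding one of them to zero gives
  \<open>P\<close> for it.\<close>

lemma vspan_induct [consumes 2, case_names zero add]:
 assumes x: "x\<in>vspan M S" and S: "S \<subseteq> carrier M"
  and 0: "P \<zero>" and add: "!!s x. s\<in>S ==> x\<in>vspan M S ==> P x ==> P (s \<oplus> x)"
 shows "P x"
proof -
 note V = vspan_sub[OF S, unfolded sub_iff]
 define N where "N = {x\<in>vspan M S. ALL y:vspan M S. P y --> P (x \<oplus> y)}"
 have "submodule N F2 M"
  unfolding sub_iff
 proof (intro conjI ballI)
  show "N \<subseteq> carrier M" using V by (auto simp: N_def)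
  show "\<zero>\<in>N" using V unfolding N_def by (auto simp: subset_iff)
  fix x y assume "x\<in>N" "y\<in>N"
  then show "x \<oplus> y\<in>N" using V unfolding N_def by (auto simp: subset_iff a_assoc)
 qed
 moreover have "S \<subseteq> N" using add vspan_incl[of S] by (auto simp: N_def)
 ultimately have "x\<in>N" using vspan_least x by blast
 then have "P (x \<oplus> \<zero>)" using 0 V unfolding N_def by blast
 moreover have "x <: M" using x V by auto
 ultimately show ?thesis by simp
qed

end

lemma f2vI:
 fixes M (structure)
 assumes "\<zero> <: M" "!!x y. x <: M ==> y <: M ==> x \<oplus> y <: M"
  "!!x y z. x <: M ==> y <: M ==> z <: M ==> (x \<oplus> y) \<oplus> z = x \<oplus> (y \<oplus> z)"
  "!!x y. x <: M ==> y <: M ==> x \<oplus> y = y \<oplus> x"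
  "!!x. x <: M ==> \<zero> \<oplus> x = x" "!!x. x <: M ==> x \<oplus> x = \<zero>"
  "!!x. x <: M ==> 0 \<odot> x = \<zero>" "!!x. x <: M ==> 1 \<odot> x = x"
 shows "f2v M"
proof (rule f2v.intro)
 have G: "abelian_group M" by (rule abelian_groupI) (use assms in blast)+
 interpret abelian_group M by fact
 have b: "c = 0 | c = 1" for c :: bit by (cases "c = 0") auto
 show "Module.module F2 M"
 proof (rule moduleI[OF cring_F2 G])
  fix a :: bit and x assume x: "x <: M"
  show "a \<odot> x <: M" using b[of a] x assms(1,7,8) by auto
  show "(a \<oplus>\<^bsub>F2\<^esub> b) \<odot> x = a \<odot> x \<oplus> b \<odot> x" for b
   using b[of a] b[of b] x assms(1,5-8) by auto
  show "(a \<otimes>\<^bsub>F2\<^esub> b) \<odot> x = a \<odot> (b \<odot> x)" for b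
   using b[of a] b[of b] x assms(1,7,8) by auto
  show "a \<odot> (x \<oplus> y) = a \<odot> x \<oplus> a \<odot> y" if "y <: M" for y
   using b[of a] x that assms(1,2,5,7,8) by auto
 qed (use assms in auto)
qed

lemma f2v_same:
 assumes "f2v M" "carrier M' = carrier M" "add M' = add M" "ring.zero M' = ring.zero M" "smult M' = smult M"
 shows "f2v M'"
proof -
 interpret f2v M by fact
 show ?thesis by (rule f2vI) (auto simp: assms(2-) ac)
qed

section \<open>Linear maps\<close>

lemma lin_closed: "f\<in>lin_maps M N ==> x <: M ==> f x <: N"
 unfolding lin_maps_def by auto

lemma lin_add: "f\<in>lin_maps M N ==> x <: M ==> y <: M ==> f (x \<oplus>\<^bsub>M\<^esub> y) = f x \<oplus>\<^bsub>N\<^esub> f y"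
 unfolding lin_maps_def by auto

lemma lin_smult: "f\<in>lin_maps M N ==> x <: M ==> f (c \<odot>\<^bsub>M\<^esub> x) = c \<odot>\<^bsub>N\<^esub> f x"
 unfolding lin_maps_def by auto

lemma linI:
 assumes "f2v M" "f2v N" "!!x. x <: M ==> f x <: N"
  "!!x y. x <: M ==> y <: M ==> f (x \<oplus>\<^bsub>M\<^esub> y) = f x \<oplus>\<^bsub>N\<^esub> f y"
 shows "f\<in>lin_maps M N"
proof -
 interpret M: f2v M by fact
 interpret N: f2v N by fact
 have "f \<zero>\<^bsub>M\<^esub> = \<zero>\<^bsub>N\<^esub>" using assms(4)[of "\<zero>\<^bsub>M\<^esub>" "\<zero>\<^bsub>M\<^esub>"] assms(3)[of "\<zero>\<^bsub>M\<^esub>"] by simp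
 then show ?thesis unfolding lin_maps_def using assms(3,4) by (auto simp: M.smult_bit N.smult_bit)
qed

lemma lin_zero:
 assumes "f2v M" "f2v N" "f\<in>lin_maps M N"
 shows "f \<zero>\<^bsub>M\<^esub> = \<zero>\<^bsub>N\<^esub>"
proof -
 interpret M: f2v M by fact
 interpret N: f2v N by fact
 show ?thesis using lin_add[OF assms(3), of "\<zero>\<^bsub>M\<^esub>" "\<zero>\<^bsub>M\<^esub>"] lin_closed[OF assms(3), of "\<zero>\<^bsub>M\<^esub>"] by simp
qed

lemma lin_comp: "f\<in>lin_maps M N ==> g\<in>lin_maps N K ==> (%x. g (f x))\<in>lin_maps M K"
 unfolding lin_maps_def by (auto simp: Pi_iff)

lemma lin_cong: "f\<in>lin_maps M N ==> f2v M ==> (!!x. x <: M ==> f x = g x) ==> g\<in>lin_maps M N"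
proof -
 assume *: "f\<in>lin_maps M N" "f2v M" "!!x. x <: M ==> f x = g x"
 interpret M: f2v M by fact
 show ?thesis using * unfolding lin_maps_def by (auto simp: Pi_iff)
qed

lemma lin_finsum:
 assumes "f2v M" "f2v N" "f\<in>lin_maps M N" "!!i. i\<in>I ==> g i <: M"
 shows "f (finsum M g I) = finsum N (%i. f (g i)) I"
proof -
 interpret M: f2v M by fact
 interpret N: f2v N by fact
 have "(!!i. i\<in>I ==> g i <: M) ==> ?thesis"
 proof (induction I rule: infinite_finite_induct)
  case (infinite A)
  then show ?case by (simp add: M.finsum_infinite N.finsum_infinite lin_zero[OF assms(1-3)])
 next
  case empty
  then show ?case by (simp add: lin_zero[OF assms(1-3)])
 next
  case (insert x F)
  have gF: "g\<in>F \<rightarrow> carrier M" using insert by auto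
  have "f (finsum M g (insert x F)) = f (g x \<oplus>\<^bsub>M\<^esub> finsum M g F)"
   using insert gF by (subst M.finsum_insert) auto
  also have "\<dots> = f (g x) \<oplus>\<^bsub>N\<^esub> finsum N (%i. f (g i)) F"
   using insert gF by (subst lin_add[OF assms(3)]) auto
  also have "\<dots> = finsum N (%i. f (g i)) (insert x F)"
   using insert lin_closed[OF assms(3)] by (subst N.finsum_insert) auto
  finally show ?case .
 qed
 then show ?thesis using assms(4) by blast
qed

lemma lin_vspan:
 assumes "f2v M" "f2v N" "f\<in>lin_maps M N" "S \<subseteq> carrier M" "submodule T F2 N" "f ` S \<subseteq> T" "x\<in>vspan M S"
 shows "f x\<in>T"
proof -
 interpret M: f2v M by fact
 interpret N: f2v N by fact
 show ?thesis
  using assms(7,4)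
 proof (induction rule: M.vspan_induct)
  case zero
  then show ?case using assms(5) by (simp add: lin_zero[OF assms(1-3)] N.sub_iff)
 next
  case (add s x)
  then have "s <: M" "x <: M" using assms(4) M.vspan_carrier by auto
  then show ?case using assms(5,6) add by (auto simp: lin_add[OF assms(3)] N.sub_iff)
 qed
qed

lemma lin_eq_vspan:
 assumes "f2v M" "f2v N" "f\<in>lin_maps M N" "g\<in>lin_maps M N" "S \<subseteq> carrier M"
  "!!s. s\<in>S ==> f s = g s" "x\<in>vspan M S"
 shows "f x = g x"
proof -
 interpret M: f2v M by fact
 show ?thesis
  using assms(7,5)
 proof (induction rule: M.vspan_induct)
  case (add s x)
  then have "s <: M" "x <: M" using assms(5) M.vspan_carrier by auto
  then show ?case using assms(6) add by (auto simp: lin_add[OF assms(3)] lin_add[OF assms(4)])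
 qed (simp add: lin_zero[OF assms(1-3)] lin_zero[OF assms(1,2,4)])
qed

section \<open>Quotients\<close>

context f2v
begin

lemma coset_mem: "submodule N F2 M ==> u <: M ==> v\<in>N +> u \<longleftrightarrow> v <: M & u \<oplus> v\<in>N"
 unfolding a_r_coset_def' sub_iff
proof (safe, goal_cases)
 case (1 h) then show ?case by auto
next
 case (2 h)
 then have "u \<oplus> (h \<oplus> u) = h" by (metis a_comm add_left_self subsetD a_closed)
 then show ?case using 2 by simp
next
 case 3
 then have "v = (u \<oplus> v) \<oplus> u" by (metis a_comm add_left_self a_closed)
 then show ?case using 3 by auto
qed

lemma coset_eq_iff:
 assumes "submodule N F2 M" "u <: M" "v <: M"
 shows "N +> u = N +> v \<longleftrightarrow> u \<oplus> v\<in>N"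
proof
 assume "N +> u = N +> v"
 moreover have "v\<in>N +> v" using assms by (auto simp: coset_mem sub_iff)
 ultimately show "u \<oplus> v\<in>N" using assms by (auto simp: coset_mem)
next
 assume uv: "u \<oplus> v\<in>N"
 { fix w assume w: "w <: M"
  have "u \<oplus> w = (u \<oplus> v) \<oplus> (v \<oplus> w)" "v \<oplus> w = (u \<oplus> v) \<oplus> (u \<oplus> w)"
   using assms w by (metis a_assoc a_closed add_left_self, metis a_assoc a_comm a_closed add_left_self)
  then have "u \<oplus> w\<in>N \<longleftrightarrow> v \<oplus> w\<in>N" using assms(1) uv unfolding sub_iff by metis }
 then show "N +> u = N +> v" using assms by (auto simp: coset_mem)
qed

lemma coset_add:
 assumes "submodule N F2 M" "u <: M" "v <: M"
 shows "(N +> u) <+>\<^bsub>M\<^esub> (N +> v) = N +> (u \<oplus> v)"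
proof -
 note N = assms(1)[unfolded sub_iff]
 show ?thesis
 proof (intro equalityI subsetI)
  fix w assume "w\<in>(N +> u) <+>\<^bsub>M\<^esub> (N +> v)"
  then obtain p q where pq: "p\<in>N +> u" "q\<in>N +> v" "w = p \<oplus> q" unfolding set_add_def' by auto
  then have "(u \<oplus> v) \<oplus> w = (u \<oplus> p) \<oplus> (v \<oplus> q)" using assms by (simp add: coset_mem ac)
  then show "w\<in>N +> (u \<oplus> v)" using pq assms N by (auto simp: coset_mem)
 next
  fix w assume "w\<in>N +> (u \<oplus> v)"
  then have w: "w <: M" "u \<oplus> v \<oplus> w\<in>N" using assms by (auto simp: coset_mem)
  have "u \<oplus> (w \<oplus> v) = u \<oplus> v \<oplus> w" "w = (w \<oplus> v) \<oplus> v" using w assms by (auto simp: ac)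
  then have "w \<oplus> v\<in>N +> u" "v\<in>N +> v" "w = (w \<oplus> v) \<oplus> v" using w assms N by (auto simp: coset_mem)
  then show "w\<in>(N +> u) <+>\<^bsub>M\<^esub> (N +> v)" unfolding set_add_def' by auto
 qed
qed

lemma coset_zero: "submodule N F2 M ==> N +> \<zero> = N"
 by (auto simp: coset_mem sub_iff)

lemma carrier_quot: "carrier (quot_mod M N) = (%v. N +> v) ` carrier M"
 unfolding quot_mod_def A_RCOSETS_def' by auto

lemma quot_simps: "add (quot_mod M N) = set_add M" "ring.zero (quot_mod M N) = N"
 unfolding quot_mod_def by auto

lemma f2v_quot:
 assumes N: "submodule N F2 M"
 shows "f2v (quot_mod M N)"
proof (rule f2vI)
 show "\<zero>\<^bsub>quot_mod M N\<^esub> <: quot_mod M N"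
  unfolding carrier_quot quot_simps using coset_zero[OF N] by force
 fix x assume x: "x <: quot_mod M N"
 then obtain v where v: "x = N +> v" "v <: M" unfolding carrier_quot by auto
 show "x \<oplus>\<^bsub>quot_mod M N\<^esub> x = \<zero>\<^bsub>quot_mod M N\<^esub>" "\<zero>\<^bsub>quot_mod M N\<^esub> \<oplus>\<^bsub>quot_mod M N\<^esub> x = x"
  using v coset_zero[OF N] coset_add[OF N, of v v] coset_add[OF N, of \<zero> v] by (auto simp: quot_simps)
 have mem: "w <: M" if "w\<in>N +> v" for w using that coset_mem[OF N] v by auto
 have ne: "v\<in>N +> v" using coset_mem[OF N] v N by (auto simp: sub_iff)
 have 0: "0 \<odot>\<^bsub>quot_mod M N\<^esub> x = (\<Union>w\<in>N +> v. N +> \<zero>)"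
  unfolding quot_mod_def using v mem by simp
 then show "0 \<odot>\<^bsub>quot_mod M N\<^esub> x = \<zero>\<^bsub>quot_mod M N\<^esub>"
  using coset_zero[OF N] ne by (auto simp: quot_simps)
 have "1 \<odot>\<^bsub>quot_mod M N\<^esub> x = (\<Union>w\<in>N +> v. N +> w)"
  unfolding quot_mod_def using v mem by simp
 also have "\<dots> = (\<Union>w\<in>N +> v. N +> v)"
 proof (rule SUP_cong)
  fix w assume w: "w\<in>N +> v"
  then have "v \<oplus> w\<in>N" using coset_mem[OF N] v by auto
  then show "N +> w = N +> v" using coset_eq_iff[OF N, of v w] v mem[OF w] by simp
 qed simp
 finally show "1 \<odot>\<^bsub>quot_mod M N\<^esub> x = x" using ne v by auto
next
 fix x y z assume "x <: quot_mod M N" "y <: quot_mod M N"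
 then obtain u v where v: "x = N +> u" "u <: M" "y = N +> v" "v <: M"
  unfolding carrier_quot by auto
 then show "x \<oplus>\<^bsub>quot_mod M N\<^esub> y <: quot_mod M N" "x \<oplus>\<^bsub>quot_mod M N\<^esub> y = y \<oplus>\<^bsub>quot_mod M N\<^esub> x"
  using coset_add[OF N] by (auto simp: quot_simps carrier_quot a_comm)
 assume "z <: quot_mod M N"
 then obtain w where "z = N +> w" "w <: M" unfolding carrier_quot by auto
 with v show "(x \<oplus>\<^bsub>quot_mod M N\<^esub> y) \<oplus>\<^bsub>quot_mod M N\<^esub> z = x \<oplus>\<^bsub>quot_mod M N\<^esub> (y \<oplus>\<^bsub>quot_mod M N\<^esub> z)"
  using coset_add[OF N] by (auto simp: quot_simps a_assoc)
qed

lemma proj_lin: "submodule N F2 M ==> (%v. N +> v)\<in>lin_maps M (quot_mod M N)"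
 by (intro linI f2v_axioms f2v_quot) (auto simp: carrier_quot quot_simps coset_add)

end

text \<open>\<open>quot_map\<close> is a union over all representatives of a coset; since
  \<open>f\<close> maps \<open>N\<close> into \<open>N'\<close>, all cosets in this union
  coincide.\<close>

lemma quot_map_coset:
 assumes "f2v M" "f2v M'" "submodule N F2 M" "submodule N' F2 M'" "f\<in>lin_maps M M'" "f ` N \<subseteq> N'" "v <: M"
 shows "quot_map M' N' f (N +>\<^bsub>M\<^esub> v) = N' +>\<^bsub>M'\<^esub> f v"
proof -
 interpret M: f2v M by fact
 interpret M': f2v M' by fact
 have "N' +>\<^bsub>M'\<^esub> f w = N' +>\<^bsub>M'\<^esub> f v" if "w\<in>N +>\<^bsub>M\<^esub> v" for w
 proof -
  have w: "w <: M" "v \<oplus>\<^bsub>M\<^esub> w\<in>N" using that M.coset_mem[OF assms(3,7)] by auto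
  then have "f v \<oplus>\<^bsub>M'\<^esub> f w\<in>N'" using assms(6,7) lin_add[OF assms(5)] by (metis image_subset_iff)
  then have "N' +>\<^bsub>M'\<^esub> f v = N' +>\<^bsub>M'\<^esub> f w"
   using M'.coset_eq_iff[OF assms(4)] lin_closed[OF assms(5)] w assms(7) by auto
  then show ?thesis by simp
 qed
 moreover have "v\<in>N +>\<^bsub>M\<^esub> v" using M.coset_mem[OF assms(3,7), of v] assms(3,7) by (simp add: M.sub_iff)
 ultimately show ?thesis unfolding quot_map_def by blast
qed

lemma quot_map_lin:
 assumes "f2v M" "f2v M'" "submodule N F2 M" "submodule N' F2 M'" "f\<in>lin_maps M M'" "f ` N \<subseteq> N'"
 shows "quot_map M' N' f\<in>lin_maps (quot_mod M N) (quot_mod M' N')"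
proof -
 interpret M: f2v M by fact
 interpret M': f2v M' by fact
 show ?thesis
 proof (rule linI)
  show "f2v (quot_mod M N)" "f2v (quot_mod M' N')" using assms M.f2v_quot M'.f2v_quot by auto
  fix x y assume "x <: quot_mod M N" "y <: quot_mod M N"
  then obtain u v where uv: "u <: M" "x = N +>\<^bsub>M\<^esub> u" "v <: M" "y = N +>\<^bsub>M\<^esub> v"
   unfolding M.carrier_quot by auto
  note f = lin_closed[OF assms(5)]
  show "quot_map M' N' f x <: quot_mod M' N'"
   using uv f by (simp add: quot_map_coset[OF assms] M'.carrier_quot)
  show "quot_map M' N' f (x \<oplus>\<^bsub>quot_mod M N\<^esub> y) = quot_map M' N' f x \<oplus>\<^bsub>quot_mod M' N'\<^esub> quot_map M' N' f y"
   using uv f by (simp add: quot_map_coset[OF assms] M.quot_simps M'.quot_simps M.coset_add[OF assms(3)]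
     M'.coset_add[OF assms(4)] lin_add[OF assms(5)])
 qed
qed

section \<open>Free spaces and presentations\<close>

lemma free_simps:
 "v <: free_mod S \<longleftrightarrow> finite {s. v s ~= 0} & {s. v s ~= 0} \<subseteq> S"
 "\<zero>\<^bsub>free_mod S\<^esub> = (%s. 0)" "u \<oplus>\<^bsub>free_mod S\<^esub> v = (%s. u s + v s)"
 unfolding free_mod_def by auto

lemma f2v_free: "f2v (free_mod S)"
proof (rule f2vI)
 fix u v assume "u <: free_mod S" "v <: free_mod S"
 then have uv: "finite ({s. u s ~= 0} \<union> {s. v s ~= 0})" "{s. u s ~= 0} \<union> {s. v s ~= 0} \<subseteq> S"
  by (auto simp: free_simps)
 have *: "{s. u s + v s ~= 0} \<subseteq> {s. u s ~= 0} \<union> {s. v s ~= 0}" by auto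
 show "u \<oplus>\<^bsub>free_mod S\<^esub> v <: free_mod S"
  using finite_subset[OF * uv(1)] * uv(2) by (simp only: free_simps) blast
qed (auto simp: free_simps fun_eq_iff add.assoc add.commute, auto simp: free_mod_def)

lemma gen_mem [simp]: "gen s <: free_mod S \<longleftrightarrow> s\<in>S"
proof -
 have "{t. gen s t ~= 0} = {s}" by (auto simp: gen_def)
 then show ?thesis by (simp add: free_simps)
qed

lemma free_mem_finite: "finite S ==> v <: free_mod S \<longleftrightarrow> (\<forall>s. s \<notin> S --> v s = 0)"
 unfolding free_simps by (metis (mono_tags, lifting) finite_subset mem_Collect_eq subsetI subsetD)

lemma free_induct [consumes 1, case_names zero add]:
 assumes "v <: free_mod S" and 0: "P (%s. 0)"
  and add: "!!s v. s\<in>S ==> v <: free_mod S ==> P v ==> P (gen s \<oplus>\<^bsub>free_mod S\<^esub> v)"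
 shows "P v"
proof -
 have "finite A ==> A \<subseteq> S ==> (!!v. {s. v s ~= 0} = A ==> P v)" for A
 proof (induction A rule: finite_induct)
  case empty
  then have "v = (%s. 0)" by auto
  then show ?case using 0 by simp
 next
  case (insert x F)
  let ?v = "v(x := 0)"
  have s: "{s. ?v s ~= 0} = F" using insert by auto
  have "P ?v" using insert s by auto
  moreover have "?v <: free_mod S" unfolding free_simps s using insert by auto
  ultimately have "P (gen x \<oplus>\<^bsub>free_mod S\<^esub> ?v)" using add insert by auto
  moreover have "v x = 1" using insert by auto
  then have "gen x \<oplus>\<^bsub>free_mod S\<^esub> ?v = v" by (auto simp: free_simps gen_def)
  ultimately show ?case by simp
 qed
 then show ?thesis using assms(1) free_simps(1) by metis
qed

text \<open>The index set in \<open>free_map\<close> varies with \<open>v\<close>; summing over a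
  fixed finite set containing the support makes additivity in \<open>v\<close> accessible.\<close>

lemma free_map_eq:
 assumes "finite X" "{s. v s ~= 0} \<subseteq> X"
 shows "free_map \<phi> v t = (\<Sum>s\<in>X. if \<phi> s = Some t then v s else 0)"
proof -
 have "(\<Sum>s\<in>X. if \<phi> s = Some t then v s else 0) = (\<Sum>s\<in>{s. v s ~= 0 & \<phi> s = Some t}. if \<phi> s = Some t then v s else 0)"
  by (rule sum.mono_neutral_right) (use assms in auto)
 also have "\<dots> = free_map \<phi> v t" unfolding free_map_def by (rule sum.cong) auto
 finally show ?thesis by simp
qed

lemma free_map_gen: "free_map \<phi> (gen s) = (case \<phi> s of None => (%t. 0) | Some t => gen t)"
 by (rule ext, subst free_map_eq[of "{s}"]) (auto simp: gen_def split: option.splits)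

lemma free_map_lin:
 assumes "!!s t. s\<in>S ==> \<phi> s = Some t ==> t\<in>T"
 shows "free_map \<phi>\<in>lin_maps (free_mod S) (free_mod T)"
proof (intro linI f2v_free)
 fix u v assume u: "u <: free_mod S" and v: "v <: free_mod S"
 have "{t. free_map \<phi> u t ~= 0} \<subseteq> the ` \<phi> ` {s. u s ~= 0} \<inter> T"
 proof
  fix t assume "t\<in>{t. free_map \<phi> u t ~= 0}"
  then have "free_map \<phi> u t ~= 0" by simp
  then obtain s where "u s ~= 0" "\<phi> s = Some t" unfolding free_map_def
   by (metis (mono_tags, lifting) mem_Collect_eq sum.neutral)
  then show "t\<in>the ` \<phi> ` {s. u s ~= 0} \<inter> T"
   using u assms[of s t] by (force simp: free_simps image_iff intro!: exI[of _ s])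
 qed
 moreover have "finite (the ` \<phi> ` {s. u s ~= 0})" using u by (simp add: free_simps)
 ultimately show "free_map \<phi> u <: free_mod T"
  unfolding free_simps by (meson finite_subset le_inf_iff)
 let ?X = "{s. u s ~= 0} \<union> {s. v s ~= 0}"
 have X: "finite ?X" using u v by (simp add: free_simps)
 show "free_map \<phi> (u \<oplus>\<^bsub>free_mod S\<^esub> v) = free_map \<phi> u \<oplus>\<^bsub>free_mod T\<^esub> free_map \<phi> v"
  unfolding free_simps
  by (rule ext, subst (1 2 3) free_map_eq[OF X]) (auto simp flip: sum.distrib intro!: sum.cong)
qed

text \<open>Linear extension of a map on generators. The nonzero coefficients are all 1, so the
  value is a plain sum over the support.\<close>

definition lext :: "(bit, 'a, 'x) module_scheme => ('s => 'a) => ('s => bit) => 'a" where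
 "lext N \<phi> v = finsum N \<phi> {s. v s ~= 0}"

context f2v
begin

lemma lext_eq:
 assumes "finite X" "{s. v s ~= 0} \<subseteq> X" "\<phi>\<in>X \<rightarrow> carrier M"
 shows "lext M \<phi> v = finsum M (%s. v s \<odot> \<phi> s) X"
proof -
 have "finsum M (%s. v s \<odot> \<phi> s) X = finsum M \<phi> {s. v s ~= 0}"
  by (rule add.finprod_mono_neutral_cong_right) (use assms in "auto simp: Pi_iff")
 then show ?thesis by (simp add: lext_def)
qed

lemma lext_lin:
 assumes "\<phi>\<in>S \<rightarrow> carrier M"
 shows "lext M \<phi>\<in>lin_maps (free_mod S) M"
proof (intro linI f2v_free f2v_axioms)
 fix u v assume u: "u <: free_mod S" and v: "v <: free_mod S"
 show "lext M \<phi> u <: M" unfolding lext_def using u assms by (intro finsum_closed) (auto simp: free_simps)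
 let ?X = "{s. u s ~= 0} \<union> {s. v s ~= 0}"
 have X: "finite ?X" "?X \<subseteq> S" using u v by (auto simp: free_simps)
 have \<phi>: "\<phi>\<in>?X \<rightarrow> carrier M" using X assms by auto
 show "lext M \<phi> (u \<oplus>\<^bsub>free_mod S\<^esub> v) = lext M \<phi> u \<oplus> lext M \<phi> v"
 proof -
  have "lext M \<phi> u \<oplus> lext M \<phi> v = (\<Oplus>s\<in>?X. u s \<odot> \<phi> s) \<oplus> (\<Oplus>s\<in>?X. v s \<odot> \<phi> s)"
   using lext_eq[OF X(1) _ \<phi>, of u] lext_eq[OF X(1) _ \<phi>, of v] by simp
  also have "\<dots> = (\<Oplus>s\<in>?X. u s \<odot> \<phi> s \<oplus> v s \<odot> \<phi> s)"
   by (rule finsum_addf[symmetric]) (use \<phi> in "simp_all add: Pi_iff")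
  also have "\<dots> = (\<Oplus>s\<in>?X. (u s + v s) \<odot> \<phi> s)"
   by (rule finsum_cong') (use \<phi> in "simp_all add: smult_plus Pi_iff")
  also have "\<dots> = lext M \<phi> (%s. u s + v s)"
   by (rule lext_eq[OF X(1) _ \<phi>, symmetric]) auto
  finally show ?thesis by (simp add: free_simps)
 qed
qed

lemma lext_gen: "\<phi> s <: M ==> lext M \<phi> (gen s) = \<phi> s"
 by (subst lext_eq[of "{s}"]) (auto simp: gen_def finsum_insert)

end

lemma minus_free: "u - v = u \<oplus>\<^bsub>free_mod S\<^esub> v"
 by (auto simp: free_simps)

locale presentation =
 fixes S :: "'s set" and R
 assumes R_sub: "R \<subseteq> carrier (free_mod S)"
begin

sublocale free: f2v "free_mod S" by (rule f2v_free)

lemma rel_sub: "submodule (vspan (free_mod S) R) F2 (free_mod S)"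
 by (rule free.vspan_sub[OF R_sub])

sublocale quo: f2v "presented S R"
 unfolding presented_def by (rule free.f2v_quot[OF rel_sub])

lemma carrier_presented: "carrier (presented S R) = (%v. vspan (free_mod S) R +>\<^bsub>free_mod S\<^esub> v) ` carrier (free_mod S)"
 unfolding presented_def by (rule free.carrier_quot)

lemma proj: "(%v. vspan (free_mod S) R +>\<^bsub>free_mod S\<^esub> v)\<in>lin_maps (free_mod S) (presented S R)"
 unfolding presented_def by (rule free.proj_lin[OF rel_sub])

lemma pres_gen_mem: "s\<in>S ==> pres_gen S R s <: presented S R"
 unfolding pres_gen_def carrier_presented by auto

lemma coset_rel: "r\<in>vspan (free_mod S) R ==> vspan (free_mod S) R +>\<^bsub>free_mod S\<^esub> r = \<zero>\<^bsub>presented S R\<^esub>"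
proof -
 assume r: "r\<in>vspan (free_mod S) R"
 have "vspan (free_mod S) R +>\<^bsub>free_mod S\<^esub> r = vspan (free_mod S) R +>\<^bsub>free_mod S\<^esub> \<zero>\<^bsub>free_mod S\<^esub>"
  using free.coset_eq_iff[OF rel_sub, of r "\<zero>\<^bsub>free_mod S\<^esub>"] r rel_sub free.sub_iff by auto
 also have "\<dots> = \<zero>\<^bsub>presented S R\<^esub>"
  using free.coset_zero[OF rel_sub] by (simp add: presented_def free.quot_simps)
 finally show ?thesis .
qed

lemma pres_induct [consumes 1, case_names zero add]:
 assumes "K <: presented S R" "P \<zero>\<^bsub>presented S R\<^esub>"
  "!!s K. s\<in>S ==> K <: presented S R ==> P K ==> P (pres_gen S R s \<oplus>\<^bsub>presented S R\<^esub> K)"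
 shows "P K"
proof -
 obtain v where v: "v <: free_mod S" "K = vspan (free_mod S) R +>\<^bsub>free_mod S\<^esub> v"
  using assms(1) carrier_presented by auto
 from v(1) have "P (vspan (free_mod S) R +>\<^bsub>free_mod S\<^esub> v)"
 proof (induction rule: free_induct)
  case zero
  then show ?case using assms(2) lin_zero[OF f2v_free _ proj] quo.f2v_axioms by (simp add: free_simps)
 next
  case (add s v)
  then show ?case using assms(3)[of s] lin_closed[OF proj] by (simp add: lin_add[OF proj] flip: pres_gen_def)
 qed
 then show ?thesis using v by simp
qed

lemma pres_span: "vspan (presented S R) (pres_gen S R ` S) = carrier (presented S R)"
proof
 have sub: "pres_gen S R ` S \<subseteq> carrier (presented S R)" using pres_gen_mem by auto
 then show "vspan (presented S R) (pres_gen S R ` S) \<subseteq> carrier (presented S R)" by (rule quo.vspan_carrier)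
 note V = quo.vspan_sub[OF sub, unfolded quo.sub_iff]
 show "carrier (presented S R) \<subseteq> vspan (presented S R) (pres_gen S R ` S)"
 proof
  fix K assume "K <: presented S R"
  then show "K\<in>vspan (presented S R) (pres_gen S R ` S)"
  proof (induction rule: pres_induct)
   case (add s K)
   then show ?case using V quo.vspan_incl[of "pres_gen S R ` S"] by (meson image_subset_iff)
  qed (use V in auto)
 qed
qed

text \<open>The linear extension of \<open>\<phi>\<close> kills the span of the relations, so it is
  constant on cosets and any representative yields the value.\<close>

lemma pres_univ:
 assumes N: "f2v N" and \<phi>: "\<phi>\<in>S \<rightarrow> carrier N" and R0: "!!r. r\<in>R ==> lext N \<phi> r = \<zero>\<^bsub>N\<^esub>"
 shows "EX f:lin_maps (presented S R) N. ALL s:S. f (pres_gen S R s) = \<phi> s"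
proof -
 interpret N: f2v N by fact
 note L = N.lext_lin[OF \<phi>]
 have "submodule {\<zero>\<^bsub>N\<^esub>} F2 N" by (simp add: N.sub_iff)
 then have kill: "lext N \<phi> r = \<zero>\<^bsub>N\<^esub>" if "r\<in>vspan (free_mod S) R" for r
  using lin_vspan[OF f2v_free N L R_sub _ _ that] R0 by blast
 define f where "f K = lext N \<phi> (SOME v. v\<in>K)" for K
 have f: "f (vspan (free_mod S) R +>\<^bsub>free_mod S\<^esub> v) = lext N \<phi> v" if v: "v <: free_mod S" for v
 proof -
  have "v\<in>vspan (free_mod S) R +>\<^bsub>free_mod S\<^esub> v"
   using v rel_sub by (simp add: free.coset_mem[OF rel_sub] free.sub_iff)
  then have "(SOME w. w\<in>vspan (free_mod S) R +>\<^bsub>free_mod S\<^esub> v)\<in>vspan (free_mod S) R +>\<^bsub>free_mod S\<^esub> v"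
   by (rule someI[where P = "%w. w\<in>_"])
  moreover have "lext N \<phi> w = lext N \<phi> v" if "w\<in>vspan (free_mod S) R +>\<^bsub>free_mod S\<^esub> v" for w
  proof -
   have w: "w <: free_mod S" "v \<oplus>\<^bsub>free_mod S\<^esub> w\<in>vspan (free_mod S) R"
    using that v by (auto simp: free.coset_mem[OF rel_sub])
   have "lext N \<phi> v \<oplus>\<^bsub>N\<^esub> lext N \<phi> w = \<zero>\<^bsub>N\<^esub>"
    using kill[OF w(2)] lin_add[OF L v w(1)] by simp
   then show ?thesis using lin_closed[OF L] v w by auto
  qed
  ultimately show ?thesis unfolding f_def by simp
 qed
 have "f\<in>lin_maps (presented S R) N"
 proof (intro linI N quo.f2v_axioms)
  fix x y assume "x <: presented S R" "y <: presented S R"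
  then obtain u v where uv: "u <: free_mod S" "x = vspan (free_mod S) R +>\<^bsub>free_mod S\<^esub> u"
   "v <: free_mod S" "y = vspan (free_mod S) R +>\<^bsub>free_mod S\<^esub> v"
   unfolding carrier_presented by auto
  show "f x <: N" using uv f lin_closed[OF L] by simp
  show "f (x \<oplus>\<^bsub>presented S R\<^esub> y) = f x \<oplus>\<^bsub>N\<^esub> f y"
   using uv f lin_add[OF L] by (simp flip: lin_add[OF proj])
 qed
 moreover have "f (pres_gen S R s) = \<phi> s" if "s\<in>S" for s
  using f[of "gen s"] that \<phi> N.lext_gen[of \<phi> s] by (auto simp: pres_gen_def)
 ultimately show ?thesis by auto
qed

lemma pres_map:
 assumes "presentation S' R'" "\<phi>\<in>S \<rightarrow> S'"
  "!!r. r\<in>R ==> free_map (Some \<circ> \<phi>) r\<in>vspan (free_mod S') R'"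
 shows "pres_map S' R' \<phi>\<in>lin_maps (presented S R) (presented S' R')"
  "s\<in>S ==> pres_map S' R' \<phi> (pres_gen S R s) = pres_gen S' R' (\<phi> s)"
proof -
 interpret P: presentation S' R' by fact
 have L: "free_map (Some \<circ> \<phi>)\<in>lin_maps (free_mod S) (free_mod S')"
  by (rule free_map_lin) (use assms(2) in auto)
 have sub: "free_map (Some \<circ> \<phi>) ` vspan (free_mod S) R \<subseteq> vspan (free_mod S') R'"
  using lin_vspan[OF f2v_free f2v_free L R_sub P.rel_sub] assms(3) by blast
 show "pres_map S' R' \<phi>\<in>lin_maps (presented S R) (presented S' R')"
  unfolding pres_map_def presented_def
  by (rule quot_map_lin[OF f2v_free f2v_free rel_sub P.rel_sub L sub])
 show "pres_map S' R' \<phi> (pres_gen S R s) = pres_gen S' R' (\<phi> s)" if "s\<in>S"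
  unfolding pres_map_def pres_gen_def
  by (subst quot_map_coset[OF f2v_free f2v_free rel_sub P.rel_sub L sub]) (use that in "auto simp: free_map_gen")
qed

end

section \<open>Tensor products\<close>

text \<open>Of the scalar relations only two kinds remain over \<open>F2\<close>: the trivial one
  for \<open>c = 1\<close>, and for \<open>c = 0\<close> the vanishing of a generator with a zero
  entry.\<close>

lemma smult_gen_diff:
 assumes "f2v M" "u <: M"
 shows "gen (F (c \<odot>\<^bsub>M\<^esub> u)) - (%s. c * gen (F u) s) = (if c = 1 then (%_. 0) else gen (F \<zero>\<^bsub>M\<^esub>))"
proof -
 interpret f2v M by fact
 show ?thesis using assms(2) by (cases "c = 1") (auto simp: fun_eq_iff)
qed

lemma tensor_relI:
 "u <: M ==> u' <: M ==> v <: N ==>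
  gen (u \<oplus>\<^bsub>M\<^esub> u', v) - gen (u, v) - gen (u', v)\<in>tensor_rel M N"
 "u <: M ==> v <: N ==> v' <: N ==>
  gen (u, v \<oplus>\<^bsub>N\<^esub> v') - gen (u, v) - gen (u, v')\<in>tensor_rel M N"
 "u <: M ==> v <: N ==> gen (c \<odot>\<^bsub>M\<^esub> u, v) - (%s. c * gen (u, v) s)\<in>tensor_rel M N"
 "u <: M ==> v <: N ==> gen (u, c \<odot>\<^bsub>N\<^esub> v) - (%s. c * gen (u, v) s)\<in>tensor_rel M N"
 unfolding tensor_rel_def by blast+

lemma tensor_rel_cases:
 assumes "f2v M" "f2v N" "r\<in>tensor_rel M N"
 obtains (l) u u' v where "u <: M" "u' <: M" "v <: N"
   "r = gen (u \<oplus>\<^bsub>M\<^esub> u', v) \<oplus>\<^bsub>free_mod (carrier M \<times> carrier N)\<^esub> gen (u, v) \<oplus>\<^bsub>free_mod (carrier M \<times> carrier N)\<^esub> gen (u', v)"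
  | (r) u v v' where "u <: M" "v <: N" "v' <: N"
   "r = gen (u, v \<oplus>\<^bsub>N\<^esub> v') \<oplus>\<^bsub>free_mod (carrier M \<times> carrier N)\<^esub> gen (u, v) \<oplus>\<^bsub>free_mod (carrier M \<times> carrier N)\<^esub> gen (u, v')"
  | (z) "r = (%_. 0)"
  | (zl) v where "v <: N" "r = gen (\<zero>\<^bsub>M\<^esub>, v)"
  | (zr) u where "u <: M" "r = gen (u, \<zero>\<^bsub>N\<^esub>)"
proof -
 from assms(3) show ?thesis
  unfolding tensor_rel_def minus_free[where S = "carrier M \<times> carrier N"]
 proof (elim UnE CollectE exE conjE, goal_cases)
  case (3 c u v) then show ?thesis using smult_gen_diff[OF assms(1), of u "%u. (u, v)" c] z zl[of v]
   by (auto simp: minus_free[where S = "carrier M \<times> carrier N"] split: if_splits)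
 next
  case (4 c u v) then show ?thesis using smult_gen_diff[OF assms(2), of v "%v. (u, v)" c] z zr[of u]
   by (auto simp: minus_free[where S = "carrier M \<times> carrier N"] split: if_splits)
 qed (use l r in blast)+
qed

locale tensor_pair = M: f2v M + N: f2v N for M :: "(bit, 'a, 'x) module_scheme" and N :: "(bit, 'b, 'y) module_scheme"
begin

abbreviation "FM \<equiv> free_mod (carrier M \<times> carrier N)"

sublocale F: f2v FM by (rule f2v_free)

lemma rel_carrier: "tensor_rel M N \<subseteq> carrier FM"
proof
 fix r assume "r\<in>tensor_rel M N"
 then show "r <: FM"
  by (cases rule: tensor_rel_cases[OF M.f2v_axioms N.f2v_axioms]) (auto intro!: F.a_closed, simp add: free_simps)
qed

sublocale P: presentation "carrier M \<times> carrier N" "tensor_rel M N"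
 by unfold_locales (rule rel_carrier)

sublocale T: f2v "tensor_mod M N"
 unfolding tensor_mod_def by (rule P.quo.f2v_axioms)

lemma tens_mem [simp]: "u <: M ==> v <: N ==> tens M N u v <: tensor_mod M N"
 unfolding tens_def tensor_mod_def by (rule P.pres_gen_mem) auto

lemma rel3:
 assumes "r\<in>tensor_rel M N" "a\<in>carrier M \<times> carrier N" "b\<in>carrier M \<times> carrier N" "c\<in>carrier M \<times> carrier N"
  "r = gen a - gen b - gen c"
 shows "pres_gen (carrier M \<times> carrier N) (tensor_rel M N) a =
  pres_gen (carrier M \<times> carrier N) (tensor_rel M N) b \<oplus>\<^bsub>tensor_mod M N\<^esub> pres_gen (carrier M \<times> carrier N) (tensor_rel M N) c"
proof -
 let ?p = "pres_gen (carrier M \<times> carrier N) (tensor_rel M N)"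
 have g: "gen a <: FM" "gen b <: FM" "gen c <: FM" using assms by auto
 have "r = gen a \<oplus>\<^bsub>FM\<^esub> gen b \<oplus>\<^bsub>FM\<^esub> gen c" using assms(5) by (simp only: minus_free[where S = "carrier M \<times> carrier N"])
 moreover have "r\<in>vspan FM (tensor_rel M N)" using assms(1) F.vspan_incl by auto
 ultimately have "\<zero>\<^bsub>tensor_mod M N\<^esub> = ?p a \<oplus>\<^bsub>tensor_mod M N\<^esub> ?p b \<oplus>\<^bsub>tensor_mod M N\<^esub> ?p c"
  using P.coset_rel[of r] g lin_add[OF P.proj] F.a_closed by (simp add: pres_gen_def tensor_mod_def)
 moreover have "?p a <: tensor_mod M N" "?p b <: tensor_mod M N" "?p c <: tensor_mod M N"
  using assms P.pres_gen_mem by (auto simp: tensor_mod_def)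
 ultimately show ?thesis by (metis T.a_assoc T.a_closed T.add_eq_zero_iff)
qed

lemma tens_add_l: "u <: M ==> u' <: M ==> v <: N ==>
  tens M N (u \<oplus>\<^bsub>M\<^esub> u') v = tens M N u v \<oplus>\<^bsub>tensor_mod M N\<^esub> tens M N u' v"
 unfolding tens_def by (rule rel3[OF _ _ _ _ refl]) (auto simp: tensor_rel_def)

lemma tens_add_r: "u <: M ==> v <: N ==> v' <: N ==>
  tens M N u (v \<oplus>\<^bsub>N\<^esub> v') = tens M N u v \<oplus>\<^bsub>tensor_mod M N\<^esub> tens M N u v'"
 unfolding tens_def by (rule rel3[OF _ _ _ _ refl]) (auto simp: tensor_rel_def)

lemma tens_lin_l: "v <: N ==> (%u. tens M N u v)\<in>lin_maps M (tensor_mod M N)"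
 by (intro linI M.f2v_axioms T.f2v_axioms) (auto simp: tens_add_l)

lemma tens_lin_r: "u <: M ==> tens M N u\<in>lin_maps N (tensor_mod M N)"
 by (intro linI N.f2v_axioms T.f2v_axioms) (auto simp: tens_add_r)

lemma tens_zero_l [simp]: "v <: N ==> tens M N \<zero>\<^bsub>M\<^esub> v = \<zero>\<^bsub>tensor_mod M N\<^esub>"
 using lin_zero[OF M.f2v_axioms T.f2v_axioms tens_lin_l] .

lemma tens_zero_r [simp]: "u <: M ==> tens M N u \<zero>\<^bsub>N\<^esub> = \<zero>\<^bsub>tensor_mod M N\<^esub>"
 using lin_zero[OF N.f2v_axioms T.f2v_axioms tens_lin_r] .

lemma tens_induct [consumes 1, case_names zero add]:
 assumes "z <: tensor_mod M N" "P \<zero>\<^bsub>tensor_mod M N\<^esub>"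
  "!!u v z. u <: M ==> v <: N ==> z <: tensor_mod M N ==> P z ==> P (tens M N u v \<oplus>\<^bsub>tensor_mod M N\<^esub> z)"
 shows "P z"
 using assms(1) unfolding tensor_mod_def
proof (induction rule: P.pres_induct)
 case (add s K)
 then show ?case using assms(3)[of "fst s" "snd s" K] by (auto simp: tens_def tensor_mod_def)
qed (use assms(2) in "simp add: tensor_mod_def")

text \<open>Biadditive maps are bilinear over \<open>F2\<close>; compatibility with scalars follows
  from additivity at zero.\<close>

lemma tens_univ:
 assumes "f2v Q" "!!u v. u <: M ==> v <: N ==> \<phi> u v <: Q"
  "!!u u' v. u <: M ==> u' <: M ==> v <: N ==> \<phi> (u \<oplus>\<^bsub>M\<^esub> u') v = \<phi> u v \<oplus>\<^bsub>Q\<^esub> \<phi> u' v"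
  "!!u v v'. u <: M ==> v <: N ==> v' <: N ==> \<phi> u (v \<oplus>\<^bsub>N\<^esub> v') = \<phi> u v \<oplus>\<^bsub>Q\<^esub> \<phi> u v'"
 shows "EX f:lin_maps (tensor_mod M N) Q. ALL u:carrier M. ALL v:carrier N. f (tens M N u v) = \<phi> u v"
proof -
 interpret Q: f2v Q by fact
 let ?\<phi> = "%(u, v). \<phi> u v"
 have L: "lext Q ?\<phi>\<in>lin_maps FM Q" by (rule Q.lext_lin) (use assms(2) in auto)
 have zl: "\<phi> \<zero>\<^bsub>M\<^esub> v = \<zero>\<^bsub>Q\<^esub>" if "v <: N" for v
  using assms(3)[of "\<zero>\<^bsub>M\<^esub>" "\<zero>\<^bsub>M\<^esub>" v] assms(2)[of "\<zero>\<^bsub>M\<^esub>" v] that by simp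
 have zr: "\<phi> u \<zero>\<^bsub>N\<^esub> = \<zero>\<^bsub>Q\<^esub>" if "u <: M" for u
  using assms(4)[of u "\<zero>\<^bsub>N\<^esub>" "\<zero>\<^bsub>N\<^esub>"] assms(2)[of u "\<zero>\<^bsub>N\<^esub>"] that by simp
 have "lext Q ?\<phi> r = \<zero>\<^bsub>Q\<^esub>" if "r\<in>tensor_rel M N" for r
  using M.f2v_axioms N.f2v_axioms that
 proof (cases rule: tensor_rel_cases)
  case (l u u' v)
  then show ?thesis using assms(2) by (simp add: lin_add[OF L] Q.lext_gen assms(3) F.a_closed Q.ac)
 next
  case (r u v v')
  then show ?thesis using assms(2) by (simp add: lin_add[OF L] Q.lext_gen assms(4) F.a_closed Q.ac)
 next
  case z
  then show ?thesis using lin_zero[OF f2v_free assms(1) L] by (simp add: free_simps)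
 qed (use assms(2) in "simp_all add: Q.lext_gen zl zr")
 then have "EX f:lin_maps (tensor_mod M N) Q. ALL s:carrier M \<times> carrier N. f (pres_gen (carrier M \<times> carrier N) (tensor_rel M N) s) = ?\<phi> s"
  unfolding tensor_mod_def by (intro P.pres_univ) (use assms in auto)
 then show ?thesis unfolding tens_def by auto
qed

end

lemma tensor_map:
 assumes "f2v M" "f2v N" "f2v M'" "f2v N'" and f: "f\<in>lin_maps M M'" and g: "g\<in>lin_maps N N'"
 defines "h \<equiv> pres_map (carrier M' \<times> carrier N') (tensor_rel M' N') (map_prod f g)"
 shows "h\<in>lin_maps (tensor_mod M N) (tensor_mod M' N')"
  "u <: M ==> v <: N ==> h (tens M N u v) = tens M' N' (f u) (g v)"
proof -
 interpret T: tensor_pair M N using assms(1,2) by (simp add: tensor_pair_def)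
 interpret T': tensor_pair M' N' using assms(3,4) by (simp add: tensor_pair_def)
 let ?\<phi> = "map_prod f g"
 have L: "free_map (Some \<circ> ?\<phi>)\<in>lin_maps T.FM T'.FM"
  by (rule free_map_lin) (use lin_closed[OF f] lin_closed[OF g] in auto)
 have fg: "free_map (Some \<circ> ?\<phi>) (gen (u, v)) = gen (f u, g v)" for u v by (simp add: free_map_gen)
 have "free_map (Some \<circ> ?\<phi>) r\<in>vspan T'.FM (tensor_rel M' N')" if "r\<in>tensor_rel M N" for r
 proof -
  note V = T'.P.rel_sub[unfolded T'.F.sub_iff]
  have I: "r\<in>tensor_rel M' N' ==> r\<in>vspan T'.FM (tensor_rel M' N')" for r
   using T'.F.vspan_incl by auto
  show ?thesis using assms(1,2) that
  proof (cases rule: tensor_rel_cases)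
   case (l u u' v)
   then have "free_map (Some \<circ> ?\<phi>) r = gen (f u \<oplus>\<^bsub>M'\<^esub> f u', g v) - gen (f u, g v) - gen (f u', g v)"
    by (simp add: lin_add[OF L] T.F.a_closed fg lin_add[OF f] minus_free[where S = "carrier M' \<times> carrier N'"])
   then show ?thesis using l lin_closed[OF f] lin_closed[OF g] by (simp add: I tensor_relI)
  next
   case (r u v v')
   then have "free_map (Some \<circ> ?\<phi>) r = gen (f u, g v \<oplus>\<^bsub>N'\<^esub> g v') - gen (f u, g v) - gen (f u, g v')"
    by (simp add: lin_add[OF L] T.F.a_closed fg lin_add[OF g] minus_free[where S = "carrier M' \<times> carrier N'"])
   then show ?thesis using r lin_closed[OF f] lin_closed[OF g] by (simp add: I tensor_relI)
  next
   case z
   then show ?thesis using lin_zero[OF f2v_free f2v_free L] V by (simp add: free_simps)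
  next
   case (zl v)
   \<comment> \<open>The image is rewritten as the scalar relation with \<open>c = 0\<close>, so
     that it is literally a member of \<open>tensor_rel\<close>.\<close>
   then have "free_map (Some \<circ> ?\<phi>) r = gen (0 \<odot>\<^bsub>M'\<^esub> \<zero>\<^bsub>M'\<^esub>, g v) - (%s. 0 * gen (\<zero>\<^bsub>M'\<^esub>, g v) s)"
    using lin_zero[OF assms(1,3) f] fg by (simp add: fun_diff_def)
   then show ?thesis using zl lin_closed[OF g]  T'.M.zero_closed T'.N.zero_closed by (simp only: I tensor_relI)
  next
   case (zr u)
   then have "free_map (Some \<circ> ?\<phi>) r = gen (f u, 0 \<odot>\<^bsub>N'\<^esub> \<zero>\<^bsub>N'\<^esub>) - (%s. 0 * gen (f u, \<zero>\<^bsub>N'\<^esub>) s)"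
    using lin_zero[OF assms(2,4) g] fg by (simp add: fun_diff_def)
   then show ?thesis using zr lin_closed[OF f]  T'.M.zero_closed T'.N.zero_closed by (simp only: I tensor_relI)
  qed
 qed
 note R = T.P.pres_map[OF T'.P.presentation_axioms _ this]
 show "h\<in>lin_maps (tensor_mod M N) (tensor_mod M' N')"
  unfolding h_def tensor_mod_def by (rule R) (use lin_closed[OF f] lin_closed[OF g] in auto)
 show "h (tens M N u v) = tens M' N' (f u) (g v)" if "u <: M" "v <: N"
  unfolding h_def tens_def by (subst R) (use that lin_closed[OF f] lin_closed[OF g] in auto)
qed

section \<open>Quadratic spaces\<close>

text \<open>One more vector at most doubles the span: the span of \<open>S\<close> together with its
  translate by \<open>s\<close> is already a subspace.\<close>

lemma (in f2v) finite_vspan: "finite S ==> S \<subseteq> carrier M ==> finite (vspan M S)"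
proof (induction S rule: finite_induct)
 case empty
 have "vspan M {} \<subseteq> {\<zero>}" by (rule vspan_least) (auto simp: sub_iff)
 then show ?case by (rule finite_subset) simp
next
 case (insert s S)
 note V = vspan_sub[of S, unfolded sub_iff]
 have sc: "s <: M" "S \<subseteq> carrier M" "vspan M S \<subseteq> carrier M" using insert vspan_carrier by auto
 have "vspan M (insert s S) \<subseteq> vspan M S \<union> (%x. s \<oplus> x) ` vspan M S" (is "_ \<subseteq> ?N")
 proof (rule vspan_least)
  have m: "x\<in>?N \<longleftrightarrow> x <: M & (x\<in>vspan M S | s \<oplus> x\<in>vspan M S)" for x
  proof
   assume "x\<in>?N"
   then show "x <: M & (x\<in>vspan M S | s \<oplus> x\<in>vspan M S)" using sc by auto
  next
   assume x: "x <: M & (x\<in>vspan M S | s \<oplus> x\<in>vspan M S)"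
   then have "x = s \<oplus> (s \<oplus> x)" using sc by simp
   then show "x\<in>?N" using x by blast
  qed
  show "submodule ?N F2 M"
   unfolding sub_iff
  proof (intro conjI ballI)
   show "?N \<subseteq> carrier M" "\<zero>\<in>?N" using m V sc by auto
   fix x y assume "x\<in>?N" "y\<in>?N"
   then have xy: "x <: M" "y <: M" "x\<in>vspan M S | s \<oplus> x\<in>vspan M S" "y\<in>vspan M S | s \<oplus> y\<in>vspan M S"
    using m by auto
   have "(s \<oplus> x) \<oplus> (s \<oplus> y) = x \<oplus> y" "(s \<oplus> x) \<oplus> y = s \<oplus> (x \<oplus> y)" "x \<oplus> (s \<oplus> y) = s \<oplus> (x \<oplus> y)"
    using xy sc by (simp_all add: ac)
   then have "x \<oplus> y\<in>vspan M S | s \<oplus> (x \<oplus> y)\<in>vspan M S" using xy V sc by metis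
   then show "x \<oplus> y\<in>?N" using m xy by auto
  qed
  show "insert s S \<subseteq> ?N" using m V sc vspan_incl[of S] by auto
 qed
 then show ?case using insert by (auto intro: finite_subset)
qed

locale qsp =
 fixes V :: "(bit, 'a) qspace" (structure)
 assumes quad: "quadratic_space V"

sublocale qsp \<subseteq> f2v V
 using quad by (intro f2v.intro) (simp add: quadratic_space_def)

context qsp
begin

lemma finite_carrier [simp]: "finite (carrier V)"
 using quad finite_vspan unfolding quadratic_space_def fin_dim_def by metis

lemma bil_add_l: "u <: V ==> v <: V ==> w <: V ==> bil V (u \<oplus> v) w = bil V u w + bil V v w"
 and bil_add_r: "u <: V ==> v <: V ==> w <: V ==> bil V w (u \<oplus> v) = bil V w u + bil V w v"
 using quad unfolding quadratic_space_def by blast+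

lemma bil_smult_l: "v <: V ==> w <: V ==> bil V (c \<odot> v) w = c * bil V v w"
 and bil_smult_r: "v <: V ==> w <: V ==> bil V w (c \<odot> v) = c * bil V w v"
 using quad unfolding quadratic_space_def by blast+

lemma bil_zero [simp]: "v <: V ==> bil V \<zero> v = 0" "v <: V ==> bil V v \<zero> = 0"
 using bil_smult_l[of v v 0] bil_smult_r[of v v 0] by simp_all

lemma bil_sym: "u <: V ==> v <: V ==> bil V u v = bil V v u"
 unfolding bil_def by (simp add: a_comm add.commute add.left_commute)

lemma qf_zero [simp]: "qf V \<zero> = 0"
proof -
 have "qf V (0 \<odot> \<zero>) = 0\<^sup>2 * qf V \<zero>" using quad zero_closed unfolding quadratic_space_def by blast
 then show ?thesis by simp
qed

lemma bil_self [simp]: "v <: V ==> bil V v v = 0"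
 unfolding bil_def by (simp add: add.assoc)

lemma qf_add: "qf V (u \<oplus> v) = qf V u + qf V v + bil V u v"
 unfolding bil_def by (simp add: algebra_simps)

lemmas bil_simps = bil_add_l bil_add_r bil_smult_l bil_smult_r

end

text \<open>Additivity in one variable suffices, as \<open>bil\<close> is symmetric and the scalars
  are bits; finite dimension follows because a finite carrier spans itself.\<close>

lemma quadratic_spaceI:
 assumes "f2v V" "finite (carrier V)" "qf V \<zero>\<^bsub>V\<^esub> = 0"
  "!!u v w. u <: V ==> v <: V ==> w <: V ==> bil V (u \<oplus>\<^bsub>V\<^esub> v) w = bil V u w + bil V v w"
 shows "quadratic_space V"
proof -
 interpret f2v V by fact
 have sym: "bil V u v = bil V v u" if "u <: V" "v <: V" for u v
  using that unfolding bil_def by (simp add: a_comm add.commute add.left_commute)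
 have z: "bil V \<zero>\<^bsub>V\<^esub> v = 0" if "v <: V" for v
  unfolding bil_def using that assms(3) by simp
 have fd: "fin_dim V" unfolding fin_dim_def
  using assms(2) vspan_incl[of "carrier V"] vspan_carrier[of "carrier V"] by blast
 have b: "c = 0 | c = 1" for c :: bit by (cases "c = 0") auto
 show ?thesis
  unfolding quadratic_space_def
 proof (intro conjI allI ballI)
  show "Module.module F2 V" by (rule module_F2)
  show "fin_dim V" by (rule fd)
  fix c v assume v: "v <: V"
  show "qf V (c \<odot>\<^bsub>V\<^esub> v) = c\<^sup>2 * qf V v" using b[of c] v assms(3) by auto
  fix w assume w: "w <: V"
  show "bil V (c \<odot>\<^bsub>V\<^esub> v) w = c * bil V v w" using b[of c] v w z by auto
  show "bil V w (c \<odot>\<^bsub>V\<^esub> v) = c * bil V w v" using b[of c] v w z sym[of w] by auto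
 next
  fix u v w assume *: "u <: V" "v <: V" "w <: V"
  show "bil V (u \<oplus>\<^bsub>V\<^esub> v) w = bil V u w + bil V v w" using assms(4) * by blast
  then show "bil V w (u \<oplus>\<^bsub>V\<^esub> v) = bil V w u + bil V w v" using * sym[of w] by auto
 qed
qed

section \<open>Nondegenerate spaces and dual systems\<close>

locale ndsp = qsp +
 assumes nondeg: "perp V (carrier V) = {\<zero>}"

lemma ndsp_iff: "ndsp V \<longleftrightarrow> nondegenerate V"
 unfolding ndsp_def ndsp_axioms_def qsp_def nondegenerate_def by auto

text \<open>Two biorthogonal families, listed in pairs. The families may overlap, so that a
  hyperbolic pair can be entered in both orders as \<open>[(a, c), (c, a)]\<close>.\<close>

fun dual :: "(bit, 'a) qspace => ('a \<times> 'a) list => bool" where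
 "dual V [] \<longleftrightarrow> True"
| "dual V ((b, c) # ps) \<longleftrightarrow> b <: V & c <: V & bil V b c = 1 &
   (ALL (b', c'):set ps. bil V b c' = 0 & bil V b' c = 0) & dual V ps"

text \<open>The expansion of \<open>v\<close> in the first components, with coefficients read off by
  the second ones; the system is complete when this is the identity.\<close>

fun xp :: "(bit, 'a) qspace => ('a \<times> 'a) list => 'a => 'a" where
 "xp V [] v = \<zero>\<^bsub>V\<^esub>"
| "xp V ((b, c) # ps) v = (bil V v c \<odot>\<^bsub>V\<^esub> b) \<oplus>\<^bsub>V\<^esub> xp V ps v"

context qsp
begin

lemma dual_mem: "dual V ps ==> (b, c)\<in>set ps ==> b <: V & c <: V"
 by (induction ps) auto

lemma xp_mem [simp]: "dual V ps ==> v <: V ==> xp V ps v <: V"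
 by (induction ps) auto

lemma xp_orth: "dual V ps ==> v <: V ==> w <: V ==> (!!b c. (b, c)\<in>set ps ==> bil V b w = 0) ==> bil V (xp V ps v) w = 0"
proof (induction ps)
 case (Cons p ps)
 obtain b c where p: "p = (b, c)" by force
 have "bil V b w = 0" by (rule Cons.prems(4)[of b c]) (simp add: p)
 moreover have "bil V (xp V ps v) w = 0" by (rule Cons.IH) (use Cons.prems p in auto)
 ultimately show ?case using Cons.prems p by (simp add: bil_simps)
qed simp

lemma xp_bil: "dual V ps ==> v <: V ==> (b, c)\<in>set ps ==> bil V (xp V ps v) c = bil V v c"
proof (induction ps)
 case (Cons p ps)
 obtain b' c' where p: "p = (b', c')" by force
 have m: "b' <: V" "c' <: V" "xp V ps v <: V" "c <: V" "b <: V"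
  using Cons dual_mem[OF Cons.prems(1), of b c] by (auto simp: p)
 show ?case
 proof (cases "(b, c) = p")
  case True
  have "bil V (xp V ps v) c = 0" by (rule xp_orth) (use Cons True p m in auto)
  then show ?thesis using True p m Cons by (auto simp: bil_simps)
 next
  case False
  then have "(b, c)\<in>set ps" using Cons by auto
  then show ?thesis using Cons p m by (auto simp: bil_simps)
 qed
qed simp

lemma xp_zero: "dual V ps ==> v <: V ==> (!!b c. (b, c)\<in>set ps ==> bil V v c = 0) ==> xp V ps v = \<zero>"
proof (induction ps)
 case (Cons p ps)
 obtain b c where p: "p = (b, c)" by force
 have "bil V v c = 0" by (rule Cons.prems(3)[of b c]) (simp add: p)
 moreover have "xp V ps v = \<zero>" by (rule Cons.IH) (use Cons.prems p in auto)
 ultimately show ?case using Cons.prems p by simp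
qed simp

abbreviation swp :: "('a \<times> 'a) list => ('a \<times> 'a) list" where
 "swp ps \<equiv> map (%(b, c). (c, b)) ps"

lemma dual_swp: "dual V ps ==> dual V (swp ps)"
proof (induction ps)
 case (Cons p ps)
 obtain b c where p: "p = (b, c)" by force
 have "bil V b' c = bil V c b'" "bil V b c' = bil V c' b" if "(b', c')\<in>set ps" for b' c'
  using dual_mem[OF Cons.prems, of b' c'] dual_mem[OF Cons.prems, of b c] that p bil_sym by auto
 then show ?case using Cons p bil_sym[of b c] by fastforce
qed simp

end

context ndsp
begin

lemma nondeg_ex: "v <: V ==> v ~= \<zero> ==> EX w:carrier V. bil V v w = 1"
 using nondeg unfolding perp_def by force

text \<open>Any partial dual system extends to a complete one: a vector that is not expanded, corrected
  to be orthogonal to the present system, can be paired with a corrected partner.\<close>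

lemma dual_extend:
 assumes "dual V ps0"
 shows "\<exists>ps. dual V (ps @ ps0) & (ALL v:carrier V. xp V (ps @ ps0) v = v)"
proof -
 \<comment> \<open>The vectors that the system expands correctly. Their number is bounded by the
   finite carrier, so a system maximizing it exists.\<close>
 define fx where "fx ps = {v\<in>carrier V. xp V ps v = v}" for ps
 have fin: "finite (fx ps)" for ps unfolding fx_def by simp
 have "\<exists>ps. dual V (ps @ ps0) & (\<forall>qs. dual V (qs @ ps0) --> card (fx (qs @ ps0)) \<le> card (fx (ps @ ps0)))"
 proof -
  have "card (fx (ps @ ps0)) \<le> card (carrier V)" for ps
   by (rule card_mono) (auto simp: fx_def)
  then show ?thesis
   using ex_has_greatest_nat[of "%ps. dual V (ps @ ps0)" "[]" "%ps. card (fx (ps @ ps0))" "Suc (card (carrier V))"] assms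
   by (auto simp: less_Suc_eq_le)
 qed
 then obtain ps where ps: "dual V (ps @ ps0)" and max: "!!qs. dual V (qs @ ps0) ==> card (fx (qs @ ps0)) \<le> card (fx (ps @ ps0))"
  by auto
 let ?q = "ps @ ps0"
 have "xp V ?q v = v" if v: "v <: V" for v
 proof (rule ccontr)
  assume ne: "xp V ?q v ~= v"
  let ?v = "v \<oplus> xp V ?q v"
  have v': "?v <: V" "?v ~= \<zero>" using v ps ne by auto
  have vc: "bil V ?v c = 0" if "(b, c)\<in>set ?q" for b c
   using v ps that dual_mem[OF ps that] by (simp add: bil_simps xp_bil[OF ps _ that])
  obtain d where d: "d <: V" "bil V ?v d = 1" using nondeg_ex v' by blast
  let ?d = "d \<oplus> xp V (swp ?q) d"
  note sw = dual_swp[OF ps]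
  have d': "?d <: V" using d xp_mem[OF sw] by simp
  have db: "bil V b ?d = 0" if "(b, c)\<in>set ?q" for b c
  proof -
   have "(c, b)\<in>set (swp ?q)" using that by force
   then have "bil V ?d b = 0" using d xp_mem[OF sw] dual_mem[OF ps that]
    by (simp add: bil_simps xp_bil[OF sw] del: map_append)
   then show ?thesis using bil_sym d' dual_mem[OF ps that] by metis
  qed
  have "bil V (xp V (swp ?q) d) ?v = 0"
  proof (rule xp_orth[OF sw d(1) v'(1)])
   fix b c assume "(b, c)\<in>set (swp ?q)"
   then have "(c, b)\<in>set ?q" by auto
   then show "bil V b ?v = 0" using vc dual_mem[OF ps] bil_sym v'(1) by metis
  qed
  then have "bil V ?v ?d = 1"
   using d v' xp_mem[OF sw d(1)] bil_sym[of ?v "xp V (swp ?q) d"] by (simp only: bil_add_r) simp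
  then have du: "dual V (((?v, ?d) # ps) @ ps0)" using ps vc db v' d' by auto
  \<comment> \<open>A vector fixed by the old expansion is a combination of first components, all
    orthogonal to \<open>?d\<close>; its new coefficient vanishes and it stays fixed.\<close>
  have sub: "fx ?q \<subseteq> fx (((?v, ?d) # ps) @ ps0)"
  proof
   fix u assume u: "u\<in>fx ?q"
   then have u': "u <: V" "xp V ?q u = u" by (auto simp: fx_def)
   have "bil V (xp V ?q u) ?d = 0" by (rule xp_orth[OF ps u'(1) d']) (use db in auto)
   then have "bil V u ?d = 0" using u' by simp
   then show "u\<in>fx (((?v, ?d) # ps) @ ps0)" using u' v' by (simp add: fx_def)
  qed
  have z: "xp V ?q ?v = \<zero>" by (rule xp_zero[OF ps v'(1)]) (use vc in auto)
  then have "?v\<in>fx (((?v, ?d) # ps) @ ps0)" "?v \<notin> fx ?q"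
   using v' \<open>bil V ?v ?d = 1\<close> by (simp_all only: fx_def mem_Collect_eq append_Cons xp.simps) auto
  then have "fx ?q \<subset> fx (((?v, ?d) # ps) @ ps0)" using sub by auto
  then have "card (fx ?q) < card (fx (((?v, ?d) # ps) @ ps0))" by (rule psubset_card_mono[OF fin])
  then show False using max[OF du] by simp
 qed
 then show ?thesis using ps by auto
qed

text \<open>For a complete dual system the representing vector is the sum of the vectors
  \<open>c\<close> with coefficients \<open>\<psi> b\<close>.\<close>

lemma riesz:
 assumes "!!u v. u <: V ==> v <: V ==> \<psi> (u \<oplus> v) = \<psi> u + \<psi> v"
 shows "EX w:carrier V. ALL v:carrier V. bil V v w = \<psi> v"
proof -
 obtain ps where ps: "dual V ps" "!!v. v <: V ==> xp V ps v = v" using dual_extend[of "[]"] by auto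
 have z: "\<psi> \<zero> = 0" using assms[of \<zero> \<zero>] by simp
 have sm: "\<psi> (c \<odot> v) = c * \<psi> v" if "v <: V" for c v
  using that z by (cases "c = 1") auto
 have "dual V ps ==> EX w:carrier V. ALL v:carrier V. bil V v w = \<psi> (xp V ps v)"
 proof (induction ps)
  case Nil
  show ?case using z by (auto intro!: bexI[of _ \<zero>])
 next
  case (Cons p ps)
  obtain b c where p: "p = (b, c)" by force
  obtain w where w: "w <: V" "ALL v:carrier V. bil V v w = \<psi> (xp V ps v)" using Cons p by auto
  show ?case
   by (rule bexI[of _ "\<psi> b \<odot> c \<oplus> w"]) (use Cons p w in "auto simp: bil_simps assms sm algebra_simps")
 qed
 then show ?thesis using ps by auto
qed

lemma bil_cancel: "v <: V ==> v' <: V ==> (!!w. w <: V ==> bil V v w = bil V v' w) ==> v = v'"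
 using nondeg_ex[of "v \<oplus> v'"] by (auto simp: bil_simps)

end

section \<open>Isometries and orthogonal projections\<close>

lemma qhomD:
 assumes "f\<in>qhom V W"
 shows "f\<in>lin_maps V W" "f\<in>extensional (carrier V)" "inj_on f (carrier V)"
  "v <: V ==> qf W (f v) = qf V v" "v <: V ==> f v <: W"
  "u <: V ==> v <: V ==> f (u \<oplus>\<^bsub>V\<^esub> v) = f u \<oplus>\<^bsub>W\<^esub> f v"
proof -
 have f: "f\<in>lin_maps V W" "f\<in>extensional (carrier V)" "inj_on f (carrier V)" "ALL v:carrier V. qf W (f v) = qf V v"
  using assms unfolding qhom_def by simp_all
 then show "f\<in>lin_maps V W" "f\<in>extensional (carrier V)" "inj_on f (carrier V)"
  "v <: V ==> qf W (f v) = qf V v" by simp_all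
 show "v <: V ==> f v <: W" by (rule lin_closed[OF f(1)])
 show "u <: V ==> v <: V ==> f (u \<oplus>\<^bsub>V\<^esub> v) = f u \<oplus>\<^bsub>W\<^esub> f v" by (rule lin_add[OF f(1)])
qed

lemma qhom_bil:
 assumes "f2v V" "f\<in>qhom V W" "u <: V" "v <: V"
 shows "bil W (f u) (f v) = bil V u v"
proof -
 interpret f2v V by fact
 show ?thesis unfolding bil_def using qhomD(4,6)[OF assms(2)] assms(3,4) by (metis a_closed)
qed

lemma qhom_zero: "f2v V ==> f2v W ==> f\<in>qhom V W ==> f \<zero>\<^bsub>V\<^esub> = \<zero>\<^bsub>W\<^esub>"
 using lin_zero qhomD(1) by metis

lemma qhom_compose: "f2v U ==> f\<in>qhom U V ==> g\<in>qhom V W ==> compose (carrier U) g f\<in>qhom U W"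
proof -
 assume U: "f2v U" and f: "f\<in>qhom U V" and g: "g\<in>qhom V W"
 have "(%x. g (f x))\<in>lin_maps U W" using lin_comp qhomD(1)[OF f] qhomD(1)[OF g] .
 then have "compose (carrier U) g f\<in>lin_maps U W" by (rule lin_cong[OF _ U]) (simp add: compose_def)
 moreover have "inj_on (compose (carrier U) g f) (carrier U)"
  using qhomD(3,5)[OF f] qhomD(3)[OF g] by (simp add: inj_on_def compose_def)
 ultimately show ?thesis
  using qhomD(4,5)[OF f] qhomD(4)[OF g] unfolding qhom_def by (simp add: compose_def)
qed

locale isom_pair = W: ndsp W + X: qsp X for W X :: "'a qsp" +
 fixes g assumes g: "g\<in>qhom W X"
begin

lemma gw [simp]: "w <: W ==> g w <: X" using qhomD(5)[OF g] .

lemma g_bil: "u <: W ==> v <: W ==> bil X (g u) (g v) = bil W u v"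
 using qhom_bil[OF W.f2v_axioms g] .

lemma proj_ex: "y <: X ==> EX w:carrier W. ALL v:carrier W. bil W w v = bil X y (g v)"
proof -
 assume y: "y <: X"
 have "EX w:carrier W. ALL v:carrier W. bil W v w = bil X y (g v)"
  by (rule W.riesz) (use y qhomD(6)[OF g] in "simp add: X.bil_simps")
 then show ?thesis using W.bil_sym by auto
qed

text \<open>The pairings with \<open>g W\<close> characterize the projection, by nondegeneracy of
  \<open>W\<close>. Later values of \<open>orth_proj\<close> are found in this way instead of by
  exhibiting orthogonal decompositions.\<close>

lemma proj_eqI:
 assumes y: "y <: X" and w: "w <: W" "!!v. v <: W ==> bil W w v = bil X y (g v)"
 shows "orth_proj X W g y = w"
 unfolding orth_proj_def
proof (rule the_equality)
 have "y \<oplus>\<^bsub>X\<^esub> g w\<in>perp X (g ` carrier W)"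
  unfolding perp_def using y w by (auto simp: X.bil_simps g_bil)
 moreover have "y = g w \<oplus>\<^bsub>X\<^esub> (y \<oplus>\<^bsub>X\<^esub> g w)" using y w gw[OF w(1)] by (simp add: X.ac)
 ultimately show "w <: W & (EX u:perp X (g ` carrier W). y = g w \<oplus>\<^bsub>X\<^esub> u)" using w by blast
 fix w' assume "w' <: W & (EX u:perp X (g ` carrier W). y = g w' \<oplus>\<^bsub>X\<^esub> u)"
 then obtain u where u: "w' <: W" "u\<in>perp X (g ` carrier W)" "y = g w' \<oplus>\<^bsub>X\<^esub> u" by auto
 show "w' = w"
 proof (rule W.bil_cancel[OF u(1) w(1)])
  fix v assume v: "v <: W"
  have "bil X y (g v) = bil W w' v" using u v by (auto simp: perp_def X.bil_simps g_bil)
  then show "bil W w' v = bil W w v" using w(2)[OF v] by simp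
 qed
qed

lemma proj_mem: "y <: X ==> orth_proj X W g y <: W"
 and proj_bil: "y <: X ==> v <: W ==> bil W (orth_proj X W g y) v = bil X y (g v)"
 using proj_ex[of y] proj_eqI[of y] by metis+

lemma proj_perp: "y <: X ==> y \<oplus>\<^bsub>X\<^esub> g (orth_proj X W g y)\<in>perp X (g ` carrier W)"
 unfolding perp_def using proj_mem by (auto simp: X.bil_simps g_bil proj_bil)

lemma proj_g: "w <: W ==> orth_proj X W g (g w) = w"
 by (rule proj_eqI) (auto simp: g_bil)

end

section \<open>Orthogonal sums and transport into the universe\<close>

definition osum :: "(bit, 'a) qspace => (bit, 'b) qspace => (bit, 'a \<times> 'b) qspace" where
 "osum X T = \<lparr>carrier = carrier X \<times> carrier T, monoid.mult = undefined, one = undefined,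
   ring.zero = (\<zero>\<^bsub>X\<^esub>, \<zero>\<^bsub>T\<^esub>), add = (%(x, t) (y, s). (x \<oplus>\<^bsub>X\<^esub> y, t \<oplus>\<^bsub>T\<^esub> s)),
   smult = (%c (x, t). (c \<odot>\<^bsub>X\<^esub> x, c \<odot>\<^bsub>T\<^esub> t)), qf = (%(x, t). qf X x + qf T t)\<rparr>"

lemma osum_simps [simp]:
 "carrier (osum X T) = carrier X \<times> carrier T" "\<zero>\<^bsub>osum X T\<^esub> = (\<zero>\<^bsub>X\<^esub>, \<zero>\<^bsub>T\<^esub>)"
 "(x, t) \<oplus>\<^bsub>osum X T\<^esub> (y, s) = (x \<oplus>\<^bsub>X\<^esub> y, t \<oplus>\<^bsub>T\<^esub> s)" "c \<odot>\<^bsub>osum X T\<^esub> (x, t) = (c \<odot>\<^bsub>X\<^esub> x, c \<odot>\<^bsub>T\<^esub> t)"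
 "qf (osum X T) (x, t) = qf X x + qf T t"
 "bil (osum X T) (x, t) (y, s) = bil X x y + bil T t s"
 by (auto simp: osum_def bil_def algebra_simps)

lemma ndsp_osum:
 assumes "ndsp X" "ndsp T"
 shows "ndsp (osum X T)"
proof -
 interpret X: ndsp X by fact
 interpret T: ndsp T by fact
 have "quadratic_space (osum X T)"
 proof (rule quadratic_spaceI)
  show "f2v (osum X T)" by (rule f2vI) (auto simp: X.ac T.ac)
 qed (auto simp: X.bil_simps T.bil_simps algebra_simps)
 moreover have "perp (osum X T) (carrier (osum X T)) = {\<zero>\<^bsub>osum X T\<^esub>}"
 proof (intro equalityI subsetI)
  fix z assume z: "z\<in>perp (osum X T) (carrier (osum X T))"
  obtain x t where xt: "z = (x, t)" by force
  have m: "x <: X" "t <: T" using z xt by (auto simp: perp_def)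
  have "bil X x y = 0" if "y <: X" for y
   using z xt that m by (auto simp: perp_def dest!: bspec[of _ _ "(y, \<zero>\<^bsub>T\<^esub>)"])
  moreover have "bil T t s = 0" if "s <: T" for s
   using z xt that m by (auto simp: perp_def dest!: bspec[of _ _ "(\<zero>\<^bsub>X\<^esub>, s)"])
  ultimately have "x = \<zero>\<^bsub>X\<^esub>" "t = \<zero>\<^bsub>T\<^esub>" using X.nondeg_ex[OF m(1)] T.nondeg_ex[OF m(2)] by auto
  then show "z\<in>{\<zero>\<^bsub>osum X T\<^esub>}" using xt by simp
 qed (auto simp: perp_def)
 ultimately show ?thesis unfolding ndsp_iff nondegenerate_def by blast
qed

text \<open>A nondegenerate space is a finite set, and an infinite type contains a set of the same
  size; the structure is copied along a bijection. This brings spaces built on product types back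
  among the objects.\<close>

lemma transport:
 fixes X :: "(bit, 'b) qspace"
 assumes "ndsp X"
 obtains X' and j :: "'b => 'a::infinite" where "ndsp X'" "bij_betw j (carrier X) (carrier X')"
  "!!u v. u <: X ==> v <: X ==> j (u \<oplus>\<^bsub>X\<^esub> v) = j u \<oplus>\<^bsub>X'\<^esub> j v"
  "!!u. u <: X ==> qf X' (j u) = qf X u"
proof -
 interpret X: ndsp X by fact
 obtain C :: "'a set" where C: "finite C" "card C = card (carrier X)"
  using infinite_arbitrarily_large[OF infinite_UNIV] by blast
 then obtain j where j: "bij_betw j (carrier X) C" using finite_same_card_bij[of "carrier X" C] by auto
 then have inj: "inj_on j (carrier X)" and img: "j ` carrier X = C" by (auto simp: bij_betw_def)
 define i where "i = inv_into (carrier X) j"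
 have ij [simp]: "i (j u) = u" if "u <: X" for u unfolding i_def using inj that by simp
 define X' :: "(bit, 'a) qspace" where "X' = \<lparr>carrier = C, monoid.mult = undefined, one = undefined, ring.zero = j \<zero>\<^bsub>X\<^esub>,
  add = (%u v. j (i u \<oplus>\<^bsub>X\<^esub> i v)), smult = (%c u. j (c \<odot>\<^bsub>X\<^esub> i u)), qf = (%u. qf X (i u))\<rparr>"
 have c [simp]: "carrier X' = C" "\<zero>\<^bsub>X'\<^esub> = j \<zero>\<^bsub>X\<^esub>" "qf X' u = qf X (i u)" for u by (simp_all add: X'_def)
 have op [simp]: "j u \<oplus>\<^bsub>X'\<^esub> j v = j (u \<oplus>\<^bsub>X\<^esub> v)" "c \<odot>\<^bsub>X'\<^esub> j u = j (c \<odot>\<^bsub>X\<^esub> u)"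
  if "u <: X" "v <: X" for u v c using that by (simp_all add: X'_def)
 have bl: "bil X' (j u) (j v) = bil X u v" if "u <: X" "v <: X" for u v
  using that by (simp add: bil_def)
 have C': "(ALL u:C. P u) \<longleftrightarrow> (ALL u:carrier X. P (j u))" for P using img by auto
 have "f2v X'"
 proof (rule f2vI)
  show "\<zero>\<^bsub>X'\<^esub> <: X'" using img by auto
  have E: "EX u:carrier X. x = j u" if "x <: X'" for x using that img by auto
  have J: "j u <: X'" if "u <: X" for u using that img by auto
  fix x assume "x <: X'"
  then obtain u where u: "u <: X" "x = j u" using E by blast
  then show "\<zero>\<^bsub>X'\<^esub> \<oplus>\<^bsub>X'\<^esub> x = x" "x \<oplus>\<^bsub>X'\<^esub> x = \<zero>\<^bsub>X'\<^esub>" "0 \<odot>\<^bsub>X'\<^esub> x = \<zero>\<^bsub>X'\<^esub>" "1 \<odot>\<^bsub>X'\<^esub> x = x"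
   by simp_all
  fix y assume "y <: X'"
  then obtain v where v: "v <: X" "y = j v" using E by blast
  then show "x \<oplus>\<^bsub>X'\<^esub> y <: X'" "x \<oplus>\<^bsub>X'\<^esub> y = y \<oplus>\<^bsub>X'\<^esub> x" using u J by (simp_all add: X.a_comm)
  fix z assume "z <: X'"
  then obtain w where w: "w <: X" "z = j w" using E by blast
  then show "(x \<oplus>\<^bsub>X'\<^esub> y) \<oplus>\<^bsub>X'\<^esub> z = x \<oplus>\<^bsub>X'\<^esub> (y \<oplus>\<^bsub>X'\<^esub> z)" using u v by (simp add: X.a_assoc)
 qed
 then have "quadratic_space X'"
  by (rule quadratic_spaceI) (use C in "auto simp flip: img simp: bl X.bil_simps")
 moreover have "perp X' (carrier X') = {\<zero>\<^bsub>X'\<^esub>}"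
 proof (intro equalityI subsetI)
  fix z assume "z\<in>perp X' (carrier X')"
  then obtain u where u: "u <: X" "z = j u" "ALL v:carrier X. bil X u v = 0"
   by (auto simp: perp_def bl simp flip: img)
  then have "u = \<zero>\<^bsub>X\<^esub>" using X.nondeg_ex[of u] by auto
  then show "z\<in>{\<zero>\<^bsub>X'\<^esub>}" using u by simp
 qed (auto simp: perp_def bl simp flip: img)
 ultimately have "ndsp X'" unfolding ndsp_iff nondegenerate_def by blast
 then show thesis by (rule that) (use j in auto)
qed

locale copy =
 fixes Q :: "(bit, 'b) qspace" and X :: "(bit, 'a) qspace" and j :: "'b => 'a"
 assumes X: "ndsp X" and bij: "bij_betw j (carrier Q) (carrier X)"
  and add: "u <: Q ==> v <: Q ==> j (u \<oplus>\<^bsub>Q\<^esub> v) = j u \<oplus>\<^bsub>X\<^esub> j v"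
  and qf: "u <: Q ==> qf X (j u) = qf Q u"
begin

lemma mem: "u <: Q ==> j u <: X"
 using bij by (auto simp: bij_betw_def)

lemma inj: "u <: Q ==> v <: Q ==> j u = j v \<longleftrightarrow> u = v"
 using bij by (auto simp: bij_betw_def inj_on_def)

end

lemma (in ndsp) copy_ex: "\<exists>X (j :: 'a => 'b::infinite). copy V X j"
 using transport[OF ndsp_axioms] unfolding copy_def by metis

lemma (in copy) bil:
 assumes "qsp Q" "u <: Q" "v <: Q"
 shows "bil X (j u) (j v) = bil Q u v"
proof -
 interpret Q: qsp Q by fact
 show ?thesis using assms unfolding bil_def by (simp add: qf flip: add)
qed

section \<open>Morphisms of the category of cospans\<close>

lemma (in qsp) qsp_sub:
 assumes "submodule N F2 V"
 shows "qsp (V\<lparr>carrier := N\<rparr>)"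
proof -
 note N = assms[unfolded sub_iff]
 have b: "bil (V\<lparr>carrier := N\<rparr>) u v = bil V u v" for u v by (simp add: bil_def)
 show ?thesis
  unfolding qsp_def
  by (rule quadratic_spaceI[OF f2v_sub[OF assms]])
   (use N in "auto simp: b bil_simps subset_iff intro: finite_subset[OF _ finite_carrier]")
qed

lemma qhom_sub_id:
 assumes "f2v V" "submodule N F2 V"
 shows "restrict id N\<in>qhom (V\<lparr>carrier := N\<rparr>) V"
proof -
 interpret f2v V by fact
 have "restrict id N\<in>lin_maps (V\<lparr>carrier := N\<rparr>) V"
  by (rule linI[OF f2v_sub[OF assms(2)] f2v_axioms]) (use assms(2) in "auto simp: sub_iff")
 then show ?thesis unfolding qhom_def by (auto simp: inj_on_def)
qed

lemma qhom_preimage_sub: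
 assumes "f2v V" "f2v W" "f2v X" "f\<in>qhom V X" "g\<in>qhom W X"
 shows "submodule {v\<in>carrier V. f v\<in>g ` carrier W} F2 V"
proof -
 interpret V: f2v V by fact
 interpret W: f2v W by fact
 show ?thesis
  unfolding V.sub_iff
 proof (intro conjI ballI)
  have "f \<zero>\<^bsub>V\<^esub> = g \<zero>\<^bsub>W\<^esub>" using qhom_zero[OF assms(1,3,4)] qhom_zero[OF assms(2,3,5)] by simp
  then show "\<zero>\<^bsub>V\<^esub>\<in>{v\<in>carrier V. f v\<in>g ` carrier W}" by auto
  fix u v assume "u\<in>{v\<in>carrier V. f v\<in>g ` carrier W}" "v\<in>{v\<in>carrier V. f v\<in>g ` carrier W}"
  then obtain w w' where w: "u <: V" "v <: V" "w <: W" "w' <: W" "f u = g w" "f v = g w'" by auto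
  then have "f (u \<oplus>\<^bsub>V\<^esub> v) = g (w \<oplus>\<^bsub>W\<^esub> w')" using qhomD(6)[OF assms(4)] qhomD(6)[OF assms(5)] by simp
  then show "u \<oplus>\<^bsub>V\<^esub> v\<in>{v\<in>carrier V. f v\<in>g ` carrier W}" using w by auto
 qed auto
qed

text \<open>The pullback of the two legs, seen as a subspace of \<open>V\<close>. It is not
  determined by \<open>eps_mor\<close>: the same linear map can occur with different
  \<open>dm\<close>, as \<open>zero_mor\<close> shows.\<close>

definition dm :: "'a qsp => 'a qsp => 'a triple set => 'a set" where
 "dm V W t = (case rep t of (X, f, g) => {v\<in>carrier V. f v\<in>g ` carrier W})"

lemma cospansD:
 assumes "(X, f, g)\<in>cospans V W"
 shows "ndsp X" "f\<in>qhom V X" "g\<in>qhom W X"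
 using assms unfolding cospans_def ndsp_iff by auto

text \<open>The map between the two middle spaces is isometric, which preserves the pairings, and
  injective, which preserves and reflects \<open>f v \<in> g W\<close>.\<close>

lemma cospan_step_inv:
 assumes "ndsp V" "ndsp W" "cospan_step V W (X, f, g) (X', f', g')"
 shows "(ALL v:carrier V. ALL w:carrier W. bil X' (f' v) (g' w) = bil X (f v) (g w)) &
  {v\<in>carrier V. f' v\<in>g' ` carrier W} = {v\<in>carrier V. f v\<in>g ` carrier W}"
proof -
 interpret V: ndsp V by fact
 interpret W: ndsp W by fact
 obtain a where a: "(X, f, g)\<in>cospans V W" "(X', f', g')\<in>cospans V W" "a\<in>qhom X X'"
   "compose (carrier V) a f = f'" "compose (carrier W) a g = g'"
  using assms(3) unfolding cospan_step_def by auto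
 note c = cospansD[OF a(1)]
 interpret X: ndsp X using c by simp
 have f: "f' v = a (f v)" "f v <: X" if "v <: V" for v
  using that qhomD(5)[OF c(2)] a(4) by (auto simp: compose_def)
 have g: "g' w = a (g w)" "g w <: X" if "w <: W" for w
  using that qhomD(5)[OF c(3)] a(5) by (auto simp: compose_def)
 have "bil X' (f' v) (g' w) = bil X (f v) (g w)" if "v <: V" "w <: W" for v w
  using that f g qhom_bil[OF X.f2v_axioms a(3)] by simp
 moreover have "f' v\<in>g' ` carrier W \<longleftrightarrow> f v\<in>g ` carrier W" if "v <: V" for v
  using that f g inj_on_eq_iff[OF qhomD(3)[OF a(3)]] by (auto simp: image_iff)
 ultimately show ?thesis by blast
qed

lemma cospan_equiv_inv:
 assumes "ndsp V" "ndsp W" "(X, f, g)\<in>cospans V W" "equivclp (cospan_step V W) (X, f, g) c'"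
 shows "c'\<in>cospans V W & (\<forall>X' f' g'. c' = (X', f', g') -->
  (ALL v:carrier V. ALL w:carrier W. bil X' (f' v) (g' w) = bil X (f v) (g w)) &
  {v\<in>carrier V. f' v\<in>g' ` carrier W} = {v\<in>carrier V. f v\<in>g ` carrier W})"
 using assms(4)
proof (induction rule: equivclp_induct)
 case base
 then show ?case using assms(3) by simp
next
 case (step y z)
 obtain Y f1 g1 where y: "y = (Y, f1, g1)" by (cases y) auto
 obtain Z f2 g2 where z: "z = (Z, f2, g2)" by (cases z) auto
 from step(2) show ?case
 proof
  assume s: "cospan_step V W y z"
  then have "z\<in>cospans V W" using y z by (auto simp: cospan_step_def)
  then show ?thesis using cospan_step_inv[OF assms(1,2), of Y f1 g1 Z f2 g2] s step.IH y z by simp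
 next
  assume s: "cospan_step V W z y"
  then have "z\<in>cospans V W" using y z by (auto simp: cospan_step_def)
  then show ?thesis using cospan_step_inv[OF assms(1,2), of Z f2 g2 Y f1 g1] s step.IH y z by simp
 qed
qed

lemma rep_class:
 assumes "ndsp V" "ndsp W" "(X, f, g)\<in>cospans V W" "t = cospan_class V W (X, f, g)" "rep t = (X', f', g')"
 shows "(X', f', g')\<in>cospans V W"
  "!!v w. v <: V ==> w <: W ==> bil X' (f' v) (g' w) = bil X (f v) (g w)"
  "{v\<in>carrier V. f' v\<in>g' ` carrier W} = {v\<in>carrier V. f v\<in>g ` carrier W}"
proof -
 have "(X, f, g)\<in>t" using assms(4) unfolding cospan_class_def by simp
 then have "rep t\<in>t" unfolding rep_def by (rule someI[where P = "%c. c\<in>t"])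
 then have "equivclp (cospan_step V W) (X, f, g) (X', f', g')" using assms(4,5) unfolding cospan_class_def by simp
 from cospan_equiv_inv[OF assms(1-3) this] show "(X', f', g')\<in>cospans V W"
  "!!v w. v <: V ==> w <: W ==> bil X' (f' v) (g' w) = bil X (f v) (g w)"
  "{v\<in>carrier V. f' v\<in>g' ` carrier W} = {v\<in>carrier V. f v\<in>g ` carrier W}"
  by simp_all
qed

lemma isom_pairI: "ndsp V ==> ndsp X ==> g\<in>qhom V X ==> isom_pair V X g"
 unfolding isom_pair_def isom_pair_axioms_def by (simp add: ndsp_def)

text \<open>\<open>eps_mor\<close> and \<open>dm\<close> are defined from the chosen representative;
  here they are computed from any given one. The projection of \<open>f v\<close> depends only on
  its pairings with the vectors \<open>g w\<close>, and these are invariant.\<close>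

lemma class_inv:
 assumes "ndsp V" "ndsp W" "(X, f, g)\<in>cospans V W" "t = cospan_class V W (X, f, g)"
 shows "v <: V ==> eps_mor V W t v = orth_proj X W g (f v)"
  "dm V W t = {v\<in>carrier V. f v\<in>g ` carrier W}"
proof -
 obtain X' f' g' where r: "rep t = (X', f', g')" by (cases "rep t") auto
 note R = rep_class[OF assms r]
 note c = cospansD[OF R(1)] and c' = cospansD[OF assms(3)]
 interpret G: isom_pair W X g by (rule isom_pairI) (use assms c' in auto)
 interpret G': isom_pair W X' g' by (rule isom_pairI) (use assms c in auto)
 show "dm V W t = {v\<in>carrier V. f v\<in>g ` carrier W}" using R(3) r unfolding dm_def by simp
 show "eps_mor V W t v = orth_proj X W g (f v)" if v: "v <: V"
 proof -
  have fv: "f v <: X" "f' v <: X'" using v qhomD(5) c c' by metis+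
  have "orth_proj X W g (f v) = orth_proj X' W g' (f' v)"
   by (rule G.proj_eqI[OF fv(1) G'.proj_mem[OF fv(2)]]) (use fv v R(2) G'.proj_bil in auto)
  then show ?thesis unfolding eps_mor_def r using v by (simp add: compose_def)
 qed
qed

lemma Tq_simps [simp]: "Obj Tq = {V. nondegenerate V}" "Hom Tq V W = cospan_class V W ` cospans V W"
  "Comp Tq = cospan_comp" "Idm Tq V = cospan_class V V (V, restrict id (carrier V), restrict id (carrier V))"
 by (simp_all add: Tq_def)

locale tmor = V: ndsp V + W: ndsp W for V W :: "'a qsp" +
 fixes t assumes t: "t\<in>Hom Tq V W"
begin

lemma rep_ex: "\<exists>X f g. rep t = (X, f, g) & isom_pair V X f & isom_pair W X g & ndsp X &
 (ALL v:carrier V. eps_mor V W t v = orth_proj X W g (f v)) &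
 dm V W t = {v\<in>carrier V. f v\<in>g ` carrier W}"
proof -
 obtain X f g where X: "t = cospan_class V W (X, f, g)" "(X, f, g)\<in>cospans V W" using t by auto
 obtain X' f' g' where r: "rep t = (X', f', g')" by (cases "rep t") auto
 note R = rep_class[OF V.ndsp_axioms W.ndsp_axioms X(2,1) r]
 note c = cospansD[OF R(1)]
 have "isom_pair V X' f'" "isom_pair W X' g'"
  by (rule isom_pairI; use c V.ndsp_axioms W.ndsp_axioms in auto)+
 moreover have "ALL v:carrier V. eps_mor V W t v = orth_proj X' W g' (f' v)"
  unfolding eps_mor_def r by (simp add: compose_def)
 ultimately show ?thesis using r c by (auto simp: dm_def)
qed

text \<open>For \<open>a\<close> in \<open>dm\<close> one has \<open>f a = g (p a)\<close> with
  \<open>p = eps_mor V W t\<close>, so pairing \<open>p v\<close> with \<open>p a\<close> can be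
  done in the middle space and gives \<open>B v a\<close>. Only one of the two vectors has to lie in
  \<open>dm\<close>; this makes the support condition \<open>B w a = 1\<close> of \<open>Mix\<close>
  functorial although \<open>p\<close> need not be isometric.\<close>

lemma eps_mem [simp]: "v <: V ==> eps_mor V W t v <: W"
 and dm_sub: "submodule (dm V W t) F2 V"
 and eps_lin: "eps_mor V W t\<in>lin_maps V W"
 and dm_bil: "a\<in>dm V W t ==> v <: V ==> bil W (eps_mor V W t a) (eps_mor V W t v) = bil V a v"
 and dm_qf: "a\<in>dm V W t ==> qf W (eps_mor V W t a) = qf V a"
 and eps_ext: "eps_mor V W t\<in>extensional (carrier V)"
proof -
 obtain X f g where X: "rep t = (X, f, g)" "isom_pair V X f" "isom_pair W X g" "ndsp X"
  "!!v. v <: V ==> eps_mor V W t v = orth_proj X W g (f v)"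
  "dm V W t = {v\<in>carrier V. f v\<in>g ` carrier W}" using rep_ex by auto
 interpret X: ndsp X by fact
 interpret f: isom_pair V X f by fact
 interpret g: isom_pair W X g by fact
 show m: "eps_mor V W t v <: W" if "v <: V" for v using X(5) g.proj_mem f.gw that by simp
 have b: "bil W (eps_mor V W t v) w = bil X (f v) (g w)" if "v <: V" "w <: W" for v w
  using X(5) g.proj_bil f.gw that by simp
 show "submodule (dm V W t) F2 V"
  unfolding X(6) by (rule qhom_preimage_sub) (use V.f2v_axioms W.f2v_axioms X.f2v_axioms f.g g.g in auto)
 show lin: "eps_mor V W t\<in>lin_maps V W"
 proof (rule linI[OF V.f2v_axioms W.f2v_axioms m])
  fix x y assume xy: "x <: V" "y <: V"
  show "eps_mor V W t (x \<oplus>\<^bsub>V\<^esub> y) = eps_mor V W t x \<oplus>\<^bsub>W\<^esub> eps_mor V W t y"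
   by (rule W.bil_cancel) (use xy m in "auto simp: W.bil_simps b qhomD(6)[OF f.g] X.bil_simps")
 qed
 have ga: "g (eps_mor V W t a) = f a" if "a\<in>dm V W t" for a
  using that X(5,6) g.proj_g by auto
 show "qf W (eps_mor V W t a) = qf V a" if "a\<in>dm V W t"
  using ga[OF that] qhomD(4)[OF g.g, of "eps_mor V W t a"] qhomD(4)[OF f.g, of a] m[of a] that X(6) by simp
 show "bil W (eps_mor V W t a) (eps_mor V W t v) = bil V a v" if a: "a\<in>dm V W t" and v: "v <: V"
 proof -
  have a': "a <: V" using a X(6) by simp
  have "bil W (eps_mor V W t a) (eps_mor V W t v) = bil W (eps_mor V W t v) (eps_mor V W t a)"
   using a' v m W.bil_sym by simp
  also have "\<dots> = bil X (f v) (f a)" using b ga a a' v m by simp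
  also have "\<dots> = bil V v a" using f.g_bil a' v by simp
  finally show ?thesis using a' v V.bil_sym by simp
 qed
 show "eps_mor V W t\<in>extensional (carrier V)" unfolding eps_mor_def X(1) by simp
qed

lemma dm_carrier: "a\<in>dm V W t ==> a <: V"
 using dm_sub V.sub_iff by auto

lemma dm_nonzero: "a\<in>dm V W t ==> a ~= \<zero>\<^bsub>V\<^esub> ==> eps_mor V W t a ~= \<zero>\<^bsub>W\<^esub>"
 using V.nondeg_ex[of a] dm_bil[of a] dm_carrier[of a] W.bil_zero(1) by force

lemma eps_add: "u <: V ==> v <: V ==> eps_mor V W t (u \<oplus>\<^bsub>V\<^esub> v) = eps_mor V W t u \<oplus>\<^bsub>W\<^esub> eps_mor V W t v"
 by (rule lin_add[OF eps_lin])

text \<open>Consequently two morphisms with the same \<open>dm\<close>, on which their projections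
  agree, are identified by every functor of the form \<open>kappa G\<close>.\<close>

lemma cospan_to_span_eq: "cospan_to_span V W t =
  span_class V W (V\<lparr>carrier := dm V W t\<rparr>, restrict id (dm V W t), restrict (eps_mor V W t) (dm V W t))"
proof -
 obtain X f g where X: "rep t = (X, f, g)" "isom_pair V X f" "isom_pair W X g" "ndsp X"
  "!!v. v <: V ==> eps_mor V W t v = orth_proj X W g (f v)"
  "dm V W t = {v\<in>carrier V. f v\<in>g ` carrier W}" using rep_ex by auto
 interpret g: isom_pair W X g by fact
 have "inv_into (carrier W) g (f v) = eps_mor V W t v" if v: "v\<in>dm V W t" for v
 proof -
  obtain w where w: "v <: V" "w <: W" "f v = g w" using v X(6) by auto
  then have "eps_mor V W t v = w" using X(5) g.proj_g by simp
  moreover have "inv_into (carrier W) g (g w) = w" using qhomD(3)[OF g.g] w by simp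
  ultimately show ?thesis using w by simp
 qed
 then have "restrict (%v. inv_into (carrier W) g (f v)) (dm V W t) = restrict (eps_mor V W t) (dm V W t)"
  by (auto simp: fun_eq_iff)
 then show ?thesis unfolding cospan_to_span_def X(1) qpullback_def X(6) Let_def by simp
qed

end

lemma tmorI: "V\<in>Obj Tq ==> W\<in>Obj Tq ==> t\<in>Hom Tq V W ==> tmor V W t"
 unfolding tmor_def tmor_axioms_def ndsp_iff by simp

lemma Tq_id:
 assumes "ndsp V"
 shows "tmor V V (Idm Tq V)" "v <: V ==> eps_mor V V (Idm Tq V) v = v" "dm V V (Idm Tq V) = carrier V"
proof -
 interpret V: ndsp V by fact
 have i: "restrict id (carrier V)\<in>qhom V V"
  using qhom_sub_id[OF V.f2v_axioms, of "carrier V"] by (simp add: V.sub_iff)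
 then have c: "(V, restrict id (carrier V), restrict id (carrier V))\<in>cospans V V"
  using V.ndsp_axioms unfolding cospans_def ndsp_iff by simp
 show "tmor V V (Idm Tq V)" by unfold_locales (use c in auto)
 note I = class_inv[OF assms assms c refl]
 interpret g: isom_pair V V "restrict id (carrier V)" by (rule isom_pairI) (use assms i in auto)
 show "v <: V ==> eps_mor V V (Idm Tq V) v = v" using I(1)[of v] g.proj_g[of v] by simp
 show "dm V V (Idm Tq V) = carrier V" using I(2) by auto
qed

section \<open>Amalgams and the composition of cospans\<close>

lemma perp_ndsp:
 assumes "isom_pair W X g" "ndsp X"
 shows "ndsp (X\<lparr>carrier := perp X (g ` carrier W)\<rparr>)"
proof -
 interpret isom_pair W X g by fact
 interpret X: ndsp X by fact
 let ?P = "perp X (g ` carrier W)"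
 have sub: "submodule ?P F2 X"
  unfolding X.sub_iff perp_def by (auto simp: X.bil_simps)
 have b: "bil (X\<lparr>carrier := ?P\<rparr>) u v = bil X u v" for u v by (simp add: bil_def)
 have "perp (X\<lparr>carrier := ?P\<rparr>) ?P = {\<zero>\<^bsub>X\<^esub>}"
 proof (intro equalityI subsetI)
  fix z assume "z\<in>perp (X\<lparr>carrier := ?P\<rparr>) ?P"
  then have z: "z\<in>?P" "ALL u:?P. bil X z u = 0" by (auto simp: perp_def[of "X\<lparr>carrier := ?P\<rparr>"] b)
  have zc: "z <: X" using z by (auto simp: perp_def)
  have "bil X z y = bil X \<zero>\<^bsub>X\<^esub> y" if y: "y <: X" for y
  proof -
   let ?w = "orth_proj X W g y"
   have "bil X z (y \<oplus>\<^bsub>X\<^esub> g ?w) = 0" "bil X z (g ?w) = 0"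
    using z proj_perp[OF y] proj_mem[OF y] by (auto simp: perp_def)
   then show ?thesis using zc y proj_mem[OF y] by (simp add: X.bil_simps)
  qed
  then show "z\<in>{\<zero>\<^bsub>X\<^esub>}" using X.bil_cancel[OF zc X.zero_closed] by auto
 next
  fix z assume "z\<in>{\<zero>\<^bsub>X\<^esub>}"
  then show "z\<in>perp (X\<lparr>carrier := ?P\<rparr>) ?P"
   using sub unfolding X.sub_iff perp_def[of "X\<lparr>carrier := ?P\<rparr>"] b by auto
 qed
 then show ?thesis using X.qsp_sub[OF sub] by (simp add: ndsp_def ndsp_axioms_def)
qed

text \<open>The orthogonal sum of \<open>X1\<close> and the orthogonal \<open>T\<close> of
  \<open>W\<close> in \<open>X2\<close> is the amalgam: a vector of \<open>X2\<close> is split into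
  its projection to \<open>W\<close>, which enters \<open>X1\<close> through \<open>g\<close>, and
  its component in \<open>T\<close>.\<close>

lemma amalgam_ex:
 fixes W :: "'a::infinite qsp"
 assumes "isom_pair W X1 g" "isom_pair W X2 f" "ndsp X1" "ndsp X2"
 shows "\<exists>A. amalgam W X1 g X2 f A"
proof -
 interpret X1: ndsp X1 by fact
 interpret X2: ndsp X2 by fact
 interpret g: isom_pair W X1 g by fact
 interpret f: isom_pair W X2 f by fact
 define P1 where "P1 = perp X1 (g ` carrier W)"
 define P2 where "P2 = perp X2 (f ` carrier W)"
 define T where "T = X2\<lparr>carrier := P2\<rparr>"
 have P2: "submodule P2 F2 X2" unfolding X2.sub_iff perp_def P2_def by (auto simp: X2.bil_simps)
 interpret T: ndsp T unfolding T_def P2_def by (rule perp_ndsp) fact+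
 have T: "carrier T = P2" "\<zero>\<^bsub>T\<^esub> = \<zero>\<^bsub>X2\<^esub>" "add T = add X2" "qf T = qf X2" "bil T = bil X2"
  unfolding T_def by (simp_all add: bil_def fun_eq_iff)
 have P2c: "t <: X2" if "t\<in>P2" for t using that P2 X2.sub_iff by auto
 interpret O: ndsp "osum X1 T" by (rule ndsp_osum) (rule X1.ndsp_axioms T.ndsp_axioms)+
 obtain X and j :: "'a \<times> 'a => 'a" where "copy (osum X1 T) X j" using O.copy_ex by blast
 then interpret j: copy "osum X1 T" X j .
 interpret X: ndsp X by (rule j.X)
 note X = j.X and j = j.bij and j_add = j.add and j_qf = j.qf and jb = j.bil[OF O.qsp_axioms] and jm = j.mem
 have jadd: "j (a, b) \<oplus>\<^bsub>X\<^esub> j (a', b') = j (a \<oplus>\<^bsub>X1\<^esub> a', b \<oplus>\<^bsub>X2\<^esub> b')"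
  if "a <: X1" "a' <: X1" "b\<in>P2" "b'\<in>P2" for a a' b b'
  using j_add[of "(a, b)" "(a', b')"] that by (simp add: T)
 have jqf: "qf X (j (a, b)) = qf X1 a + qf X2 b" if "a <: X1" "b\<in>P2" for a b
  using j_qf[of "(a, b)"] that by (simp add: T)
 have jbil: "bil X (j (a, b)) (j (a', b')) = bil X1 a a' + bil X2 b b'"
  if "a <: X1" "a' <: X1" "b\<in>P2" "b'\<in>P2" for a a' b b'
  using jb[of "(a, b)" "(a', b')"] that by (simp add: T)
 have jinj: "j (a, b) = j (a', b') \<longleftrightarrow> a = a' & b = b'"
  if "a <: X1" "a' <: X1" "b\<in>P2" "b'\<in>P2" for a a' b b'
  using j that by (auto simp: bij_betw_def inj_on_def T)
 have z: "\<zero>\<^bsub>X2\<^esub>\<in>P2" using P2 X2.sub_iff by auto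
 define pf where "pf y = orth_proj X2 W f y" for y
 define s where "s y = y \<oplus>\<^bsub>X2\<^esub> f (pf y)" for y
 have pf: "pf y <: W" "s y\<in>P2" if "y <: X2" for y
  using f.proj_mem[OF that] f.proj_perp[OF that] by (auto simp: pf_def s_def P2_def)
 have pf_add: "pf (y \<oplus>\<^bsub>X2\<^esub> y') = pf y \<oplus>\<^bsub>W\<^esub> pf y'" if "y <: X2" "y' <: X2" for y y'
  unfolding pf_def
  by (rule f.proj_eqI) (use that f.proj_mem f.proj_bil in "auto simp: g.W.bil_simps X2.bil_simps")
 have s_add: "s (y \<oplus>\<^bsub>X2\<^esub> y') = s y \<oplus>\<^bsub>X2\<^esub> s y'" if "y <: X2" "y' <: X2" for y y'
  unfolding s_def using that pf by (simp add: pf_add qhomD(6)[OF f.g] X2.ac)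
 have y_eq: "y = f (pf y) \<oplus>\<^bsub>X2\<^esub> s y" if "y <: X2" for y
  using that pf f.gw by (simp add: s_def X2.ac)
 have pf_P2: "pf t = \<zero>\<^bsub>W\<^esub>" "s t = t" if "t\<in>P2" for t
 proof -
  have "pf t = \<zero>\<^bsub>W\<^esub>" unfolding pf_def by (rule f.proj_eqI) (use P2c[OF that] that in "simp_all add: P2_def perp_def")
  then show "pf t = \<zero>\<^bsub>W\<^esub>" "s t = t"
   using qhom_zero[OF g.W.f2v_axioms X2.f2v_axioms f.g] P2c[OF that] by (simp_all add: s_def)
 qed
 have pf_f: "pf (f w) = w" "s (f w) = \<zero>\<^bsub>X2\<^esub>" if "w <: W" for w
  using f.proj_g[OF that] that by (simp_all add: pf_def s_def)
 define i1 where "i1 = restrict (%y. j (y, \<zero>\<^bsub>X2\<^esub>)) (carrier X1)"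
 define i2 where "i2 = restrict (%y. j (g (pf y), s y)) (carrier X2)"
 have i1: "i1\<in>qhom X1 X"
  unfolding qhom_def i1_def
  using z jm by (auto intro!: linI X1.f2v_axioms X.f2v_axioms simp: inj_on_def jadd jqf jinj T)
 have i2: "i2\<in>qhom X2 X"
 proof -
  have "i2\<in>lin_maps X2 X"
   unfolding i2_def
   by (rule linI[OF X2.f2v_axioms X.f2v_axioms])
    (use pf jm in "auto simp: jadd pf_add s_add T qhomD(6)[OF g.g]")
  moreover have "inj_on i2 (carrier X2)"
  proof (rule inj_onI)
   fix y y' assume *: "y <: X2" "y' <: X2" "i2 y = i2 y'"
   then have "g (pf y) = g (pf y')" "s y = s y'" using pf by (auto simp: i2_def jinj)
   then have "pf y = pf y'" using qhomD(3)[OF g.g] pf * by (auto simp: inj_on_def)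
   then show "y = y'" using y_eq[OF *(1)] y_eq[OF *(2)] \<open>s y = s y'\<close> by simp
  qed
  moreover have "qf X (i2 y) = qf X2 y" if y: "y <: X2" for y
  proof -
   have "bil X2 (s y) (f (pf y)) = 0" using pf[OF y] by (auto simp: P2_def perp_def)
   then have "bil X2 (f (pf y)) (s y) = 0" using X2.bil_sym pf[OF y] P2c by simp
   then have "qf X2 y = qf X2 (f (pf y)) + qf X2 (s y)" by (subst y_eq[OF y]) (simp add: X2.qf_add)
   then show ?thesis using pf[OF y] y qhomD(4)[OF f.g] qhomD(4)[OF g.g] by (simp add: i2_def jqf)
  qed
  ultimately show ?thesis unfolding qhom_def by (simp add: i2_def)
 qed
 have P1c: "u <: X1" if "u\<in>P1" for u using that by (auto simp: P1_def perp_def)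
 have P1a: "u\<in>P1 ==> v\<in>P1 ==> u \<oplus>\<^bsub>X1\<^esub> v\<in>P1" for u v unfolding P1_def perp_def by (auto simp: X1.bil_simps)
 have val: "i1 (g w) \<oplus>\<^bsub>X\<^esub> i1 u \<oplus>\<^bsub>X\<^esub> i2 t = j (g w \<oplus>\<^bsub>X1\<^esub> u, t)"
  if "w <: W" "u\<in>P1" "t\<in>P2" for w u t
  using that P1c P2c z pf_P2[OF that(3)] qhom_zero[OF g.W.f2v_axioms X1.f2v_axioms g.g]
  by (simp add: i1_def i2_def jadd)
 have "bij_betw (%(w, u, t). i1 (g w) \<oplus>\<^bsub>X\<^esub> i1 u \<oplus>\<^bsub>X\<^esub> i2 t) (carrier W \<times> P1 \<times> P2) (carrier X)"
  unfolding bij_betw_def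
 proof
  show "inj_on (%(w, u, t). i1 (g w) \<oplus>\<^bsub>X\<^esub> i1 u \<oplus>\<^bsub>X\<^esub> i2 t) (carrier W \<times> P1 \<times> P2)"
  proof (rule inj_onI)
   fix p p' assume p: "p\<in>carrier W \<times> P1 \<times> P2" "p'\<in>carrier W \<times> P1 \<times> P2"
    "(case p of (w, u, t) => i1 (g w) \<oplus>\<^bsub>X\<^esub> i1 u \<oplus>\<^bsub>X\<^esub> i2 t) = (case p' of (w, u, t) => i1 (g w) \<oplus>\<^bsub>X\<^esub> i1 u \<oplus>\<^bsub>X\<^esub> i2 t)"
   obtain w u t w' u' t' where pp: "p = (w, u, t)" "p' = (w', u', t')" by (cases p, cases p') auto
   have m: "w <: W" "u\<in>P1" "t\<in>P2" "w' <: W" "u'\<in>P1" "t'\<in>P2" using p pp by auto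
   have "j (g w \<oplus>\<^bsub>X1\<^esub> u, t) = j (g w' \<oplus>\<^bsub>X1\<^esub> u', t')" using p(3) pp m by (simp add: val)
   then have e: "g w \<oplus>\<^bsub>X1\<^esub> u = g w' \<oplus>\<^bsub>X1\<^esub> u'" "t = t'" using m P1c[OF m(2)] P1c[OF m(5)] by (simp_all add: jinj)
   have "w = w'"
   proof (rule g.W.bil_cancel[OF m(1,4)])
    fix v assume v: "v <: W"
    have u0: "bil X1 u (g v) = 0" "bil X1 u' (g v) = 0" using m(2,5) v by (auto simp: P1_def perp_def)
    have "bil X1 (g w \<oplus>\<^bsub>X1\<^esub> u) (g v) = bil W w v" "bil X1 (g w' \<oplus>\<^bsub>X1\<^esub> u') (g v) = bil W w' v"
     using m(1,4) v P1c[OF m(2)] P1c[OF m(5)] u0 by (simp_all add: X1.bil_simps g.g_bil)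
    then show "bil W w v = bil W w' v" using e by simp
   qed
   moreover have "u = u'"
    using e(1) \<open>w = w'\<close> X1.add_left_self[of "g w'" u] X1.add_left_self[of "g w'" u'] m P1c g.gw by simp
   ultimately show "p = p'" using e pp by simp
  qed
  show "(%(w, u, t). i1 (g w) \<oplus>\<^bsub>X\<^esub> i1 u \<oplus>\<^bsub>X\<^esub> i2 t) ` (carrier W \<times> P1 \<times> P2) = carrier X"
  proof (intro equalityI subsetI)
   fix y assume "y <: X"
   then have "y\<in>j ` (carrier X1 \<times> P2)" using j by (simp add: bij_betw_def T)
   then obtain a b where ab: "a <: X1" "b\<in>P2" "y = j (a, b)" by auto
   let ?w = "orth_proj X1 W g a"
   have w: "?w <: W" "a \<oplus>\<^bsub>X1\<^esub> g ?w\<in>P1" using g.proj_mem[OF ab(1)] g.proj_perp[OF ab(1)] by (auto simp: P1_def)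
   have "g ?w \<oplus>\<^bsub>X1\<^esub> (a \<oplus>\<^bsub>X1\<^esub> g ?w) = a" using ab w g.gw by (simp add: X1.ac)
   then have "y = i1 (g ?w) \<oplus>\<^bsub>X\<^esub> i1 (a \<oplus>\<^bsub>X1\<^esub> g ?w) \<oplus>\<^bsub>X\<^esub> i2 b" using val[OF w(1,2) ab(2)] ab by simp
   then show "y\<in>(%(w, u, t). i1 (g w) \<oplus>\<^bsub>X\<^esub> i1 u \<oplus>\<^bsub>X\<^esub> i2 t) ` (carrier W \<times> P1 \<times> P2)"
    using w ab by (auto intro!: image_eqI[of _ _ "(?w, a \<oplus>\<^bsub>X1\<^esub> g ?w, b)"])
  qed (use val jm P1c in "auto simp: T")
 qed
 moreover have "i1 (g w) = i2 (f w)" if "w <: W" for w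
  using that pf_f by (simp add: i1_def i2_def)
 moreover have "bil X (i1 u) (i2 t) = 0" if "u\<in>P1" "t\<in>P2" for u t
  using that P1c P2c z pf_P2[OF that(2)] qhom_zero[OF g.W.f2v_axioms X1.f2v_axioms g.g]
  by (simp add: i1_def i2_def jbil)
 ultimately have "amalgam W X1 g X2 f (X, i1, i2)"
  using i1 i2 X unfolding amalgam_def P1_def P2_def ndsp_iff by simp
 then show ?thesis by blast
qed

text \<open>Representatives and amalgam are arbitrary choices, so both invariants are derived from
  the clauses of \<open>amalgam\<close> alone: the projection through pairings, the subspace through
  uniqueness of the decomposition into \<open>W\<close>, \<open>W'\<close> and
  \<open>W''\<close>.\<close>

lemma Tq_comp:
 fixes V :: "'a::infinite qsp"
 assumes "tmor V W s" "tmor W Y t"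
 shows "tmor V Y (Comp Tq V W Y t s)"
  "v <: V ==> eps_mor V Y (Comp Tq V W Y t s) v = eps_mor W Y t (eps_mor V W s v)"
  "dm V Y (Comp Tq V W Y t s) = {v\<in>dm V W s. eps_mor V W s v\<in>dm W Y t}"
proof -
 interpret s: tmor V W s by fact
 interpret t: tmor W Y t by fact
 obtain X1 f g where X1: "rep s = (X1, f, g)" "isom_pair V X1 f" "isom_pair W X1 g" "ndsp X1"
  "!!v. v <: V ==> eps_mor V W s v = orth_proj X1 W g (f v)"
  "dm V W s = {v\<in>carrier V. f v\<in>g ` carrier W}" using s.rep_ex by auto
 obtain X2 f' g' where X2: "rep t = (X2, f', g')" "isom_pair W X2 f'" "isom_pair Y X2 g'" "ndsp X2"
  "!!v. v <: W ==> eps_mor W Y t v = orth_proj X2 Y g' (f' v)"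
  "dm W Y t = {v\<in>carrier W. f' v\<in>g' ` carrier Y}" using t.rep_ex by auto
 interpret X1: ndsp X1 by fact
 interpret X2: ndsp X2 by fact
 interpret f: isom_pair V X1 f by fact
 interpret g: isom_pair W X1 g by fact
 interpret f': isom_pair W X2 f' by fact
 interpret g': isom_pair Y X2 g' by fact
 define A where "A = (SOME A. amalgam W X1 g X2 f' A)"
 have am: "amalgam W X1 g X2 f' A"
  unfolding A_def by (rule someI_ex, rule amalgam_ex) fact+
 obtain X i1 i2 where A: "A = (X, i1, i2)" by (cases A) auto
 define P1 where "P1 = perp X1 (g ` carrier W)"
 define P2 where "P2 = perp X2 (f' ` carrier W)"
 from am have X: "ndsp X" and i1: "i1\<in>qhom X1 X" and i2: "i2\<in>qhom X2 X"
  and i12: "!!w. w <: W ==> i1 (g w) = i2 (f' w)"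
  and orth: "!!u v. u\<in>P1 ==> v\<in>P2 ==> bil X (i1 u) (i2 v) = 0"
  and bij: "bij_betw (%(w, s, t). i1 (g w) \<oplus>\<^bsub>X\<^esub> i1 s \<oplus>\<^bsub>X\<^esub> i2 t) (carrier W \<times> P1 \<times> P2) (carrier X)"
  unfolding A amalgam_def ndsp_iff P1_def P2_def by auto
 interpret X: ndsp X by fact
 let ?F = "compose (carrier V) i1 f" and ?G = "compose (carrier Y) i2 g'"
 have F: "?F\<in>qhom V X" by (rule qhom_compose[OF s.V.f2v_axioms f.g i1])
 have G: "?G\<in>qhom Y X" by (rule qhom_compose[OF t.W.f2v_axioms g'.g i2])
 have comp: "Comp Tq V W Y t s = cospan_class V Y (X, ?F, ?G)"
  unfolding Tq_simps cospan_comp_def X1(1) X2(1) using A by (simp add: A_def)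
 have c: "(X, ?F, ?G)\<in>cospans V Y" using X F G unfolding cospans_def ndsp_iff by simp
 show "tmor V Y (Comp Tq V W Y t s)"
  by unfold_locales (use c comp in "auto simp del: Tq_simps(3)")
 note I = class_inv[OF s.V.ndsp_axioms t.W.ndsp_axioms c comp]
 interpret G: isom_pair Y X ?G by (rule isom_pairI) (use t.W.ndsp_axioms X G in auto)
 have i1m: "i1 u <: X" if "u <: X1" for u using qhomD(5)[OF i1 that] .
 have i2m: "i2 u <: X" if "u <: X2" for u using qhomD(5)[OF i2 that] .
 \<comment> \<open>Only the component of \<open>y\<close> in \<open>W\<close> contributes, since its
   component orthogonal to \<open>g W\<close> is orthogonal to all of \<open>i2 X2\<close>.\<close>
 have bil1: "bil X (i1 y) (i2 z) = bil X2 (f' (orth_proj X1 W g y)) z" if y: "y <: X1" and z: "z <: X2" for y z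
 proof -
  let ?w = "orth_proj X1 W g y" and ?w' = "orth_proj X2 W f' z"
  let ?s = "y \<oplus>\<^bsub>X1\<^esub> g ?w" and ?t = "z \<oplus>\<^bsub>X2\<^esub> f' ?w'"
  have m: "?w <: W" "?w' <: W" "?s\<in>P1" "?t\<in>P2"
   using y z g.proj_mem g.proj_perp f'.proj_mem f'.proj_perp by (auto simp: P1_def P2_def)
  have mc: "?s <: X1" "?t <: X2" using m by (auto simp: P1_def P2_def perp_def)
  have ye: "y = g ?w \<oplus>\<^bsub>X1\<^esub> ?s" and ze: "z = f' ?w' \<oplus>\<^bsub>X2\<^esub> ?t"
   using y z m g.gw f'.gw by (simp_all add: X1.ac X2.ac)
  have "i1 y = i2 (f' ?w) \<oplus>\<^bsub>X\<^esub> i1 ?s"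
   using qhomD(6)[OF i1, of "g ?w" ?s] m mc ye i12 by simp
  moreover have "bil X (i1 ?s) (i2 z) = 0"
  proof -
   have "i2 z = i1 (g ?w') \<oplus>\<^bsub>X\<^esub> i2 ?t" using qhomD(6)[OF i2, of "f' ?w'" ?t] m mc ze i12 by simp
   moreover have "bil X (i1 ?s) (i1 (g ?w')) = 0"
    using qhom_bil[OF X1.f2v_axioms i1, of ?s "g ?w'"] m mc by (auto simp: P1_def perp_def)
   ultimately show ?thesis using orth[OF m(3,4)] m mc i1m i2m by (simp add: X.bil_simps)
  qed
  ultimately show ?thesis
   using m mc i1m i2m z qhom_bil[OF X2.f2v_axioms i2, of "f' ?w" z] by (simp add: X.bil_simps)
 qed
 show "eps_mor V Y (Comp Tq V W Y t s) v = eps_mor W Y t (eps_mor V W s v)" if v: "v <: V"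
 proof -
  have "orth_proj X Y ?G (?F v) = eps_mor W Y t (eps_mor V W s v)"
  proof (rule G.proj_eqI)
   show "?F v <: X" using qhomD(5)[OF F v] .
   show "eps_mor W Y t (eps_mor V W s v) <: Y" using v by simp
   fix y assume y: "y <: Y"
   have "bil X (?F v) (?G y) = bil X2 (f' (orth_proj X1 W g (f v))) (g' y)"
    using bil1[of "f v" "g' y"] v y by (simp add: compose_def)
   also have "\<dots> = bil X2 (f' (eps_mor V W s v)) (g' y)" using X1(5) v by simp
   also have "\<dots> = bil Y (eps_mor W Y t (eps_mor V W s v)) y"
    using X2(5) v y g'.proj_bil by simp
   finally show "bil Y (eps_mor W Y t (eps_mor V W s v)) y = bil X (?F v) (?G y)" by simp
  qed
  then show ?thesis using I(1)[OF v] by simp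
 qed
 show "dm V Y (Comp Tq V W Y t s) = {v\<in>dm V W s. eps_mor V W s v\<in>dm W Y t}"
 proof (intro equalityI subsetI)
  fix v assume "v\<in>dm V Y (Comp Tq V W Y t s)"
  then obtain y where v: "v <: V" "y <: Y" "i1 (f v) = i2 (g' y)"
   unfolding I(2) by (auto simp: compose_def)
  let ?w = "orth_proj X1 W g (f v)" and ?w' = "orth_proj X2 W f' (g' y)"
  let ?s = "f v \<oplus>\<^bsub>X1\<^esub> g ?w" and ?t = "g' y \<oplus>\<^bsub>X2\<^esub> f' ?w'"
  have m: "?w <: W" "?w' <: W" "?s\<in>P1" "?t\<in>P2"
   using v g.proj_mem g.proj_perp f'.proj_mem f'.proj_perp by (auto simp: P1_def P2_def)
  have mc: "?s <: X1" "?t <: X2" using m by (auto simp: P1_def P2_def perp_def)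
  have z: "\<zero>\<^bsub>X1\<^esub>\<in>P1" "\<zero>\<^bsub>X2\<^esub>\<in>P2" unfolding P1_def P2_def perp_def by auto
  have e1: "f v = g ?w \<oplus>\<^bsub>X1\<^esub> ?s" and e2: "g' y = f' ?w' \<oplus>\<^bsub>X2\<^esub> ?t"
   using v m g.gw f'.gw by (simp_all add: X1.ac X2.ac)
  have "i1 (f v) = i1 (g ?w) \<oplus>\<^bsub>X\<^esub> i1 ?s \<oplus>\<^bsub>X\<^esub> i2 \<zero>\<^bsub>X2\<^esub>"
   using e1 qhomD(6)[OF i1, of "g ?w" ?s] qhom_zero[OF X2.f2v_axioms X.f2v_axioms i2] m mc i1m by simp
  moreover have "i2 (g' y) = i1 (g ?w') \<oplus>\<^bsub>X\<^esub> i1 \<zero>\<^bsub>X1\<^esub> \<oplus>\<^bsub>X\<^esub> i2 ?t"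
   using e2 qhomD(6)[OF i2, of "f' ?w'" ?t] qhom_zero[OF X1.f2v_axioms X.f2v_axioms i1] m mc i1m i2m i12 by simp
  \<comment> \<open>A vector of \<open>i1 X1\<close> has no component in \<open>W''\<close>, a
    vector of \<open>i2 X2\<close> none in \<open>W'\<close>; comparing the two decompositions puts
    the common vector into \<open>W\<close>.\<close>
  ultimately have "(?w, ?s, \<zero>\<^bsub>X2\<^esub>) = (?w', \<zero>\<^bsub>X1\<^esub>, ?t)"
   using bij_betw_imp_inj_on[OF bij] m z v(3) unfolding inj_on_def by fastforce
  then have eqs: "?w = ?w'" "?s = \<zero>\<^bsub>X1\<^esub>" "?t = \<zero>\<^bsub>X2\<^esub>" by auto
  have "f v = g ?w" using eqs(2) v(1) m(1) by simp
  moreover have "g' y = f' ?w'" using eqs(3) v(2) m(2) by simp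
  ultimately have "f v = g ?w" "f' ?w = g' y" using eqs(1) by simp_all
  then show "v\<in>{v\<in>dm V W s. eps_mor V W s v\<in>dm W Y t}"
   unfolding X1(6) X2(6) using v m X1(5) by auto
 next
  fix v assume "v\<in>{v\<in>dm V W s. eps_mor V W s v\<in>dm W Y t}"
  then obtain w y where v: "v <: V" "w <: W" "f v = g w" "f' (eps_mor V W s v) = g' y" "y <: Y"
   unfolding X1(6) X2(6) by auto
  then have "eps_mor V W s v = w" using X1(5) g.proj_g by simp
  then have "i1 (f v) = i2 (g' y)" using v i12 by metis
  then show "v\<in>dm V Y (Comp Tq V W Y t s)" unfolding I(2) using v by (auto simp: compose_def)
 qed
qed

text \<open>Realizes \<open>V \<rightarrow> W \<bottom> (V \<oplus> V)\<close>, \<open>v \<mapsto> (p v, \<pi> v, 0)\<close>, where the second summand carries the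
  form \<open>q v + q (p v) + B(v, v')\<close>, nondegenerate because of the hyperbolic part.\<close>

lemma Tq_realize:
 fixes V :: "'a::infinite qsp"
 assumes "ndsp V" "ndsp W" and p: "p\<in>lin_maps V W" and \<pi>: "\<pi>\<in>lin_maps V V"
  and q: "!!v. v <: V ==> qf V v + qf W (p v) = qf V (\<pi> v) + qf W (p (\<pi> v))"
  and ker: "!!v. v <: V ==> p v = \<zero>\<^bsub>W\<^esub> ==> \<pi> v = \<zero>\<^bsub>V\<^esub> ==> v = \<zero>\<^bsub>V\<^esub>"
 shows "\<exists>t. tmor V W t & (ALL v:carrier V. eps_mor V W t v = p v) & dm V W t = {v\<in>carrier V. \<pi> v = \<zero>\<^bsub>V\<^esub>}"
proof -
 interpret V: ndsp V by fact
 interpret W: ndsp W by fact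
 note pm = lin_closed[OF p] and pa = lin_add[OF p] and \<pi>m = lin_closed[OF \<pi>] and \<pi>a = lin_add[OF \<pi>]
 have pz: "p \<zero>\<^bsub>V\<^esub> = \<zero>\<^bsub>W\<^esub>" by (rule lin_zero[OF V.f2v_axioms W.f2v_axioms p])
 define U :: "(bit, 'a \<times> 'a) qspace" where "U = \<lparr>carrier = carrier V \<times> carrier V, monoid.mult = undefined, one = undefined,
  ring.zero = (\<zero>\<^bsub>V\<^esub>, \<zero>\<^bsub>V\<^esub>), add = (%(x, t) (y, s). (x \<oplus>\<^bsub>V\<^esub> y, t \<oplus>\<^bsub>V\<^esub> s)),
  smult = (%c (x, t). (c \<odot>\<^bsub>V\<^esub> x, c \<odot>\<^bsub>V\<^esub> t)), qf = (%(x, t). qf V x + qf W (p x) + bil V x t)\<rparr>"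
 have U: "carrier U = carrier V \<times> carrier V" "\<zero>\<^bsub>U\<^esub> = (\<zero>\<^bsub>V\<^esub>, \<zero>\<^bsub>V\<^esub>)"
  "(x, t) \<oplus>\<^bsub>U\<^esub> (y, s) = (x \<oplus>\<^bsub>V\<^esub> y, t \<oplus>\<^bsub>V\<^esub> s)" "c \<odot>\<^bsub>U\<^esub> (x, t) = (c \<odot>\<^bsub>V\<^esub> x, c \<odot>\<^bsub>V\<^esub> t)"
  "qf U (x, t) = qf V x + qf W (p x) + bil V x t" for x y s t c
  by (simp_all add: U_def)
 have Ub: "bil U (x, t) (y, s) = bil V x y + bil W (p x) (p y) + bil V x s + bil V y t"
  if "x <: V" "y <: V" "s <: V" "t <: V" for x y s t
  using that by (simp add: bil_def[of U] U V.bil_simps V.qf_add W.qf_add pa algebra_simps)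
 have qU: "quadratic_space U"
 proof (rule quadratic_spaceI)
  show "f2v U" by (rule f2vI) (auto simp: U V.ac)
  show "bil U (u \<oplus>\<^bsub>U\<^esub> v) w = bil U u w + bil U v w" if "u <: U" "v <: U" "w <: U" for u v w
   using that by (auto simp: U Ub V.bil_simps W.bil_simps pa pm algebra_simps)
 qed (auto simp: U pz)
 have "ndsp U"
  unfolding ndsp_iff nondegenerate_def
 proof (intro conjI qU equalityI subsetI)
  fix z assume z: "z\<in>perp U (carrier U)"
  obtain x t where xt: "z = (x, t)" "x <: V" "t <: V" using z by (auto simp: perp_def U)
  have zU: "bil U (x, t) y = 0" if "y <: U" for y using z that unfolding perp_def xt(1) by simp
  have "bil V x s = 0" if "s <: V" for s
   using zU[of "(\<zero>\<^bsub>V\<^esub>, s)"] xt(2,3) that pm by (simp add: U Ub pz)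
  then have x: "x = \<zero>\<^bsub>V\<^esub>" using V.nondeg_ex[OF xt(2)] by auto
  have "bil V s t = 0" if "s <: V" for s
   using zU[of "(s, \<zero>\<^bsub>V\<^esub>)"] xt(2,3) that pm x by (simp add: U Ub pz)
  then have "t = \<zero>\<^bsub>V\<^esub>" using V.nondeg_ex[OF xt(3)] V.bil_sym xt by fastforce
  then show "z\<in>{\<zero>\<^bsub>U\<^esub>}" using x xt by (simp add: U)
 qed (auto simp: perp_def U Ub pz pm)
 then interpret U: ndsp U .
 interpret O: ndsp "osum W U" by (rule ndsp_osum) (rule W.ndsp_axioms U.ndsp_axioms)+
 obtain X and j :: "'a \<times> 'a \<times> 'a => 'a" where "copy (osum W U) X j" using O.copy_ex by blast
 then interpret j: copy "osum W U" X j .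
 interpret X: ndsp X by (rule j.X)
 note X = j.X and j = j.bij and j_add = j.add and j_qf = j.qf and jb = j.bil[OF O.qsp_axioms] and jm = j.mem
 note jinj = j.inj
 define f where "f = restrict (%v. j (p v, \<pi> v, \<zero>\<^bsub>V\<^esub>)) (carrier V)"
 define g where "g = restrict (%w. j (w, \<zero>\<^bsub>V\<^esub>, \<zero>\<^bsub>V\<^esub>)) (carrier W)"
 have mf: "(p v, \<pi> v, \<zero>\<^bsub>V\<^esub>) <: osum W U" if "v <: V" for v using that pm \<pi>m by (simp add: U)
 have mg: "(w, \<zero>\<^bsub>V\<^esub>, \<zero>\<^bsub>V\<^esub>) <: osum W U" if "w <: W" for w using that by (simp add: U)
 have f: "f\<in>qhom V X"
 proof -
  have "f\<in>lin_maps V X"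
   by (rule linI[OF V.f2v_axioms X.f2v_axioms])
    (use mf jm in "auto simp del: osum_simps simp add: f_def j_add[symmetric]", simp add: U pa \<pi>a)
  moreover have "inj_on f (carrier V)"
  proof (rule inj_onI)
   fix v v' assume v: "v <: V" "v' <: V" "f v = f v'"
   then have "p v = p v'" "\<pi> v = \<pi> v'" using jinj[OF mf mf] by (auto simp: f_def)
   then have "p (v \<oplus>\<^bsub>V\<^esub> v') = \<zero>\<^bsub>W\<^esub>" "\<pi> (v \<oplus>\<^bsub>V\<^esub> v') = \<zero>\<^bsub>V\<^esub>" using v pm \<pi>m by (simp_all add: pa \<pi>a)
   then have "v \<oplus>\<^bsub>V\<^esub> v' = \<zero>\<^bsub>V\<^esub>" using ker v by simp
   then show "v = v'" using v by simp
  qed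
  moreover have "qf X (f v) = qf V v" if v: "v <: V" for v
  proof -
   \<comment> \<open>The bracket equals \<open>qf V v + qf W (p v)\<close> by the hypothesis
     \<open>q\<close>, and the two copies of \<open>qf W (p v)\<close> cancel.\<close>
   have "qf X (f v) = qf W (p v) + (qf V (\<pi> v) + qf W (p (\<pi> v)))"
    using v mf[OF v] \<pi>m by (simp add: f_def j_qf U)
   then show ?thesis using q[OF v, symmetric] by (simp add: add.left_commute)
  qed
  ultimately show ?thesis unfolding qhom_def by (simp add: f_def)
 qed
 have g: "g\<in>qhom W X"
 proof -
  have "g\<in>lin_maps W X"
   by (rule linI[OF W.f2v_axioms X.f2v_axioms])
    (use mg jm in "auto simp del: osum_simps simp add: g_def j_add[symmetric]", simp add: U)
  then show ?thesis unfolding qhom_def using jinj[OF mg mg] mg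
   by (auto simp: g_def inj_on_def j_qf U pz)
 qed
 define t where "t = cospan_class V W (X, f, g)"
 have c: "(X, f, g)\<in>cospans V W" using X f g unfolding cospans_def ndsp_iff by simp
 have T: "tmor V W t" by unfold_locales (use c in "auto simp: t_def")
 note I = class_inv[OF V.ndsp_axioms W.ndsp_axioms c t_def]
 interpret G: isom_pair W X g by (rule isom_pairI) (use W.ndsp_axioms X g in auto)
 have "eps_mor V W t v = p v" if v: "v <: V" for v
 proof -
  have "orth_proj X W g (f v) = p v"
   by (rule G.proj_eqI) (use v qhomD(5)[OF f] pm mf mg \<pi>m in "auto simp: f_def g_def jb U.bil_zero(2)[unfolded U] U")
  then show ?thesis using I(1)[OF v] by simp
 qed
 moreover have "dm V W t = {v\<in>carrier V. \<pi> v = \<zero>\<^bsub>V\<^esub>}"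
  unfolding I(2)
 proof (intro Collect_cong conj_cong refl)
  fix v assume v: "v <: V"
  have "f v\<in>g ` carrier W \<longleftrightarrow> (EX w:carrier W. j (p v, \<pi> v, \<zero>\<^bsub>V\<^esub>) = j (w, \<zero>\<^bsub>V\<^esub>, \<zero>\<^bsub>V\<^esub>))"
   using v by (auto simp: f_def g_def)
  also have "\<dots> \<longleftrightarrow> \<pi> v = \<zero>\<^bsub>V\<^esub>" using jinj[OF mf mg] v pm by auto
  finally show "f v\<in>g ` carrier W \<longleftrightarrow> \<pi> v = \<zero>\<^bsub>V\<^esub>" .
 qed
 ultimately show ?thesis using T by blast
qed

section \<open>Functors\<close>

lemma is_functorI:
 assumes "!!X. X\<in>Obj C ==> f2v (fob F X)"
  "!!X Y m. X\<in>Obj C ==> Y\<in>Obj C ==> m\<in>Hom C X Y ==> fmor F X Y m\<in>lin_maps (fob F X) (fob F Y)"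
  "!!X z. X\<in>Obj C ==> z <: fob F X ==> fmor F X X (Idm C X) z = z"
  "!!X Y Z m n z. X\<in>Obj C ==> Y\<in>Obj C ==> Z\<in>Obj C ==> m\<in>Hom C X Y ==> n\<in>Hom C Y Z ==>
   z <: fob F X ==> fmor F X Z (Comp C X Y Z n m) z = fmor F Y Z n (fmor F X Y m z)"
 shows "is_functor C F"
 using assms unfolding is_functor_def f2v_def by blast

lemma is_functorD:
 assumes "is_functor C F"
 shows "X\<in>Obj C ==> f2v (fob F X)"
  "X\<in>Obj C ==> Y\<in>Obj C ==> m\<in>Hom C X Y ==> fmor F X Y m\<in>lin_maps (fob F X) (fob F Y)"
  "X\<in>Obj C ==> z <: fob F X ==> fmor F X X (Idm C X) z = z"
  "X\<in>Obj C ==> Y\<in>Obj C ==> Z\<in>Obj C ==> m\<in>Hom C X Y ==> n\<in>Hom C Y Z ==>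
   z <: fob F X ==> fmor F X Z (Comp C X Y Z n m) z = fmor F Y Z n (fmor F X Y m z)"
proof -
 note * = assms[unfolded is_functor_def]
 show "X\<in>Obj C ==> f2v (fob F X)"
  "X\<in>Obj C ==> Y\<in>Obj C ==> m\<in>Hom C X Y ==> fmor F X Y m\<in>lin_maps (fob F X) (fob F Y)"
  "X\<in>Obj C ==> z <: fob F X ==> fmor F X X (Idm C X) z = z"
  using * unfolding f2v_def by simp_all
 show "X\<in>Obj C ==> Y\<in>Obj C ==> Z\<in>Obj C ==> m\<in>Hom C X Y ==> n\<in>Hom C Y Z ==>
   z <: fob F X ==> fmor F X Z (Comp C X Y Z n m) z = fmor F Y Z n (fmor F X Y m z)"
  using * by simp
qed

lemma free_lin_eq:
 assumes "f2v N" "f\<in>lin_maps (free_mod S) N" "g\<in>lin_maps (free_mod S) N"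
  "!!s. s\<in>S ==> f (gen s) = g (gen s)" "v <: free_mod S"
 shows "f v = g v"
 using assms(5)
proof (induction rule: free_induct)
 case zero
 show ?case using lin_zero[OF f2v_free assms(1,2)] lin_zero[OF f2v_free assms(1,3)] by (simp add: free_simps)
next
 case (add s v)
 then show ?case using assms(4) by (simp add: lin_add[OF assms(2)] lin_add[OF assms(3)])
qed

lemma (in tensor_pair) tens_lin_eq:
 assumes "f2v Q" "f\<in>lin_maps (tensor_mod M N) Q" "g\<in>lin_maps (tensor_mod M N) Q"
  "!!u v. u <: M ==> v <: N ==> f (tens M N u v) = g (tens M N u v)" "z <: tensor_mod M N"
 shows "f z = g z"
 using assms(5)
proof (induction rule: tens_induct)
 case zero
 show ?case using lin_zero[OF T.f2v_axioms assms(1,2)] lin_zero[OF T.f2v_axioms assms(1,3)] by simp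
next
 case (add u v z)
 then show ?case using assms(4) by (simp add: lin_add[OF assms(2)] lin_add[OF assms(3)])
qed

lemma lin_id: "f2v M ==> (%x. x)\<in>lin_maps M M"
 by (rule linI) auto

section \<open>Tensor products of functors\<close>

lemma tensor_fun_tens:
 assumes F: "is_functor C F" and G: "is_functor C G" and X: "X\<in>Obj C" "Y\<in>Obj C" "m\<in>Hom C X Y"
 shows "fmor (tensor_fun F G) X Y m\<in>lin_maps (tensor_mod (fob F X) (fob G X)) (tensor_mod (fob F Y) (fob G Y))"
  "u <: fob F X ==> v <: fob G X ==>
   fmor (tensor_fun F G) X Y m (tens (fob F X) (fob G X) u v) = tens (fob F Y) (fob G Y) (fmor F X Y m u) (fmor G X Y m v)"
 using tensor_map[of "fob F X" "fob G X" "fob F Y" "fob G Y" "fmor F X Y m" "fmor G X Y m"]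
  is_functorD(1,2)[OF F] is_functorD(1,2)[OF G] X
 by (simp_all add: tensor_fun_def)

text \<open>The functor laws speak of members of hom-sets only, so identities and composites must be
  known to be members before these laws can be used on generators.\<close>

definition closed_cat :: "('o, 'm, 'z) cat_scheme => bool" where
 "closed_cat C \<longleftrightarrow> (ALL X:Obj C. Idm C X\<in>Hom C X X) &
   (ALL X:Obj C. ALL Y:Obj C. ALL Z:Obj C. ALL m:Hom C X Y. ALL n:Hom C Y Z. Comp C X Y Z n m\<in>Hom C X Z)"

lemma closed_catD:
 assumes "closed_cat C"
 shows "X\<in>Obj C ==> Idm C X\<in>Hom C X X"
  "X\<in>Obj C ==> Y\<in>Obj C ==> Z\<in>Obj C ==> m\<in>Hom C X Y ==> n\<in>Hom C Y Z ==> Comp C X Y Z n m\<in>Hom C X Z"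
 using assms unfolding closed_cat_def by blast+

lemma tensor_functor:
 assumes F: "is_functor C F" and G: "is_functor C G"
  and cc: "closed_cat C"
 shows "is_functor C (tensor_fun F G)"
proof (rule is_functorI)
 note f = is_functorD[OF F] and g = is_functorD[OF G]
 have P: "tensor_pair (fob F X) (fob G X)" if "X\<in>Obj C" for X
  unfolding tensor_pair_def using f g that by simp
 have ob: "fob (tensor_fun F G) X = tensor_mod (fob F X) (fob G X)" for X by (simp add: tensor_fun_def)
 show v: "f2v (fob (tensor_fun F G) X)" if "X\<in>Obj C" for X
 proof -
  interpret tensor_pair "fob F X" "fob G X" by (rule P[OF that])
  show ?thesis using T.f2v_axioms by (simp add: ob)
 qed
 note L = tensor_fun_tens[OF F G]
 show "fmor (tensor_fun F G) X Y m\<in>lin_maps (fob (tensor_fun F G) X) (fob (tensor_fun F G) Y)"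
  if "X\<in>Obj C" "Y\<in>Obj C" "m\<in>Hom C X Y" for X Y m using L(1) that by (simp add: ob)
 show "fmor (tensor_fun F G) X X (Idm C X) z = z"
  if X: "X\<in>Obj C" and z: "z <: fob (tensor_fun F G) X" for X z
 proof -
  interpret tensor_pair "fob F X" "fob G X" by (rule P[OF X])
  show ?thesis
   by (rule tens_lin_eq[OF T.f2v_axioms L(1)[OF X X closed_catD(1)[OF cc X]] lin_id[OF T.f2v_axioms] _ z[unfolded ob]])
    (simp add: L(2)[OF X X closed_catD(1)[OF cc X]] f(3)[OF X] g(3)[OF X])
 qed
 show "fmor (tensor_fun F G) X Z (Comp C X Y Z n m) z = fmor (tensor_fun F G) Y Z n (fmor (tensor_fun F G) X Y m z)"
  if X: "X\<in>Obj C" "Y\<in>Obj C" "Z\<in>Obj C" and m: "m\<in>Hom C X Y" "n\<in>Hom C Y Z"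
   and z: "z <: fob (tensor_fun F G) X" for X Y Z m n z
 proof -
  interpret X: tensor_pair "fob F X" "fob G X" by (rule P[OF X(1)])
  interpret Z: tensor_pair "fob F Z" "fob G Z" by (rule P[OF X(3)])
  note c = closed_catD(2)[OF cc X m]
  show ?thesis
   by (rule X.tens_lin_eq[OF Z.T.f2v_axioms L(1)[OF X(1,3) c] lin_comp[OF L(1)[OF X(1,2) m(1)] L(1)[OF X(2,3) m(2)]] _ z[unfolded ob]])
    (simp add: L(2)[OF X(1,3) c] L(2)[OF X(1,2) m(1)] L(2)[OF X(2,3) m(2)] f(4)[OF X m] g(4)[OF X m]
     lin_closed[OF f(2)[OF X(1,2) m(1)]] lin_closed[OF g(2)[OF X(1,2) m(1)]])
 qed
qed

lemma tmor_hom: "tmor V W t ==> V\<in>Obj Tq & W\<in>Obj Tq & t\<in>Hom Tq V W"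
 unfolding tmor_def tmor_axioms_def ndsp_iff by simp

lemma Tq_closed: "closed_cat (Tq :: ('a::infinite qsp, 'a triple set) cat)"
 unfolding closed_cat_def
proof (intro conjI ballI)
 show "Idm Tq V\<in>Hom Tq V V" if "V\<in>Obj Tq" for V :: "'a qsp"
  using tmor_hom[OF Tq_id(1)[of V]] that unfolding ndsp_iff Tq_simps(1) by blast
 show "Comp Tq V W Y t s\<in>Hom Tq V Y"
  if "V\<in>Obj Tq" "W\<in>Obj Tq" "Y\<in>Obj Tq" "s\<in>Hom Tq V W" "t\<in>Hom Tq W Y" for V W Y :: "'a qsp" and s t
  using tmor_hom[OF Tq_comp(1)[OF tmorI[OF that(1,2,4)] tmorI[OF that(2,3,5)]]] by blast
qed

section \<open>Functoriality of \<open>iota\<close>\<close>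

lemma eps_obj_simps [simp]:
 "carrier (eps_obj V) = carrier V" "add (eps_obj V) = add V" "ring.zero (eps_obj V) = ring.zero V"
 "smult (eps_obj V) = smult V"
 unfolding eps_obj_def module.truncate_def by simp_all

lemma lin_maps_eps [simp]: "lin_maps (eps_obj V) (eps_obj W) = lin_maps V W"
 unfolding lin_maps_def by simp

lemma eps_obj_Ef:
 assumes "ndsp V"
 shows "eps_obj V\<in>Obj Ef" "f2v (eps_obj V)"
proof -
 interpret V: ndsp V by fact
 show f: "f2v (eps_obj V)" by (rule f2v_same[OF V.f2v_axioms]) simp_all
 then interpret E: f2v "eps_obj V" .
 have "fin_dim (eps_obj V)"
  unfolding fin_dim_def using E.vspan_incl[of "carrier V"] E.vspan_carrier[of "carrier V"]
  by (intro exI[of _ "carrier V"]) auto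
 then show "eps_obj V\<in>Obj Ef" using E.module_F2 by (simp add: Ef_def)
qed

lemma iota_functor:
 fixes F :: "('a::infinite fsp, 'a => 'a, 'u) vfun"
 assumes F: "is_functor Ef F"
 shows "is_functor Tq (iota F)"
proof (rule is_functorI)
 note f = is_functorD[OF F]
 have h: "eps_mor V W t\<in>Hom Ef (eps_obj V) (eps_obj W)" if "tmor V W t" for V W :: "'a qsp" and t
  using tmor.eps_lin[OF that] tmor.eps_ext[OF that] by (simp add: Ef_def)
 have nd: "ndsp X" if "X\<in>Obj Tq" for X :: "'a qsp" using that by (simp add: ndsp_iff)
 have ob: "fob (iota F) X = fob F (eps_obj X)" for X by (simp add: iota_def)
 have mo: "fmor (iota F) X Y m = fmor F (eps_obj X) (eps_obj Y) (eps_mor X Y m)" for X Y m by (simp add: iota_def)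
 show "f2v (fob (iota F) X)" if "X\<in>Obj Tq" for X unfolding ob by (rule f(1)[OF eps_obj_Ef(1)[OF nd[OF that]]])
 show "fmor (iota F) X Y m\<in>lin_maps (fob (iota F) X) (fob (iota F) Y)"
  if X: "X\<in>Obj Tq" "Y\<in>Obj Tq" "m\<in>Hom Tq X Y" for X Y m
  unfolding ob mo by (rule f(2)[OF eps_obj_Ef(1)[OF nd[OF X(1)]] eps_obj_Ef(1)[OF nd[OF X(2)]] h[OF tmorI[OF X]]])
 show "fmor (iota F) X X (Idm Tq X) z = z" if X: "X\<in>Obj Tq" and z: "z <: fob (iota F) X" for X z
 proof -
  note i = Tq_id[OF nd[OF X]]
  have "eps_mor X X (Idm Tq X) = Idm Ef (eps_obj X)"
   using tmor.eps_ext[OF i(1)] i(2) by (auto simp: Ef_def fun_eq_iff extensional_def)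
  then show ?thesis using z f(3)[OF eps_obj_Ef(1)[OF nd[OF X]]] unfolding ob mo by simp
 qed
 show "fmor (iota F) X Z (Comp Tq X Y Z n m) z = fmor (iota F) Y Z n (fmor (iota F) X Y m z)"
  if X: "X\<in>Obj Tq" "Y\<in>Obj Tq" "Z\<in>Obj Tq" and m: "m\<in>Hom Tq X Y" "n\<in>Hom Tq Y Z"
   and z: "z <: fob (iota F) X" for X Y Z m n z
 proof -
  note tm = tmorI[OF X(1,2) m(1)] and tn = tmorI[OF X(2,3) m(2)]
  note c = Tq_comp[OF tm tn]
  have "eps_mor X Z (Comp Tq X Y Z n m) = Comp Ef (eps_obj X) (eps_obj Y) (eps_obj Z) (eps_mor Y Z n) (eps_mor X Y m)"
   using tmor.eps_ext[OF c(1)] c(2) by (auto simp: Ef_def fun_eq_iff extensional_def compose_def)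
  then show ?thesis
   using z f(4)[OF eps_obj_Ef(1)[OF nd[OF X(1)]] eps_obj_Ef(1)[OF nd[OF X(2)]] eps_obj_Ef(1)[OF nd[OF X(3)]] h[OF tm] h[OF tn]]
   unfolding ob mo by simp
 qed
qed

lemma free_map_comp:
 assumes "!!s t. s\<in>S ==> \<phi> s = Some t ==> t\<in>T" "!!s t. s\<in>T ==> \<psi> s = Some t ==> t\<in>U"
  "!!s. s\<in>S ==> \<chi> s = Option.bind (\<phi> s) \<psi>" "v <: free_mod S"
 shows "free_map \<chi> v = free_map \<psi> (free_map \<phi> v)"
proof (rule free_lin_eq[OF f2v_free _ _ _ assms(4), of _ U])
 show "free_map \<chi>\<in>lin_maps (free_mod S) (free_mod U)"
  by (rule free_map_lin) (use assms in "auto simp: bind_eq_Some_conv")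
 show "(%v. free_map \<psi> (free_map \<phi> v))\<in>lin_maps (free_mod S) (free_mod U)"
  by (rule lin_comp[of _ _ "free_mod T"]; rule free_map_lin) (use assms in auto)
 have "free_map \<psi> (%_. 0) = (%_. 0)" by (simp add: free_map_def)
 then show "free_map \<chi> (gen s) = free_map \<psi> (free_map \<phi> (gen s))" if "s\<in>S" for s
  using assms(3)[OF that] by (cases "\<phi> s") (simp_all add: free_map_gen)
qed

lemma free_map_id:
 assumes "!!s. s\<in>S ==> \<chi> s = Some s" "v <: free_mod S"
 shows "free_map \<chi> v = v"
 by (rule free_lin_eq[OF f2v_free _ lin_id[OF f2v_free] _ assms(2)])
  (use assms(1) in "auto intro!: free_map_lin simp: free_map_gen")

section \<open>Spans and the functor iso\<close>

text \<open>The partial injection carried by a span, that is \<open>b\<close> after the inverse of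
  \<open>a\<close>. It is the same for all spans in a class, and it turns composition by pullback
  into composition of partial maps.\<close>

definition pm :: "'a triple => 'a => 'a option" where
 "pm = (%(A, a, b) v. if v\<in>a ` carrier A then Some (b (inv_into (carrier A) a v)) else None)"

lemma pm_a: "inj_on a (carrier A) ==> y <: A ==> pm (A, a, b) (a y) = Some (b y)"
 by (auto simp: pm_def)

lemma pm_None: "v \<notin> a ` carrier A ==> pm (A, a, b) v = None"
 by (auto simp: pm_def)

lemma spansD: "(A, a, b)\<in>spans V W ==> qsp A & a\<in>qhom A V & b\<in>qhom A W"
 by (auto simp: spans_def qsp_def)

lemma qhom_id: "f2v V ==> restrict id (carrier V)\<in>qhom V V"
proof -
 assume "f2v V"
 then interpret f2v V .
 show ?thesis using qhom_sub_id[OF f2v_axioms, of "carrier V"] by (simp add: sub_iff)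
qed

lemma span_class_refl: "c\<in>spans V W ==> c\<in>span_class V W c"
proof (cases c)
 case (fields A a b)
 assume "c\<in>spans V W"
 then have c: "(A, a, b)\<in>spans V W" "qsp A" "a\<in>qhom A V" "b\<in>qhom A W" using fields spansD[of A a b V W] by auto
 interpret A: qsp A by fact
 have "compose (carrier A) a (restrict id (carrier A)) = a" "compose (carrier A) b (restrict id (carrier A)) = b"
  using qhomD(2)[OF c(3)] qhomD(2)[OF c(4)] by (auto simp: compose_def extensional_def fun_eq_iff)
 then show ?thesis using c(1) fields qhom_id[OF A.f2v_axioms] unfolding span_class_def
  by (auto intro!: bexI[of _ "restrict id (carrier A)"])
qed

lemma span_class_pm:
 assumes "c\<in>spans V W"
 shows "rep (span_class V W c)\<in>spans V W" "pm (rep (span_class V W c)) = pm c"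
proof -
 obtain A a b where c: "c = (A, a, b)" by (cases c) auto
 obtain A' a' b' where r: "rep (span_class V W c) = (A', a', b')" by (cases "rep (span_class V W c)") auto
 have "rep (span_class V W c)\<in>span_class V W c"
  unfolding rep_def by (rule someI[where P = "%c'. c'\<in>_", OF span_class_refl[OF assms]])
 then have "(A', a', b')\<in>span_class V W (A, a, b)" unfolding r unfolding c .
 then obtain \<phi> where \<phi>: "(A', a', b')\<in>spans V W" "\<phi>\<in>qhom A A'" "\<phi> ` carrier A = carrier A'"
  "compose (carrier A) a' \<phi> = a" "compose (carrier A) b' \<phi> = b"
  unfolding span_class_def by auto
 show "rep (span_class V W c)\<in>spans V W" using \<phi> r by simp
 have ia: "inj_on a (carrier A)" "inj_on a' (carrier A')" using spansD[of A a b V W] spansD[OF \<phi>(1)] qhomD(3)[of a A V] qhomD(3)[of a' A' V] assms c by auto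
 have ph: "a y = a' (\<phi> y)" "b y = b' (\<phi> y)" "\<phi> y <: A'" if "y <: A" for y
  using that \<phi> by (auto simp: compose_def)
 have im: "a ` carrier A = a' ` carrier A'"
 proof -
  have "a ` carrier A = a' ` (\<phi> ` carrier A)" unfolding image_image by (rule image_cong) (use ph(1) in auto)
  then show ?thesis using \<phi>(3) by simp
 qed
 show "pm (rep (span_class V W c)) = pm c"
 proof
  fix v
  show "pm (rep (span_class V W c)) v = pm c v"
  proof (cases "v\<in>a ` carrier A")
   case True
   then obtain y where y: "y <: A" "v = a y" by auto
   show ?thesis using y ph[OF y(1)] pm_a[OF ia(1) y(1), of b] pm_a[OF ia(2), of "\<phi> y" b'] unfolding r unfolding c by simp
  next
   case False
   then show ?thesis unfolding r unfolding c using im by (simp add: pm_None)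
  qed
 qed
qed

section \<open>Embeddings of the line and the functor \<open>iso_fun D\<close>\<close>

locale line =
 fixes D :: "'a::infinite qsp" and x :: 'a
 assumes line: "line_qspace D x (qf D x)"
begin

sublocale D: qsp D
 using line by (simp add: qsp_def line_qspace_def)

lemma x: "x <: D" "x ~= \<zero>\<^bsub>D\<^esub>" and carrier_D: "carrier D = {\<zero>\<^bsub>D\<^esub>, x}"
proof -
 show x: "x <: D" "x ~= \<zero>\<^bsub>D\<^esub>" using line by (auto simp: line_qspace_def)
 have "vspan D {x} \<subseteq> {\<zero>\<^bsub>D\<^esub>, x}" by (rule D.vspan_least) (use x in "auto simp: D.sub_iff")
 then show "carrier D = {\<zero>\<^bsub>D\<^esub>, x}" using line x by (auto simp: line_qspace_def)
qed

text \<open>An isometric embedding of the line into \<open>V\<close> amounts to the image of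
  \<open>x\<close>. Being nonzero is a separate condition because \<open>qf D x\<close> may be
  0.\<close>

definition al :: "'a qsp => 'a set" where
 "al V = {a\<in>carrier V. a ~= \<zero>\<^bsub>V\<^esub> & qf V a = qf D x}"

lemma alD: "a\<in>al V ==> a <: V" "a\<in>al V ==> a ~= \<zero>\<^bsub>V\<^esub>" "a\<in>al V ==> qf V a = qf D x"
 by (auto simp: al_def)

abbreviation lm :: "'a qsp => 'a => 'a => 'a" where
 "lm \<equiv> line_map D x"

lemma lm_x [simp]: "lm V a x = a" and lm_0 [simp]: "lm V a \<zero>\<^bsub>D\<^esub> = \<zero>\<^bsub>V\<^esub>"
 using x by (auto simp: line_map_def)

lemma lm_inj [simp]: "lm V a = lm V b \<longleftrightarrow> a = b"
 using lm_x by metis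

lemma lm_hom:
 assumes "qsp V" "a\<in>al V"
 shows "lm V a\<in>qhom D V"
proof -
 interpret V: qsp V by fact
 have "lm V a\<in>lin_maps D V"
  by (rule linI[OF D.f2v_axioms V.f2v_axioms]) (use alD[OF assms(2)] carrier_D x in auto)
 then show ?thesis unfolding qhom_def using alD[OF assms(2)] carrier_D x by (auto simp: inj_on_def line_map_def)
qed

lemma hom_lm:
 assumes "qsp V" "h\<in>qhom D V"
 shows "h x\<in>al V" "h = lm V (h x)"
proof -
 interpret V: qsp V by fact
 have z: "h \<zero>\<^bsub>D\<^esub> = \<zero>\<^bsub>V\<^esub>" by (rule qhom_zero[OF D.f2v_axioms V.f2v_axioms assms(2)])
 then have "h x ~= \<zero>\<^bsub>V\<^esub>" using qhomD(3)[OF assms(2)] x by (metis D.zero_closed inj_onD)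
 then show "h x\<in>al V" using qhomD(4,5)[OF assms(2) x(1)] by (auto simp: al_def)
 show "h = lm V (h x)" using qhomD(2)[OF assms(2)] z carrier_D by (auto simp: fun_eq_iff line_map_def extensional_def)
qed

lemma qhom_D: "qsp V ==> qhom D V = lm V ` al V"
 using lm_hom hom_lm by blast

lemma finite_al: "qsp V ==> finite (al V)"
 using qsp.finite_carrier[of V] by (simp add: al_def)

lemma pm_al:
 assumes "qsp V" "qsp W" "c\<in>spans V W" "v\<in>al V" "pm c v = Some w"
 shows "w\<in>al W"
proof -
 obtain A a b where c: "c = (A, a, b)" by (cases c) auto
 have A: "qsp A" "a\<in>qhom A V" "b\<in>qhom A W" using assms(3) c spansD[of A a b V W] by auto
 interpret A: qsp A by fact
 interpret V: qsp V by fact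
 interpret W: qsp W by fact
 obtain y where y: "y <: A" "v = a y" "w = b y"
  using assms(5) pm_a[OF qhomD(3)[OF A(2)]] pm_None[of v a A b] unfolding c by (cases "v\<in>a ` carrier A") auto
 have z: "a \<zero>\<^bsub>A\<^esub> = \<zero>\<^bsub>V\<^esub>" "b \<zero>\<^bsub>A\<^esub> = \<zero>\<^bsub>W\<^esub>"
  using qhom_zero[OF A.f2v_axioms V.f2v_axioms A(2)] qhom_zero[OF A.f2v_axioms W.f2v_axioms A(3)] .
 have "y ~= \<zero>\<^bsub>A\<^esub>" using y z alD[OF assms(4)] by auto
 then have "w ~= \<zero>\<^bsub>W\<^esub>" using y z qhomD(3)[OF A(3)] by (metis A.zero_closed inj_onD)
 then show ?thesis using y alD[OF assms(4)] qhomD(4,5)[OF A(2) y(1)] qhomD(4,5)[OF A(3) y(1)] by (auto simp: al_def)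
qed

text \<open>Factorizations of \<open>lm V v\<close> through \<open>a\<close> correspond to preimages
  of \<open>v\<close>; as \<open>a\<close> is injective there is at most one, so the choice in
  \<open>iso_act\<close> is forced.\<close>

lemma iso_act_eq:
 assumes "qsp V" "qsp W" "c\<in>spans V W" "v\<in>al V"
 shows "iso_act D c (lm V v) = map_option (lm W) (pm c v)"
proof -
 obtain A a b where c: "c = (A, a, b)" by (cases c) auto
 have A: "qsp A" "a\<in>qhom A V" "b\<in>qhom A W" using assms(3) c spansD[of A a b V W] by auto
 interpret A: qsp A by fact
 interpret V: qsp V by fact
 interpret W: qsp W by fact
 have z: "a \<zero>\<^bsub>A\<^esub> = \<zero>\<^bsub>V\<^esub>" "b \<zero>\<^bsub>A\<^esub> = \<zero>\<^bsub>W\<^esub>"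
  using qhom_zero[OF A.f2v_axioms V.f2v_axioms A(2)] qhom_zero[OF A.f2v_axioms W.f2v_axioms A(3)] .
 have co: "compose (carrier D) a (lm A y) = lm V (a y)" "compose (carrier D) b (lm A y) = lm W (b y)" for y
  using z carrier_D by (auto simp: compose_def line_map_def fun_eq_iff)
 have iff: "h'\<in>qhom D A & lm V v = compose (carrier D) a h' \<longleftrightarrow> (EX y:carrier A. h' = lm A y & v = a y)" for h'
 proof
  assume h: "h'\<in>qhom D A & lm V v = compose (carrier D) a h'"
  then have h': "h' = lm A (h' x)" "h' x <: A" using hom_lm[OF A(1)] alD(1) by blast+
  then have "lm V v = lm V (a (h' x))" using h co(1)[of "h' x"] by simp
  then show "EX y:carrier A. h' = lm A y & v = a y" using h' by auto
 next
  assume "EX y:carrier A. h' = lm A y & v = a y"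
  then obtain y where y: "y <: A" "h' = lm A y" "v = a y" by auto
  have "y ~= \<zero>\<^bsub>A\<^esub>" using y z alD[OF assms(4)] by auto
  then have "y\<in>al A" using y alD[OF assms(4)] qhomD(4)[OF A(2) y(1)] by (auto simp: al_def)
  then show "h'\<in>qhom D A & lm V v = compose (carrier D) a h'" using y lm_hom[OF A(1)] co by auto
 qed
 show ?thesis
 proof (cases "v\<in>a ` carrier A")
  case True
  then obtain y where y: "y <: A" "v = a y" by auto
  have inj: "y' = y" if "y' <: A" "v = a y'" for y'
   using y that qhomD(3)[OF A(2)] by (auto simp: inj_on_def)
  have "(SOME h'. h'\<in>qhom D A & lm V v = compose (carrier D) a h') = lm A y"
   unfolding iff
  proof (rule some_equality)
   show "EX y':carrier A. lm A y = lm A y' & v = a y'" using y by blast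
   fix h' assume "EX y':carrier A. h' = lm A y' & v = a y'"
   then show "h' = lm A y" using inj by blast
  qed
  moreover have "EX h':qhom D A. lm V v = compose (carrier D) a h'" using iff[of "lm A y"] y by auto
  ultimately show ?thesis unfolding c iso_act_def using pm_a[OF qhomD(3)[OF A(2)] y(1)] y(2) by (simp add: co)
 next
  case False
  then have "\<not> (EX h':qhom D A. lm V v = compose (carrier D) a h')" using iff by blast
  then show ?thesis unfolding c iso_act_def using False by (simp add: pm_None)
 qed
qed

lemma iso_act_hom:
 assumes "qsp V" "qsp W" "c\<in>spans V W" "h\<in>qhom D V" "iso_act D c h = Some k"
 shows "k\<in>qhom D W"
proof -
 note h = hom_lm[OF assms(1,4)]
 have "map_option (lm W) (pm c (h x)) = Some k" using iso_act_eq[OF assms(1-3) h(1)] h(2) assms(5) by simp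
 then show ?thesis using pm_al[OF assms(1-3) h(1)] lm_hom[OF assms(2)] by auto
qed

lemma Sp_simps [simp]: "Obj Sp = {V. quadratic_space V}" "Hom Sp V W = span_class V W ` spans V W"
  "Comp Sp = span_comp" "Idm Sp V = span_class V V (V, restrict id (carrier V), restrict id (carrier V))"
 by (simp_all add: Sp_def)

lemma Sp_id:
 assumes "qsp V"
 shows "rep (Idm Sp V)\<in>spans V V" "v <: V ==> pm (rep (Idm Sp V)) v = Some v"
proof -
 interpret V: qsp V by fact
 have c: "(V, restrict id (carrier V), restrict id (carrier V))\<in>spans V V"
  using qhom_id[OF V.f2v_axioms] V.quad by (simp add: spans_def)
 show "rep (Idm Sp V)\<in>spans V V" using span_class_pm[OF c] by simp
 show "v <: V ==> pm (rep (Idm Sp V)) v = Some v"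
  using span_class_pm[OF c] pm_a[of "restrict id (carrier V)" V v] by (auto simp: inj_on_def)
qed

lemma Sp_comp:
 assumes V: "qsp V" "qsp W" "qsp Y" and s: "rep s\<in>spans V W" and t: "rep t\<in>spans W Y"
 shows "rep (Comp Sp V W Y t s)\<in>spans V Y" "pm (rep (Comp Sp V W Y t s)) v = Option.bind (pm (rep s) v) (pm (rep t))"
proof -
 obtain A a b where r: "rep s = (A, a, b)" by (cases "rep s") auto
 obtain A' a' b' where r': "rep t = (A', a', b')" by (cases "rep t") auto
 have A: "qsp A" "a\<in>qhom A V" "b\<in>qhom A W" using s r spansD[of A a b V W] by auto
 have A': "qsp A'" "a'\<in>qhom A' W" "b'\<in>qhom A' Y" using t r' spansD[of A' a' b' W Y] by auto
 interpret V: qsp V by fact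
 interpret W: qsp W by fact
 interpret Y: qsp Y by fact
 interpret A: qsp A by fact
 interpret A': qsp A' by fact
 define P where "P = {v\<in>carrier A. b v\<in>a' ` carrier A'}"
 have P: "submodule P F2 A"
  unfolding P_def by (rule qhom_preimage_sub[OF A.f2v_axioms A'.f2v_axioms W.f2v_axioms A(3) A'(2)])
 define i where "i = restrict (%v. inv_into (carrier A') a' (b v)) P"
 have i: "i v <: A'" "a' (i v) = b v" if "v\<in>P" for v
  using that by (auto simp: i_def P_def inv_into_into f_inv_into_f)
 have iI: "i v = y" if "v\<in>P" "y <: A'" "a' y = b v" for v y
  using i[OF that(1)] that qhomD(3)[OF A'(2)] by (auto simp: inj_on_def)
 let ?A = "A\<lparr>carrier := P\<rparr>"
 interpret P: qsp ?A by (rule A.qsp_sub[OF P])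
 have Pc: "v <: A" if "v\<in>P" for v using that by (simp add: P_def)
 have iq: "i\<in>qhom ?A A'"
 proof -
  have add: "i (u \<oplus>\<^bsub>A\<^esub> v) = i u \<oplus>\<^bsub>A'\<^esub> i v" if "u\<in>P" "v\<in>P" for u v
   by (rule iI) (use that i P Pc in "auto simp: A.sub_iff qhomD(6)[OF A(3)] qhomD(6)[OF A'(2)]")
  have "i\<in>lin_maps ?A A'" by (rule linI[OF P.f2v_axioms A'.f2v_axioms]) (use i add in auto)
  moreover have "inj_on i P"
  proof (rule inj_onI)
   fix u v assume "u\<in>P" "v\<in>P" "i u = i v"
   then have "b u = b v" using i by metis
   then show "u = v" using \<open>u\<in>P\<close> \<open>v\<in>P\<close> Pc qhomD(3)[OF A(3)] by (auto simp: inj_on_def)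
  qed
  moreover have "qf A' (i v) = qf A v" if "v\<in>P" for v
   using that i[OF that] Pc qhomD(4)[OF A(3)] qhomD(4)[OF A'(2)] by metis
  ultimately show ?thesis unfolding qhom_def by (simp add: i_def)
 qed
 have q: "qpullback A b A' a' = (?A, restrict id P, i)"
  unfolding qpullback_def Let_def P_def i_def by simp
 let ?c = "(?A, compose P a (restrict id P), compose P b' i)"
 have co: "Comp Sp V W Y t s = span_class V Y ?c"
  unfolding Sp_simps span_comp_def r r' by (simp add: q)
 have "compose P a (restrict id P)\<in>qhom ?A V"
  using qhom_compose[OF P.f2v_axioms qhom_sub_id[OF A.f2v_axioms P] A(2)] by simp
 moreover have "compose P b' i\<in>qhom ?A Y"
  using qhom_compose[OF P.f2v_axioms iq A'(3)] by simp
 ultimately have c: "?c\<in>spans V Y" using P.quad by (simp add: spans_def)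
 note S = span_class_pm[OF c, folded co]
 show "rep (Comp Sp V W Y t s)\<in>spans V Y" by (rule S(1))
 show "pm (rep (Comp Sp V W Y t s)) v = Option.bind (pm (rep s) v) (pm (rep t))"
 proof (cases "v\<in>a ` carrier A")
  case True
  then obtain y where y: "y <: A" "v = a y" by auto
  have s: "pm (rep s) v = Some (b y)" unfolding r using pm_a[OF qhomD(3)[OF A(2)] y(1)] y(2) by simp
  show ?thesis
  proof (cases "y\<in>P")
   case True
   have "pm ?c v = Some (b' (i y))"
    using pm_a[of "compose P a (restrict id P)" ?A y "compose P b' i"] True y qhomD(3)[OF A(2)] Pc
    by (auto simp: compose_def inj_on_def)
   moreover have "pm (rep t) (b y) = Some (b' (i y))"
    unfolding r' using pm_a[OF qhomD(3)[OF A'(2)] i(1)[OF True], of b'] i(2)[OF True] by simp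
   ultimately show ?thesis using S(2) s by simp
  next
   case False
   then have "b y \<notin> a' ` carrier A'" using y by (simp add: P_def)
   moreover have "v \<notin> compose P a (restrict id P) ` carrier ?A"
    using False y qhomD(3)[OF A(2)] Pc by (auto simp: compose_def inj_on_def)
   ultimately show ?thesis using S(2) s unfolding r' by (simp add: pm_None)
  qed
 next
  case False
  then have "v \<notin> compose P a (restrict id P) ` carrier ?A" using Pc by (auto simp: compose_def)
  then show ?thesis using S(2) False unfolding r by (simp add: pm_None)
 qed
qed

lemma Sp_hom: "s\<in>Hom Sp V W ==> rep s\<in>spans V W"
 using span_class_pm(1) by auto

lemma iso_act_comp:
 assumes V: "qsp V" "qsp W" "qsp Y" and s: "rep s\<in>spans V W" and t: "rep t\<in>spans W Y" and h: "h\<in>qhom D V"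
  and u: "rep u\<in>spans V Y" "!!v. v <: V ==> pm (rep u) v = Option.bind (pm (rep s) v) (pm (rep t))"
 shows "iso_act D (rep u) h = Option.bind (iso_act D (rep s) h) (iso_act D (rep t))"
proof -
 note hx = hom_lm[OF V(1) h]
 have "iso_act D (rep u) h = map_option (lm Y) (Option.bind (pm (rep s) (h x)) (pm (rep t)))"
  using iso_act_eq[OF V(1,3) u(1) hx(1)] hx(2) u(2)[OF alD(1)[OF hx(1)]] by simp
 moreover have "iso_act D (rep s) h = map_option (lm W) (pm (rep s) (h x))"
  using iso_act_eq[OF V(1,2) s hx(1)] hx(2) by simp
 ultimately show ?thesis
  using iso_act_eq[OF V(2,3) t] pm_al[OF V(1,2) s hx(1)] by (cases "pm (rep s) (h x)") auto
qed

lemma iso_functor: "is_functor Sp (iso_fun D)"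
proof (rule is_functorI)
 have ob: "fob (iso_fun D) V = free_mod (qhom D V)" and mo: "fmor (iso_fun D) V W s = free_map (iso_act D (rep s))" for V W s
  by (simp_all add: iso_fun_def)
 have q: "qsp V" if "V\<in>Obj Sp" for V :: "'a qsp" using that by (simp add: qsp_def)
 show "f2v (fob (iso_fun D) V)" for V unfolding ob by (rule f2v_free)
 show "fmor (iso_fun D) V W s\<in>lin_maps (fob (iso_fun D) V) (fob (iso_fun D) W)"
  if "V\<in>Obj Sp" "W\<in>Obj Sp" "s\<in>Hom Sp V W" for V W s
  unfolding ob mo by (rule free_map_lin) (use iso_act_hom[OF q[OF that(1)] q[OF that(2)] Sp_hom[OF that(3)]] in auto)
 show "fmor (iso_fun D) V V (Idm Sp V) z = z" if V: "V\<in>Obj Sp" and "z <: fob (iso_fun D) V" for V z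
  unfolding mo
 proof (rule free_map_id[OF _ that(2)[unfolded ob]])
  fix h assume h: "h\<in>qhom D V"
  note h' = hom_lm[OF q[OF V] h]
  show "iso_act D (rep (Idm Sp V)) h = Some h"
   using iso_act_eq[OF q[OF V] q[OF V] Sp_id(1)[OF q[OF V]] h'(1)] Sp_id(2)[OF q[OF V] alD(1)[OF h'(1)]] h'(2) by simp
 qed
 show "fmor (iso_fun D) X Z (Comp Sp X Y Z n m) z = fmor (iso_fun D) Y Z n (fmor (iso_fun D) X Y m z)"
  if X: "X\<in>Obj Sp" "Y\<in>Obj Sp" "Z\<in>Obj Sp" and m: "m\<in>Hom Sp X Y" "n\<in>Hom Sp Y Z"
   and z: "z <: fob (iso_fun D) X" for X Y Z m n z
  unfolding mo
 proof (rule free_map_comp[OF _ _ _ z[unfolded ob]])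
  show "h\<in>qhom D X ==> iso_act D (rep m) h = Some k ==> k\<in>qhom D Y" for h k
   using iso_act_hom[OF q[OF X(1)] q[OF X(2)] Sp_hom[OF m(1)]] .
  show "h\<in>qhom D Y ==> iso_act D (rep n) h = Some k ==> k\<in>qhom D Z" for h k
   using iso_act_hom[OF q[OF X(2)] q[OF X(3)] Sp_hom[OF m(2)]] .
  show "iso_act D (rep (Comp Sp X Y Z n m)) h = Option.bind (iso_act D (rep m) h) (iso_act D (rep n))" if "h\<in>qhom D X" for h
   using iso_act_comp[OF q[OF X(1)] q[OF X(2)] q[OF X(3)] Sp_hom[OF m(1)] Sp_hom[OF m(2)] that
     Sp_comp[OF q[OF X(1)] q[OF X(2)] q[OF X(3)] Sp_hom[OF m(1)] Sp_hom[OF m(2)]]] .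
 qed
qed

text \<open>The span from \<open>W\<close> to \<open>V\<close> through \<open>D\<close> with legs
  \<open>h\<close> and \<open>k\<close> sends the generator \<open>h\<close> to \<open>k\<close> and
  kills all others. Applied to an element with nonzero coefficient at \<open>h\<close> it yields
  \<open>gen k\<close>, so a nonzero subfunctor contains every generator.\<close>

lemma iso_simple: "simple_functor Sp (iso_fun D)"
 unfolding simple_functor_def
proof (intro conjI iso_functor allI impI)
 have ob: "fob (iso_fun D) V = free_mod (qhom D V)" and mo: "fmor (iso_fun D) V W s = free_map (iso_act D (rep s))" for V W s
  by (simp_all add: iso_fun_def)
 have q: "qsp V" if "V\<in>Obj Sp" for V :: "'a qsp" using that by (simp add: qsp_def)
 have "gen (restrict id (carrier D)) <: free_mod (qhom D D)" using qhom_id[OF D.f2v_axioms] by simp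
 moreover have "gen (restrict id (carrier D)) ~= (%_. 0)" by (metis gen_def zero_neq_one)
 ultimately have "carrier (free_mod (qhom D D)) ~= {%_. 0}" by blast
 then show "\<not> sub_eq Sp (sub_top (iso_fun D)) (sub_zero (iso_fun D))"
  unfolding sub_eq_def sub_top_def sub_zero_def ob using D.quad by (auto simp: free_simps(2))
 fix S assume S: "subfunctor Sp (iso_fun D) S"
 have Ssub: "submodule (S V) F2 (free_mod (qhom D V))" if "V\<in>Obj Sp" for V
  using S that by (simp add: subfunctor_def ob)
 have Sv: "S V \<subseteq> carrier (free_mod (qhom D V))" "(%_. 0)\<in>S V" "!!u v. u\<in>S V ==> v\<in>S V ==> u \<oplus>\<^bsub>free_mod (qhom D V)\<^esub> v\<in>S V" if "V\<in>Obj Sp" for V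
  using Ssub[OF that] by (auto simp: f2v.sub_iff[OF f2v_free] free_simps)
 show "sub_eq Sp S (sub_zero (iso_fun D)) | sub_eq Sp S (sub_top (iso_fun D))"
 proof (cases "sub_eq Sp S (sub_zero (iso_fun D))")
  case False
  then obtain W z where W: "W\<in>Obj Sp" "z\<in>S W" "z ~= (%_. 0)"
   using Sv unfolding sub_eq_def sub_zero_def ob by (auto simp: free_simps)
  then obtain h where h: "z h ~= 0" by (auto simp: fun_eq_iff)
  have zc: "z <: free_mod (qhom D W)" using W Sv by auto
  then have hW: "h\<in>qhom D W" using h by (auto simp: free_simps)
  have "gen k\<in>S V" if V: "V\<in>Obj Sp" and k: "k\<in>qhom D V" for V k
  proof -
   have c: "(D, h, k)\<in>spans W V" using hW k D.quad by (simp add: spans_def)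
   note r = span_class_pm[OF c]
   let ?s = "span_class W V (D, h, k)"
   have act: "iso_act D (rep ?s) h' = (if h' = h then Some k else None)" if h': "h'\<in>qhom D W" for h'
   proof -
    note hh = hom_lm[OF q[OF W(1)] h'] and hx = hom_lm[OF q[OF W(1)] hW] and kx = hom_lm[OF q[OF V] k]
    have eq: "iso_act D (rep ?s) h' = map_option (lm V) (pm (D, h, k) (h' x))"
     using iso_act_eq[OF q[OF W(1)] q[OF V] r(1) hh(1)] hh(2) r(2) by simp
    show ?thesis
    proof (cases "h' = h")
     case True
     then show ?thesis using eq pm_a[OF qhomD(3)[OF hW] x(1), of k] kx by simp
    next
     case False
     then have "h' x ~= h x" using hh hx by metis
     \<comment> \<open>The image of \<open>h\<close> consists of zero and \<open>h x\<close> only,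
       so another embedding does not factor through it.\<close>
     moreover have "h' x ~= h \<zero>\<^bsub>D\<^esub>" using alD(2)[OF hh(1)] hx(2) lm_0 by metis
     ultimately have "h' x \<notin> h ` carrier D" using carrier_D by auto
     then show ?thesis using eq False by (simp add: pm_None)
    qed
   qed
   have fin: "finite {s. z s ~= 0}" using zc by (simp add: free_simps)
   have "free_map (iso_act D (rep ?s)) z = gen k"
   proof
    fix l
    have "free_map (iso_act D (rep ?s)) z l = (\<Sum>s\<in>{s. z s ~= 0}. if iso_act D (rep ?s) s = Some l then z s else 0)"
     by (rule free_map_eq[OF fin]) simp
    also have "\<dots> = (\<Sum>s\<in>{s. z s ~= 0}. if s = h then gen k l else 0)"
    proof (rule sum.cong[OF refl])
     fix s assume "s\<in>{s. z s ~= 0}"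
     then have "s\<in>qhom D W" "z s = 1" using zc by (auto simp: free_simps)
     then show "(if iso_act D (rep ?s) s = Some l then z s else 0) = (if s = h then gen k l else 0)"
      using act[of s] by (auto simp: gen_def)
    qed
    also have "\<dots> = gen k l" using fin h by simp
    finally show "free_map (iso_act D (rep ?s)) z l = gen k l" .
   qed
   moreover have "fmor (iso_fun D) W V ?s ` S W \<subseteq> S V"
    using S W(1) V c unfolding subfunctor_def by (metis Sp_simps(2) imageI)
   ultimately show ?thesis using W(2) unfolding mo by auto
  qed
  note g = this
  have "z\<in>S V" if V: "V\<in>Obj Sp" and z: "z <: free_mod (qhom D V)" for V z
   using z by (induction rule: free_induct) (use Sv[OF V] g[OF V] in auto)
  then show ?thesis using Sv unfolding sub_eq_def sub_top_def ob by blast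
 qed simp
qed

section \<open>The functor \<open>kappa (iso_fun D)\<close> on \<open>Tq\<close>\<close>

abbreviation ik :: "('a qsp, 'a triple set, ('a => 'a) => bit) vfun" where
 "ik \<equiv> kappa (iso_fun D)"

lemma ik_simps: "fob ik V = free_mod (qhom D V)" "fmor ik V W t = free_map (iso_act D (rep (cospan_to_span V W t)))"
 by (simp_all add: kappa_def iso_fun_def)

lemma cospan_to_span_pm:
 assumes "tmor V W t"
 shows "rep (cospan_to_span V W t)\<in>spans V W"
  "pm (rep (cospan_to_span V W t)) v = (if v\<in>dm V W t then Some (eps_mor V W t v) else None)"
proof -
 interpret tmor V W t by fact
 let ?A = "V\<lparr>carrier := dm V W t\<rparr>"
 let ?c = "(?A, restrict id (dm V W t), restrict (eps_mor V W t) (dm V W t))"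
 interpret A: qsp ?A by (rule V.qsp_sub[OF dm_sub])
 have inj: "inj_on (eps_mor V W t) (dm V W t)"
 proof (rule inj_onI)
  fix u v assume uv: "u\<in>dm V W t" "v\<in>dm V W t" "eps_mor V W t u = eps_mor V W t v"
  show "u = v"
   by (rule V.bil_cancel) (use uv dm_carrier dm_bil in "auto, metis")
 qed
 have "restrict (eps_mor V W t) (dm V W t)\<in>lin_maps ?A W"
  by (rule linI[OF A.f2v_axioms W.f2v_axioms])
   (use dm_carrier eps_add dm_sub in "auto simp: V.sub_iff")
 then have "restrict (eps_mor V W t) (dm V W t)\<in>qhom ?A W"
  unfolding qhom_def using dm_qf inj by (auto simp: inj_on_def)
 then have c: "?c\<in>spans V W" using qhom_sub_id[OF V.f2v_axioms dm_sub] A.quad by (simp add: spans_def)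
 note S = span_class_pm[OF c, folded cospan_to_span_eq]
 show "rep (cospan_to_span V W t)\<in>spans V W" by (rule S)
 have "inj_on (restrict id (dm V W t)) (carrier ?A)" by (auto simp: inj_on_def)
 from pm_a[OF this, of v "restrict (eps_mor V W t) (dm V W t)"]
 show "pm (rep (cospan_to_span V W t)) v = (if v\<in>dm V W t then Some (eps_mor V W t v) else None)"
  unfolding S(2) by (auto intro: pm_None)
qed

lemma eps_al: "tmor V W t ==> a\<in>al V ==> a\<in>dm V W t ==> eps_mor V W t a\<in>al W"
 using tmor.dm_qf[of V W t a] tmor.dm_nonzero[of V W t a] tmor.eps_mem[of V W t a] by (auto simp: al_def)

lemma ik_functor: "is_functor Tq ik"
proof (rule is_functorI)
 have nd: "ndsp V" and q: "qsp V" if "V\<in>Obj Tq" for V :: "'a qsp" using that by (simp_all add: ndsp_iff qsp_def nondegenerate_def)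
 show "f2v (fob ik V)" for V unfolding ik_simps by (rule f2v_free)
 have H: "k\<in>qhom D W" if "V\<in>Obj Tq" "W\<in>Obj Tq" "t\<in>Hom Tq V W" "h\<in>qhom D V"
   "iso_act D (rep (cospan_to_span V W t)) h = Some k" for V W t h k
  using iso_act_hom[OF q[OF that(1)] q[OF that(2)] cospan_to_span_pm(1)[OF tmorI[OF that(1-3)]] that(4,5)] .
 show "fmor ik V W t\<in>lin_maps (fob ik V) (fob ik W)"
  if "V\<in>Obj Tq" "W\<in>Obj Tq" "t\<in>Hom Tq V W" for V W t
  unfolding ik_simps by (rule free_map_lin) (use H that in blast)
 show "fmor ik V V (Idm Tq V) z = z" if V: "V\<in>Obj Tq" and "z <: fob ik V" for V z
  unfolding ik_simps
 proof (rule free_map_id[OF _ that(2)[unfolded ik_simps]])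
  fix h assume h: "h\<in>qhom D V"
  note h' = hom_lm[OF q[OF V] h] and i = Tq_id[OF nd[OF V]]
  show "iso_act D (rep (cospan_to_span V V (Idm Tq V))) h = Some h"
   using iso_act_eq[OF q[OF V] q[OF V] cospan_to_span_pm(1)[OF i(1)] h'(1)] cospan_to_span_pm(2)[OF i(1), of "h x"]
    alD(1)[OF h'(1)] h'(2) i(2,3) by simp
 qed
 show "fmor ik X Z (Comp Tq X Y Z n m) z = fmor ik Y Z n (fmor ik X Y m z)"
  if X: "X\<in>Obj Tq" "Y\<in>Obj Tq" "Z\<in>Obj Tq" and m: "m\<in>Hom Tq X Y" "n\<in>Hom Tq Y Z"
   and z: "z <: fob ik X" for X Y Z m n z
  unfolding ik_simps
 proof (rule free_map_comp[OF _ _ _ z[unfolded ik_simps]])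
  note tm = tmorI[OF X(1,2) m(1)] and tn = tmorI[OF X(2,3) m(2)]
  note c = Tq_comp[OF tm tn]
  show "h\<in>qhom D X ==> iso_act D (rep (cospan_to_span X Y m)) h = Some k ==> k\<in>qhom D Y" for h k
   using H[OF X(1,2) m(1)] .
  show "h\<in>qhom D Y ==> iso_act D (rep (cospan_to_span Y Z n)) h = Some k ==> k\<in>qhom D Z" for h k
   using H[OF X(2,3) m(2)] .
  show "iso_act D (rep (cospan_to_span X Z (Comp Tq X Y Z n m))) h =
    Option.bind (iso_act D (rep (cospan_to_span X Y m)) h) (iso_act D (rep (cospan_to_span Y Z n)))" if "h\<in>qhom D X" for h
  proof (rule iso_act_comp[OF q[OF X(1)] q[OF X(2)] q[OF X(3)] cospan_to_span_pm(1)[OF tm] cospan_to_span_pm(1)[OF tn] that cospan_to_span_pm(1)[OF c(1)]])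
   fix v assume v: "v <: X"
   show "pm (rep (cospan_to_span X Z (Comp Tq X Y Z n m))) v =
     Option.bind (pm (rep (cospan_to_span X Y m)) v) (pm (rep (cospan_to_span Y Z n)))"
    unfolding cospan_to_span_pm(2)[OF tm] cospan_to_span_pm(2)[OF tn] cospan_to_span_pm(2)[OF c(1)] c(3)
    using c(2)[OF v] by simp
  qed
 qed
qed

lemma ik_gen:
 assumes "tmor V W t" "a\<in>al V"
 shows "fmor ik V W t (gen (lm V a)) = (if a\<in>dm V W t then gen (lm W (eps_mor V W t a)) else (%_. 0))"
proof -
 interpret tmor V W t by fact
 have "iso_act D (rep (cospan_to_span V W t)) (lm V a) = (if a\<in>dm V W t then Some (lm W (eps_mor V W t a)) else None)"
  using iso_act_eq[OF V.qsp_axioms W.qsp_axioms cospan_to_span_pm(1)[OF assms(1)] assms(2)] cospan_to_span_pm(2)[OF assms(1)] by simp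
 then show ?thesis unfolding ik_simps free_map_gen by simp
qed

end

section \<open>Exterior powers\<close>

definition addfun :: "(bit, 'a, 'x) module_scheme => ('a => bit) => bool" where
 "addfun M \<phi> \<longleftrightarrow> (ALL u:carrier M. ALL v:carrier M. \<phi> (u \<oplus>\<^bsub>M\<^esub> v) = \<phi> u + \<phi> v)"

lemma tuples_append [simp]: "xs @ ys\<in>tuples n M \<longleftrightarrow> set xs \<subseteq> carrier M & set ys \<subseteq> carrier M & length xs + length ys = n"
 by (auto simp: tuples_def)

lemma tuples_Cons [simp]: "x # ys\<in>tuples n M \<longleftrightarrow> x <: M & set ys \<subseteq> carrier M & Suc (length ys) = n"
 by (auto simp: tuples_def)

lemma tuples_Nil [simp]: "[]\<in>tuples n M \<longleftrightarrow> n = 0"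
 by (auto simp: tuples_def)

lemma ext_relI:
 "xs @ (u \<oplus>\<^bsub>M\<^esub> v) # ys\<in>tuples n M ==> u <: M ==> v <: M ==>
  gen (xs @ (u \<oplus>\<^bsub>M\<^esub> v) # ys) - gen (xs @ u # ys) - gen (xs @ v # ys)\<in>ext_rel n M"
 "xs @ u # ys\<in>tuples n M ==> gen (xs @ (c \<odot>\<^bsub>M\<^esub> u) # ys) - (%s. c * gen (xs @ u # ys) s)\<in>ext_rel n M"
 "xs @ u # ys @ u # zs\<in>tuples n M ==> gen (xs @ u # ys @ u # zs)\<in>ext_rel n M"
proof -
 assume *: "xs @ (u \<oplus>\<^bsub>M\<^esub> v) # ys\<in>tuples n M" "u <: M" "v <: M"
 then have "xs @ u # ys\<in>tuples n M" "length xs < n" by auto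
 then show "gen (xs @ (u \<oplus>\<^bsub>M\<^esub> v) # ys) - gen (xs @ u # ys) - gen (xs @ v # ys)\<in>ext_rel n M"
  unfolding ext_rel_def using *(2,3)
  by (intro UnI1 CollectI exI[of _ "xs @ u # ys"] exI[of _ "length xs"] exI[of _ u] exI[of _ v]) simp
next
 assume *: "xs @ u # ys\<in>tuples n M"
 then have "length xs < n" "u <: M" by auto
 then show "gen (xs @ (c \<odot>\<^bsub>M\<^esub> u) # ys) - (%s. c * gen (xs @ u # ys) s)\<in>ext_rel n M"
  unfolding ext_rel_def using *
  by (intro UnI1[OF UnI2] CollectI exI[of _ "xs @ u # ys"] exI[of _ "length xs"] exI[of _ c] exI[of _ u]) simp
next
 assume *: "xs @ u # ys @ u # zs\<in>tuples n M"
 let ?j = "Suc (length xs + length ys)"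
 have "(xs @ u # ys @ u # zs) ! length xs = u" "(xs @ u # ys @ u # zs) ! ?j = u" "length xs < ?j" "?j < n"
  using * by (auto simp: nth_append)
 then show "gen (xs @ u # ys @ u # zs)\<in>ext_rel n M"
  unfolding ext_rel_def using * by (intro UnI2 CollectI exI[of _ "xs @ u # ys @ u # zs"]) metis
qed

lemma ext_rel_cases:
 assumes "f2v M" "r\<in>ext_rel n M"
 obtains (add) xs u v ys where "set xs \<subseteq> carrier M" "set ys \<subseteq> carrier M" "u <: M" "v <: M" "Suc (length xs + length ys) = n"
   "r = gen (xs @ (u \<oplus>\<^bsub>M\<^esub> v) # ys) \<oplus>\<^bsub>free_mod (tuples n M)\<^esub> gen (xs @ u # ys) \<oplus>\<^bsub>free_mod (tuples n M)\<^esub> gen (xs @ v # ys)"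
  | (z) "r = (%_. 0)"
  | (zero) xs ys where "set xs \<subseteq> carrier M" "set ys \<subseteq> carrier M" "Suc (length xs + length ys) = n" "r = gen (xs @ \<zero>\<^bsub>M\<^esub> # ys)"
  | (alt) xs u ys zs where "xs @ u # ys @ u # zs\<in>tuples n M" "r = gen (xs @ u # ys @ u # zs)"
proof -
 interpret f2v M by fact
 have sp: "\<exists>xs ys. set xs \<subseteq> carrier M & set ys \<subseteq> carrier M & Suc (length xs + length ys) = n & (\<forall>a. vs[i := a] = xs @ a # ys)"
  if "vs\<in>tuples n M" "i < n" for vs i
  by (rule exI[of _ "take i vs"], rule exI[of _ "drop (Suc i) vs"])
   (use that in "auto simp: tuples_def upd_conv_take_nth_drop dest: in_set_takeD in_set_dropD")
 from assms(2) show ?thesis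
  unfolding ext_rel_def
 proof (elim UnE CollectE exE conjE, goal_cases)
  case (1 vs i u v)
  then obtain xs ys where "set xs \<subseteq> carrier M" "set ys \<subseteq> carrier M" "Suc (length xs + length ys) = n" "\<forall>a. vs[i := a] = xs @ a # ys"
   using sp by blast
  then show ?thesis using 1 add[of xs ys u v] by (simp add: minus_free[where S = "tuples n M"])
 next
  case (2 vs i c u)
  then obtain xs ys where *: "set xs \<subseteq> carrier M" "set ys \<subseteq> carrier M" "Suc (length xs + length ys) = n" "\<forall>a. vs[i := a] = xs @ a # ys"
   using sp by blast
  then show ?thesis using 2 smult_gen_diff[OF assms(1), of u "%a. vs[i := a]" c] z zero[of xs ys] by (auto split: if_splits)
 next
  case (3 vs i j)
  have "vs = take i vs @ vs ! i # drop (Suc i) vs" using 3 by (intro id_take_nth_drop) (auto simp: tuples_def)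
  moreover have "drop (Suc i) vs = take (j - Suc i) (drop (Suc i) vs) @ vs ! j # drop (Suc j) vs"
   using id_take_nth_drop[of "j - Suc i" "drop (Suc i) vs"] 3 by (auto simp: tuples_def)
  ultimately have "vs = take i vs @ vs ! i # take (j - Suc i) (drop (Suc i) vs) @ vs ! i # drop (Suc j) vs"
   using 3 by simp
  then show ?thesis using 3 alt by metis
 qed
qed

locale ext = f2v M for M :: "(bit, 'a, 'x) module_scheme" (structure)
begin

abbreviation E :: "nat => (bit, ('a list => bit) set) module" where "E n \<equiv> ext_mod n M"
abbreviation w :: "nat => 'a list => ('a list => bit) set" where "w n \<equiv> wedge n M"

lemma ext_rel_carrier: "ext_rel n M \<subseteq> carrier (free_mod (tuples n M))"
proof
 interpret F: f2v "free_mod (tuples n M)" by (rule f2v_free)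
 fix r assume "r\<in>ext_rel n M"
 with f2v_axioms show "r <: free_mod (tuples n M)"
  by (cases rule: ext_rel_cases) (auto intro!: F.a_closed simp: free_simps(2)[symmetric], simp add: free_simps)
qed

lemma ext_presentation: "presentation (tuples n M) (ext_rel n M)"
 by unfold_locales (rule ext_rel_carrier)

lemma f2v_E: "f2v (E n)"
 unfolding ext_mod_def using presentation.pres_induct ext_presentation
 by (metis ext_presentation f2v_free f2v.f2v_quot presentation.rel_sub presented_def)

sublocale E: f2v "E n" for n by (rule f2v_E)

lemma w_mem [simp]: "vs\<in>tuples n M ==> w n vs <: E n"
 unfolding ext_mod_def wedge_def by (rule presentation.pres_gen_mem[OF ext_presentation])

lemma w_rel:
 assumes "r\<in>ext_rel n M" "r = gen a - gen b - gen c" "a\<in>tuples n M" "b\<in>tuples n M" "c\<in>tuples n M"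
 shows "w n a = w n b \<oplus>\<^bsub>E n\<^esub> w n c"
proof -
 interpret P: presentation "tuples n M" "ext_rel n M" by (rule ext_presentation)
 have "r\<in>vspan (free_mod (tuples n M)) (ext_rel n M)" using assms(1) P.free.vspan_incl by auto
 moreover have "r = gen a \<oplus>\<^bsub>free_mod (tuples n M)\<^esub> gen b \<oplus>\<^bsub>free_mod (tuples n M)\<^esub> gen c"
  using assms(2) by (simp only: minus_free[where S = "tuples n M"])
 ultimately have "\<zero>\<^bsub>E n\<^esub> = w n a \<oplus>\<^bsub>E n\<^esub> w n b \<oplus>\<^bsub>E n\<^esub> w n c"
  using P.coset_rel[of r] assms(3-) lin_add[OF P.proj] P.free.a_closed by (simp add: pres_gen_def ext_mod_def wedge_def)
 then show ?thesis using w_mem[OF assms(3)] w_mem[OF assms(4)] w_mem[OF assms(5)]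
  by (metis E.a_assoc E.a_closed E.add_eq_zero_iff)
qed

lemma w_add:
 assumes "u <: M" "v <: M" "xs @ u # ys\<in>tuples n M"
 shows "w n (xs @ (u \<oplus> v) # ys) = w n (xs @ u # ys) \<oplus>\<^bsub>E n\<^esub> w n (xs @ v # ys)"
 by (rule w_rel[OF ext_relI(1) refl]) (use assms in auto)

lemma w_alt:
 assumes "xs @ u # ys @ u # zs\<in>tuples n M"
 shows "w n (xs @ u # ys @ u # zs) = \<zero>\<^bsub>E n\<^esub>"
proof -
 interpret P: presentation "tuples n M" "ext_rel n M" by (rule ext_presentation)
 show ?thesis unfolding wedge_def pres_gen_def ext_mod_def
  by (rule P.coset_rel) (use ext_relI(3)[OF assms] P.free.vspan_incl in auto)
qed

lemma w_zero:
 assumes "set xs \<subseteq> carrier M" "set ys \<subseteq> carrier M" "Suc (length xs + length ys) = n"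
 shows "w n (xs @ \<zero> # ys) = \<zero>\<^bsub>E n\<^esub>"
 using w_add[of \<zero> \<zero> xs ys n] assms by simp

lemma w_smult:
 assumes "u <: M" "xs @ u # ys\<in>tuples n M"
 shows "w n (xs @ (c \<odot> u) # ys) = c \<odot>\<^bsub>E n\<^esub> w n (xs @ u # ys)"
 using assms w_zero[of xs ys n] by (auto simp: smult_bit E.smult_bit)

text \<open>Expand the vanishing wedge with \<open>u + v\<close> in two adjacent places; no sign
  appears in characteristic two.\<close>

lemma w_swap:
 assumes "xs @ u # v # ys\<in>tuples n M"
 shows "w n (xs @ u # v # ys) = w n (xs @ v # u # ys)"
proof -
 have m: "u <: M" "v <: M" "xs @ v # u # ys\<in>tuples n M" "xs @ u # u # ys\<in>tuples n M" "xs @ v # v # ys\<in>tuples n M"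
  using assms by auto
 have alt: "w n (xs @ a # a # ys) = \<zero>\<^bsub>E n\<^esub>" if "a <: M" for a
  using w_alt[of xs a "[]" ys n] assms that by simp
 have "\<zero>\<^bsub>E n\<^esub> = w n (xs @ (u \<oplus> v) # (u \<oplus> v) # ys)" using alt m by simp
 also have "\<dots> = w n (xs @ u # (u \<oplus> v) # ys) \<oplus>\<^bsub>E n\<^esub> w n (xs @ v # (u \<oplus> v) # ys)"
  using m by (intro w_add) auto
 also have "w n (xs @ u # (u \<oplus> v) # ys) = w n (xs @ u # u # ys) \<oplus>\<^bsub>E n\<^esub> w n (xs @ u # v # ys)"
  using w_add[of u v "xs @ [u]" ys n] m by simp
 also have "w n (xs @ v # (u \<oplus> v) # ys) = w n (xs @ v # u # ys) \<oplus>\<^bsub>E n\<^esub> w n (xs @ v # v # ys)"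
  using w_add[of u v "xs @ [v]" ys n] m by simp
 finally show ?thesis using assms m alt by (metis E.a_closed E.add_eq_zero_iff E.l_zero E.r_zero w_mem)
qed

lemma w_move: "xs @ v # ys @ zs\<in>tuples n M ==> w n (xs @ v # ys @ zs) = w n (xs @ ys @ v # zs)"
proof (induction ys arbitrary: xs)
 case (Cons y ys)
 have "w n (xs @ v # y # ys @ zs) = w n (xs @ y # v # ys @ zs)"
  by (rule w_swap) (use Cons.prems in auto)
 also have "\<dots> = w n ((xs @ [y]) @ ys @ v # zs)" using Cons.IH[of "xs @ [y]"] Cons.prems by simp
 finally show ?case by simp
qed simp

lemma ext_univ:
 assumes N: "f2v N" and cl: "!!vs. vs\<in>tuples n M ==> \<phi> vs <: N"
  and add: "!!xs u v ys. xs @ u # ys\<in>tuples n M ==> v <: M ==>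
   \<phi> (xs @ (u \<oplus> v) # ys) = \<phi> (xs @ u # ys) \<oplus>\<^bsub>N\<^esub> \<phi> (xs @ v # ys)"
  and alt: "!!xs u ys zs. xs @ u # ys @ u # zs\<in>tuples n M ==> \<phi> (xs @ u # ys @ u # zs) = \<zero>\<^bsub>N\<^esub>"
 shows "EX f:lin_maps (E n) N. ALL vs:tuples n M. f (w n vs) = \<phi> vs"
proof -
 interpret N: f2v N by fact
 interpret P: presentation "tuples n M" "ext_rel n M" by (rule ext_presentation)
 have L: "lext N \<phi>\<in>lin_maps (free_mod (tuples n M)) N" by (rule N.lext_lin) (use cl in auto)
 have z: "\<phi> (xs @ \<zero> # ys) = \<zero>\<^bsub>N\<^esub>" if "xs @ \<zero> # ys\<in>tuples n M" for xs ys
  using add[of xs \<zero> ys \<zero>] cl[OF that] that by simp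
 have "lext N \<phi> r = \<zero>\<^bsub>N\<^esub>" if "r\<in>ext_rel n M" for r
  using f2v_axioms that
 proof (cases rule: ext_rel_cases)
  case (add xs u v ys)
  then show ?thesis using cl by (simp add: lin_add[OF L] N.lext_gen assms(3) P.free.a_closed N.ac)
 next
  case z
  then show ?thesis using lin_zero[OF f2v_free N L] by (simp add: free_simps)
 next
  case (zero xs ys)
  then show ?thesis using z[of xs ys] cl[of "xs @ \<zero> # ys"] by (simp add: N.lext_gen)
 next
  case (alt xs u ys zs)
  then show ?thesis using assms(4)[of xs u ys zs] cl by (simp add: N.lext_gen)
 qed
 then show ?thesis unfolding ext_mod_def wedge_def by (intro P.pres_univ N) (use cl in auto)
qed

lemma ext_span: "vspan (E n) (w n ` tuples n M) = carrier (E n)"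
 unfolding ext_mod_def wedge_def by (rule presentation.pres_span[OF ext_presentation])

lemma ext_lin_eq:
 assumes "f2v N" "f\<in>lin_maps (E n) N" "g\<in>lin_maps (E n) N" "!!vs. vs\<in>tuples n M ==> f (w n vs) = g (w n vs)" "y <: E n"
 shows "f y = g y"
 by (rule lin_eq_vspan[OF f2v_E assms(1-3), of "w n ` tuples n M"]) (use assms in "auto simp: ext_span")

section \<open>Multiplication by a vector and contraction with a linear form\<close>

lemma wr_ex: "a <: M ==> EX f:lin_maps (E n) (E (Suc n)). ALL vs:tuples n M. f (w n vs) = w (Suc n) (vs @ [a])"
 by (rule ext_univ[OF f2v_E]) (use w_add[of _ _ _ "_ @ [a]" "Suc n"] w_alt[of _ _ _ "_ @ [a]" "Suc n"] in "auto simp: tuples_def")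

text \<open>Right multiplication by \<open>a\<close>; this is what \<open>mu\<close> does in the
  fibre over \<open>a\<close>.\<close>

definition wr :: "nat => 'a => ('a list => bit) set => ('a list => bit) set" where
 "wr n a = (SOME f. f\<in>lin_maps (E n) (E (Suc n)) & (ALL vs:tuples n M. f (w n vs) = w (Suc n) (vs @ [a])))"

lemma wr_lin: "a <: M ==> wr n a\<in>lin_maps (E n) (E (Suc n))"
 and wr_w: "a <: M ==> vs\<in>tuples n M ==> wr n a (w n vs) = w (Suc n) (vs @ [a])"
 using someI_ex[OF wr_ex[of a n, unfolded Bex_def], folded wr_def] by blast+

text \<open>Contraction of a wedge with a linear form, as a recursion along the list:
  \<open>pre\<close> keeps the factors already passed, so that each summand omits exactly one
  factor. For the form \<open>B(-, a)\<close> this is \<open>nu\<close> in the fibre over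
  \<open>a\<close>.\<close>

fun conl :: "nat => ('a => bit) => 'a list => 'a list => ('a list => bit) set" where
 "conl n \<phi> pre [] = \<zero>\<^bsub>E n\<^esub>"
| "conl n \<phi> pre (v # vs) = (\<phi> v \<odot>\<^bsub>E n\<^esub> w n (pre @ vs)) \<oplus>\<^bsub>E n\<^esub> conl n \<phi> (pre @ [v]) vs"

lemma conl_mem [simp]: "pre @ vs\<in>tuples (Suc n) M ==> conl n \<phi> pre vs <: E n"
 by (induction vs arbitrary: pre) auto

lemma conl_pre_add: "p1 @ u # p2 @ vs\<in>tuples (Suc n) M ==> v <: M ==>
  conl n \<phi> (p1 @ (u \<oplus> v) # p2) vs = conl n \<phi> (p1 @ u # p2) vs \<oplus>\<^bsub>E n\<^esub> conl n \<phi> (p1 @ v # p2) vs"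
proof (induction vs arbitrary: p2)
 case (Cons y vs)
 have "w n (p1 @ (u \<oplus> v) # p2 @ vs) = w n (p1 @ u # p2 @ vs) \<oplus>\<^bsub>E n\<^esub> w n (p1 @ v # p2 @ vs)"
  by (rule w_add) (use Cons.prems in auto)
 moreover have "conl n \<phi> (p1 @ a # p2 @ [y]) vs <: E n" "w n (p1 @ a # p2 @ vs) <: E n" if "a <: M" for a
  using conl_mem[of "p1 @ a # p2 @ [y]" vs n \<phi>] w_mem[of "p1 @ a # p2 @ vs" n] Cons.prems that by simp_all
 ultimately show ?case using Cons.IH[of "p2 @ [y]"] Cons.prems by (cases "\<phi> y = 0") (simp_all add: E.ac)
qed simp

lemma conl_add: "addfun M \<phi> ==> pre @ xs @ u # ys\<in>tuples (Suc n) M ==> v <: M ==>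
  conl n \<phi> pre (xs @ (u \<oplus> v) # ys) = conl n \<phi> pre (xs @ u # ys) \<oplus>\<^bsub>E n\<^esub> conl n \<phi> pre (xs @ v # ys)"
proof (induction xs arbitrary: pre)
 case Nil
 have "conl n \<phi> (pre @ [u \<oplus> v]) ys = conl n \<phi> (pre @ [u]) ys \<oplus>\<^bsub>E n\<^esub> conl n \<phi> (pre @ [v]) ys"
  using conl_pre_add[of pre u "[]" ys n v \<phi>] Nil by simp
 moreover have "conl n \<phi> (pre @ [a]) ys <: E n" if "a <: M" for a
  using conl_mem[of "pre @ [a]" ys n \<phi>] Nil that by simp
 moreover have "\<phi> (u \<oplus> v) = \<phi> u + \<phi> v" "w n (pre @ ys) <: E n" using Nil by (auto simp: addfun_def)
 ultimately show ?case using Nil by (simp add: E.smult_plus E.ac)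
next
 case (Cons y xs)
 have "w n (pre @ xs @ (u \<oplus> v) # ys) = w n (pre @ xs @ u # ys) \<oplus>\<^bsub>E n\<^esub> w n (pre @ xs @ v # ys)"
  using w_add[of u v "pre @ xs" ys n] Cons.prems by simp
 moreover have "conl n \<phi> (pre @ [y]) (xs @ a # ys) <: E n" "w n (pre @ xs @ a # ys) <: E n" if "a <: M" for a
  using conl_mem[of "pre @ [y]" "xs @ a # ys" n \<phi>] w_mem[of "pre @ xs @ a # ys" n] Cons.prems that by simp_all
 ultimately show ?case using Cons.IH[of "pre @ [y]"] Cons.prems by (cases "\<phi> y = 0") (simp_all add: E.ac)
qed

lemma conl_pre_alt: "p1 @ u # p2 @ u # p3 @ vs\<in>tuples (Suc n) M ==> conl n \<phi> (p1 @ u # p2 @ u # p3) vs = \<zero>\<^bsub>E n\<^esub>"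
proof (induction vs arbitrary: p3)
 case (Cons y vs)
 have "w n (p1 @ u # p2 @ u # p3 @ vs) = \<zero>\<^bsub>E n\<^esub>" by (rule w_alt) (use Cons.prems in auto)
 then show ?case using Cons.IH[of "p3 @ [y]"] Cons.prems by simp
qed simp

text \<open>With \<open>u\<close> already in the prefix, every summand that keeps the second
  \<open>u\<close> has a repeated factor; only the summand omitting it remains.\<close>

lemma conl_pre_alt1: "p1 @ u # p2 @ ys @ u # zs\<in>tuples (Suc n) M ==>
  conl n \<phi> (p1 @ u # p2) (ys @ u # zs) = \<phi> u \<odot>\<^bsub>E n\<^esub> w n (p1 @ u # p2 @ ys @ zs)"
proof (induction ys arbitrary: p2)
 case Nil
 then show ?case using conl_pre_alt[of p1 u p2 "[]" zs n \<phi>] w_mem[of "p1 @ u # p2 @ zs" n] by simp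
next
 case (Cons y ys)
 have "w n (p1 @ u # (p2 @ ys) @ u # zs) = \<zero>\<^bsub>E n\<^esub>" by (rule w_alt) (use Cons.prems in auto)
 moreover have "w n (p1 @ u # p2 @ y # ys @ zs) <: E n" by (rule w_mem) (use Cons.prems in auto)
 ultimately show ?case using Cons.IH[of "p2 @ [y]"] Cons.prems by simp
qed

text \<open>Two summands survive, each omitting one of the equal factors. Moving \<open>u\<close>
  past \<open>ys\<close> shows that they are equal, so they cancel.\<close>

lemma conl_alt: "pre @ xs @ u # ys @ u # zs\<in>tuples (Suc n) M ==> conl n \<phi> pre (xs @ u # ys @ u # zs) = \<zero>\<^bsub>E n\<^esub>"
proof (induction xs arbitrary: pre)
 case Nil
 have "conl n \<phi> (pre @ [u]) (ys @ u # zs) = \<phi> u \<odot>\<^bsub>E n\<^esub> w n (pre @ u # ys @ zs)"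
  using conl_pre_alt1[of pre u "[]" ys zs n \<phi>] Nil by simp
 moreover have "w n (pre @ u # ys @ zs) = w n (pre @ ys @ u # zs)" by (rule w_move) (use Nil in auto)
 moreover have "w n (pre @ ys @ u # zs) <: E n" using Nil by auto
 ultimately show ?case by simp
next
 case (Cons y xs)
 have "w n ((pre @ xs) @ u # ys @ u # zs) = \<zero>\<^bsub>E n\<^esub>" by (rule w_alt) (use Cons.prems in auto)
 then show ?case using Cons.IH[of "pre @ [y]"] Cons.prems by simp
qed

lemma con_ex: "addfun M \<phi> ==> EX f:lin_maps (E (Suc n)) (E n). ALL vs:tuples (Suc n) M. f (w (Suc n) vs) = conl n \<phi> [] vs"
 by (rule ext_univ[OF f2v_E]) (use conl_add[of \<phi> "[]"] conl_alt[of "[]"] conl_mem[of "[]"] in auto)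

definition con :: "nat => ('a => bit) => ('a list => bit) set => ('a list => bit) set" where
 "con n \<phi> = (SOME f. f\<in>lin_maps (E (Suc n)) (E n) & (ALL vs:tuples (Suc n) M. f (w (Suc n) vs) = conl n \<phi> [] vs))"

lemma con_lin: "addfun M \<phi> ==> con n \<phi>\<in>lin_maps (E (Suc n)) (E n)"
 and con_w: "addfun M \<phi> ==> vs\<in>tuples (Suc n) M ==> con n \<phi> (w (Suc n) vs) = conl n \<phi> [] vs"
 using someI_ex[OF con_ex[of \<phi> n, unfolded Bex_def], folded con_def] by blast+

lemma conl_finsum: "pre @ vs\<in>tuples (Suc n) M ==>
  conl n \<phi> pre vs = finsum (E n) (%i. \<phi> (vs ! i) \<odot>\<^bsub>E n\<^esub> w n (pre @ take i vs @ drop (Suc i) vs)) {..<length vs}"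
proof (induction vs arbitrary: pre)
 case (Cons v vs)
 have mem: "w n (pre @ take i (v # vs) @ drop (Suc i) (v # vs)) <: E n" if "i < length (v # vs)" for i
  using that Cons.prems set_take_subset[of i "v # vs"] set_drop_subset[of "Suc i" "v # vs"]
  by (intro w_mem) (auto simp del: take.simps drop.simps take_Cons drop_Cons)
 show ?case
 proof (cases vs)
  case Nil
  then show ?thesis using Cons.prems mem[of 0] by (simp add: E.finsum_insert lessThan_Suc)
 next
  case (Cons v' vs')
  then obtain k where k: "length vs = Suc k" by auto
  have "finsum (E n) (%i. \<phi> ((v # vs) ! i) \<odot>\<^bsub>E n\<^esub> w n (pre @ take i (v # vs) @ drop (Suc i) (v # vs))) {..Suc k} =
   finsum (E n) (%i. \<phi> ((v # vs) ! Suc i) \<odot>\<^bsub>E n\<^esub> w n (pre @ take (Suc i) (v # vs) @ drop (Suc (Suc i)) (v # vs))) {..k} \<oplus>\<^bsub>E n\<^esub>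
   (\<phi> ((v # vs) ! 0) \<odot>\<^bsub>E n\<^esub> w n (pre @ take 0 (v # vs) @ drop (Suc 0) (v # vs)))"
   by (rule E.finsum_Suc2) (use mem k in auto)
  moreover have "conl n \<phi> (pre @ [v]) vs = finsum (E n) (%i. \<phi> (vs ! i) \<odot>\<^bsub>E n\<^esub> w n (pre @ v # take i vs @ drop (Suc i) vs)) {..k}"
   using Cons.IH[of "pre @ [v]"] Cons.prems k by (simp add: lessThan_Suc_atMost)
  moreover have "conl n \<phi> (pre @ [v]) vs <: E n" "w n (pre @ vs) <: E n"
   using conl_mem[of "pre @ [v]" vs n \<phi>] w_mem[of "pre @ vs" n] Cons.prems by simp_all
  ultimately show ?thesis using k by (simp add: lessThan_Suc_atMost E.a_comm)
 qed
qed simp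

lemma conl_snoc:
 assumes a: "a <: M"
 shows "pre @ vs\<in>tuples (Suc n) M ==>
  conl (Suc n) \<phi> pre (vs @ [a]) = wr n a (conl n \<phi> pre vs) \<oplus>\<^bsub>E (Suc n)\<^esub> (\<phi> a \<odot>\<^bsub>E (Suc n)\<^esub> w (Suc n) (pre @ vs))"
proof (induction vs arbitrary: pre)
 case Nil
 then show ?case using lin_zero[OF f2v_E f2v_E wr_lin[OF a]] w_mem[of pre "Suc n"] by (simp add: tuples_def)
next
 case (Cons v vs)
 have m: "pre @ vs\<in>tuples n M" "(pre @ [v]) @ vs\<in>tuples (Suc n) M" using Cons.prems by auto
 have c: "conl n \<phi> (pre @ [v]) vs <: E n" "w n (pre @ vs) <: E n" using m by simp_all
 have c': "wr n a (conl n \<phi> (pre @ [v]) vs) <: E (Suc n)" "wr n a (w n (pre @ vs)) <: E (Suc n)"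
  "w (Suc n) (pre @ v # vs) <: E (Suc n)"
  using lin_closed[OF wr_lin[OF a]] c Cons.prems by auto
 show ?case
  using Cons.IH[OF m(2)] wr_w[OF a m(1)] c c'
  by (simp add: lin_add[OF wr_lin[OF a]] lin_smult[OF wr_lin[OF a]] E.ac)
qed

text \<open>Contraction is a derivation, without signs in characteristic two. When
  \<open>\<phi> a = 1\<close> it is a contracting homotopy for multiplication by \<open>a\<close>.
  In degree zero the first summand disappears, which is the case of \<open>con_wr0\<close>.\<close>

lemma con_wr:
 assumes "addfun M \<phi>" "a <: M" "y <: E (Suc n)"
 shows "con (Suc n) \<phi> (wr (Suc n) a y) = wr n a (con n \<phi> y) \<oplus>\<^bsub>E (Suc n)\<^esub> (\<phi> a \<odot>\<^bsub>E (Suc n)\<^esub> y)"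
proof (rule ext_lin_eq[OF f2v_E _ _ _ assms(3)])
 show "(%y. con (Suc n) \<phi> (wr (Suc n) a y))\<in>lin_maps (E (Suc n)) (E (Suc n))"
  by (rule lin_comp[OF wr_lin con_lin]) fact+
 note l = lin_comp[OF con_lin[OF assms(1)] wr_lin[OF assms(2)], of n]
 show "(%y. wr n a (con n \<phi> y) \<oplus>\<^bsub>E (Suc n)\<^esub> \<phi> a \<odot>\<^bsub>E (Suc n)\<^esub> y)\<in>lin_maps (E (Suc n)) (E (Suc n))"
  by (rule linI[OF f2v_E f2v_E]) (use lin_closed[OF l] in "auto simp: lin_add[OF l] E.smult_bit E.ac")
 fix vs assume vs: "vs\<in>tuples (Suc n) M"
 then have "vs @ [a]\<in>tuples (Suc (Suc n)) M" using assms(2) by (auto simp: tuples_def)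
 then show "con (Suc n) \<phi> (wr (Suc n) a (w (Suc n) vs)) = wr n a (con n \<phi> (w (Suc n) vs)) \<oplus>\<^bsub>E (Suc n)\<^esub> \<phi> a \<odot>\<^bsub>E (Suc n)\<^esub> w (Suc n) vs"
  using vs assms by (simp add: wr_w con_w conl_snoc)
qed

lemma con_wr0:
 assumes "addfun M \<phi>" "a <: M" "y <: E 0"
 shows "con 0 \<phi> (wr 0 a y) = \<phi> a \<odot>\<^bsub>E 0\<^esub> y"
proof (rule ext_lin_eq[OF f2v_E _ _ _ assms(3)])
 show "(%y. con 0 \<phi> (wr 0 a y))\<in>lin_maps (E 0) (E 0)"
  by (rule lin_comp[OF wr_lin con_lin]) fact+
 show "(%y. \<phi> a \<odot>\<^bsub>E 0\<^esub> y)\<in>lin_maps (E 0) (E 0)"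
  by (rule linI[OF f2v_E f2v_E]) (auto simp: E.smult_bit)
 fix vs assume "vs\<in>tuples 0 M"
 then have "vs = []" by (simp add: tuples_def)
 then show "con 0 \<phi> (wr 0 a (w 0 vs)) = \<phi> a \<odot>\<^bsub>E 0\<^esub> w 0 vs"
  using assms con_w[of \<phi> "[a]" 0] wr_w[of a "[]" 0] w_mem[of "[]" 0] by simp
qed

lemma wr_conl_pre:
 assumes c: "c <: M"
 shows "p1 @ c # p2 @ vs\<in>tuples (Suc n) M ==> wr n c (conl n \<phi> (p1 @ c # p2) vs) = \<zero>\<^bsub>E (Suc n)\<^esub>"
proof (induction vs arbitrary: p2)
 case Nil
 then show ?case using lin_zero[OF f2v_E f2v_E wr_lin[OF c]] by simp
next
 case (Cons v vs)
 have m: "p1 @ c # p2 @ vs\<in>tuples n M" "(p1 @ c # p2 @ [v]) @ vs\<in>tuples (Suc n) M" using Cons.prems by auto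
 have "wr n c (w n (p1 @ c # p2 @ vs)) = w (Suc n) (p1 @ c # (p2 @ vs) @ c # [])"
  using wr_w[OF c m(1)] by simp
 also have "\<dots> = \<zero>\<^bsub>E (Suc n)\<^esub>" by (rule w_alt) (use m c in auto)
 finally show ?case
  using Cons.IH[of "p2 @ [v]"] m conl_mem[OF m(2)] w_mem[OF m(1)] Cons.prems
  by (simp add: lin_add[OF wr_lin[OF c]] lin_smult[OF wr_lin[OF c]])
qed

text \<open>Expand the wedge of the vectors \<open>v + \<phi>(v) c\<close>: terms containing
  \<open>c\<close> twice vanish, and those containing it once add up to the contraction multiplied
  by \<open>c\<close>.\<close>

lemma w_map:
 assumes c: "c <: M"
 shows "pre @ vs\<in>tuples (Suc n) M ==>
  w (Suc n) (pre @ map (%v. v \<oplus> (\<phi> v \<odot> c)) vs) = w (Suc n) (pre @ vs) \<oplus>\<^bsub>E (Suc n)\<^esub> wr n c (conl n \<phi> pre vs)"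
proof (induction vs arbitrary: pre)
 case Nil
 then show ?case using lin_zero[OF f2v_E f2v_E wr_lin[OF c]] w_mem[of pre "Suc n"] by (simp add: tuples_def)
next
 case (Cons v vs)
 let ?T = "%v. v \<oplus> (\<phi> v \<odot> c)"
 have mc: "pre @ a # vs\<in>tuples (Suc n) M" "pre @ a # [] @ vs\<in>tuples (Suc n) M" "(pre @ [a]) @ vs\<in>tuples (Suc n) M" if "a <: M" for a
  using Cons.prems that by auto
 have v: "v <: M" "?T v <: M" "\<phi> v \<odot> c <: M" and pv: "pre @ vs\<in>tuples n M" using Cons.prems c by auto
 have 1: "w (Suc n) (pre @ ?T v # vs) = w (Suc n) (pre @ v # vs) \<oplus>\<^bsub>E (Suc n)\<^esub> (\<phi> v \<odot>\<^bsub>E (Suc n)\<^esub> w (Suc n) (pre @ c # vs))"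
  using w_add[of v "\<phi> v \<odot> c" pre vs "Suc n"] w_smult[OF c mc(1)[OF c], of "\<phi> v"] v mc by simp
 have 2: "wr n c (conl n \<phi> (pre @ [?T v]) vs) = wr n c (conl n \<phi> (pre @ [v]) vs)"
 proof (cases "\<phi> v = 0")
  case False
  then have "conl n \<phi> (pre @ [?T v]) vs = conl n \<phi> (pre @ [v]) vs \<oplus>\<^bsub>E n\<^esub> conl n \<phi> (pre @ [c]) vs"
   using conl_pre_add[of pre v "[]" vs n c \<phi>] v c mc by simp
  moreover have "wr n c (conl n \<phi> (pre @ [c]) vs) = \<zero>\<^bsub>E (Suc n)\<^esub>"
   using wr_conl_pre[OF c, of pre "[]" vs n \<phi>] mc(2)[OF c] by simp
  moreover have "conl n \<phi> (pre @ [v]) vs <: E n" "conl n \<phi> (pre @ [c]) vs <: E n"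
   using conl_mem mc(3) v c by blast+
  ultimately show ?thesis using lin_closed[OF wr_lin[OF c]] by (simp add: lin_add[OF wr_lin[OF c]])
 qed (use v c in simp)
 have 3: "wr n c (w n (pre @ vs)) = w (Suc n) (pre @ c # vs)"
  using wr_w[OF c pv] w_move[of pre c vs "[]" "Suc n"] mc(1)[OF c] by simp
 have mem: "conl n \<phi> (pre @ [v]) vs <: E n" "w n (pre @ vs) <: E n"
  "w (Suc n) (pre @ v # vs) <: E (Suc n)" "w (Suc n) (pre @ c # vs) <: E (Suc n)"
  using conl_mem[OF mc(3)[OF v(1)]] w_mem[OF pv] w_mem[OF mc(1)[OF v(1)]] w_mem[OF mc(1)[OF c]] by simp_all
 have "w (Suc n) (pre @ map ?T (v # vs)) = w (Suc n) (pre @ ?T v # vs) \<oplus>\<^bsub>E (Suc n)\<^esub> wr n c (conl n \<phi> (pre @ [?T v]) vs)"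
  using Cons.IH[OF mc(3)[OF v(2)]] by simp
 also have "\<dots> = w (Suc n) (pre @ v # vs) \<oplus>\<^bsub>E (Suc n)\<^esub> wr n c (conl n \<phi> pre (v # vs))"
  unfolding 1 2 using mem lin_closed[OF wr_lin[OF c] mem(1)]
  by (simp add: lin_add[OF wr_lin[OF c]] lin_smult[OF wr_lin[OF c]] 3 E.ac)
 finally show ?case .
qed

section \<open>Values of exterior elements on tuples of linear forms\<close>

lemma cou_ex: "EX f:lin_maps (E 0) (free_mod {()}). ALL vs:tuples 0 M. f (w 0 vs) = gen ()"
 by (rule ext_univ[OF f2v_free]) auto

text \<open>The identification of the zeroth exterior power with \<open>F2\<close>, obtained from
  \<open>ext_univ\<close> with the free space on one point as target.\<close>

definition cou :: "('a list => bit) set => bit" where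
 "cou y = (SOME f. f\<in>lin_maps (E 0) (free_mod {()}) & (ALL vs:tuples 0 M. f (w 0 vs) = gen ())) y ()"

lemma cou: "cou (w 0 []) = 1" "y <: E 0 ==> z <: E 0 ==> cou (y \<oplus>\<^bsub>E 0\<^esub> z) = cou y + cou z"
proof -
 define f where "f = (SOME f. f\<in>lin_maps (E 0) (free_mod {()}) & (ALL vs:tuples 0 M. f (w 0 vs) = gen ()))"
 have f: "f\<in>lin_maps (E 0) (free_mod {()})" "f (w 0 []) = gen ()"
  using someI_ex[OF cou_ex[unfolded Bex_def], folded f_def] by auto
 have c: "cou y = f y ()" for y by (simp add: cou_def f_def)
 show "cou (w 0 []) = 1" using f by (simp add: c gen_def)
 show "y <: E 0 ==> z <: E 0 ==> cou (y \<oplus>\<^bsub>E 0\<^esub> z) = cou y + cou z"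
  using lin_add[OF f(1)] by (simp add: c free_simps)
qed

text \<open>Iterated contraction down to degree zero. On a wedge of vectors this is the determinant
  of the matrix of values of the forms.\<close>

fun hat :: "('a => bit) list => ('a list => bit) set => bit" where
 "hat [] y = cou y"
| "hat (\<phi> # \<phi>s) y = hat \<phi>s (con (length \<phi>s) \<phi> y)"

lemma hat_add: "ALL \<phi>:set \<phi>s. addfun M \<phi> ==> y <: E (length \<phi>s) ==> z <: E (length \<phi>s) ==>
  hat \<phi>s (y \<oplus>\<^bsub>E (length \<phi>s)\<^esub> z) = hat \<phi>s y + hat \<phi>s z"
proof (induction \<phi>s arbitrary: y z)
 case (Cons \<phi> \<phi>s)
 then have l: "con (length \<phi>s) \<phi>\<in>lin_maps (E (Suc (length \<phi>s))) (E (length \<phi>s))" using con_lin by simp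
 show ?case using Cons lin_closed[OF l] by (simp add: lin_add[OF l])
qed (simp add: cou)

lemma hat_zero: "ALL \<phi>:set \<phi>s. addfun M \<phi> ==> hat \<phi>s \<zero>\<^bsub>E (length \<phi>s)\<^esub> = 0"
 using hat_add[of \<phi>s "\<zero>\<^bsub>E (length \<phi>s)\<^esub>" "\<zero>\<^bsub>E (length \<phi>s)\<^esub>"] by simp

lemma hat_finsum:
 assumes "ALL \<phi>:set \<phi>s. addfun M \<phi>" "finite I" "!!i. i\<in>I ==> g i <: E (length \<phi>s)"
 shows "hat \<phi>s (finsum (E (length \<phi>s)) g I) = (\<Sum>i\<in>I. hat \<phi>s (g i))"
 using assms(2,3)
proof (induction I rule: finite_induct)
 case (insert i I)
 then have "g\<in>I \<rightarrow> carrier (E (length \<phi>s))" by auto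
 then show ?case using insert by (simp add: E.finsum_insert hat_add[OF assms(1)])
qed (simp add: hat_zero[OF assms(1)])

lemma hat_w_Cons:
 assumes "addfun M \<phi>" "ALL \<phi>:set \<phi>s. addfun M \<phi>" "vs\<in>tuples (Suc (length \<phi>s)) M"
 shows "hat (\<phi> # \<phi>s) (w (Suc (length \<phi>s)) vs) =
  (\<Sum>i<length vs. \<phi> (vs ! i) * hat \<phi>s (w (length \<phi>s) (take i vs @ drop (Suc i) vs)))"
proof -
 have mem: "w (length \<phi>s) (take i vs @ drop (Suc i) vs) <: E (length \<phi>s)" if "i < length vs" for i
  using that assms(3) by (intro w_mem) (auto simp: tuples_def dest: in_set_takeD in_set_dropD)
 have "hat (\<phi> # \<phi>s) (w (Suc (length \<phi>s)) vs) = hat \<phi>s (finsum (E (length \<phi>s)) (%i. \<phi> (vs ! i) \<odot>\<^bsub>E (length \<phi>s)\<^esub> w (length \<phi>s) (take i vs @ drop (Suc i) vs)) {..<length vs})"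
  using con_w[OF assms(1,3)] conl_finsum[of "[]" vs "length \<phi>s" \<phi>] assms(3) by simp
 also have "\<dots> = (\<Sum>i<length vs. hat \<phi>s (\<phi> (vs ! i) \<odot>\<^bsub>E (length \<phi>s)\<^esub> w (length \<phi>s) (take i vs @ drop (Suc i) vs)))"
  by (rule hat_finsum[OF assms(2)]) (use mem in auto)
 also have "\<dots> = (\<Sum>i<length vs. \<phi> (vs ! i) * hat \<phi>s (w (length \<phi>s) (take i vs @ drop (Suc i) vs)))"
  by (rule sum.cong) (use mem hat_zero[OF assms(2)] in "auto simp: E.smult_bit")
 finally show ?thesis .
qed

definition Sp :: "nat => 'a set => ('a list => bit) set set" where
 "Sp n B = vspan (E n) {w n vs | vs. length vs = n & set vs \<subseteq> B}"

lemma Sp_gens: "B \<subseteq> carrier M ==> {w n vs | vs. length vs = n & set vs \<subseteq> B} \<subseteq> carrier (E n)"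
 by (auto simp: tuples_def)

lemma Sp_sub: "B \<subseteq> carrier M ==> submodule (Sp n B) F2 (E n)"
 unfolding Sp_def by (rule E.vspan_sub[OF Sp_gens])

lemma Sp_w: "length vs = n ==> set vs \<subseteq> B ==> w n vs\<in>Sp n B"
 unfolding Sp_def by (rule subsetD[OF E.vspan_incl]) auto

lemma Sp_all:
 assumes B: "B \<subseteq> carrier M" "vspan M B = carrier M"
 shows "Sp n B = carrier (E n)"
proof -
 note S = Sp_sub[OF B(1), unfolded E.sub_iff]
 have "length pre + length vs = n ==> set pre \<subseteq> B ==> set vs \<subseteq> carrier M ==> w n (pre @ vs)\<in>Sp n B" for pre vs
 proof (induction vs arbitrary: pre)
  case Nil
  then show ?case using Sp_w by simp
 next
  case (Cons v vs)
  have "v\<in>vspan M B" using Cons B by auto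
  then show ?case using B(1)
  proof (induction rule: vspan_induct)
   case zero
   then show ?case using w_zero[of pre vs n] Cons.prems S B by auto
  next
   case (add b v)
   have m: "b <: M" "v <: M" using add B by auto
   have "w n (pre @ (b \<oplus> v) # vs) = w n (pre @ b # vs) \<oplus>\<^bsub>E n\<^esub> w n (pre @ v # vs)"
    by (rule w_add) (use m Cons.prems B in auto)
   moreover have "w n ((pre @ [b]) @ vs)\<in>Sp n B" by (rule Cons.IH) (use Cons.prems add in auto)
   ultimately show ?case using add.IH S by auto
  qed
 qed
 from this[of "[]"] have "w n ` tuples n M \<subseteq> Sp n B" by (auto simp: tuples_def)
 then have "carrier (E n) \<subseteq> Sp n B" using E.vspan_least[OF Sp_sub[OF B(1)]] ext_span by metis
 then show ?thesis using S[of n] by blast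
qed

text \<open>Vectors with linear forms, unitriangular in one direction: each form is 1 on its own
  vector and 0 on the later ones. This is adapted to splitting off the vectors one at a
  time.\<close>

fun tri :: "('a \<times> ('a => bit)) list => bool" where
 "tri [] \<longleftrightarrow> True"
| "tri ((b, \<phi>) # ps) \<longleftrightarrow> b <: M & addfun M \<phi> & \<phi> b = 1 & (ALL (b', \<psi>):set ps. \<phi> b' = 0) & tri ps"

lemma tri_mem: "tri ps ==> fst ` set ps \<subseteq> carrier M"
 by (induction ps rule: tri.induct) auto

lemma conl_kill: "pre @ vs\<in>tuples (Suc n) M ==> ALL v:set vs. \<phi> v = 0 ==> conl n \<phi> pre vs = \<zero>\<^bsub>E n\<^esub>"
proof (induction vs arbitrary: pre)
 case (Cons v vs)
 then show ?case using w_mem[of "pre @ vs" n] by simp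
qed simp

lemma con_kill:
 assumes "addfun M \<phi>" "B \<subseteq> carrier M" "ALL b:B. \<phi> b = 0" "y\<in>Sp (Suc n) B"
 shows "con n \<phi> y = \<zero>\<^bsub>E n\<^esub>"
proof -
 have "submodule {\<zero>\<^bsub>E n\<^esub>} F2 (E n)" by (simp add: E.sub_iff)
 moreover have "con n \<phi> ` {w (Suc n) vs | vs. length vs = Suc n & set vs \<subseteq> B} \<subseteq> {\<zero>\<^bsub>E n\<^esub>}"
 proof (rule image_subsetI)
  fix y assume "y\<in>{w (Suc n) vs | vs. length vs = Suc n & set vs \<subseteq> B}"
  then obtain vs where "y = w (Suc n) vs" "length vs = Suc n" "set vs \<subseteq> B" by blast
  then show "con n \<phi> y\<in>{\<zero>\<^bsub>E n\<^esub>}"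
   using con_w[OF assms(1), of vs n] conl_kill[of "[]" vs n \<phi>] assms(2,3) by (auto simp: tuples_def)
 qed
 ultimately show ?thesis
  using lin_vspan[OF f2v_E f2v_E con_lin[OF assms(1)] Sp_gens[OF assms(2)], where T = "{\<zero>\<^bsub>E n\<^esub>}"] assms(4)[unfolded Sp_def]
  by simp
qed

text \<open>Write \<open>y\<close> as \<open>y1\<close> plus the product of \<open>u\<close> with
  the leading vector \<open>b\<close>, where \<open>y1\<close> and \<open>u\<close> involve only the
  later vectors. Contraction with the leading form kills \<open>y1\<close> and returns
  \<open>u\<close>, so \<open>u\<close> vanishes by induction, and then so does
  \<open>y1\<close>.\<close>

lemma hat_inj_aux:
 "tri ps ==> y\<in>Sp n (fst ` set ps) ==> (!!\<phi>s. length \<phi>s = n ==> set \<phi>s \<subseteq> snd ` set ps ==> hat \<phi>s y = 0) ==> y = \<zero>\<^bsub>E n\<^esub>"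
proof (induction ps arbitrary: n y)
 case Nil
 show ?case
 proof (cases n)
  case 0
  have e: "{w 0 vs |vs. length vs = 0 & set vs \<subseteq> fst ` set ([] :: ('a \<times> ('a => bit)) list)} = {w 0 []}" by auto
  have w0: "w 0 [] <: E 0" by simp
  have "y\<in>vspan (E 0) {w 0 []}" using Nil(2) unfolding Sp_def 0 e .
  moreover have "{w 0 []} \<subseteq> carrier (E 0)" using w0 by simp
  ultimately have "y = \<zero>\<^bsub>E 0\<^esub> | y = w 0 []"
   by (induction rule: E.vspan_induct[where n = 0]) (use w0 in auto)
  then show ?thesis using Nil(3)[of "[]"] 0 cou by auto
 next
  case (Suc m)
  then have e: "{w n vs |vs. length vs = n & set vs \<subseteq> fst ` set ([] :: ('a \<times> ('a => bit)) list)} = {}" by auto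
  have "vspan (E n) {} \<subseteq> {\<zero>\<^bsub>E n\<^esub>}" by (rule E.vspan_least) (auto simp: E.sub_iff)
  then show ?thesis using Nil(2) unfolding Sp_def e by auto
 qed
next
 case (Cons p ps)
 obtain b \<phi> where p: "p = (b, \<phi>)" by force
 let ?B = "fst ` set ps"
 have b: "b <: M" "addfun M \<phi>" "\<phi> b = 1" "ALL b':?B. \<phi> b' = 0" "tri ps" "?B \<subseteq> carrier M"
  using Cons.prems(1) p tri_mem[of ps] by auto
 have bB: "b \<notin> ?B" using b(3,4) by auto
 show ?case
 proof (cases n)
  case 0
  have "Sp n (fst ` set (p # ps)) = Sp n ?B" unfolding Sp_def 0 by simp
  then show ?thesis using Cons.IH[OF b(5), of y n] Cons.prems 0 by auto
 next
  case (Suc m)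
  note S = Sp_sub[OF b(6), of n, unfolded E.sub_iff] Sp_sub[OF b(6), of m, unfolded E.sub_iff]
  note wl = wr_lin[OF b(1), of m]
  have "y\<in>vspan (E n) {w n vs | vs. length vs = n & set vs \<subseteq> fst ` set (p # ps)}" using Cons.prems(2) by (simp add: Sp_def)
  then have "EX y1:Sp n ?B. EX u:Sp m ?B. y = y1 \<oplus>\<^bsub>E n\<^esub> wr m b u"
   using Sp_gens[OF tri_mem[OF Cons.prems(1)]]
  proof (induction rule: E.vspan_induct)
   case zero
   have "\<zero>\<^bsub>E n\<^esub> = \<zero>\<^bsub>E n\<^esub> \<oplus>\<^bsub>E n\<^esub> wr m b \<zero>\<^bsub>E m\<^esub>" using lin_zero[OF f2v_E f2v_E wl] by (simp add: Suc)
   then show ?case using S by blast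
  next
   case (add g z)
   then obtain vs y1 u where vs: "g = w n vs" "length vs = n" "set vs \<subseteq> insert b ?B" and
    y1: "y1\<in>Sp n ?B" "u\<in>Sp m ?B" "z = y1 \<oplus>\<^bsub>E n\<^esub> wr m b u" using p by auto
   have c: "y1 <: E n" "u <: E m" "wr m b u <: E n"
    using y1 S lin_closed[OF wl, of u] by (auto simp: Suc)
   show ?case
   proof (cases "b\<in>set vs")
    case False
    then have g: "g\<in>Sp n ?B" using vs Sp_w[of vs n ?B] by auto
    then have "g \<oplus>\<^bsub>E n\<^esub> z = (g \<oplus>\<^bsub>E n\<^esub> y1) \<oplus>\<^bsub>E n\<^esub> wr m b u" using S c y1 by (auto simp: E.a_assoc)
    then show ?thesis using g y1 S by blast
   next
    case True
    then obtain xs zs where xz: "vs = xs @ b # zs" "b \<notin> set xs" by (meson split_list_first)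
    show ?thesis
    proof (cases "b\<in>set zs")
     case True
     then obtain ys zs' where "zs = ys @ b # zs'" by (meson split_list)
     moreover have "set vs \<subseteq> carrier M" using vs(3) b(1,6) by blast
     then have "xs @ b # ys @ b # zs'\<in>tuples n M" using calculation vs(2) xz(1) by (simp add: tuples_def)
     ultimately have "g = \<zero>\<^bsub>E n\<^esub>" using w_alt[of xs b ys zs' n] vs(1) xz(1) by simp
     then show ?thesis using y1 c by auto
    next
     case False
     then have xs: "set (xs @ zs) \<subseteq> ?B" "length (xs @ zs) = m" using vs xz Suc by auto
     then have xt: "xs @ zs\<in>tuples m M" using b(6) by (auto simp: tuples_def)
     have "xs @ b # zs @ []\<in>tuples n M" using xs b(1,6) Suc by auto
     then have "w n (xs @ b # zs) = w n (xs @ zs @ [b])" using w_move[of xs b zs "[]" n] by simp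
     then have g: "g = wr m b (w m (xs @ zs))" using wr_w[OF b(1) xt] vs xz Suc by simp
     have "g \<oplus>\<^bsub>E n\<^esub> z = y1 \<oplus>\<^bsub>E n\<^esub> wr m b (w m (xs @ zs) \<oplus>\<^bsub>E m\<^esub> u)"
      using g y1 c w_mem[OF xt] lin_closed[OF wl w_mem[OF xt]] by (simp add: lin_add[OF wl] Suc E.ac)
     then show ?thesis using Sp_w[OF xs(2,1)] y1 S by blast
    qed
   qed
  qed
  then obtain y1 u where y: "y1\<in>Sp n ?B" "u\<in>Sp m ?B" "y = y1 \<oplus>\<^bsub>E n\<^esub> wr m b u" by auto
  have c: "y1 <: E (Suc m)" "u <: E m" "wr m b u <: E (Suc m)"
   using y S lin_closed[OF wl, of u] by (auto simp: Suc)
  have "con m \<phi> (wr m b u) = u"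
  proof (cases m)
   case 0
   then show ?thesis using con_wr0[OF b(2,1)] c b(3) by simp
  next
   case (Suc k)
   have "con k \<phi> u = \<zero>\<^bsub>E k\<^esub>" using con_kill[OF b(2,6,4)] y(2) Suc by simp
   then show ?thesis using con_wr[OF b(2,1), of u k] c b(3) Suc lin_zero[OF f2v_E f2v_E wr_lin[OF b(1)]] by simp
  qed
  moreover have "con m \<phi> y1 = \<zero>\<^bsub>E m\<^esub>" using con_kill[OF b(2,6,4)] y(1) Suc by simp
  ultimately have cy: "con m \<phi> y = u" using y(3) c lin_add[OF con_lin[OF b(2), of m] c(1,3)] by (simp add: Suc)
  have "u = \<zero>\<^bsub>E m\<^esub>"
  proof (rule Cons.IH[OF b(5) y(2)])
   fix \<phi>s assume "length \<phi>s = m" "set \<phi>s \<subseteq> snd ` set ps"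
   then show "hat \<phi>s u = 0" using Cons.prems(3)[of "\<phi> # \<phi>s"] cy Suc p by auto
  qed
  then have "y = y1" using y(3) c lin_zero[OF f2v_E f2v_E wl] by (simp add: Suc)
  moreover have "y1 = \<zero>\<^bsub>E n\<^esub>" by (rule Cons.IH[OF b(5) y(1)]) (use Cons.prems(3) \<open>y = y1\<close> in auto)
  ultimately show ?thesis by simp
 qed
qed

end

lemma ext_map:
 assumes "f2v M" "f2v N" and T: "T\<in>lin_maps M N"
 shows "pres_map (tuples n N) (ext_rel n N) (map T)\<in>lin_maps (ext_mod n M) (ext_mod n N)"
  "vs\<in>tuples n M ==> pres_map (tuples n N) (ext_rel n N) (map T) (wedge n M vs) = wedge n N (map T vs)"
proof -
 interpret M: ext M unfolding ext_def by fact
 interpret N: ext N unfolding ext_def by fact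
 interpret PM: presentation "tuples n M" "ext_rel n M" by (rule M.ext_presentation)
 interpret PN: presentation "tuples n N" "ext_rel n N" by (rule N.ext_presentation)
 have mt: "map T vs\<in>tuples n N" if "vs\<in>tuples n M" for vs using that lin_closed[OF T] by (auto simp: tuples_def)
 have L: "free_map (Some \<circ> map T)\<in>lin_maps (free_mod (tuples n M)) (free_mod (tuples n N))"
  by (rule free_map_lin) (use mt in auto)
 have fg: "free_map (Some \<circ> map T) (gen vs) = gen (map T vs)" for vs by (simp add: free_map_gen)
 note V = PN.rel_sub[unfolded PN.free.sub_iff]
 have I: "r\<in>ext_rel n N ==> r\<in>vspan (free_mod (tuples n N)) (ext_rel n N)" for r
  using PN.free.vspan_incl by auto
 have st: "set (map T xs) \<subseteq> carrier N" if "set xs \<subseteq> carrier M" for xs using that lin_closed[OF T] by auto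
 have "free_map (Some \<circ> map T) r\<in>vspan (free_mod (tuples n N)) (ext_rel n N)" if "r\<in>ext_rel n M" for r
  using assms(1) that
 proof (cases rule: ext_rel_cases)
  case (add xs u v ys)
  then have "free_map (Some \<circ> map T) r = gen (map T xs @ (T u \<oplus>\<^bsub>N\<^esub> T v) # map T ys) - gen (map T xs @ T u # map T ys) - gen (map T xs @ T v # map T ys)"
   by (simp add: lin_add[OF L] PM.free.a_closed fg lin_add[OF T] minus_free[where S = "tuples n N"])
  moreover have "map T xs @ (T u \<oplus>\<^bsub>N\<^esub> T v) # map T ys\<in>tuples n N"
   using add st[of xs] st[of ys] lin_closed[OF T] by auto
  ultimately show ?thesis using I[OF ext_relI(1)] add lin_closed[OF T] by metis
 next
  case z
  then show ?thesis using lin_zero[OF f2v_free f2v_free L] V by (simp add: free_simps)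
 next
  case (zero xs ys)
  have "map T xs @ \<zero>\<^bsub>N\<^esub> # map T ys\<in>tuples n N" using zero st[of xs] st[of ys] by auto
  from I[OF ext_relI(2)[OF this, of 0]] show ?thesis
   using zero lin_zero[OF assms(1,2) T] fg by (simp add: fun_diff_def)
 next
  case (alt xs u ys zs)
  then have "map T xs @ T u # map T ys @ T u # map T zs\<in>tuples n N" using mt[OF alt(1)] by simp
  from I[OF ext_relI(3)[OF this]] show ?thesis using alt fg by simp
 qed
 note R = PM.pres_map[OF PN.presentation_axioms _ this]
 show "pres_map (tuples n N) (ext_rel n N) (map T)\<in>lin_maps (ext_mod n M) (ext_mod n N)"
  unfolding ext_mod_def by (rule R) (use mt in auto)
 show "pres_map (tuples n N) (ext_rel n N) (map T) (wedge n M vs) = wedge n N (map T vs)" if "vs\<in>tuples n M"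
  unfolding wedge_def by (subst R) (use that mt in auto)
qed

section \<open>Subfunctors and quotients\<close>

lemma subfun_simps [simp]: "fob (subfun F S) X = (fob F X)\<lparr>carrier := S X\<rparr>" "fmor (subfun F S) = fmor F"
 by (simp_all add: subfun_def)

lemma lin_sub: "f\<in>lin_maps M N ==> A \<subseteq> carrier M ==> f ` A \<subseteq> B ==> f\<in>lin_maps (M\<lparr>carrier := A\<rparr>) (N\<lparr>carrier := B\<rparr>)"
 unfolding lin_maps_def by (auto simp: subset_iff)

locale sfun =
 fixes C :: "('o, 'm) cat" and F :: "('o, 'm, 'u) vfun" and S
 assumes F: "is_functor C F" and S: "subfunctor C F S"
begin

lemma f2vF: "X\<in>Obj C ==> f2v (fob F X)"
 using is_functorD(1)[OF F] .

lemma Ssub: "X\<in>Obj C ==> submodule (S X) F2 (fob F X)"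
 using S unfolding subfunctor_def by blast

lemma Sc: "X\<in>Obj C ==> S X \<subseteq> carrier (fob F X)"
 using f2v.sub_iff[OF f2vF, of X "S X"] Ssub[of X] by simp

lemma Smor: "X\<in>Obj C ==> Y\<in>Obj C ==> m\<in>Hom C X Y ==> fmor F X Y m ` S X \<subseteq> S Y"
 using S unfolding subfunctor_def by blast

lemma sub_functor: "is_functor C (subfun F S)"
proof (rule is_functorI)
 show "f2v (fob (subfun F S) X)" if "X\<in>Obj C" for X
  using f2v.f2v_sub[OF f2vF[OF that] Ssub[OF that]] by simp
 show "fmor (subfun F S) X Y m\<in>lin_maps (fob (subfun F S) X) (fob (subfun F S) Y)"
  if "X\<in>Obj C" "Y\<in>Obj C" "m\<in>Hom C X Y" for X Y m
  unfolding subfun_simps by (rule lin_sub[OF is_functorD(2)[OF F that] Sc[OF that(1)] Smor[OF that]])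
 show "fmor (subfun F S) X X (Idm C X) z = z" if "X\<in>Obj C" "z <: fob (subfun F S) X" for X z
  using is_functorD(3)[OF F that(1), of z] Sc[OF that(1)] that(2) by auto
 show "fmor (subfun F S) X Z (Comp C X Y Z n m) z = fmor (subfun F S) Y Z n (fmor (subfun F S) X Y m z)"
  if "X\<in>Obj C" "Y\<in>Obj C" "Z\<in>Obj C" "m\<in>Hom C X Y" "n\<in>Hom C Y Z" "z <: fob (subfun F S) X" for X Y Z m n z
  using is_functorD(4)[OF F that(1-5), of z] Sc[OF that(1)] that(6) by auto
qed

lemma subfunctor_sub: "subfunctor C (subfun F S) T \<longleftrightarrow> subfunctor C F T & sub_le C T S"
proof -
 have "submodule (T X) F2 (fob (subfun F S) X) \<longleftrightarrow> submodule (T X) F2 (fob F X) & T X \<subseteq> S X" if X: "X\<in>Obj C" for X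
  using f2v.sub_iff[OF f2vF[OF X]] f2v.sub_iff[OF f2v.f2v_sub[OF f2vF[OF X] Ssub[OF X]]] Sc[OF X] by auto
 then show ?thesis unfolding subfunctor_def sub_le_def by auto
qed

lemma quot_simps: "fob (quotfun F S) X = quot_mod (fob F X) (S X)"
 "fmor (quotfun F S) X Y m = quot_map (fob F Y) (S Y) (fmor F X Y m)"
 by (simp_all add: quotfun_def)

lemma quot_carrier: "X\<in>Obj C ==> carrier (fob (quotfun F S) X) = (%v. S X +>\<^bsub>fob F X\<^esub> v) ` carrier (fob F X)"
 unfolding quot_simps by (rule f2v.carrier_quot[OF f2vF])

lemma quot_f2v: "X\<in>Obj C ==> f2v (fob (quotfun F S) X)"
 unfolding quot_simps by (rule f2v.f2v_quot[OF f2vF Ssub])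

lemma quot_zero: "X\<in>Obj C ==> \<zero>\<^bsub>fob (quotfun F S) X\<^esub> = S X"
 unfolding quot_simps using f2v.quot_simps[OF f2vF] by auto

lemma quot_coset: "X\<in>Obj C ==> Y\<in>Obj C ==> m\<in>Hom C X Y ==> v <: fob F X ==>
 fmor (quotfun F S) X Y m (S X +>\<^bsub>fob F X\<^esub> v) = S Y +>\<^bsub>fob F Y\<^esub> fmor F X Y m v"
 unfolding quot_simps by (rule quot_map_coset) (use f2vF Ssub is_functorD(2)[OF F] Smor in auto)

lemma quot_add: "X\<in>Obj C ==> u <: fob F X ==> v <: fob F X ==>
 (S X +>\<^bsub>fob F X\<^esub> u) \<oplus>\<^bsub>fob (quotfun F S) X\<^esub> (S X +>\<^bsub>fob F X\<^esub> v) = S X +>\<^bsub>fob F X\<^esub> (u \<oplus>\<^bsub>fob F X\<^esub> v)"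
 unfolding quot_simps f2v.quot_simps(1)[OF f2vF] by (rule f2v.coset_add[OF f2vF Ssub])

lemma quot_eq_iff: "X\<in>Obj C ==> u <: fob F X ==> v <: fob F X ==>
 S X +>\<^bsub>fob F X\<^esub> u = S X +>\<^bsub>fob F X\<^esub> v \<longleftrightarrow> u \<oplus>\<^bsub>fob F X\<^esub> v\<in>S X"
 by (rule f2v.coset_eq_iff[OF f2vF Ssub])

lemma quot_eq_zero: "X\<in>Obj C ==> u <: fob F X ==> S X +>\<^bsub>fob F X\<^esub> u = S X \<longleftrightarrow> u\<in>S X"
proof -
 assume X: "X\<in>Obj C" and u: "u <: fob F X"
 interpret f2v "fob F X" by (rule f2vF[OF X])
 show "S X +>\<^bsub>fob F X\<^esub> u = S X \<longleftrightarrow> u\<in>S X"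
  using quot_eq_iff[OF X u zero_closed] coset_zero[OF Ssub[OF X]] u by simp
qed

text \<open>The maps of a quotient are only controlled on morphisms of the category, so identities and
  composites have to be morphisms.\<close>

lemma quot_functor:
 assumes cc: "closed_cat C"
 shows "is_functor C (quotfun F S)"
proof (rule is_functorI)
 show "f2v (fob (quotfun F S) X)" if "X\<in>Obj C" for X by (rule quot_f2v[OF that])
 show "fmor (quotfun F S) X Y m\<in>lin_maps (fob (quotfun F S) X) (fob (quotfun F S) Y)"
  if "X\<in>Obj C" "Y\<in>Obj C" "m\<in>Hom C X Y" for X Y m
  unfolding quot_simps by (rule quot_map_lin) (use f2vF Ssub is_functorD(2)[OF F] Smor that in auto)
 show "fmor (quotfun F S) X X (Idm C X) z = z" if X: "X\<in>Obj C" "z <: fob (quotfun F S) X" for X z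
 proof -
  obtain v where "v <: fob F X" "z = S X +>\<^bsub>fob F X\<^esub> v" using X quot_carrier by auto
  then show ?thesis using quot_coset[OF X(1) X(1) closed_catD(1)[OF cc X(1)]] is_functorD(3)[OF F X(1)] by simp
 qed
 show "fmor (quotfun F S) X Z (Comp C X Y Z n m) z = fmor (quotfun F S) Y Z n (fmor (quotfun F S) X Y m z)"
  if X: "X\<in>Obj C" "Y\<in>Obj C" "Z\<in>Obj C" and m: "m\<in>Hom C X Y" "n\<in>Hom C Y Z" and z: "z <: fob (quotfun F S) X" for X Y Z m n z
 proof -
  obtain v where v: "v <: fob F X" "z = S X +>\<^bsub>fob F X\<^esub> v" using X z quot_carrier by auto
  then show ?thesis using quot_coset[OF X(1,3) closed_catD(2)[OF cc X m]] quot_coset[OF X(1,2) m(1)] quot_coset[OF X(2,3) m(2)]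
    is_functorD(4)[OF F X m] lin_closed[OF is_functorD(2)[OF F X(1,2) m(1)]] by simp
 qed
qed

end

section \<open>Surjective transformations with a given kernel, and simplicity\<close>

locale epi = sfun C F S for C :: "('o, 'm) cat" and F :: "('o, 'm, 'u) vfun" and S +
 fixes G :: "('o, 'm, 'v) vfun" and \<phi> :: "'o => 'u => 'v"
 assumes nt: "nat_trans C F G \<phi>"
  and ker: "X\<in>Obj C ==> z <: fob F X ==> \<phi> X z = \<zero>\<^bsub>fob G X\<^esub> \<longleftrightarrow> z\<in>S X"
  and sur: "X\<in>Obj C ==> carrier (fob G X) \<subseteq> \<phi> X ` carrier (fob F X)"
begin

lemma G: "is_functor C G"
 and lin: "X\<in>Obj C ==> \<phi> X\<in>lin_maps (fob F X) (fob G X)"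
 and nat: "X\<in>Obj C ==> Y\<in>Obj C ==> m\<in>Hom C X Y ==> z <: fob F X ==> \<phi> Y (fmor F X Y m z) = fmor G X Y m (\<phi> X z)"
 using nt unfolding nat_trans_def by auto

lemma f2vG: "X\<in>Obj C ==> f2v (fob G X)"
 by (rule is_functorD(1)[OF G])

lemma closed: "X\<in>Obj C ==> v <: fob F X ==> \<phi> X v <: fob G X"
 by (rule lin_closed[OF lin])

lemma image: "X\<in>Obj C ==> \<phi> X ` carrier (fob F X) = carrier (fob G X)"
 using sur closed by blast

lemma \<phi>_add: "X\<in>Obj C ==> u <: fob F X ==> v <: fob F X ==> \<phi> X (u \<oplus>\<^bsub>fob F X\<^esub> v) = \<phi> X u \<oplus>\<^bsub>fob G X\<^esub> \<phi> X v"
 by (rule lin_add[OF lin])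

lemma \<phi>_zero: "X\<in>Obj C ==> \<phi> X \<zero>\<^bsub>fob F X\<^esub> = \<zero>\<^bsub>fob G X\<^esub>"
 by (rule lin_zero[OF f2vF f2vG lin])

lemma eq_iff:
 assumes X: "X\<in>Obj C" and u: "u <: fob F X" and v: "v <: fob F X"
 shows "\<phi> X u = \<phi> X v \<longleftrightarrow> u \<oplus>\<^bsub>fob F X\<^esub> v\<in>S X"
proof -
 interpret f2v "fob F X" by (rule f2vF[OF X])
 show ?thesis
  using ker[OF X, of "u \<oplus>\<^bsub>fob F X\<^esub> v"] f2v.add_eq_zero_iff[OF f2vG[OF X] closed[OF X u] closed[OF X v]] u v
  by (simp add: \<phi>_add[OF X])
qed

text \<open>Images and preimages match the subfunctors of \<open>G\<close> with the subfunctors of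
  \<open>F\<close> that contain the kernel \<open>S\<close>. Simplicity of a quotient thus becomes
  maximality of the kernel, a statement that mentions no cosets.\<close>

lemma simple_iff: "simple_functor C G \<longleftrightarrow> \<not> sub_eq C S (sub_top F) &
 (\<forall>T. subfunctor C F T --> sub_le C S T --> sub_eq C T S | sub_eq C T (sub_top F))" (is "_ \<longleftrightarrow> _ & ?max")
proof -
 have kerS: "S X = {v\<in>carrier (fob F X). \<phi> X v = \<zero>\<^bsub>fob G X\<^esub>}" if "X\<in>Obj C" for X using ker[OF that] Sc[OF that] by auto
 have "sub_eq C (sub_top G) (sub_zero G) \<longleftrightarrow> sub_eq C S (sub_top F)"
 proof -
  have "carrier (fob G X) = {\<zero>\<^bsub>fob G X\<^esub>} \<longleftrightarrow> S X = carrier (fob F X)" if X: "X\<in>Obj C" for X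
  proof -
   interpret f2v "fob F X" by (rule f2vF[OF X])
   have "\<zero>\<^bsub>fob G X\<^esub>\<in>\<phi> X ` carrier (fob F X)" using imageI[OF zero_closed, of "\<phi> X"] \<phi>_zero[OF X] by simp
   then show ?thesis unfolding image[OF X, symmetric] kerS[OF X] by blast
  qed
  then show ?thesis by (simp add: sub_eq_def sub_top_def sub_zero_def)
 qed
 moreover have "(\<forall>Q. subfunctor C G Q --> sub_eq C Q (sub_zero G) | sub_eq C Q (sub_top G)) \<longleftrightarrow> ?max"
 proof (intro iffI allI impI)
  fix T assume h: "\<forall>Q. subfunctor C G Q --> sub_eq C Q (sub_zero G) | sub_eq C Q (sub_top G)" and T: "subfunctor C F T" "sub_le C S T"
  interpret T: sfun C F T by unfold_locales (rule F T)+
  have mem: "\<phi> X v\<in>\<phi> X ` T X \<longleftrightarrow> v\<in>T X" if X: "X\<in>Obj C" and v: "v <: fob F X" for X v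
  proof
   assume "\<phi> X v\<in>\<phi> X ` T X"
   then obtain u where u: "u\<in>T X" "\<phi> X u = \<phi> X v" by auto
   interpret f2v "fob F X" by (rule f2vF[OF X])
   have uc: "u <: fob F X" using u T.Sc[OF X] by auto
   then have "u \<oplus>\<^bsub>fob F X\<^esub> v\<in>T X" using eq_iff[OF X uc v] u T(2) X by (auto simp: sub_le_def)
   then have "u \<oplus>\<^bsub>fob F X\<^esub> (u \<oplus>\<^bsub>fob F X\<^esub> v)\<in>T X" using T.Ssub[OF X] u sub_iff by blast
   then show "v\<in>T X" using uc v by simp
  qed simp
  have "subfunctor C G (%X. \<phi> X ` T X)"
   unfolding subfunctor_def
  proof (intro conjI ballI)
   fix X assume X: "X\<in>Obj C"
   interpret f2v "fob F X" by (rule f2vF[OF X])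
   have t: "T X \<subseteq> carrier (fob F X)" "\<zero>\<^bsub>fob F X\<^esub>\<in>T X" "!!p q. p\<in>T X ==> q\<in>T X ==> p \<oplus>\<^bsub>fob F X\<^esub> q\<in>T X"
    using T.Ssub[OF X] unfolding sub_iff by auto
   have "\<phi> X p \<oplus>\<^bsub>fob G X\<^esub> \<phi> X q\<in>\<phi> X ` T X" if "p\<in>T X" "q\<in>T X" for p q
    using that t(3)[OF that] \<phi>_add[OF X subsetD[OF t(1)] subsetD[OF t(1)]] by (metis imageI)
   then show "submodule (\<phi> X ` T X) F2 (fob G X)"
    unfolding f2v.sub_iff[OF f2vG[OF X]] using t(1) closed[OF X] imageI[OF t(2), of "\<phi> X"] \<phi>_zero[OF X] by auto
   fix Y m assume Y: "Y\<in>Obj C" "m\<in>Hom C X Y"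
   show "fmor G X Y m ` \<phi> X ` T X \<subseteq> \<phi> Y ` T Y"
    using T.Smor[OF X Y] nat[OF X Y, symmetric] t(1) by (auto simp: subset_iff)
  qed
  with h consider "sub_eq C (%X. \<phi> X ` T X) (sub_zero G)" | "sub_eq C (%X. \<phi> X ` T X) (sub_top G)" by blast
  then show "sub_eq C T S | sub_eq C T (sub_top F)"
  proof cases
   case 1
   have "T X \<subseteq> S X" if X: "X\<in>Obj C" for X
    using 1 X T.Sc[OF X] unfolding kerS[OF X] sub_eq_def sub_zero_def by auto
   then show ?thesis using T(2) by (auto simp: sub_eq_def sub_le_def)
  next
   case 2
   have "carrier (fob F X) \<subseteq> T X" if X: "X\<in>Obj C" for X
    using 2 X mem[OF X] closed[OF X] unfolding sub_eq_def sub_top_def by auto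
   then show ?thesis using T.Sc by (auto simp: sub_eq_def sub_top_def)
  qed
 next
  fix Q assume h: ?max and Q: "subfunctor C G Q"
  interpret Q: sfun C G Q by unfold_locales (rule G Q)+
  define T where "T X = {v\<in>carrier (fob F X). \<phi> X v\<in>Q X}" for X
  have Qs: "\<zero>\<^bsub>fob G X\<^esub>\<in>Q X" "!!p q. p\<in>Q X ==> q\<in>Q X ==> p \<oplus>\<^bsub>fob G X\<^esub> q\<in>Q X" if "X\<in>Obj C" for X
   using Q.Ssub[OF that] unfolding f2v.sub_iff[OF f2vG[OF that]] by auto
  have QT: "Q X = \<phi> X ` T X" if X: "X\<in>Obj C" for X using Q.Sc[OF X] sur[OF X] by (auto simp: T_def)
  have "subfunctor C F T"
   unfolding subfunctor_def
  proof (intro conjI ballI)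
   fix X assume X: "X\<in>Obj C"
   interpret f2v "fob F X" by (rule f2vF[OF X])
   show "submodule (T X) F2 (fob F X)" unfolding sub_iff T_def using Qs[OF X] \<phi>_zero[OF X] \<phi>_add[OF X] by auto
   fix Y m assume Y: "Y\<in>Obj C" "m\<in>Hom C X Y"
   show "fmor F X Y m ` T X \<subseteq> T Y"
    using Q.Smor[OF X Y] nat[OF X Y] lin_closed[OF is_functorD(2)[OF F X Y]] by (auto simp: T_def subset_iff)
  qed
  moreover have "sub_le C S T" unfolding sub_le_def T_def using kerS Qs(1) by auto
  ultimately consider "sub_eq C T S" | "sub_eq C T (sub_top F)" using h by blast
  then show "sub_eq C Q (sub_zero G) | sub_eq C Q (sub_top G)"
  proof cases
   case 1
   have "Q X = {\<zero>\<^bsub>fob G X\<^esub>}" if X: "X\<in>Obj C" for X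
    using 1 X Qs(1)[OF X] unfolding QT[OF X] sub_eq_def by (auto simp: kerS[OF X])
   then show ?thesis by (simp add: sub_eq_def sub_zero_def)
  next
   case 2
   then show ?thesis using QT image by (simp add: sub_eq_def sub_top_def)
  qed
 qed
 ultimately show ?thesis unfolding simple_functor_def using G by blast
qed

lemma kernel_iso:
 assumes cc: "closed_cat C"
 shows "fun_iso C (quotfun F S) G"
proof -
 define \<eta> where "\<eta> X K = \<phi> X (SOME v. v\<in>K)" for X K
 have \<eta>: "\<eta> X (S X +>\<^bsub>fob F X\<^esub> v) = \<phi> X v" if X: "X\<in>Obj C" and v: "v <: fob F X" for X v
 proof -
  interpret f2v "fob F X" by (rule f2vF[OF X])
  have "v\<in>S X +>\<^bsub>fob F X\<^esub> v" using coset_mem[OF Ssub[OF X] v] v Ssub[OF X] sub_iff by auto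
  define k where "k = (SOME w. w\<in>S X +>\<^bsub>fob F X\<^esub> v)"
  have "k\<in>S X +>\<^bsub>fob F X\<^esub> v" unfolding k_def by (rule someI[where P = "%w. w\<in>_"]) fact
  then show ?thesis unfolding \<eta>_def k_def[symmetric] using coset_mem[OF Ssub[OF X] v, of k] eq_iff[OF X v, of k] by simp
 qed
 have qc: "EX v:carrier (fob F X). K = S X +>\<^bsub>fob F X\<^esub> v" if "X\<in>Obj C" "K <: fob (quotfun F S) X" for X K
  using that quot_carrier by auto
 have "nat_trans C (quotfun F S) G \<eta>"
  unfolding nat_trans_def
 proof (intro conjI ballI quot_functor cc G)
  fix X assume X: "X\<in>Obj C"
  show "\<eta> X\<in>lin_maps (fob (quotfun F S) X) (fob G X)"
  proof (rule linI[OF quot_f2v[OF X] f2vG[OF X]])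
   interpret f2v "fob F X" by (rule f2vF[OF X])
   fix p q assume "p <: fob (quotfun F S) X" "q <: fob (quotfun F S) X"
   then obtain u v where uv: "u <: fob F X" "p = S X +>\<^bsub>fob F X\<^esub> u" "v <: fob F X" "q = S X +>\<^bsub>fob F X\<^esub> v"
    using qc[OF X] by metis
   show "\<eta> X p <: fob G X" using uv \<eta>[OF X] closed[OF X] by simp
   show "\<eta> X (p \<oplus>\<^bsub>fob (quotfun F S) X\<^esub> q) = \<eta> X p \<oplus>\<^bsub>fob G X\<^esub> \<eta> X q"
    using uv \<eta>[OF X] \<phi>_add[OF X] by (simp add: quot_add[OF X])
  qed
  fix Y m z assume Y: "Y\<in>Obj C" "m\<in>Hom C X Y" and "z <: fob (quotfun F S) X"
  then obtain v where "v <: fob F X" "z = S X +>\<^bsub>fob F X\<^esub> v" using qc[OF X] by metis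
  then show "\<eta> Y (fmor (quotfun F S) X Y m z) = fmor G X Y m (\<eta> X z)"
   using quot_coset[OF X Y] \<eta>[OF X] \<eta>[OF Y(1)] nat[OF X Y] lin_closed[OF is_functorD(2)[OF F X Y]] by simp
 qed
 moreover have "bij_betw (\<eta> X) (carrier (fob (quotfun F S) X)) (carrier (fob G X))" if X: "X\<in>Obj C" for X
  unfolding bij_betw_def
 proof
  show "inj_on (\<eta> X) (carrier (fob (quotfun F S) X))"
   unfolding quot_carrier[OF X] by (rule inj_onI, elim imageE) (use \<eta>[OF X] eq_iff[OF X] quot_eq_iff[OF X] in simp)
  show "\<eta> X ` carrier (fob (quotfun F S) X) = carrier (fob G X)"
   unfolding quot_carrier[OF X] image_image image[OF X, symmetric] by (rule image_cong) (use \<eta>[OF X] in auto)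
 qed
 ultimately show ?thesis unfolding fun_iso_def by blast
qed

end

lemma (in sfun) simple_quot_iff:
 assumes "closed_cat C"
 shows "simple_functor C (quotfun F S) \<longleftrightarrow> \<not> sub_eq C S (sub_top F) &
  (\<forall>T. subfunctor C F T --> sub_le C S T --> sub_eq C T S | sub_eq C T (sub_top F))"
proof -
 have "(%v. S X +>\<^bsub>fob F X\<^esub> v)\<in>lin_maps (fob F X) (fob (quotfun F S) X)" if "X\<in>Obj C" for X
  unfolding quot_simps by (rule f2v.proj_lin[OF f2vF[OF that] Ssub[OF that]])
 then interpret epi C F S "quotfun F S" "%X v. S X +>\<^bsub>fob F X\<^esub> v"
  by unfold_locales (auto simp: nat_trans_def F quot_functor[OF assms] quot_coset quot_zero quot_eq_zero quot_carrier)
 show ?thesis by (rule simple_iff)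
qed

text \<open>An isomorphism is a surjection with zero kernel, so \<open>simple_iff\<close>
  applies.\<close>

lemma simple_iso:
 assumes s: "simple_functor C F" and "fun_iso C F G"
 shows "simple_functor C G"
proof -
 obtain \<eta> where n: "nat_trans C F G \<eta>" and bij: "!!X. X\<in>Obj C ==> bij_betw (\<eta> X) (carrier (fob F X)) (carrier (fob G X))"
  using assms(2) unfolding fun_iso_def by blast
 have F: "is_functor C F" and G: "is_functor C G" using n unfolding nat_trans_def by auto
 interpret epi C F "sub_zero F" G \<eta>
 proof (unfold_locales)
  show "subfunctor C F (sub_zero F)"
   unfolding subfunctor_def sub_zero_def
  proof (intro conjI ballI)
   fix X assume X: "X\<in>Obj C"
   interpret f2v "fob F X" by (rule is_functorD(1)[OF F X])
   show "submodule {\<zero>\<^bsub>fob F X\<^esub>} F2 (fob F X)" by (simp add: sub_iff)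
   show "fmor F X Y m ` {\<zero>\<^bsub>fob F X\<^esub>} \<subseteq> {\<zero>\<^bsub>fob F Y\<^esub>}" if "Y\<in>Obj C" "m\<in>Hom C X Y" for Y m
    using lin_zero[OF f2v_axioms is_functorD(1)[OF F that(1)] is_functorD(2)[OF F X that]] by simp
  qed
  fix X assume X: "X\<in>Obj C"
  interpret f2v "fob F X" by (rule is_functorD(1)[OF F X])
  have "\<eta> X \<zero>\<^bsub>fob F X\<^esub> = \<zero>\<^bsub>fob G X\<^esub>"
   by (rule lin_zero[OF f2v_axioms is_functorD(1)[OF G X]]) (use n X in "simp add: nat_trans_def")
  then show "\<eta> X z = \<zero>\<^bsub>fob G X\<^esub> \<longleftrightarrow> z\<in>sub_zero F X" if "z <: fob F X" for z
   using inj_onD[of "\<eta> X" "carrier (fob F X)" z "\<zero>\<^bsub>fob F X\<^esub>"] bij[OF X] that by (auto simp: sub_zero_def bij_betw_def)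
  show "carrier (fob G X) \<subseteq> \<eta> X ` carrier (fob F X)" using bij[OF X] by (simp add: bij_betw_def)
 qed (rule F n)+
 have "sub_eq C (sub_zero F) (sub_top F) \<longleftrightarrow> sub_eq C (sub_top F) (sub_zero F)" by (auto simp: sub_eq_def)
 then show ?thesis unfolding simple_iff using s unfolding simple_functor_def by blast
qed

section \<open>Tensor products with a free space\<close>

locale tenfree = tensor_pair M "free_mod T" for M :: "(bit, 'a, 'x) module_scheme" and T :: "'h set" +
 assumes fin: "finite T"
begin

abbreviation "MT \<equiv> tensor_mod M (free_mod T)"
abbreviation "tn \<equiv> tens M (free_mod T)"

lemma co_ex: "EX f:lin_maps MT M. ALL m:carrier M. ALL v:carrier (free_mod T). f (tn m v) = v h \<odot>\<^bsub>M\<^esub> m"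
 by (rule tens_univ[OF M.f2v_axioms]) (auto simp: M.smult_bit free_simps(3) M.smult_plus[unfolded M.smult_bit])

text \<open>The tensor product with a free space on a finite set is a direct sum of copies of
  \<open>M\<close>; this is the coordinate at \<open>h\<close>.\<close>

definition co :: "'h => ('a \<times> ('h => bit) => bit) set => 'a" where
 "co h = (SOME f. f\<in>lin_maps MT M & (ALL m:carrier M. ALL v:carrier (free_mod T). f (tn m v) = v h \<odot>\<^bsub>M\<^esub> m))"

lemma co_lin: "co h\<in>lin_maps MT M"
 and co_tens: "m <: M ==> v <: free_mod T ==> co h (tn m v) = v h \<odot>\<^bsub>M\<^esub> m"
 using someI_ex[OF co_ex[of h, unfolded Bex_def], folded co_def] by blast+

lemma co_gen: "m <: M ==> k\<in>T ==> co h (tn m (gen k)) = (if h = k then m else \<zero>\<^bsub>M\<^esub>)"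
 using co_tens[of m "gen k" h] by (simp, simp add: gen_def)

lemma tn_gen [simp]: "m <: M ==> k\<in>T ==> tn m (gen k) <: MT"
 by simp

lemma span_gen: "vspan MT {tn m (gen h) | m h. m <: M & h\<in>T} = carrier MT"
proof
 let ?G = "{tn m (gen h) | m h. m <: M & h\<in>T}"
 have G: "?G \<subseteq> carrier MT" by auto
 show "vspan MT ?G \<subseteq> carrier MT" by (rule T.vspan_carrier[OF G])
 note V = T.vspan_sub[OF G, unfolded T.sub_iff]
 have t: "tn m v\<in>vspan MT ?G" if "v <: free_mod T" "m <: M" for m v
  using that(1)
 proof (induction rule: free_induct)
  case zero
  then show ?case using tens_zero_r[OF that(2)] V by (simp add: free_simps)
 next
  case (add s v)
  then have "tn m (gen s)\<in>vspan MT ?G" using that(2) by (intro subsetD[OF T.vspan_incl]) auto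
  then show ?case using add V that(2) tens_add_r[of m "gen s" v] by auto
 qed
 show "carrier MT \<subseteq> vspan MT ?G"
 proof
  fix z assume "z <: MT"
  then show "z\<in>vspan MT ?G" by (induction rule: tens_induct) (use t V in auto)
 qed
qed

lemma decomp: "z <: MT ==> finsum MT (%h. tn (co h z) (gen h)) T = z"
proof (rule lin_eq_vspan[OF T.f2v_axioms T.f2v_axioms, of "%z. finsum MT (%h. tn (co h z) (gen h)) T" "%z. z"])
 have m: "tn (co h z) (gen h) <: MT" if "z <: MT" "h\<in>T" for h z
  using lin_closed[OF co_lin] that by simp
 show "(%z. finsum MT (%h. tn (co h z) (gen h)) T)\<in>lin_maps MT MT"
 proof (rule linI[OF T.f2v_axioms T.f2v_axioms])
  fix y z assume yz: "y <: MT" "z <: MT"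
  show "finsum MT (%h. tn (co h y) (gen h)) T <: MT" by (rule T.finsum_closed) (use m yz in auto)
  have "finsum MT (%h. tn (co h (y \<oplus>\<^bsub>MT\<^esub> z)) (gen h)) T = finsum MT (%h. tn (co h y) (gen h) \<oplus>\<^bsub>MT\<^esub> tn (co h z) (gen h)) T"
   by (rule T.finsum_cong') (use m yz lin_closed[OF co_lin] in "auto simp: lin_add[OF co_lin] tens_add_l")
  also have "\<dots> = finsum MT (%h. tn (co h y) (gen h)) T \<oplus>\<^bsub>MT\<^esub> finsum MT (%h. tn (co h z) (gen h)) T"
   by (rule T.finsum_addf) (use m yz in auto)
  finally show "finsum MT (%h. tn (co h (y \<oplus>\<^bsub>MT\<^esub> z)) (gen h)) T = finsum MT (%h. tn (co h y) (gen h)) T \<oplus>\<^bsub>MT\<^esub> finsum MT (%h. tn (co h z) (gen h)) T" .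
 qed
 show "(%z. z)\<in>lin_maps MT MT" by (rule lin_id[OF T.f2v_axioms])
 show "{tn m (gen h) | m h. m <: M & h\<in>T} \<subseteq> carrier MT" by auto
 show "z\<in>vspan MT {tn m (gen h) | m h. m <: M & h\<in>T}" if "z <: MT" using that span_gen by simp
 fix s assume "s\<in>{tn m (gen h) | m h. m <: M & h\<in>T}"
 then obtain m k where mk: "s = tn m (gen k)" "m <: M" "k\<in>T" by auto
 have "finsum MT (%h. tn (co h s) (gen h)) T = finsum MT (%h. if k = h then tn m (gen h) else \<zero>\<^bsub>MT\<^esub>) T"
  by (rule T.finsum_cong') (use mk in "auto simp: co_gen")
 also have "\<dots> = s" using T.finsum_singleton[OF mk(3) fin, of "%h. tn m (gen h)"] mk by auto
 finally show "finsum MT (%h. tn (co h s) (gen h)) T = s" .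
qed

lemma co_eqI: "y <: MT ==> z <: MT ==> (!!h. h\<in>T ==> co h y = co h z) ==> y = z"
proof -
 assume yz: "y <: MT" "z <: MT" "!!h. h\<in>T ==> co h y = co h z"
 have "finsum MT (%h. tn (co h y) (gen h)) T = finsum MT (%h. tn (co h z) (gen h)) T"
  by (rule T.finsum_cong') (use yz lin_closed[OF co_lin] in auto)
 then show ?thesis using decomp yz by simp
qed

end

text \<open>Apply \<open>g h\<close> in the copy of \<open>M\<close> at \<open>h\<close>. The swap
  and the maps \<open>mu\<close> and \<open>nu\<close> all have this form, with a map depending on
  the fibre.\<close>

lemma tenfree_lift:
 assumes "tenfree M T" "tenfree M' T" "!!h. h\<in>T ==> g h\<in>lin_maps M M'"
 shows "EX f:lin_maps (tensor_mod M (free_mod T)) (tensor_mod M' (free_mod T)).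
  ALL m:carrier M. ALL h:T. f (tens M (free_mod T) m (gen h)) = tens M' (free_mod T) (g h m) (gen h)"
proof -
 interpret A: tenfree M T by fact
 interpret B: tenfree M' T by fact
 let ?f = "%z. finsum B.MT (%h. B.tn (g h (A.co h z)) (gen h)) T"
 have m: "B.tn (g h (A.co h z)) (gen h) <: B.MT" if "z <: A.MT" "h\<in>T" for h z
  using lin_closed[OF A.co_lin] lin_closed[OF assms(3)] that by simp
 have "?f\<in>lin_maps A.MT B.MT"
 proof (rule linI[OF A.T.f2v_axioms B.T.f2v_axioms])
  fix y z assume yz: "y <: A.MT" "z <: A.MT"
  show "?f y <: B.MT" by (rule B.T.finsum_closed) (use m yz in auto)
  have "?f (y \<oplus>\<^bsub>A.MT\<^esub> z) = finsum B.MT (%h. B.tn (g h (A.co h y)) (gen h) \<oplus>\<^bsub>B.MT\<^esub> B.tn (g h (A.co h z)) (gen h)) T"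
   by (rule B.T.finsum_cong') (use m yz lin_closed[OF A.co_lin] lin_closed[OF assms(3)]
    in "auto simp: lin_add[OF A.co_lin] lin_add[OF assms(3)] B.tens_add_l")
  also have "\<dots> = ?f y \<oplus>\<^bsub>B.MT\<^esub> ?f z" by (rule B.T.finsum_addf) (use m yz in auto)
  finally show "?f (y \<oplus>\<^bsub>A.MT\<^esub> z) = ?f y \<oplus>\<^bsub>B.MT\<^esub> ?f z" .
 qed
 moreover have "?f (A.tn m (gen k)) = B.tn (g k m) (gen k)" if mk: "m <: M" "k\<in>T" for m k
 proof -
  have "?f (A.tn m (gen k)) = finsum B.MT (%h. if k = h then B.tn (g h m) (gen h) else \<zero>\<^bsub>B.MT\<^esub>) T"
   by (rule B.T.finsum_cong') (use mk lin_closed[OF assms(3)] lin_zero[OF A.M.f2v_axioms B.M.f2v_axioms assms(3)] in "auto simp: A.co_gen")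
  also have "\<dots> = B.tn (g k m) (gen k)"
   using B.T.finsum_singleton[OF mk(2) A.fin, of "%h. B.tn (g h m) (gen h)"] mk lin_closed[OF assms(3)] by auto
  finally show ?thesis .
 qed
 ultimately show ?thesis by (intro bexI[of _ ?f]) simp_all
qed

section \<open>The functors of group algebras and exterior powers\<close>

lemma EfD: "W\<in>Obj Ef ==> f2v W"
 by (simp add: Ef_def f2v_def)

lemma PF_functor: "is_functor Ef PF"
proof (rule is_functorI)
 fix V :: "'a fsp" and z assume "V\<in>Obj Ef" "z <: fob PF V"
 then show "fmor PF V V (Idm Ef V) z = z" by (auto simp: PF_def Ef_def intro!: free_map_id[of "carrier V"])
next
 fix V W :: "'a fsp" and m assume "m\<in>Hom Ef V W"
 then have "m\<in>lin_maps V W" by (simp add: Ef_def)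
 then show "fmor PF V W m\<in>lin_maps (fob PF V) (fob PF W)"
  unfolding PF_def using lin_closed[of m V W] by (auto intro!: free_map_lin)
next
 fix V W Y :: "'a fsp" and m n z assume "m\<in>Hom Ef V W" "n\<in>Hom Ef W Y" "z <: fob PF V"
 then have "m\<in>lin_maps V W" "n\<in>lin_maps W Y" "z <: free_mod (carrier V)" by (simp_all add: Ef_def PF_def)
 then show "fmor PF V Y (Comp Ef V W Y n m) z = fmor PF W Y n (fmor PF V W m z)"
  unfolding PF_def using lin_closed[of m V W] lin_closed[of n W Y]
  by (auto intro!: free_map_comp[of "carrier V" _ "carrier W" _ "carrier Y"] simp: Ef_def compose_def)
qed (simp add: PF_def f2v_free)

lemma Ext_functor: "is_functor Ef (Ext n)"
proof (rule is_functorI)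
 have ob: "fob (Ext n) W = ext_mod n W" and mo: "fmor (Ext n) V W f = pres_map (tuples n W) (ext_rel n W) (map f)" for V W :: "'a fsp" and f
  by (simp_all add: Ext_def)
 have E: "ext W" if "W\<in>Obj Ef" for W :: "'a fsp" using EfD[OF that] by (simp add: ext_def)
 have L: "m\<in>lin_maps V W" if "m\<in>Hom Ef V W" for V W :: "'a fsp" and m using that by (simp add: Ef_def)
 show "f2v (fob (Ext n) W)" if "W\<in>Obj Ef" for W :: "'a fsp" unfolding ob by (rule ext.f2v_E[OF E[OF that]])
 show l: "fmor (Ext n) V W m\<in>lin_maps (fob (Ext n) V) (fob (Ext n) W)"
  if "V\<in>Obj Ef" "W\<in>Obj Ef" "m\<in>Hom Ef V W" for V W :: "'a fsp" and m
  unfolding ob mo by (rule ext_map(1)[OF EfD[OF that(1)] EfD[OF that(2)] L[OF that(3)]])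
 note ml = l[unfolded ob mo]
 show "fmor (Ext n) V V (Idm Ef V) z = z" if V: "V\<in>Obj Ef" and z: "z <: fob (Ext n) V" for V :: "'a fsp" and z
 proof -
  interpret V: ext V by (rule E[OF V])
  have i: "Idm Ef V\<in>lin_maps V V" by (rule linI[OF V.f2v_axioms V.f2v_axioms]) (auto simp: Ef_def)
  show ?thesis
   unfolding mo
  proof (rule V.ext_lin_eq[OF V.f2v_E ext_map(1)[OF V.f2v_axioms V.f2v_axioms i] lin_id[OF V.f2v_E] _ z[unfolded ob]])
   fix vs assume vs: "vs\<in>tuples n V"
   then have "map (Idm Ef V) vs = vs" by (auto simp: tuples_def Ef_def intro!: map_idI)
   then show "pres_map (tuples n V) (ext_rel n V) (map (Idm Ef V)) (wedge n V vs) = wedge n V vs"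
    using ext_map(2)[OF V.f2v_axioms V.f2v_axioms i vs] by simp
  qed
 qed
 show "fmor (Ext n) V Y (Comp Ef V W Y k m) z = fmor (Ext n) W Y k (fmor (Ext n) V W m z)"
  if V: "V\<in>Obj Ef" "W\<in>Obj Ef" "Y\<in>Obj Ef" and m: "m\<in>Hom Ef V W" "k\<in>Hom Ef W Y" and z: "z <: fob (Ext n) V"
  for V W Y :: "'a fsp" and m k z
 proof -
  interpret V: ext V by (rule E[OF V(1)])
  interpret W: ext W by (rule E[OF V(2)])
  interpret Y: ext Y by (rule E[OF V(3)])
  note mm = L[OF m(1)] and kk = L[OF m(2)]
  have c: "Comp Ef V W Y k m\<in>lin_maps V Y"
   by (rule lin_cong[OF lin_comp[OF mm kk] V.f2v_axioms]) (simp add: Ef_def compose_def)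
  note M = ext_map[OF V.f2v_axioms W.f2v_axioms mm] and K = ext_map[OF W.f2v_axioms Y.f2v_axioms kk] and C = ext_map[OF V.f2v_axioms Y.f2v_axioms c]
  show ?thesis
   unfolding mo
  proof (rule V.ext_lin_eq[OF Y.f2v_E C(1) lin_comp[OF M(1) K(1)] _ z[unfolded ob]])
   fix vs assume vs: "vs\<in>tuples n V"
   then have mv: "map m vs\<in>tuples n W" using lin_closed[OF mm] by (auto simp: tuples_def)
   have "map (Comp Ef V W Y k m) vs = map k (map m vs)" using vs by (auto simp: tuples_def Ef_def compose_def)
   then show "pres_map (tuples n Y) (ext_rel n Y) (map (Comp Ef V W Y k m)) (wedge n V vs) =
    pres_map (tuples n Y) (ext_rel n Y) (map k) (pres_map (tuples n W) (ext_rel n W) (map m) (wedge n V vs))"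
    using C(2)[OF vs] M(2)[OF vs] K(2)[OF mv] by metis
  qed
 qed
qed

section \<open>Tensor products with iso\<close>

locale fib = line D x for D :: "'a::infinite qsp" and x +
 fixes F :: "('a fsp, 'a => 'a, 'u) vfun"
 assumes FF: "is_functor Ef F"
begin

definition TF where "TF = tensor_fun (iota F) ik"

abbreviation Mo :: "'a qsp => (bit, 'u) module" where "Mo V \<equiv> fob F (eps_obj V)"

text \<open>The element \<open>m\<close> placed in the fibre over \<open>a\<close>;
  \<open>cz\<close> is the projection to that fibre.\<close>

definition tz where "tz V m a = tens (Mo V) (free_mod (qhom D V)) m (gen (lm V a))"

definition cz where "cz V a = tenfree.co (Mo V) (qhom D V) (lm V a)"

lemma TF_functor: "is_functor Tq TF"
 unfolding TF_def by (rule tensor_functor[OF iota_functor[OF FF] ik_functor Tq_closed])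

lemma fobT: "fob TF V = tensor_mod (Mo V) (free_mod (qhom D V))"
 by (simp add: TF_def tensor_fun_def ik_simps iota_def)

end

locale fibV = fib D x F + V: ndsp V for D :: "'a::infinite qsp" and x and F :: "('a fsp, 'a => 'a, 'u) vfun" and V :: "'a qsp"
begin

lemma f2v_Mo: "f2v (Mo V)"
 by (rule is_functorD(1)[OF FF eps_obj_Ef(1)[OF V.ndsp_axioms]])

lemma qhD: "qhom D V = lm V ` al V"
 by (rule qhom_D[OF V.qsp_axioms])

lemma finite_al' [simp]: "finite (al V)"
 by (rule finite_al[OF V.qsp_axioms])

lemma tenfree: "tenfree (Mo V) (qhom D V)"
 unfolding tenfree_def tenfree_axioms_def tensor_pair_def using f2v_Mo f2v_free qhD by auto

sublocale Mo: f2v "Mo V" by (rule f2v_Mo)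
sublocale tf: tenfree "Mo V" "qhom D V" by (rule tenfree)

sublocale T: f2v "fob TF V" unfolding fobT by (rule tf.T.f2v_axioms)

lemma lmV: "a\<in>al V ==> lm V a\<in>qhom D V" by (simp add: qhD)

lemma tz_mem [simp]: "m <: Mo V ==> a\<in>al V ==> tz V m a <: fob TF V"
 unfolding tz_def fobT using lmV by simp

lemma tz_lin: "a\<in>al V ==> (%m. tz V m a)\<in>lin_maps (Mo V) (fob TF V)"
 unfolding tz_def fobT by (rule tf.tens_lin_l) (simp add: lmV)

lemma tz_add: "a\<in>al V ==> m <: Mo V ==> n <: Mo V ==> tz V (m \<oplus>\<^bsub>Mo V\<^esub> n) a = tz V m a \<oplus>\<^bsub>fob TF V\<^esub> tz V n a"
 by (rule lin_add[OF tz_lin])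

lemma tz_zero [simp]: "a\<in>al V ==> tz V \<zero>\<^bsub>Mo V\<^esub> a = \<zero>\<^bsub>fob TF V\<^esub>"
 by (rule lin_zero[OF f2v_Mo T.f2v_axioms tz_lin])

lemma cz_lin: "cz V a\<in>lin_maps (fob TF V) (Mo V)"
 unfolding cz_def fobT by (rule tf.co_lin)

lemma cz_mem [simp]: "z <: fob TF V ==> cz V a z <: Mo V"
 by (rule lin_closed[OF cz_lin])

lemma cz_add: "y <: fob TF V ==> z <: fob TF V ==> cz V a (y \<oplus>\<^bsub>fob TF V\<^esub> z) = cz V a y \<oplus>\<^bsub>Mo V\<^esub> cz V a z"
 by (rule lin_add[OF cz_lin])

lemma cz_zero [simp]: "cz V a \<zero>\<^bsub>fob TF V\<^esub> = \<zero>\<^bsub>Mo V\<^esub>"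
 by (rule lin_zero[OF T.f2v_axioms f2v_Mo cz_lin])

lemma cz_tz: "m <: Mo V ==> b\<in>al V ==> cz V a (tz V m b) = (if a = b then m else \<zero>\<^bsub>Mo V\<^esub>)"
 unfolding cz_def tz_def by (subst tf.co_gen) (use lmV in auto)

lemma cz_eqI: "y <: fob TF V ==> z <: fob TF V ==> (!!a. a\<in>al V ==> cz V a y = cz V a z) ==> y = z"
 unfolding fobT cz_def by (rule tf.co_eqI) (auto simp: qhD)

lemma cz_finsum: "(!!i. i\<in>I ==> g i <: fob TF V) ==> cz V a (finsum (fob TF V) g I) = finsum (Mo V) (%i. cz V a (g i)) I"
 by (rule lin_finsum[OF T.f2v_axioms f2v_Mo cz_lin])

lemma decompV: "z <: fob TF V ==> z = finsum (fob TF V) (%a. tz V (cz V a z) a) (al V)"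
proof (rule cz_eqI)
 assume z: "z <: fob TF V"
 show "finsum (fob TF V) (%a. tz V (cz V a z) a) (al V) <: fob TF V"
  by (rule T.finsum_closed) (use z in auto)
 fix a assume a: "a\<in>al V"
 have "cz V a (finsum (fob TF V) (%a. tz V (cz V a z) a) (al V)) = finsum (Mo V) (%b. if a = b then cz V b z else \<zero>\<^bsub>Mo V\<^esub>) (al V)"
  by (subst cz_finsum) (use z in "auto simp: cz_tz intro!: Mo.finsum_cong'")
 also have "\<dots> = cz V a z" using Mo.finsum_singleton[OF a finite_al', of "%b. cz V b z"] z by auto
 finally show "cz V a z = cz V a (finsum (fob TF V) (%a. tz V (cz V a z) a) (al V))" by simp
qed

lemma sub_decomp: "submodule N F2 (fob TF V) ==> z <: fob TF V ==> (!!a. a\<in>al V ==> tz V (cz V a z) a\<in>N) ==> z\<in>N"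
 using T.sub_finsum[of N "%a. tz V (cz V a z) a" "al V"] decompV[of z] by auto

end

context fib
begin

lemma fmor_tz:
 assumes "tmor V W t" "a\<in>al V" "m <: Mo V"
 shows "fmor TF V W t (tz V m a) = (if a\<in>dm V W t then tz W (fmor F (eps_obj V) (eps_obj W) (eps_mor V W t) m) (eps_mor V W t a) else \<zero>\<^bsub>fob TF W\<^esub>)"
proof -
 interpret t: tmor V W t by fact
 interpret fV: fibV D x F V by unfold_locales
 interpret fW: fibV D x F W by unfold_locales
 note V = tmor_hom[OF assms(1)]
 have "fmor TF V W t (tz V m a) = tens (fob (iota F) W) (fob ik W) (fmor (iota F) V W t m) (fmor ik V W t (gen (lm V a)))"
  using tensor_fun_tens(2)[OF iota_functor[OF FF] ik_functor, of V W t m "gen (lm V a)"] V assms fV.lmV[OF assms(2)]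
  unfolding TF_def tz_def by (simp add: iota_def ik_simps)
 also have "\<dots> = tens (Mo W) (free_mod (qhom D W)) (fmor F (eps_obj V) (eps_obj W) (eps_mor V W t) m)
   (if a\<in>dm V W t then gen (lm W (eps_mor V W t a)) else (%_. 0))"
  using ik_gen[OF assms(1,2)] by (simp add: iota_def ik_simps)
 also have "\<dots> = (if a\<in>dm V W t then tz W (fmor F (eps_obj V) (eps_obj W) (eps_mor V W t) m) (eps_mor V W t a) else \<zero>\<^bsub>fob TF W\<^esub>)"
 proof -
  have "fmor (iota F) V W t m <: fob (iota F) W"
   using lin_closed[OF is_functorD(2)[OF iota_functor[OF FF], of V W t]] V assms(3) by (simp add: iota_def)
  then show ?thesis using fW.tf.tens_zero_r by (simp add: tz_def fobT iota_def free_simps)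
 qed
 finally show ?thesis .
qed

lemma fmor_TF_lin: "tmor V W t ==> fmor TF V W t\<in>lin_maps (fob TF V) (fob TF W)"
 using is_functorD(2)[OF TF_functor] tmor_hom by metis

end

section \<open>Finite differences\<close>

declare free_simps(2) [simp]

text \<open>Iterated finite difference of \<open>F\<close> at \<open>v\<close>: unfolding gives the
  sum of \<open>F\<close> over the points obtained by adding to \<open>v\<close> the sums of all
  sublists of \<open>ls\<close>.\<close>

fun dd :: "(bit, 'a) qspace => 'a list => ('a => bit) => 'a => bit" where
 "dd V [] F v = F v"
| "dd V (l # ls) F v = dd V ls F v + dd V ls F (v \<oplus>\<^bsub>V\<^esub> l)"

text \<open>As a function of \<open>w\<close> this is a polynomial of degree at most
  \<open>length us\<close>; the values are bits, so repeated forms count once.\<close>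

definition mnl :: "(bit, 'a) qspace => 'a list => 'a => bit" where
 "mnl V us w = prod_list (map (%u. bil V w u) us)"

text \<open>The cube at \<open>v\<close> with directions \<open>ls\<close>, its points counted
  modulo 2. On a vector space it vanishes when the directions are linearly dependent.\<close>

definition fc :: "(bit, 'a) qspace => 'a list => 'a => 'a => bit" where
 "fc V ls v w = dd V ls (%u. gen u w) v"

definition pr :: "(bit, 'a) qspace => ('a => bit) => ('a => bit) => bit" where
 "pr V f F = (\<Sum>w\<in>carrier V. f w * F w)"

lemma mnl_simps [simp]: "mnl V [] w = 1" "mnl V (u # us) w = bil V w u * mnl V us w"
 "mnl V (us @ us') w = mnl V us w * mnl V us' w"
 by (simp_all add: mnl_def)

lemma mnl_fun: "mnl V [] = (%w. 1)" "mnl V (u # us) = (%w. bil V w u * mnl V us w)"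
 by (simp_all add: fun_eq_iff)

lemma dd_add: "dd V ls (%u. F u + G u) v = dd V ls F v + dd V ls G v"
 by (induction ls arbitrary: v) (simp_all add: algebra_simps)

lemma dd_zero: "dd V ls (%u. 0) v = 0"
 by (induction ls arbitrary: v) simp_all

context qsp
begin

lemma dd_shift: "set ls \<subseteq> carrier V ==> v <: V ==> a <: V ==> dd V ls (%u. F (u \<oplus> a)) v = dd V ls F (v \<oplus> a)"
proof (induction ls arbitrary: v)
 case (Cons l ls)
 have "v \<oplus> l \<oplus> a = v \<oplus> a \<oplus> l" using Cons.prems by (simp add: ac)
 then show ?case using Cons by simp
qed simp

lemma dd_cong: "set ls \<subseteq> carrier V ==> v <: V ==> (!!u. u <: V ==> F u = G u) ==> dd V ls F v = dd V ls G v"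
 by (induction ls arbitrary: v) simp_all

text \<open>Steps orthogonal to \<open>a\<close> do not change \<open>B(-, a)\<close>, so the
  difference only involves points with the same value as \<open>v\<close>.\<close>

lemma dd_cong_orth:
 "set ls \<subseteq> carrier V ==> v <: V ==> a <: V ==> (!!l. l\<in>set ls ==> bil V l a = 0) ==>
  (!!u. u <: V ==> bil V u a = bil V v a ==> F u = G u) ==> dd V ls F v = dd V ls G v"
proof (induction ls arbitrary: v)
 case (Cons l ls)
 have "bil V (v \<oplus> l) a = bil V v a" using Cons.prems by (simp add: bil_simps)
 then show ?case using Cons.IH[of v] Cons.IH[of "v \<oplus> l"] Cons.prems by simp
qed simp

lemma dd_comm: "set ls \<subseteq> carrier V ==> v <: V ==> a <: V ==> b <: V ==> dd V (a # b # ls) F v = dd V (b # a # ls) F v"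
proof -
 assume *: "set ls \<subseteq> carrier V" "v <: V" "a <: V" "b <: V"
 then have "v \<oplus> a \<oplus> b = v \<oplus> b \<oplus> a" by (simp add: ac)
 then show ?thesis by (simp add: algebra_simps)
qed

text \<open>The Leibniz rule; the derivatives in the sum are shifted.\<close>

lemma dd_mult:
 assumes "u <: V"
 shows "set ls \<subseteq> carrier V ==> v <: V ==> dd V ls (%w. bil V w u * G w) v = bil V v u * dd V ls G v +
  (\<Sum>i<length ls. bil V (ls ! i) u * dd V (take i ls @ drop (Suc i) ls) G (v \<oplus> ls ! i))"
proof (induction ls arbitrary: v)
 case (Cons l ls)
 have l: "l <: V" "set ls \<subseteq> carrier V" using Cons.prems by auto
 have nth: "ls ! i <: V" if "i < length ls" for i using that l(2) by (meson nth_mem subsetD)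
 let ?r = "%i. take i ls @ drop (Suc i) ls"
 have "(\<Sum>i<length (l # ls). bil V ((l # ls) ! i) u * dd V (take i (l # ls) @ drop (Suc i) (l # ls)) G (v \<oplus> (l # ls) ! i)) =
  bil V l u * dd V ls G (v \<oplus> l) + (\<Sum>i<length ls. bil V (ls ! i) u * (dd V (?r i) G (v \<oplus> ls ! i) + dd V (?r i) G (v \<oplus> ls ! i \<oplus> l)))"
  unfolding length_Cons sum.lessThan_Suc_shift by simp
 also have "(\<Sum>i<length ls. bil V (ls ! i) u * (dd V (?r i) G (v \<oplus> ls ! i) + dd V (?r i) G (v \<oplus> ls ! i \<oplus> l))) =
   (\<Sum>i<length ls. bil V (ls ! i) u * dd V (?r i) G (v \<oplus> ls ! i)) + (\<Sum>i<length ls. bil V (ls ! i) u * dd V (?r i) G (v \<oplus> l \<oplus> ls ! i))"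
  unfolding sum.distrib[symmetric]
  by (rule sum.cong) (use nth Cons.prems in "auto simp: algebra_simps ac")
 finally show ?case
  using Cons.IH[of v] Cons.IH[of "v \<oplus> l"] Cons.prems assms l
  by (simp add: bil_simps algebra_simps)
qed simp

text \<open>Each difference lowers the degree by one; this is the Leibniz rule applied by induction
  on the number of forms.\<close>

lemma dd_mono_zero: "set us \<subseteq> carrier V ==> set ls \<subseteq> carrier V ==> v <: V ==> length us < length ls ==> dd V ls (mnl V us) v = 0"
proof (induction us arbitrary: ls v)
 case Nil
 then obtain l ls' where "ls = l # ls'" by (cases ls) auto
 moreover have "dd V ls' (%w. 1) v = dd V ls' (%w. 1) (v \<oplus> l)"
  using dd_shift[of ls' v l "%w. 1"] Nil calculation by simp
 ultimately show ?case by (simp add: mnl_fun)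
next
 case (Cons u us)
 have "dd V (take i ls @ drop (Suc i) ls) (mnl V us) (v \<oplus> ls ! i) = 0" if i: "i < length ls" for i
 proof (rule Cons.IH)
  show "set (take i ls @ drop (Suc i) ls) \<subseteq> carrier V" using Cons.prems(2) by (auto dest: in_set_takeD in_set_dropD)
  show "v \<oplus> ls ! i <: V" using Cons.prems i by (meson a_closed nth_mem subsetD)
  show "length us < length (take i ls @ drop (Suc i) ls)" using Cons.prems(4) i by simp
 qed (use Cons.prems in simp)
 moreover have "dd V ls (mnl V us) v = 0" using Cons by simp
 ultimately show ?case using dd_mult[of u ls v "mnl V us"] Cons.prems by (simp add: mnl_fun)
qed

text \<open>When degree and number of directions agree, the Leibniz term in which \<open>u\<close>
  is not differentiated vanishes by \<open>dd_mono_zero\<close>; the others are the expansion of the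
  contraction with \<open>B(-, u)\<close>. Here products of linear forms turn into alternating
  forms, and the dependence on \<open>v\<close> disappears.\<close>

lemma dd_mono_hat:
 assumes E: "ext M" and M: "carrier M = carrier V" "add M = add V"
 shows "set us \<subseteq> carrier V ==> set ls \<subseteq> carrier V ==> v <: V ==> length us = length ls ==>
  dd V ls (mnl V us) v = ext.hat M (map (%u w. bil V w u) us) (wedge (length ls) M ls)"
proof (induction us arbitrary: ls v)
 case Nil
 interpret E: ext M by fact
 show ?case using Nil E.cou(1) by simp
next
 case (Cons u us)
 interpret E: ext M by fact
 have af: "addfun M (%w. bil V w u)" if "u <: V" for u using that unfolding addfun_def M by (simp add: bil_simps)
 have len: "length ls = Suc (length us)" using Cons.prems by simp
 have "dd V ls (mnl V us) v = 0" by (rule dd_mono_zero) (use Cons.prems in auto)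
 moreover have "dd V (take i ls @ drop (Suc i) ls) (mnl V us) (v \<oplus> ls ! i) =
   E.hat (map (%u w. bil V w u) us) (wedge (length us) M (take i ls @ drop (Suc i) ls))" if i: "i < length ls" for i
 proof -
  have l: "length (take i ls @ drop (Suc i) ls) = length us" using i len by simp
  show ?thesis
   unfolding l[symmetric]
  proof (rule Cons.IH)
   show "set (take i ls @ drop (Suc i) ls) \<subseteq> carrier V" using Cons.prems(2) by (auto dest: in_set_takeD in_set_dropD)
   show "v \<oplus> ls ! i <: V" using Cons.prems i by (meson a_closed nth_mem subsetD)
  qed (use Cons.prems l in auto)
 qed
 ultimately have "dd V ls (mnl V (u # us)) v = (\<Sum>i<length ls. bil V (ls ! i) u *
   E.hat (map (%u w. bil V w u) us) (wedge (length us) M (take i ls @ drop (Suc i) ls)))"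
  using dd_mult[of u ls v "mnl V us"] Cons.prems by (simp add: mnl_fun)
 also have "\<dots> = E.hat (map (%u w. bil V w u) (u # us)) (wedge (length ls) M ls)"
 proof -
  have 1: "addfun M (%w. bil V w u)" "ALL \<phi>:set (map (%u w. bil V w u) us). addfun M \<phi>" using af Cons.prems(1) by auto
  have 2: "ls\<in>tuples (Suc (length (map (%u w. bil V w u) us))) M" using Cons.prems len by (auto simp: tuples_def M)
  show ?thesis using E.hat_w_Cons[OF 1 2] unfolding length_map list.map len by simp
 qed
 finally show ?case .
qed

lemma pr_fc: "set ls \<subseteq> carrier V ==> v <: V ==> pr V (fc V ls v) F = dd V ls F v"
proof (induction ls arbitrary: v)
 case Nil
 have "pr V (fc V [] v) F = (\<Sum>w\<in>carrier V. if w = v then F v else 0)"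
  unfolding pr_def fc_def by (rule sum.cong) (auto simp: gen_def)
 then show ?case using Nil by simp
next
 case (Cons l ls)
 have "pr V (fc V (l # ls) v) F = pr V (fc V ls v) F + pr V (fc V ls (v \<oplus> l)) F"
  unfolding pr_def fc_def by (simp add: distrib_right sum.distrib)
 then show ?case using Cons by simp
qed

lemma fc_mem: "set ls \<subseteq> carrier V ==> v <: V ==> fc V ls v <: free_mod (carrier V)"
proof -
 assume *: "set ls \<subseteq> carrier V" "v <: V"
 have "fc V ls v w = 0" if "w \<notin> carrier V" for w
 proof -
  have "fc V ls v w = dd V ls (%u. 0) v"
   unfolding fc_def by (rule dd_cong) (use * that in "auto simp: gen_def")
  then show ?thesis by (simp add: dd_zero)
 qed
 then show ?thesis by (simp add: free_mem_finite)
qed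

lemma fc_Cons: "fc V (l # ls) v = (%w. fc V ls v w + fc V ls (v \<oplus> l) w)"
 by (simp add: fc_def fun_eq_iff)

text \<open>Translation by \<open>b\<close> is the identity plus the difference in direction
  \<open>b\<close>, and the bit \<open>bil V w c\<close> tells whether it takes place; multiplying
  out over the pairs gives one term for each subsequence.\<close>

lemma taylor: "dual V ps ==> v <: V ==> w <: V ==>
 G (v \<oplus> xp V ps w) = (\<Sum>S\<leftarrow>subseqs ps. mnl V (map snd S) w * dd V (map fst S) G v)"
proof (induction ps arbitrary: v)
 case (Cons p ps)
 obtain b c where p: "p = (b, c)" by force
 have m: "b <: V" "c <: V" "dual V ps" using Cons.prems p by auto
 have "(\<Sum>S\<leftarrow>subseqs (p # ps). mnl V (map snd S) w * dd V (map fst S) G v) =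
  (\<Sum>S\<leftarrow>subseqs ps. bil V w c * mnl V (map snd S) w * (dd V (map fst S) G v + dd V (map fst S) G (v \<oplus> b))) +
  (\<Sum>S\<leftarrow>subseqs ps. mnl V (map snd S) w * dd V (map fst S) G v)"
  by (simp add: p Let_def comp_def)
 also have "\<dots> = G (v \<oplus> xp V (p # ps) w)"
 proof (cases "bil V w c = 0")
  case True
  then show ?thesis using Cons.IH[OF m(3) Cons.prems(2,3)] m Cons.prems p by simp
 next
  case False
  then have "(\<Sum>S\<leftarrow>subseqs ps. bil V w c * mnl V (map snd S) w * (dd V (map fst S) G v + dd V (map fst S) G (v \<oplus> b))) +
   (\<Sum>S\<leftarrow>subseqs ps. mnl V (map snd S) w * dd V (map fst S) G v) = (\<Sum>S\<leftarrow>subseqs ps. mnl V (map snd S) w * dd V (map fst S) G (v \<oplus> b))"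
   by (simp add: sum_list_addf[symmetric] distrib_left add.assoc add.commute add.left_commute)
  also have "\<dots> = G (v \<oplus> b \<oplus> xp V ps w)" using Cons.IH[OF m(3), of "v \<oplus> b"] Cons.prems m by simp
  finally show ?thesis using False m Cons.prems p by (simp add: a_assoc)
 qed
 finally show ?case by simp
qed simp

lemma vspan_insert_sum:
 assumes "finite B" "insert l B \<subseteq> carrier V" "l \<notin> vspan V B"
 shows "(\<Sum>z\<in>vspan V (insert l B). (F::'a => bit) z) = (\<Sum>z\<in>vspan V B. F z) + (\<Sum>z\<in>vspan V B. F (l \<oplus> z))"
proof -
 have S: "submodule (vspan V B) F2 V" "submodule (vspan V (insert l B)) F2 V" using vspan_sub assms(2) by auto
 note s1 = S(1)[unfolded sub_iff] and s2 = S(2)[unfolded sub_iff]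
 have sub: "vspan V B \<subseteq> vspan V (insert l B)" by (rule vspan_mono) auto
 have l: "l\<in>vspan V (insert l B)" "l <: V" using vspan_incl[of "insert l B"] assms(2) by auto
 have "vspan V (insert l B) = vspan V B \<union> (%z. l \<oplus> z) ` vspan V B"
 proof
  show "vspan V B \<union> (%z. l \<oplus> z) ` vspan V B \<subseteq> vspan V (insert l B)" using sub l s2 by auto
  show "vspan V (insert l B) \<subseteq> vspan V B \<union> (%z. l \<oplus> z) ` vspan V B"
  proof
   fix y assume "y\<in>vspan V (insert l B)"
   then show "y\<in>vspan V B \<union> (%z. l \<oplus> z) ` vspan V B"
    using assms(2)
   proof (induction rule: vspan_induct)
    case (add s y)
    have yc: "y <: V" using add.hyps s2 by auto
    consider "s = l" "y\<in>vspan V B" | z where "s = l" "y = l \<oplus> z" "z\<in>vspan V B" | "s\<in>B" "y\<in>vspan V B"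
     | z where "s\<in>B" "y = l \<oplus> z" "z\<in>vspan V B" using add by auto
    then show ?case
    proof cases
     case 2
     then have "s \<oplus> y = z" using l s1 by auto
     then show ?thesis using 2 by simp
    next
     case 3
     then show ?thesis using s1 vspan_incl[of B] by blast
    next
     case 4
     have sB: "s\<in>vspan V B" using 4 vspan_incl by auto
     then have "s \<oplus> y = l \<oplus> (s \<oplus> z)" using 4 s1 l by (auto simp: a_lcomm subset_iff)
     then show ?thesis using 4 s1 sB by blast
    qed auto
   qed (use s1 in auto)
  qed
 qed
 moreover have "vspan V B \<inter> (%z. l \<oplus> z) ` vspan V B = {}"
 proof (rule ccontr)
  assume "vspan V B \<inter> (%z. l \<oplus> z) ` vspan V B ~= {}"
  then obtain z where z: "z\<in>vspan V B" "l \<oplus> z\<in>vspan V B" by auto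
  then have zc: "z <: V" using s1 by auto
  have "(l \<oplus> z) \<oplus> z\<in>vspan V B" using z s1 by blast
  moreover have "(l \<oplus> z) \<oplus> z = l" using l zc by (simp add: a_assoc)
  ultimately show False using assms(3) by simp
 qed
 moreover have "finite (vspan V B)" using finite_vspan assms by auto
 moreover have "inj_on (%z. l \<oplus> z) (vspan V B)"
 proof (rule inj_onI)
  fix y z assume "y\<in>vspan V B" "z\<in>vspan V B" "l \<oplus> y = l \<oplus> z"
  moreover from this have "y <: V" "z <: V" using s1 by auto
  ultimately show "y = z" using l(2) by (metis add_left_self)
 qed
 ultimately show ?thesis by (simp add: sum.union_disjoint sum.reindex)
qed

text \<open>Independent directions make the partial sums run through the span without repetition. In
  this way the sums over subspaces in \<open>k_sub\<close> become cubes.\<close>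

lemma vspan_sum:
 "set ls \<subseteq> carrier V ==> distinct ls ==> (!!b. b\<in>set ls ==> b \<notin> vspan V (set ls - {b})) ==> v <: V ==>
  (\<Sum>z\<in>vspan V (set ls). (F::'a => bit) (v \<oplus> z)) = dd V ls F v"
proof (induction ls arbitrary: v)
 case Nil
 have "vspan V {} = {\<zero>}"
  using vspan_least[of "{\<zero>}" "{}"] vspan_sub[of "{}"] by (auto simp: sub_iff)
 then show ?case using Nil by simp
next
 case (Cons l ls)
 have l: "l <: V" "set ls \<subseteq> carrier V" "l \<notin> set ls" using Cons.prems by auto
 have nl: "l \<notin> vspan V (set ls)" using Cons.prems(3)[of l] l(3) by simp
 have ind: "b \<notin> vspan V (set ls - {b})" if "b\<in>set ls" for b
  using Cons.prems(3)[of b] that vspan_mono[of "set ls - {b}" "set (l # ls) - {b}"] by auto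
 have vc: "z <: V" if "z\<in>vspan V (set ls)" for z using that vspan_carrier[OF l(2)] by auto
 have "(\<Sum>z\<in>vspan V (set (l # ls)). F (v \<oplus> z)) = (\<Sum>z\<in>vspan V (set ls). F (v \<oplus> z)) + (\<Sum>z\<in>vspan V (set ls). F (v \<oplus> (l \<oplus> z)))"
  using vspan_insert_sum[of "set ls" l "%z. F (v \<oplus> z)"] nl l by simp
 also have "(\<Sum>z\<in>vspan V (set ls). F (v \<oplus> (l \<oplus> z))) = (\<Sum>z\<in>vspan V (set ls). F ((v \<oplus> l) \<oplus> z))"
  by (rule sum.cong) (use vc l Cons.prems in "auto simp: a_assoc")
 finally show ?case using Cons.IH[of v] Cons.IH[of "v \<oplus> l"] Cons.prems ind l by simp
qed

end

section \<open>The functor Mix on a nondegenerate space\<close>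

context line
begin

abbreviation "Sg \<equiv> Sigma_fun D x"
abbreviation "Mx \<equiv> Mix D x"
abbreviation "ks d \<equiv> k_sub d D x"
abbreviation "Ls n \<equiv> L_sub n D x"
abbreviation "Lf n \<equiv> L_fun n D x"

sublocale mx: fib D x PF
 by unfold_locales (rule PF_functor)

sublocale ex: fib D x "Ext n" for n
 by unfold_locales (rule Ext_functor)

lemma PF_iso_eq: "PF_iso D = mx.TF"
 by (simp add: PF_iso_def mx.TF_def)

lemma Ext_iso_eq: "Ext_iso n D = ex.TF n"
 by (simp add: Ext_iso_def ex.TF_def)

lemma Mo_mx [simp]: "fob PF (eps_obj V) = free_mod (carrier V)"
 by (simp add: PF_def)

end

locale lineV = line D x + V: ndsp V for D :: "'a::infinite qsp" and x and V :: "'a qsp" (structure)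
begin

sublocale mx: fibV D x PF V
 by unfold_locales

sublocale ex: fibV D x "Ext n" V for n
 by unfold_locales

abbreviation "\<Gamma> \<equiv> fob mx.TF V"
abbreviation "B \<equiv> bil V"
abbreviation "cc \<equiv> mx.cz V"
abbreviation "tt \<equiv> mx.tz V"

lemma mix_gen_eq: "mix_gen D V w (lm V a) = tt (gen w) a"
 by (simp add: mix_gen_def mx.tz_def iota_def ik_simps)

lemma MoD: "f <: free_mod (carrier V) \<longleftrightarrow> (\<forall>w. w \<notin> carrier V --> f w = 0)"
 by (rule free_mem_finite) simp

lemma cc_out: "z <: \<Gamma> ==> w \<notin> carrier V ==> cc a z w = 0"
 using mx.cz_mem[of z a] by (simp add: MoD)

lemma cc_add [simp]: "y <: \<Gamma> ==> z <: \<Gamma> ==> cc a (y \<oplus>\<^bsub>\<Gamma>\<^esub> z) w = cc a y w + cc a z w"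
 by (simp add: mx.cz_add free_simps)

lemma cc_zero [simp]: "cc a \<zero>\<^bsub>\<Gamma>\<^esub> w = 0"
 by (simp add: free_simps)

lemma cc_tt: "f <: free_mod (carrier V) ==> b\<in>al V ==> cc a (tt f b) = (if a = b then f else (%w. 0))"
 using mx.cz_tz[of f b a] by (simp add: free_simps)

lemma tt_add: "a\<in>al V ==> f <: free_mod (carrier V) ==> g <: free_mod (carrier V) ==>
  tt (%w. f w + g w) a = tt f a \<oplus>\<^bsub>\<Gamma>\<^esub> tt g a"
 using mx.tz_add[of a f g] by (simp add: free_simps)

lemma cc_eqI: "y <: \<Gamma> ==> z <: \<Gamma> ==> (!!a w. a\<in>al V ==> w <: V ==> cc a y w = cc a z w) ==> y = z"
 using mx.cz_eqI[of y z] cc_out by (metis ext)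

definition fib_sub :: "_ => 'a => ('a => bit) set" where
 "fib_sub N a = {f\<in>carrier (free_mod (carrier V)). tt f a\<in>N}"

lemma fib_sub: "submodule N F2 \<Gamma> ==> a\<in>al V ==> submodule (fib_sub N a) F2 (free_mod (carrier V))"
 unfolding f2v.sub_iff[OF f2v_free] mx.T.sub_iff fib_sub_def
 using mx.tz_zero[of a] mx.tz_add[of a] mx.Mo.zero_closed mx.Mo.a_closed by auto

lemma fib_sub_sum_list:
 assumes "submodule N F2 \<Gamma>" "a\<in>al V" "!!s. s\<in>set xs ==> g s\<in>fib_sub N a"
 shows "(%w. \<Sum>s\<leftarrow>xs. g s w)\<in>fib_sub N a"
 using assms(3)
proof (induction xs)
 case Nil
 then show ?case using fib_sub[OF assms(1,2)] by (auto simp: f2v.sub_iff[OF f2v_free] free_simps)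
next
 case (Cons s xs)
 then show ?case using fib_sub[OF assms(1,2)] by (auto simp: f2v.sub_iff[OF f2v_free] free_simps)
qed

lemma sub_gen:
 assumes N: "submodule N F2 \<Gamma>" and a: "a\<in>al V" and S: "S \<subseteq> carrier V" "!!w. w\<in>S ==> tt (gen w) a\<in>N"
  and f: "f <: free_mod S"
 shows "tt f a\<in>N"
proof -
 have "f\<in>fib_sub N a"
  using f
 proof (induction rule: free_induct)
  case zero
  then show ?case using fib_sub[OF N a] by (auto simp: f2v.sub_iff[OF f2v_free] free_simps)
 next
  case (add s v)
  have "gen s\<in>fib_sub N a" using add S by (auto simp: fib_sub_def)
  then show ?case using fib_sub[OF N a] add by (auto simp: f2v.sub_iff[OF f2v_free] free_simps)
 qed
 then show ?thesis by (simp add: fib_sub_def)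
qed

section \<open>\<open>Mix\<close>, the swap and \<open>\<Sigma>\<close> in coordinates\<close>

definition MS where "MS = {z\<in>carrier \<Gamma>. ALL a:al V. ALL w:carrier V. cc a z w ~= 0 --> B w a = 1}"

lemma MS_sub: "submodule MS F2 \<Gamma>"
proof -
 have "B w a = 1" if "x\<in>MS" "y\<in>MS" "a\<in>al V" "w <: V" "cc a (x \<oplus>\<^bsub>\<Gamma>\<^esub> y) w ~= 0" for x y a w
 proof -
  have "cc a x w ~= 0 | cc a y w ~= 0" using that by (auto simp: MS_def)
  then show ?thesis using that by (auto simp: MS_def)
 qed
 then have "x \<oplus>\<^bsub>\<Gamma>\<^esub> y\<in>MS" if "x\<in>MS" "y\<in>MS" for x y using that unfolding MS_def by blast
 moreover have "\<zero>\<^bsub>\<Gamma>\<^esub>\<in>MS" by (simp add: MS_def)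
 moreover have "MS \<subseteq> carrier \<Gamma>" by (auto simp: MS_def)
 ultimately show ?thesis unfolding mx.T.sub_iff by blast
qed

lemma Mix_gens: "{mix_gen D V w h |w h. w <: V & h\<in>qhom D V & B w (h x) = 1} =
  {tt (gen w) a | w a. w <: V & a\<in>al V & B w a = 1}"
proof (rule equalityI; rule subsetI)
 fix y assume "y\<in>{mix_gen D V w h |w h. w <: V & h\<in>qhom D V & B w (h x) = 1}"
 then show "y\<in>{tt (gen w) a | w a. w <: V & a\<in>al V & B w a = 1}"
  unfolding mx.qhD using mix_gen_eq by force
next
 fix y assume "y\<in>{tt (gen w) a | w a. w <: V & a\<in>al V & B w a = 1}"
 then obtain w a where "y = mix_gen D V w (lm V a)" "w <: V" "a\<in>al V" "B w (lm V a x) = 1" using mix_gen_eq by auto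
 then show "y\<in>{mix_gen D V w h |w h. w <: V & h\<in>qhom D V & B w (h x) = 1}"
  unfolding mx.qhD by blast
qed

lemma gen_in_MS: "w <: V ==> a\<in>al V ==> B w a = 1 ==> tt (gen w) a\<in>MS"
 using cc_tt[of "gen w"] by (auto simp: MS_def) (auto simp: gen_def split: if_splits)

lemma Mix_eq_vspan: "Mix_sub D x V = vspan \<Gamma> {tt (gen w) a | w a. w <: V & a\<in>al V & B w a = 1}"
 unfolding Mix_sub_def PF_iso_eq Mix_gens ..

lemma Mix_eq: "Mix_sub D x V = MS"
proof
 let ?G = "{tt (gen w) a | w a. w <: V & a\<in>al V & B w a = 1}"
 show "Mix_sub D x V \<subseteq> MS"
  unfolding Mix_eq_vspan by (rule mx.T.vspan_least[OF MS_sub]) (use gen_in_MS in auto)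
 have G: "?G \<subseteq> carrier \<Gamma>" using gen_in_MS by (auto simp: MS_def)
 note S = mx.T.vspan_sub[OF G]
 show "MS \<subseteq> Mix_sub D x V"
  unfolding Mix_eq_vspan
 proof
  fix z assume z: "z\<in>MS"
  then have zc: "z <: \<Gamma>" by (simp add: MS_def)
  show "z\<in>vspan \<Gamma> ?G"
  proof (rule mx.sub_decomp[OF S zc])
   fix a assume a: "a\<in>al V"
   show "tt (cc a z) a\<in>vspan \<Gamma> ?G"
   proof (rule sub_gen[OF S a, of "{w\<in>carrier V. B w a = 1}"])
    show "tt (gen w) a\<in>vspan \<Gamma> ?G" if "w\<in>{w\<in>carrier V. B w a = 1}" for w
     by (rule subsetD[OF mx.T.vspan_incl]) (use that a in auto)
    have "{w. cc a z w ~= 0} \<subseteq> {w\<in>carrier V. B w a = 1}"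
    proof
     fix w assume w: "w\<in>{w. cc a z w ~= 0}"
     then have "w <: V" using cc_out[OF zc, of w a] by auto
     then show "w\<in>{w\<in>carrier V. B w a = 1}" using z a w by (simp add: MS_def)
    qed
    then show "cc a z <: free_mod {w\<in>carrier V. B w a = 1}"
     unfolding free_simps using finite_subset[OF _ V.finite_carrier, of "{w. cc a z w ~= 0}"] by blast
   qed auto
  qed
 qed
qed

lemma fob_Mix [simp]: "fob Mx V = \<Gamma>\<lparr>carrier := MS\<rparr>"
 unfolding Mix_def PF_iso_eq by (simp add: Mix_eq)

lemma MSc: "z\<in>MS ==> z <: \<Gamma>" by (simp add: MS_def)

text \<open>As the form is alternating, \<open>B w2 (w1 + w2)\<close> equals \<open>B w1 w2\<close>;
  and when this is 1 the sum \<open>w1 + w2\<close> cannot be zero.\<close>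

lemma pairs: "(w1, w2)\<in>mix_pairs D x V \<longleftrightarrow> w1 <: V & w2 <: V & w1 \<oplus> w2\<in>al V & B w2 (w1 \<oplus> w2) = 1"
proof (cases "w1 <: V & w2 <: V")
 case True
 then have b: "B w2 (w1 \<oplus> w2) = B w1 w2" using V.bil_sym by (simp add: V.bil_simps)
 have "w1 \<oplus> w2 ~= \<zero>" if "B w1 w2 = 1" using that True by auto
 then show ?thesis using True b by (auto simp: mix_pairs_def al_def)
qed (auto simp: mix_pairs_def)

lemma pair_elt_eq: "pair_elt D x V w1 w2 = tt (gen w2) (w1 \<oplus> w2)"
 unfolding pair_elt_def by (rule mix_gen_eq)

lemma shift_lin: "a\<in>al V ==> free_map (Some \<circ> (%w. w \<oplus> a))\<in>lin_maps (free_mod (carrier V)) (free_mod (carrier V))"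
 by (rule free_map_lin) (use alD in auto)

text \<open>The pair \<open>(w1, w2)\<close> is the point \<open>w2\<close> in the fibre over
  \<open>a = w1 + w2\<close>, and \<open>w2 + a = w1\<close>; so translation by \<open>a\<close> in
  each fibre has the required values.\<close>

lemma swap_ex: "\<exists>\<tau>. \<tau>\<in>lin_maps (fob Mx V) (fob Mx V) &
   (ALL (w1, w2):mix_pairs D x V. \<tau> (pair_elt D x V w1 w2) = pair_elt D x V w2 w1)"
proof -
 have "EX f:lin_maps \<Gamma> \<Gamma>. ALL m:carrier (free_mod (carrier V)). ALL h:qhom D V.
   f (tens (free_mod (carrier V)) (free_mod (qhom D V)) m (gen h)) =
   tens (free_mod (carrier V)) (free_mod (qhom D V)) (free_map (Some \<circ> (%w. w \<oplus> h x)) m) (gen h)"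
  unfolding mx.fobT Mo_mx
  by (rule tenfree_lift) (use mx.tenfree shift_lin in "auto simp: mx.qhD")
 then obtain f where f: "f\<in>lin_maps \<Gamma> \<Gamma>" "!!m a. m <: free_mod (carrier V) ==> a\<in>al V ==>
   f (tt m a) = tt (free_map (Some \<circ> (%w. w \<oplus> a)) m) a"
  unfolding mx.tz_def by (auto simp: mx.qhD)
 have g: "f (tt (gen w) a) = tt (gen (w \<oplus> a)) a" if "w <: V" "a\<in>al V" for w a
  using f(2)[of "gen w" a] that by (simp add: free_map_gen)
 have "f ` MS \<subseteq> MS"
 proof (rule image_subsetI)
  fix z assume "z\<in>MS"
  then have "z\<in>vspan \<Gamma> {tt (gen w) a | w a. w <: V & a\<in>al V & B w a = 1}" using Mix_eq Mix_eq_vspan by simp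
  then show "f z\<in>MS"
  proof (rule lin_vspan[OF mx.T.f2v_axioms mx.T.f2v_axioms f(1) _ MS_sub, rotated 2])
   show "f ` {tt (gen w) a | w a. w <: V & a\<in>al V & B w a = 1} \<subseteq> MS"
    using g gen_in_MS alD(1) by (auto simp: V.bil_simps)
  qed auto
 qed
 then have l: "f\<in>lin_maps (fob Mx V) (fob Mx V)" unfolding fob_Mix using f(1) MSc by (intro lin_sub) auto
 have e: "w2 \<oplus> (w1 \<oplus> w2) = w1" "w2 \<oplus> w1 = w1 \<oplus> w2" if "w1 <: V" "w2 <: V" for w1 w2
  using that by (simp_all add: V.ac)
 show ?thesis by (rule exI[of _ f]) (use l g in "auto simp: pairs pair_elt_eq e")
qed

abbreviation "\<sigma> \<equiv> swap_map D x V"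

lemma swap_lin: "\<sigma>\<in>lin_maps (\<Gamma>\<lparr>carrier := MS\<rparr>) (\<Gamma>\<lparr>carrier := MS\<rparr>)"
 and swap_pair: "(w1, w2)\<in>mix_pairs D x V ==> \<sigma> (pair_elt D x V w1 w2) = pair_elt D x V w2 w1"
 using someI_ex[OF swap_ex, folded swap_map_def] by auto

lemma swap_mem: "z\<in>MS ==> \<sigma> z\<in>MS"
 using lin_closed[OF swap_lin, of z] by simp

lemma swap_add: "y\<in>MS ==> z\<in>MS ==> \<sigma> (y \<oplus>\<^bsub>\<Gamma>\<^esub> z) = \<sigma> y \<oplus>\<^bsub>\<Gamma>\<^esub> \<sigma> z"
 using lin_add[OF swap_lin, of y z] by simp

lemma swap_zero: "\<sigma> \<zero>\<^bsub>\<Gamma>\<^esub> = \<zero>\<^bsub>\<Gamma>\<^esub>"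
 using lin_zero[OF mx.T.f2v_sub[OF MS_sub] mx.T.f2v_sub[OF MS_sub] swap_lin] by simp

lemma swap_gen: "w <: V ==> a\<in>al V ==> B w a = 1 ==> \<sigma> (tt (gen w) a) = tt (gen (w \<oplus> a)) a"
proof -
 assume w: "w <: V" "a\<in>al V" "B w a = 1"
 have e: "w \<oplus> a \<oplus> w = a" "w \<oplus> (w \<oplus> a) = a" using w alD[of a] by (simp_all add: V.ac)
 have "(w \<oplus> a, w)\<in>mix_pairs D x V" using w alD[of a] e by (simp add: pairs)
 from swap_pair[OF this] show ?thesis by (simp add: pair_elt_eq e)
qed

lemma swap_cc:
 assumes "z\<in>MS" "a\<in>al V" "w <: V"
 shows "cc a (\<sigma> z) w = cc a z (w \<oplus> a)"
proof -
 have G: "{tt (gen w) a | w a. w <: V & a\<in>al V & B w a = 1} \<subseteq> carrier \<Gamma>" by auto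
 have "z\<in>vspan \<Gamma> {tt (gen w) a | w a. w <: V & a\<in>al V & B w a = 1}" using assms(1) Mix_eq Mix_eq_vspan by simp
 then show ?thesis using G
 proof (induction rule: mx.T.vspan_induct)
  case zero
  then show ?case by (simp add: swap_zero)
 next
  case (add s z)
  then obtain u b where u: "s = tt (gen u) b" "u <: V" "b\<in>al V" "B u b = 1" by auto
  have m: "s\<in>MS" "z\<in>MS" using u gen_in_MS add Mix_eq Mix_eq_vspan by auto
  have bc: "b <: V" using alD u by simp
  have "cc a (\<sigma> s) w = cc a s (w \<oplus> a)"
  proof (cases "a = b")
   case True
   have "w = u \<oplus> b \<longleftrightarrow> w \<oplus> b = u" using V.add_eq_iff[OF assms(3) bc u(2)] V.a_comm[OF bc u(2)] by simp
   moreover have "cc b (\<sigma> s) w = gen (u \<oplus> b) w" "cc b s (w \<oplus> b) = gen u (w \<oplus> b)"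
    using u bc by (simp_all add: swap_gen cc_tt)
   ultimately show ?thesis unfolding True by (simp only: gen_def)
  qed (use u bc in "simp add: swap_gen cc_tt")
  then show ?case using add.IH m swap_mem[OF m(1)] swap_mem[OF m(2)] MSc by (simp add: swap_add)
 qed
qed

definition SS where "SS = {z\<in>MS. ALL a:al V. ALL w:carrier V. cc a z (w \<oplus> a) = cc a z w}"

lemma Sigma_eq: "Sigma_sub D x V = SS"
proof -
 have "\<sigma> z = z \<longleftrightarrow> (ALL a:al V. ALL w:carrier V. cc a z (w \<oplus> a) = cc a z w)" if z: "z\<in>MS" for z
  using cc_eqI[of "\<sigma> z" z] swap_cc[OF z] MSc[OF z] MSc[OF swap_mem[OF z]] by auto
 then show ?thesis unfolding Sigma_sub_def SS_def Mix_eq by auto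
qed

lemma SS_MS: "SS \<subseteq> MS" and SSc: "z\<in>SS ==> z <: \<Gamma>"
 by (auto simp: SS_def MS_def)

lemma SS_sub: "submodule SS F2 \<Gamma>"
 using MS_sub MSc alD unfolding mx.T.sub_iff by (auto simp: SS_def)

lemma fob_Sigma [simp]: "fob (Sg) V = \<Gamma>\<lparr>carrier := SS\<rparr>"
 unfolding Sigma_fun_def by (simp add: Sigma_eq)

lemma SSD: "z\<in>SS ==> a\<in>al V ==> w <: V ==> cc a z w ~= 0 ==> B w a = 1"
 "z\<in>SS ==> a\<in>al V ==> w <: V ==> cc a z (w \<oplus> a) = cc a z w"
 by (auto simp: SS_def MS_def)

section \<open>Cubes and vanishing of pairings\<close>

definition orth :: "'a => 'a list => bool" where
 "orth a ls \<longleftrightarrow> set ls \<subseteq> carrier V & (ALL l:set ls. B l a = 0)"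

definition cgen :: "nat => _ set" where
 "cgen d = {tt (fc V (a # ls) v) a | a v ls. a\<in>al V & v <: V & B v a = 1 & orth a ls & length ls = d}"

text \<open>Degree exactly \<open>d\<close> covers the lower degrees: \<open>B(-, a)\<close> is 1 on
  the support of the fibre over \<open>a\<close>, so further factors \<open>a\<close> can be
  appended to \<open>us\<close> without changing the pairing.\<close>

definition KS :: "nat => _ set" where
 "KS d = {z\<in>SS. ALL a:al V. \<forall>us. set us \<subseteq> carrier V --> length us = d --> pr V (cc a z) (mnl V us) = 0}"

lemma pr_add: "pr V (%w. f w + g w) F = pr V f F + pr V g F"
 by (simp add: pr_def distrib_right sum.distrib)

lemma pr_zero: "pr V (%w. 0) F = 0"
 by (simp add: pr_def)

lemma KS_sub: "submodule (KS d) F2 \<Gamma>"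
proof -
 have "cc a (y \<oplus>\<^bsub>\<Gamma>\<^esub> z) = (%w. cc a y w + cc a z w)" if "y <: \<Gamma>" "z <: \<Gamma>" for a y z
  using that by (auto simp: fun_eq_iff)
 then show ?thesis
  using SS_sub SSc unfolding mx.T.sub_iff by (auto simp: KS_def pr_add pr_zero free_simps)
qed

lemma fcm: "orth a ls ==> v <: V ==> a\<in>al V ==> fc V (a # ls) v <: free_mod (carrier V)"
 by (rule V.fc_mem) (use alD in "auto simp: orth_def")

text \<open>Directions orthogonal to \<open>a\<close> keep the cube inside
  \<open>B(-, a) = 1\<close>, and the direction \<open>a\<close> makes it invariant under
  translation by \<open>a\<close>.\<close>

lemma cube_SS:
 assumes a: "a\<in>al V" and v: "v <: V" "B v a = 1" and ls: "orth a ls"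
 shows "tt (fc V (a # ls) v) a\<in>SS"
proof -
 have ac: "a <: V" using alD a by simp
 have lsc: "set (a # ls) \<subseteq> carrier V" "set ls \<subseteq> carrier V" using ls ac by (auto simp: orth_def)
 have o: "B l a = 0" if "l\<in>set (a # ls)" for l using that ls ac by (auto simp: orth_def)
 have 1: "B w a = 1" if w: "w <: V" "fc V (a # ls) v w ~= 0" for w
 proof (rule ccontr)
  assume n: "B w a ~= 1"
  have "fc V (a # ls) v w = dd V (a # ls) (%u. 0) v"
   unfolding fc_def by (rule V.dd_cong_orth[OF lsc(1) v(1) ac o]) (use n v in "auto simp: gen_def")
  then show False using w(2) dd_zero[of V "a # ls" v] by simp
 qed
 have 2: "fc V (a # ls) v (w \<oplus> a) = fc V (a # ls) v w" if w: "w <: V" for w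
 proof -
  have e: "gen u (w \<oplus> a) = gen (u \<oplus> a) w" if "u <: V" for u
   using V.add_eq_iff[OF w ac that] V.a_comm[OF ac that] by (auto simp: gen_def)
  have "fc V (a # ls) v (w \<oplus> a) = dd V (a # ls) (%u. gen (u \<oplus> a) w) v"
   unfolding fc_def by (rule V.dd_cong[OF lsc(1) v(1) e])
  also have "\<dots> = dd V (a # ls) (%u. gen u w) (v \<oplus> a)" by (rule V.dd_shift[OF lsc(1) v(1) ac])
  also have "\<dots> = fc V (a # ls) v w" using v ac by (simp add: fc_def V.a_assoc add.commute)
  finally show ?thesis .
 qed
 show ?thesis using a fcm[OF ls v(1) a] 1 2 by (auto simp: SS_def MS_def cc_tt)
qed

text \<open>Together with \<open>a\<close> there are more than \<open>d\<close> directions, and so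
  many differences annihilate products of \<open>d\<close> forms.\<close>

lemma cube_KS:
 assumes a: "a\<in>al V" and v: "v <: V" "B v a = 1" and ls: "orth a ls" and d: "d \<le> length ls"
 shows "tt (fc V (a # ls) v) a\<in>KS d"
proof -
 have lsc: "set (a # ls) \<subseteq> carrier V" using ls alD a by (auto simp: orth_def)
 have "pr V (fc V (a # ls) v) (mnl V us) = 0" if "set us \<subseteq> carrier V" "length us = d" for us
  unfolding V.pr_fc[OF lsc v(1)] by (rule V.dd_mono_zero) (use that lsc v d in auto)
 then show ?thesis using cube_SS[OF a v ls] fcm[OF ls v(1) a] a by (auto simp: KS_def cc_tt pr_zero)
qed

text \<open>The generators from \<open>k_sub\<close>. Their directions are linearly independent,
  which a morphism may destroy; \<open>cgen\<close> admits dependent directions and is the set used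
  to prove functoriality.\<close>

definition kgen :: "nat => _ set" where
 "kgen d = {finsum (fob (Sg) V) (%z. upair_elt D x V (v \<oplus> z) (w \<oplus> z)) L | v w L.
    (v, w)\<in>mix_pairs D x V & submodule L F2 V & has_dim V L d & L \<subseteq> perp V (vspan V {v \<oplus> w})}"

lemma upair_eq:
 assumes "(v, w)\<in>mix_pairs D x V"
 shows "upair_elt D x V v w = tt (fc V [v \<oplus> w] v) (v \<oplus> w)"
proof -
 have m: "v <: V" "w <: V" "v \<oplus> w\<in>al V" using assms by (auto simp: pairs)
 have "fc V [v \<oplus> w] v = (%u. gen v u + gen w u)"
  using m by (simp add: fc_def fun_eq_iff)
 then show ?thesis
  unfolding upair_elt_def pair_elt_eq using m tt_add[of "v \<oplus> w" "gen v" "gen w"] by (simp add: V.a_comm mx.T.a_comm)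
qed

lemma finsum_cube:
 assumes p: "(v, w)\<in>mix_pairs D x V" and ls: "orth (v \<oplus> w) ls" "distinct ls"
  and ind: "!!b. b\<in>set ls ==> b \<notin> vspan V (set ls - {b})"
 shows "finsum (fob (Sg) V) (%z. upair_elt D x V (v \<oplus> z) (w \<oplus> z)) (vspan V (set ls)) =
  tt (fc V ((v \<oplus> w) # ls) v) (v \<oplus> w)"
proof -
 let ?a = "v \<oplus> w" and ?L = "vspan V (set ls)"
 have m: "v <: V" "w <: V" "?a\<in>al V" "B w ?a = 1" using p by (auto simp: pairs)
 have ac: "?a <: V" using m by simp
 have va: "B v ?a = 1" using m V.bil_sym[of v w] by (simp add: V.bil_simps)
 have lsc: "set ls \<subseteq> carrier V" using ls by (auto simp: orth_def)
 have "?L \<subseteq> perp V {?a}"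
  by (rule V.vspan_least) (use lsc ls(1) ac in "auto simp: V.sub_iff perp_def orth_def V.bil_simps")
 then have L: "z <: V" "B z ?a = 0" if "z\<in>?L" for z using that by (auto simp: perp_def)
 have fin: "finite ?L" using V.finite_vspan lsc by simp
 have up: "upair_elt D x V (v \<oplus> z) (w \<oplus> z) = tt (fc V [?a] (v \<oplus> z)) ?a" if z: "z\<in>?L" for z
 proof -
  have e: "v \<oplus> z \<oplus> (w \<oplus> z) = ?a" using L(1)[OF z] m by (simp add: V.ac)
  have "(v \<oplus> z, w \<oplus> z)\<in>mix_pairs D x V" using L[OF z] m e by (simp add: pairs V.bil_simps)
  from upair_eq[OF this] show ?thesis by (simp add: e)
 qed
 have fm: "fc V [?a] (v \<oplus> z) <: free_mod (carrier V)" if "z\<in>?L" for z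
  by (rule fcm) (use L[OF that] m in "auto simp: orth_def")
 have mem: "tt (fc V [?a] (v \<oplus> z)) ?a\<in>SS" if "z\<in>?L" for z
  by (rule cube_SS) (use L[OF that] m va in "auto simp: orth_def V.bil_simps")
 interpret S: f2v "\<Gamma>\<lparr>carrier := SS\<rparr>" by (rule mx.T.f2v_sub[OF SS_sub])
 have "finsum (fob (Sg) V) (%z. upair_elt D x V (v \<oplus> z) (w \<oplus> z)) ?L =
   finsum (\<Gamma>\<lparr>carrier := SS\<rparr>) (%z. tt (fc V [?a] (v \<oplus> z)) ?a) ?L"
  unfolding fob_Sigma by (rule S.finsum_cong') (use up mem in auto)
 also have "\<dots> = finsum \<Gamma> (%z. tt (fc V [?a] (v \<oplus> z)) ?a) ?L"
  by (rule mx.T.finsum_sub[OF SS_sub]) (use mem in auto)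
 also have "\<dots> = tt (fc V (?a # ls) v) ?a"
 proof (rule cc_eqI)
  show "finsum \<Gamma> (%z. tt (fc V [?a] (v \<oplus> z)) ?a) ?L <: \<Gamma>"
   by (rule mx.T.finsum_closed) (use mem SSc in auto)
  show "tt (fc V (?a # ls) v) ?a <: \<Gamma>" using cube_SS[OF m(3,1) va ls(1)] SSc by simp
  fix b u assume b: "b\<in>al V" and u: "u <: V"
  have fs: "finsum (free_mod (carrier V)) g I u = (\<Sum>i\<in>I. g i u)" if "finite I" "!!i. i\<in>I ==> g i <: free_mod (carrier V)" for g and I :: "'a set"
   using that
  proof (induction I rule: finite_induct)
   case (insert i I)
   have "g\<in>I \<rightarrow> carrier (free_mod (carrier V))" using insert by auto
   then show ?case using insert mx.Mo.finsum_insert[of I i g] by (simp add: free_simps)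
  qed (use mx.Mo.finsum_empty[of g] in "simp add: free_simps")
  have "cc b (finsum \<Gamma> (%z. tt (fc V [?a] (v \<oplus> z)) ?a) ?L) u = (\<Sum>z\<in>?L. cc b (tt (fc V [?a] (v \<oplus> z)) ?a) u)"
   using mx.cz_finsum[of ?L "%z. tt (fc V [?a] (v \<oplus> z)) ?a" b] mem SSc
    fs[OF fin, of "%z. cc b (tt (fc V [?a] (v \<oplus> z)) ?a)"] mx.cz_mem by simp
  also have "\<dots> = (if b = ?a then (\<Sum>z\<in>?L. fc V [?a] (v \<oplus> z) u) else 0)"
   using fm m(3) by (simp add: cc_tt)
  also have "(\<Sum>z\<in>?L. fc V [?a] (v \<oplus> z) u) = dd V ls (%y. fc V [?a] y u) v"
   by (rule V.vspan_sum[OF lsc ls(2) ind m(1)])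
  also have "\<dots> = fc V (?a # ls) v u"
   using V.dd_shift[OF lsc m(1) ac, of "%y. gen y u"] by (simp add: fc_def dd_add)
  finally show "cc b (finsum \<Gamma> (%z. tt (fc V [?a] (v \<oplus> z)) ?a) ?L) u = cc b (tt (fc V (?a # ls) v) ?a) u"
   using fcm[OF ls(1) m(1,3)] m(3) by (simp add: cc_tt)
 qed
 finally show ?thesis .
qed

lemma kgen_cgen: "kgen d \<subseteq> cgen d"
proof
 fix y assume "y\<in>kgen d"
 then obtain v w L where y: "y = finsum (fob (Sg) V) (%z. upair_elt D x V (v \<oplus> z) (w \<oplus> z)) L"
  and p: "(v, w)\<in>mix_pairs D x V" and L: "has_dim V L d" "L \<subseteq> perp V (vspan V {v \<oplus> w})" unfolding kgen_def by auto
 have m: "v <: V" "w <: V" "v \<oplus> w\<in>al V" "B w (v \<oplus> w) = 1" using p by (auto simp: pairs)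
 have va: "B v (v \<oplus> w) = 1" using m V.bil_sym[of v w] by (simp add: V.bil_simps)
 obtain Bs where Bs: "finite Bs" "card Bs = d" "Bs \<subseteq> carrier V" "vspan V Bs = L" "!!b. b\<in>Bs ==> b \<notin> vspan V (Bs - {b})"
  using L(1) unfolding has_dim_def by auto
 obtain ls where ls: "set ls = Bs" "distinct ls" using finite_distinct_list[OF Bs(1)] by auto
 have "v \<oplus> w\<in>vspan V {v \<oplus> w}" using V.vspan_incl by auto
 then have o: "orth (v \<oplus> w) ls"
  using L(2) ls Bs(3,4) V.vspan_incl[of Bs] unfolding orth_def perp_def by blast
 have "y = tt (fc V ((v \<oplus> w) # ls) v) (v \<oplus> w)"
  unfolding y Bs(4)[symmetric] ls(1)[symmetric] by (rule finsum_cube[OF p o ls(2)]) (use Bs ls in auto)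
 moreover have "length ls = d" using ls Bs distinct_card by metis
 ultimately show "y\<in>cgen d" using m va o unfolding cgen_def by blast
qed

lemma cgen_KS: "cgen d \<subseteq> KS d"
 unfolding cgen_def using cube_KS by auto

lemma KSc: "KS d \<subseteq> carrier \<Gamma>"
 using SSc by (auto simp: KS_def)

lemma kgen_carrier: "kgen d \<subseteq> carrier \<Gamma>" and cgen_carrier: "cgen d \<subseteq> carrier \<Gamma>"
 using kgen_cgen cgen_KS KSc by blast+

section \<open>Taylor expansion of invariant elements and generation by cubes\<close>

lemma dual_start: "a\<in>al V ==> c <: V ==> B a c = 1 ==> dual V [(a, c), (c, a)]"
 using alD V.bil_sym[of a c] by simp

lemma dual_append_orth: "dual V (ps @ qs) ==> (b, c)\<in>set ps ==> (b', c')\<in>set qs ==> B b c' = 0 & B b' c = 0"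
proof (induction ps)
 case (Cons p ps)
 show ?case
 proof (cases "(b, c) = p")
  case True
  have "(b', c')\<in>set (ps @ qs)" using Cons.prems(3) by simp
  then show ?thesis using Cons.prems(1) True by fastforce
 next
  case False
  then show ?thesis using Cons by (cases p) auto
 qed
qed simp

lemma dual_append: "dual V (ps @ qs) ==> dual V ps"
 by (induction ps) auto

lemma xp_append: "dual V (ps @ qs) ==> w <: V ==> dual V qs ==> xp V (ps @ qs) w = xp V ps w \<oplus> xp V qs w"
proof (induction ps)
 case (Cons p ps)
 obtain b c where p: "p = (b, c)" by force
 show ?case using Cons p V.xp_mem[of ps w] dual_append[of ps qs] V.xp_mem[of qs w] by (simp add: V.a_assoc)
qed (use V.xp_mem in simp)

text \<open>The points over \<open>a\<close> come in pairs \<open>{w, w + a}\<close>, and \<open>B w c = 1\<close> selects one point of each.\<close>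

lemma half_sum:
 assumes z: "z\<in>SS" and a: "a\<in>al V" and c: "c <: V" "B a c = 1"
 shows "(\<Sum>w\<in>carrier V. cc a z w * G w) = (\<Sum>w\<in>carrier V. B w c * cc a z w * (G w + G (w \<oplus> a)))"
proof -
 let ?f = "cc a z"
 have ac: "a <: V" using alD a by simp
 have bij: "bij_betw (%w. w \<oplus> a) (carrier V) (carrier V)"
  by (rule bij_betw_byWitness[of _ "%w. w \<oplus> a"]) (use ac in "auto simp: V.a_assoc")
 have "(\<Sum>w\<in>carrier V. B w c * ?f w * G (w \<oplus> a)) = (\<Sum>w\<in>carrier V. (B w c + 1) * ?f w * G w)"
  by (subst sum.reindex_bij_betw[OF bij, symmetric])
   (use ac c in "auto simp: V.a_assoc V.bil_simps SSD(2)[OF z a] intro!: sum.cong")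
 then have "(\<Sum>w\<in>carrier V. B w c * ?f w * (G w + G (w \<oplus> a))) = (\<Sum>w\<in>carrier V. B w c * ?f w * G w + (B w c + 1) * ?f w * G w)"
  by (simp add: distrib_left sum.distrib)
 also have "\<dots> = (\<Sum>w\<in>carrier V. ?f w * G w)" by (rule sum.cong) (auto simp: algebra_simps)
 finally show ?thesis by simp
qed

text \<open>Taylor expansion; the coefficients are pairings with monomials.\<close>

lemma SS_expand:
 assumes z: "z\<in>SS" and a: "a\<in>al V" and c: "c <: V" "B a c = 1"
  and ps: "dual V (ps @ [(a, c), (c, a)])" "!!v. v <: V ==> xp V (ps @ [(a, c), (c, a)]) v = v"
  and u: "u <: V"
 shows "cc a z u = (\<Sum>S\<leftarrow>subseqs ps. pr V (cc a z) (mnl V (c # map snd S)) * fc V (a # map fst S) c u)"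
proof -
 let ?f = "cc a z"
 have ac: "a <: V" using alD a by simp
 have dps: "dual V ps" by (rule dual_append[OF ps(1)])
 have sm: "set (map fst S) \<subseteq> carrier V" "set (map snd S) \<subseteq> carrier V" "ALL y:set (map snd S). B a y = 0" if "S\<in>set (subseqs ps)" for S
 proof -
  have "set S \<subseteq> set ps" using that subseqs_powset[of ps] by auto
  then show "set (map fst S) \<subseteq> carrier V" "set (map snd S) \<subseteq> carrier V" "ALL y:set (map snd S). B a y = 0"
   using V.dual_mem[OF dps] dual_append_orth[OF ps(1), of _ _ a c] by force+
 qed
 note half = half_sum[OF z a c]
 \<comment> \<open>Both \<open>B w a\<close> and \<open>B w c\<close> are 1 for such
   \<open>w\<close>, so its component in the plane of \<open>a\<close> and \<open>c\<close> is
   \<open>a + c\<close>, and the expansion can be based at \<open>c + a\<close>.\<close>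
 have pt: "w = c \<oplus> a \<oplus> xp V ps w" if w: "w <: V" "?f w ~= 0" "B w c = 1" for w
 proof -
  have wa: "B w a = 1" using SSD(1)[OF z a w(1,2)] .
  have "w = xp V ps w \<oplus> xp V [(a, c), (c, a)] w"
   using ps(2)[OF w(1)] xp_append[OF ps(1) w(1) dual_start[OF a c]] by simp
  also have "xp V [(a, c), (c, a)] w = a \<oplus> c" using wa w(3) ac c by simp
  finally show ?thesis using ac c V.xp_mem[OF dps w(1)] by (simp add: V.ac)
 qed
 \<comment> \<open>A cube with direction \<open>a\<close> does not change when its base point moves
   by \<open>a\<close>, which brings the base point from \<open>c + a\<close> to
   \<open>c\<close>.\<close>
 have aS: "fc V (a # map fst S) (c \<oplus> a) u = fc V (a # map fst S) c u" for S
  using ac c by (simp add: fc_def V.a_assoc add.commute)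
 have "?f u = (\<Sum>w\<in>carrier V. ?f w * gen w u)"
 proof -
  have "(\<Sum>w\<in>carrier V. ?f w * gen w u) = (\<Sum>w\<in>carrier V. if w = u then ?f u else 0)"
   by (rule sum.cong) (auto simp: gen_def)
  then show ?thesis using u by simp
 qed
 \<comment> \<open>\<open>half_sum\<close> groups \<open>gen w\<close> with
   \<open>gen (w + a)\<close>, and this sum is the cube at \<open>w\<close> with the single
   direction \<open>a\<close>.\<close>
 also have "\<dots> = (\<Sum>w\<in>carrier V. B w c * ?f w * fc V [a] w u)"
  unfolding half by (simp add: fc_def)
 also have "\<dots> = (\<Sum>w\<in>carrier V. B w c * ?f w * (\<Sum>S\<leftarrow>subseqs ps. mnl V (map snd S) w * dd V (map fst S) (%y. fc V [a] y u) (c \<oplus> a)))"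
 proof (rule sum.cong[OF refl])
  fix w assume w: "w <: V"
  show "B w c * ?f w * fc V [a] w u = B w c * ?f w * (\<Sum>S\<leftarrow>subseqs ps. mnl V (map snd S) w * dd V (map fst S) (%y. fc V [a] y u) (c \<oplus> a))"
  proof (cases "B w c = 0 | ?f w = 0")
   case False
   then have "w = c \<oplus> a \<oplus> xp V ps w" using pt[OF w] by simp
   then show ?thesis using V.taylor[OF dps, of "c \<oplus> a" w "%y. fc V [a] y u"] ac c w by simp
  qed auto
 qed
 also have "\<dots> = (\<Sum>w\<in>carrier V. \<Sum>S\<leftarrow>subseqs ps. B w c * ?f w * (mnl V (map snd S) w * fc V (a # map fst S) c u))"
 proof (rule sum.cong[OF refl])
  fix w assume w: "w <: V"
  have "dd V (map fst S) (%y. fc V [a] y u) (c \<oplus> a) = fc V (a # map fst S) c u" if "S\<in>set (subseqs ps)" for S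
   using V.dd_shift[OF sm(1)[OF that], of "c \<oplus> a" a "%y. gen y u"] ac c aS[of S] by (simp add: fc_def dd_add)
  then have "map (%S. mnl V (map snd S) w * dd V (map fst S) (%y. fc V [a] y u) (c \<oplus> a)) (subseqs ps) =
   map (%S. mnl V (map snd S) w * fc V (a # map fst S) c u) (subseqs ps)" by simp
  then show "B w c * ?f w * (\<Sum>S\<leftarrow>subseqs ps. mnl V (map snd S) w * dd V (map fst S) (%y. fc V [a] y u) (c \<oplus> a)) =
   (\<Sum>S\<leftarrow>subseqs ps. B w c * ?f w * (mnl V (map snd S) w * fc V (a # map fst S) c u))"
   by (simp only: sum_list_const_mult)
 qed
 also have "\<dots> = (\<Sum>S\<leftarrow>subseqs ps. \<Sum>w\<in>carrier V. B w c * ?f w * (mnl V (map snd S) w * fc V (a # map fst S) c u))"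
 proof -
  have "(\<Sum>w\<in>W. \<Sum>S\<leftarrow>xs. g w S) = (\<Sum>S\<leftarrow>xs. \<Sum>w\<in>W. g w S)" for W :: "'a set" and xs and g :: "'a => ('a \<times> 'a) list => bit"
   by (induction xs) (simp_all add: sum.distrib)
  then show ?thesis .
 qed
 also have "\<dots> = (\<Sum>S\<leftarrow>subseqs ps. pr V ?f (mnl V (c # map snd S)) * fc V (a # map fst S) c u)"
  by (simp add: pr_def sum_distrib_right mult.assoc mult.left_commute)
 finally show ?thesis .
qed

text \<open>The partner of \<open>b\<close> pairs to 1 with \<open>b\<close> and to 0 with the other
  first components, hence with their span.\<close>

lemma dual_indep:
 assumes "dual V S" "b\<in>fst ` set S"
 shows "b \<notin> vspan V (fst ` set S - {b})"
proof
 assume b: "b\<in>vspan V (fst ` set S - {b})"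
 obtain c where c: "(b, c)\<in>set S" using assms(2) by auto
 have orth: "dual V S ==> (b, c)\<in>set S ==> (b', c')\<in>set S ==> b' ~= b ==> B b' c = 0" for b' c'
  by (induction S) auto
 have one: "dual V S ==> (b, c)\<in>set S ==> B b c = 1"
  by (induction S) auto
 have m: "b <: V" "c <: V" using V.dual_mem[OF assms(1) c] by auto
 have "vspan V (fst ` set S - {b}) \<subseteq> {v\<in>carrier V. B v c = 0}"
 proof (rule V.vspan_least)
  show "submodule {v\<in>carrier V. B v c = 0} F2 V" using m by (auto simp: V.sub_iff V.bil_simps)
  show "fst ` set S - {b} \<subseteq> {v\<in>carrier V. B v c = 0}" using orth[OF assms(1) c] V.dual_mem[OF assms(1)] by auto
 qed
 then show False using b one[OF assms(1) c] by auto
qed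

lemma dual_distinct: "dual V S ==> distinct (map fst S)"
proof (induction S)
 case (Cons p S)
 obtain b c where p: "p = (b, c)" by force
 show ?case using Cons p by fastforce
qed simp

lemma dual_subseq: "dual V ps ==> S\<in>set (subseqs ps) ==> dual V S & set S \<subseteq> set ps"
proof (induction ps arbitrary: S)
 case (Cons p ps)
 obtain b c where p: "p = (b, c)" by force
 from Cons.prems(2) consider S' where "S = p # S'" "S'\<in>set (subseqs ps)" | "S\<in>set (subseqs ps)"
  by (auto simp: Let_def)
 then show ?case
 proof cases
  case 1
  then have "dual V S'" "set S' \<subseteq> set ps" using Cons by (auto simp: p)
  then show ?thesis using 1 Cons.prems(1) p by auto
 next
  case 2
  then show ?thesis using Cons by (auto simp: p)
 qed
qed simp

lemma dual_cube_kgen0: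
 assumes a: "a\<in>al V" and S: "dual V S" "!!b c. (b, c)\<in>set S ==> B b a = 0" and v: "v <: V" "B v a = 1"
 shows "tt (fc V (a # map fst S) v) a\<in>kgen (length S)"
proof -
 let ?ls = "map fst S"
 have ac: "a <: V" using alD a by simp
 have o: "orth a ?ls" using S V.dual_mem[OF S(1)] unfolding orth_def by force
 define w where "w = v \<oplus> a"
 have w: "w <: V" "v \<oplus> w = a" using v ac by (auto simp: w_def)
 have p: "(v, w)\<in>mix_pairs D x V" unfolding pairs w(2) using w(1) v a ac by (simp add: w_def V.bil_simps)
 have lsc: "set ?ls \<subseteq> carrier V" using o by (simp add: orth_def)
 have ind: "b \<notin> vspan V (set ?ls - {b})" if "b\<in>set ?ls" for b using dual_indep[OF S(1), of b] that by simp
 have "tt (fc V (a # ?ls) v) a = finsum (fob (Sg) V) (%z. upair_elt D x V (v \<oplus> z) (w \<oplus> z)) (vspan V (set ?ls))"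
  using finsum_cube[OF p _ dual_distinct[OF S(1)] ind] o w(2) by simp
 moreover have "submodule (vspan V (set ?ls)) F2 V" by (rule V.vspan_sub[OF lsc])
 moreover have "has_dim V (vspan V (set ?ls)) (length S)"
  unfolding has_dim_def using ind lsc distinct_card[OF dual_distinct[OF S(1)]] by (intro exI[of _ "set ?ls"]) auto
 moreover have "vspan V (set ?ls) \<subseteq> perp V (vspan V {v \<oplus> w})"
 proof (rule V.vspan_least)
  have sp: "vspan V {a} \<subseteq> carrier V" using V.vspan_carrier[of "{a}"] ac by simp
  then show "submodule (perp V (vspan V {v \<oplus> w})) F2 V"
   unfolding w(2) by (auto simp: V.sub_iff perp_def V.bil_simps subset_iff)
  have "vspan V {a} \<subseteq> {y\<in>carrier V. B l y = 0}" if "l\<in>set ?ls" for l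
   by (rule V.vspan_least) (use that o ac in "auto simp: V.sub_iff V.bil_simps orth_def")
  then show "set ?ls \<subseteq> perp V (vspan V {v \<oplus> w})" unfolding w(2) perp_def using lsc by auto
 qed
 ultimately show ?thesis using p unfolding kgen_def by blast
qed

text \<open>A cube with too many directions is the sum of two opposite faces, which are cubes with
  one direction less; the induction is on the excess over \<open>d\<close>.\<close>

lemma dual_cube_kgen:
 assumes a: "a\<in>al V"
 shows "dual V S ==> (!!b c. (b, c)\<in>set S ==> B b a = 0) ==> v <: V ==> B v a = 1 ==> d \<le> length S ==>
  fc V (a # map fst S) v\<in>fib_sub (vspan \<Gamma> (kgen d)) a"
proof (induction "length S - d" arbitrary: S v)
 case 0
 then have "length S = d" by simp
 then have "tt (fc V (a # map fst S) v) a\<in>vspan \<Gamma> (kgen d)"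
  using dual_cube_kgen0[OF a 0(2,3,4,5)] mx.T.vspan_incl[of "kgen d"] by auto
 moreover have "fc V (a # map fst S) v <: free_mod (carrier V)"
  by (rule V.fc_mem) (use 0(4) alD a V.dual_mem[OF 0(2)] in force)+
 ultimately show ?case by (simp add: fib_sub_def)
next
 case (Suc n)
 then obtain p S' where S: "S = p # S'" by (cases S) auto
 obtain b c where p: "p = (b, c)" by force
 have ac: "a <: V" using alD a by simp
 have d: "dual V S'" "b <: V" "B b a = 0" using Suc.prems(1,2) S p by auto
 have o: "B b' a = 0" if "(b', c')\<in>set S'" for b' c' using Suc.prems(2)[of b' c'] that S by simp
 have n: "n = length S' - d" "d \<le> length S'" using Suc.hyps(2) S by auto
 have vb: "v \<oplus> b <: V" "B (v \<oplus> b) a = 1" using Suc.prems d ac by (simp_all add: V.bil_simps)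
 have "fc V (a # map fst S') y\<in>fib_sub (vspan \<Gamma> (kgen d)) a" if "y <: V" "B y a = 1" for y
  by (rule Suc.hyps(1)[OF n(1) d(1) _ that n(2)]) (use o in auto)
 from this[OF Suc.prems(3,4)] this[OF vb] have "(%w. fc V (a # map fst S') v w + fc V (a # map fst S') (v \<oplus> b) w)\<in>fib_sub (vspan \<Gamma> (kgen d)) a"
  using fib_sub[OF mx.T.vspan_sub[OF kgen_carrier] a, of d] by (auto simp: f2v.sub_iff[OF f2v_free] free_simps)
 moreover have "fc V (a # map fst S) v = (%w. fc V (a # map fst S') v w + fc V (a # map fst S') (v \<oplus> b) w)"
 proof -
  have sc: "set (map fst S') \<subseteq> carrier V" using V.dual_mem[OF d(1)] by force
  have "fc V (a # map fst S) v w = fc V (b # a # map fst S') v w" for w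
   unfolding fc_def S p using V.dd_comm[OF sc Suc.prems(3) ac d(2)] by simp
  then show ?thesis by (simp add: V.fc_Cons[of b] fun_eq_iff)
 qed
 ultimately show ?case by simp
qed

text \<open>In the expansion \<open>SS_expand\<close> the terms with at least \<open>d\<close>
  directions besides \<open>a\<close> are in the span anyway; the coefficients of the others are
  pairings of degree at most \<open>d\<close> and vanish. The hypothesis \<open>h\<close> asks only
  for the pairings that occur there, which is what makes its contrapositive \<open>not_KS\<close>
  strong.\<close>

lemma coeff_zero_kgen:
 assumes z: "z\<in>SS" and
  h: "!!a c us. a\<in>al V ==> c <: V ==> B a c = 1 ==> orth a us ==> Suc (length us) = d ==> pr V (cc a z) (mnl V (c # us)) = 0"
 shows "z\<in>vspan \<Gamma> (kgen d)"
proof (rule mx.sub_decomp[OF mx.T.vspan_sub[OF kgen_carrier] SSc[OF z]])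
 fix a assume a: "a\<in>al V"
 have ac: "a <: V" "a ~= \<zero>" using alD a by simp_all
 obtain c where c: "c <: V" "B a c = 1" using V.nondeg_ex[OF ac] by auto
 then have ca: "B c a = 1" using V.bil_sym[of a c] ac by simp
 \<comment> \<open>Starting with the hyperbolic pair in both orders forces all vectors in
   \<open>ps\<close> to be orthogonal to both \<open>a\<close> and \<open>c\<close>.\<close>
 obtain ps where ps: "dual V (ps @ [(a, c), (c, a)])" "!!v. v <: V ==> xp V (ps @ [(a, c), (c, a)]) v = v"
  using V.dual_extend[OF dual_start[OF a c]] by auto
 let ?N = "vspan \<Gamma> (kgen d)"
 note N = mx.T.vspan_sub[OF kgen_carrier, of d]
 have trm: "(%u. pr V (cc a z) (mnl V (c # map snd S)) * fc V (a # map fst S) c u)\<in>fib_sub ?N a" if S: "S\<in>set (subseqs ps)" for S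
 proof -
  have dS: "dual V S" "set S \<subseteq> set ps" using dual_subseq[OF dual_append[OF ps(1)] S] by auto
  have o: "B b a = 0" "B a c' = 0" if "(b, c')\<in>set S" for b c'
   using dual_append_orth[OF ps(1), of b c' c a] dual_append_orth[OF ps(1), of b c' a c] that dS(2) by auto
  show ?thesis
  proof (cases "d \<le> length S")
   case True
   have "fc V (a # map fst S) c\<in>fib_sub ?N a" by (rule dual_cube_kgen[OF a dS(1) o(1) c(1) ca True])
   moreover have "(%u. 0)\<in>fib_sub ?N a" using fib_sub[OF N a] by (simp add: f2v.sub_iff[OF f2v_free] free_simps)
   ultimately show ?thesis by (cases "pr V (cc a z) (mnl V (c # map snd S)) = 0") simp_all
  next
   case False
   \<comment> \<open>The coefficient has degree \<open>Suc (length S)\<close>, possibly less than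
     \<open>d\<close>. It is padded with factors \<open>B(-, a)\<close>, which are 1 on the support
     and orthogonal to \<open>a\<close> as the hypothesis demands.\<close>
   let ?us = "map snd S @ replicate (d - Suc (length S)) a"
   have us: "orth a ?us"
    unfolding orth_def
   proof (intro conjI ballI)
    show "set ?us \<subseteq> carrier V" using V.dual_mem[OF dS(1)] ac by auto
    fix l assume "l\<in>set ?us"
    then consider b where "(b, l)\<in>set S" | "l = a" by (auto split: if_splits)
    then show "B l a = 0"
     using o(2) V.dual_mem[OF dS(1)] ac V.bil_sym by cases (metis, simp)
   qed
   have "pr V (cc a z) (mnl V (c # ?us)) = 0" by (rule h[OF a c us]) (use False in simp)
   moreover have "mnl V (replicate k a) w = 1" if "B w a = 1" for k w using that by (induction k) auto
   then have "cc a z w * mnl V (c # ?us) w = cc a z w * mnl V (c # map snd S) w" if "w <: V" for w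
    using SSD(1)[OF z a that] by (cases "cc a z w = 0") simp_all
   then have "pr V (cc a z) (mnl V (c # ?us)) = pr V (cc a z) (mnl V (c # map snd S))"
    unfolding pr_def by (rule sum.cong[OF refl])
   ultimately have "pr V (cc a z) (mnl V (c # map snd S)) = 0" by simp
   then show ?thesis using fib_sub[OF N a] by (simp add: f2v.sub_iff[OF f2v_free] free_simps)
  qed
 qed
 have "(%u. \<Sum>S\<leftarrow>subseqs ps. pr V (cc a z) (mnl V (c # map snd S)) * fc V (a # map fst S) c u)\<in>fib_sub ?N a"
  by (rule fib_sub_sum_list[OF N a trm])
 moreover have "(\<Sum>S\<leftarrow>subseqs ps. pr V (cc a z) (mnl V (c # map snd S)) * fc V (a # map fst S) c u) = cc a z u" for u
 proof (cases "u <: V")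
  case True
  then show ?thesis using SS_expand[OF z a c ps] by simp
 next
  case False
  have "(%u. \<Sum>S\<leftarrow>subseqs ps. pr V (cc a z) (mnl V (c # map snd S)) * fc V (a # map fst S) c u) <: free_mod (carrier V)"
   using calculation by (simp add: fib_sub_def)
  then show ?thesis using False cc_out[OF SSc[OF z]] by (simp add: MoD)
 qed
 ultimately show "tt (cc a z) a\<in>?N" by (simp add: fib_sub_def)
qed

lemma KS_eq_kgen: "KS d = vspan \<Gamma> (kgen d)"
proof
 show "KS d \<subseteq> vspan \<Gamma> (kgen d)"
  using coeff_zero_kgen by (auto simp: KS_def orth_def)
 show "vspan \<Gamma> (kgen d) \<subseteq> KS d"
  by (rule mx.T.vspan_least[OF KS_sub]) (use kgen_cgen cgen_KS in blast)
qed

lemma KS_eq_cgen: "KS d = vspan \<Gamma> (cgen d)"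
proof
 show "KS d \<subseteq> vspan \<Gamma> (cgen d)" unfolding KS_eq_kgen by (rule mx.T.vspan_mono[OF kgen_cgen])
 show "vspan \<Gamma> (cgen d) \<subseteq> KS d" by (rule mx.T.vspan_least[OF KS_sub cgen_KS])
qed

lemma KS_SS: "KS d \<subseteq> SS"
 by (auto simp: KS_def)

lemma k_sub_eq: "ks d V = KS d"
proof -
 have "ks d V = vspan (fob (Sg) V) (kgen d)" unfolding k_sub_def kgen_def ..
 also have "\<dots> = vspan \<Gamma> (kgen d)"
  unfolding fob_Sigma by (rule mx.T.vspan_in_sub[OF SS_sub]) (use kgen_cgen cgen_KS KS_SS in blast)
 finally show ?thesis using KS_eq_kgen by simp
qed

text \<open>For \<open>d = 0\<close> the condition \<open>Suc (length us) = d\<close> in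
  \<open>coeff_zero_kgen\<close> never holds, so no coefficient has to vanish.\<close>

lemma KS_0: "KS 0 = SS"
proof -
 have "SS \<subseteq> vspan \<Gamma> (kgen 0)" using coeff_zero_kgen[of _ 0] by auto
 then show ?thesis using KS_eq_kgen[of 0] KS_SS[of 0] by blast
qed

lemma KS_Suc: "KS (Suc d) \<subseteq> KS d"
 unfolding KS_eq_cgen[of "Suc d"]
 by (rule mx.T.vspan_least[OF KS_sub]) (auto simp: cgen_def intro!: cube_KS)

text \<open>Every Taylor coefficient is a pairing of some degree, so an element of all
  \<open>KS d\<close> has none.\<close>

lemma KS_inter:
 assumes "!!d. z\<in>KS d"
 shows "z = \<zero>\<^bsub>\<Gamma>\<^esub>"
proof (rule cc_eqI)
 have z: "z\<in>SS" using assms KS_SS by blast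
 then show "z <: \<Gamma>" by (rule SSc)
 show "\<zero>\<^bsub>\<Gamma>\<^esub> <: \<Gamma>" by simp
 fix a u assume a: "a\<in>al V" and u: "u <: V"
 have ac: "a <: V" "a ~= \<zero>" using alD a by simp_all
 obtain c where c: "c <: V" "B a c = 1" using V.nondeg_ex[OF ac] by auto
 obtain ps where ps: "dual V (ps @ [(a, c), (c, a)])" "!!v. v <: V ==> xp V (ps @ [(a, c), (c, a)]) v = v"
  using V.dual_extend[OF dual_start[OF a c]] by auto
 have "pr V (cc a z) (mnl V (c # map snd S)) = 0" if "S\<in>set (subseqs ps)" for S
 proof -
  have "set (c # map snd S) \<subseteq> carrier V"
   using dual_subseq[OF dual_append[OF ps(1)] that] V.dual_mem[of S] c by auto
  then show ?thesis using assms[of "length (c # map snd S)"] a unfolding KS_def by blast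
 qed
 then have "map (%S. pr V (cc a z) (mnl V (c # map snd S)) * fc V (a # map fst S) c u) (subseqs ps) = map (%S. 0) (subseqs ps)"
  by simp
 then have "(\<Sum>S\<leftarrow>subseqs ps. pr V (cc a z) (mnl V (c # map snd S)) * fc V (a # map fst S) c u) = 0"
  by (simp only: sum_list_0)
 then show "cc a z u = cc a \<zero>\<^bsub>\<Gamma>\<^esub> u" using SS_expand[OF z a c ps u] by simp
qed

text \<open>A nonzero pairing can be found in normal form: one form \<open>c\<close> with
  \<open>B a c = 1\<close>, the other \<open>d\<close> orthogonal to \<open>a\<close>. This is the
  shape in which \<open>key\<close> uses it.\<close>

lemma not_KS:
 assumes "z\<in>SS" "z \<notin> KS (Suc d)"
 obtains a c us where "a\<in>al V" "c <: V" "B a c = 1" "orth a us" "length us = d" "pr V (cc a z) (mnl V (c # us)) = 1"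
proof (rule ccontr)
 assume *: "\<not> thesis"
 have "z\<in>vspan \<Gamma> (kgen (Suc d))"
 proof (rule coeff_zero_kgen[OF assms(1)])
  fix a c us assume a: "a\<in>al V" "c <: V" "B a c = 1" "orth a us" "Suc (length us) = Suc d"
  show "pr V (cc a z) (mnl V (c # us)) = 0"
  proof (rule ccontr)
   assume "pr V (cc a z) (mnl V (c # us)) ~= 0"
   then show False using that[OF a(1-4)] a(5) * by simp
  qed
 qed
 then show False using assms(2) KS_eq_kgen by simp
qed

end

section \<open>Subfunctors of \<open>\<Sigma>\<close>\<close>

lemma Tq_ndsp: "V\<in>Obj Tq \<longleftrightarrow> ndsp V"
 by (simp add: ndsp_iff)

lemma subfunctorD:
 "subfunctor C F S ==> X\<in>Obj C ==> Y\<in>Obj C ==> m\<in>Hom C X Y ==> fmor F X Y m ` S X \<subseteq> S Y"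
 unfolding subfunctor_def by blast

lemma subfunctor_mod: "subfunctor C F S ==> X\<in>Obj C ==> submodule (S X) F2 (fob F X)"
 unfolding subfunctor_def by blast

lemma free_map_push:
 assumes "finite S" "f <: free_mod S"
 shows "free_map (Some \<circ> p) f w' = (\<Sum>w\<in>S. f w * gen (p w) w')"
proof -
 have "free_map (Some \<circ> p) f w' = (\<Sum>w\<in>S. if (Some \<circ> p) w = Some w' then f w else 0)"
  by (rule free_map_eq[OF assms(1)]) (use assms in "auto simp: free_simps")
 also have "\<dots> = (\<Sum>w\<in>S. f w * gen (p w) w')" by (rule sum.cong) (auto simp: gen_def)
 finally show ?thesis .
qed

text \<open>The sum of the rank one maps \<open>B(-, u) l\<close>, with \<open>u\<close> and
  \<open>l\<close> taken from the two lists in parallel.\<close>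

fun pl :: "(bit, 'a) qspace => (bit, 'b) qspace => 'a list => 'b list => 'a => 'b" where
 "pl V W (u # us) (l # ls) w = (bil V w u \<odot>\<^bsub>W\<^esub> l) \<oplus>\<^bsub>W\<^esub> pl V W us ls w"
| "pl V W _ _ w = \<zero>\<^bsub>W\<^esub>"

text \<open>The hyperbolic plane for \<open>\<beta> = 0\<close>; for both values of \<open>\<beta>\<close> it contains vectors of norm \<open>\<beta>\<close>.\<close>

definition plane :: "bit => (bit, bit \<times> bit) qspace" where
 "plane \<beta> = \<lparr>carrier = UNIV, monoid.mult = undefined, one = undefined, ring.zero = (0, 0),
   add = (%(x, y) (x', y'). (x + x', y + y')), smult = (%c (x, y). (c * x, c * y)), qf = (%(x, y). x * y + \<beta> * x)\<rparr>"

lemma plane_simps: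
 "carrier (plane \<beta>) = UNIV" "\<zero>\<^bsub>plane \<beta>\<^esub> = (0, 0)" "(p, q) \<oplus>\<^bsub>plane \<beta>\<^esub> (p', q') = (p + p', q + q')"
 "c \<odot>\<^bsub>plane \<beta>\<^esub> (p, q) = (c * p, c * q)" "qf (plane \<beta>) (p, q) = p * q + \<beta> * p"
 "bil (plane \<beta>) (p, q) (p', q') = p * q' + p' * q"
 by (auto simp: plane_def bil_def algebra_simps)

lemma ndsp_plane: "ndsp (plane \<beta>)"
proof -
 have fin: "finite (UNIV :: (bit \<times> bit) set)"
 proof (rule finite_subset)
  show "(UNIV :: (bit \<times> bit) set) \<subseteq> {0, 1} \<times> {0, 1}" by auto
 qed simp
 have "quadratic_space (plane \<beta>)"
 proof (rule quadratic_spaceI)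
  show "f2v (plane \<beta>)" by (rule f2vI) (auto simp: plane_simps algebra_simps)
 qed (use fin in "auto simp: plane_simps algebra_simps")
 moreover have "perp (plane \<beta>) (carrier (plane \<beta>)) = {\<zero>\<^bsub>plane \<beta>\<^esub>}"
 proof (intro equalityI subsetI)
  fix z assume z: "z\<in>perp (plane \<beta>) (carrier (plane \<beta>))"
  obtain p q where pq: "z = (p, q)" by force
  have zz: "bil (plane \<beta>) (p, q) w = 0" for w using z pq by (cases w) (auto simp: perp_def plane_simps(1))
  show "z\<in>{\<zero>\<^bsub>plane \<beta>\<^esub>}" using zz[of "(0, 1)"] zz[of "(1, 0)"] pq by (simp add: plane_simps)
 qed (auto simp: perp_def plane_simps)
 ultimately show ?thesis unfolding ndsp_iff nondegenerate_def by blast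
qed

lemma dual_map:
 assumes "!!u. u <: V ==> g u <: V'" "!!u v. u <: V ==> v <: V ==> bil V' (g u) (g v) = bil V u v"
 shows "qsp V ==> dual V ps ==> dual V' (map (map_prod g g) ps)"
proof (induction ps)
 case (Cons p ps)
 interpret V: qsp V by fact
 obtain b c where p: "p = (b, c)" by force
 have "b' <: V & c' <: V" if "(b', c')\<in>set ps" for b' c' using V.dual_mem[of ps b' c'] Cons.prems(2) that p by simp
 then show ?case using Cons assms by (fastforce simp: p)
qed simp

lemma fc_Nil: "fc V [] v = gen v"
 by (simp add: fc_def fun_eq_iff)

text \<open>The pairing matrix of the two families is the identity, so in the Leibniz rule only the
  term pairing \<open>b\<close> with its partner survives.\<close>

lemma (in qsp) dd_dual: "dual V S ==> v <: V ==> dd V (map fst S) (mnl V (map snd S)) v = 1"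
proof (induction S arbitrary: v)
 case (Cons p S)
 obtain b c where p: "p = (b, c)" by force
 have m: "b <: V" "c <: V" "bil V b c = 1" "dual V S" using Cons.prems p by auto
 have sc: "set (map fst S) \<subseteq> carrier V" "set (map snd S) \<subseteq> carrier V" using dual_mem[OF m(4)] by force+
 have o: "bil V (map fst S ! i) c = 0" if "i < length S" for i
  using Cons.prems(1) p that nth_mem[OF that] by (cases "S ! i") fastforce
 have "dd V (b # map fst S) (mnl V (map snd S)) v = 0" by (rule dd_mono_zero) (use m sc Cons.prems in auto)
 then have "dd V (map fst (p # S)) (mnl V (map snd (p # S))) v =
  (\<Sum>i<Suc (length S). bil V ((b # map fst S) ! i) c * dd V (take i (b # map fst S) @ drop (Suc i) (b # map fst S)) (mnl V (map snd S)) (v \<oplus> (b # map fst S) ! i))"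
  using dd_mult[OF m(2), of "b # map fst S" v "mnl V (map snd S)"] m sc Cons.prems p by (simp add: mnl_fun del: dd.simps)
 also have "\<dots> = 1"
  unfolding sum.lessThan_Suc_shift using o m Cons.IH[OF m(4), of "v \<oplus> b"] Cons.prems by simp
 finally show ?case .
qed simp

section \<open>Spaces with long dual systems, and special morphisms\<close>

context line
begin

lemma lineVI: "ndsp V ==> lineV D x V"
 by (simp add: lineV_def line_axioms)

lemma lineVO: "V\<in>Obj Tq ==> lineV D x V"
 using lineVI ndsp_iff by auto

text \<open>The vector \<open>(1, 0)\<close> of \<open>plane \<beta>\<close> has norm
  \<open>\<beta>\<close>, which provides \<open>a\<close>; each further pair comes from adding an
  orthogonal hyperbolic plane. Such spaces show that no step of the filtration is trivial.\<close>

lemma big: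
 "\<exists>V a c ps. ndsp V & a\<in>al V & c <: V & bil V a c = 1 & dual V (ps @ [(a, c), (c, a)]) & length ps = d"
proof (induction d)
 case 0
 let ?P = "plane (qf D x)"
 interpret P: ndsp ?P by (rule ndsp_plane)
 obtain X and j :: "bit \<times> bit => 'a" where "copy ?P X j" using P.copy_ex by blast
 then interpret j: copy ?P X j .
 interpret X: ndsp X by (rule j.X)
 note X = j.X and j_qf = j.qf
 have m: "j u <: X" for u by (rule j.mem) (simp add: plane_simps)
 have b: "bil X (j u) (j v) = bil ?P u v" for u v by (rule j.bil[OF P.qsp_axioms]) (simp_all add: plane_simps)
 have ac: "bil X (j (1, 0)) (j (0, 1)) = 1" by (simp add: b plane_simps)
 then have "j (1, 0) ~= \<zero>\<^bsub>X\<^esub>" using m[of "(0, 1)"] by auto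
 then have a: "j (1, 0)\<in>al X" using m j_qf[of "(1, 0)"] by (simp add: al_def plane_simps)
 show ?case
  by (rule exI[of _ X], rule exI[of _ "j (1, 0)"], rule exI[of _ "j (0, 1)"], rule exI[of _ "[]"])
   (use X a ac m X.bil_sym[of "j (1, 0)" "j (0, 1)"] in simp)
next
 case (Suc d)
 then obtain V a c ps where V: "ndsp V" "a\<in>al V" "c <: V" "bil V a c = 1" "dual V (ps @ [(a, c), (c, a)])" "length ps = d"
  by blast
 interpret V: ndsp V by fact
 let ?P = "osum V (plane 0)"
 interpret P: ndsp ?P by (rule ndsp_osum[OF V(1) ndsp_plane])
 interpret H: ndsp "plane 0" by (rule ndsp_plane)
 obtain X and j :: "'a \<times> bit \<times> bit => 'a" where "copy ?P X j" using P.copy_ex by blast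
 then interpret j: copy ?P X j .
 interpret X: ndsp X by (rule j.X)
 note X = j.X and j_qf = j.qf and m = j.mem and b = j.bil[OF P.qsp_axioms]
 define g where "g u = j (u, 0, 0)" for u
 have gm: "g u <: X" if "u <: V" for u unfolding g_def by (rule m) (use that in "simp add: plane_simps")
 have gb: "bil X (g u) (g v) = bil V u v" if "u <: V" "v <: V" for u v
  unfolding g_def by (subst b) (use that in "simp_all add: plane_simps")
 let ?e = "j (\<zero>\<^bsub>V\<^esub>, 1, 0)" and ?f = "j (\<zero>\<^bsub>V\<^esub>, 0, 1)"
 have ef: "?e <: X" "?f <: X" "bil X ?e ?f = 1" by (auto intro!: m simp: plane_simps b)
 have eg: "bil X ?e (g u) = 0" "bil X (g u) ?f = 0" if "u <: V" for u
  unfolding g_def by (subst b; use that in "simp add: plane_simps")+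
 have ac: "a <: V" using alD V by simp
 let ?ps = "(?e, ?f) # map (map_prod g g) ps"
 have dg: "dual X (map (map_prod g g) (ps @ [(a, c), (c, a)]))" by (rule dual_map[OF gm gb V.qsp_axioms V(5)])
 have "ALL (b', c'):set (map (map_prod g g) (ps @ [(a, c), (c, a)])). bil X ?e c' = 0 & bil X b' ?f = 0"
  using eg V.dual_mem[OF V(5)] by fastforce
 then have "dual X (?ps @ [(g a, g c), (g c, g a)])" using dg ef by simp
 moreover have "g a\<in>al X"
 proof -
  have "qf X (g a) = qf D x" using j_qf[of "(a, 0, 0)"] ac alD(3)[OF V(2)] by (simp add: g_def plane_simps)
  moreover have "g a ~= \<zero>\<^bsub>X\<^esub>" using gb[OF ac V(3)] V(4) gm[OF V(3)] by auto
  ultimately show ?thesis using gm[OF ac] by (simp add: al_def)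
 qed
 moreover have "bil X (g a) (g c) = 1" using gb ac V by simp
 ultimately show ?case using X gm[OF V(3)] V(6)
  by (intro exI[of _ X] exI[of _ "g a"] exI[of _ "g c"] exI[of _ ?ps]) simp
qed

text \<open>Existence of the morphisms \<open>V \<rightarrow> W\<close> that act on the fibre over \<open>a\<close> by \<open>p\<close> and kill the other fibres.\<close>

lemma line_mor:
 assumes V: "ndsp V" "ndsp W" and a: "a\<in>al V" and b: "b\<in>al W" and p: "p\<in>lin_maps V W" "p a = b"
  and pb: "!!w. w <: V ==> bil W (p w) b = bil V w a"
 shows "\<exists>t. tmor V W t & (ALL v:carrier V. eps_mor V W t v = p v) & dm V W t = {\<zero>\<^bsub>V\<^esub>, a}"
proof -
 interpret V: ndsp V by fact
 interpret W: ndsp W by fact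
 note aD = alD[OF a] and bD = alD[OF b]
 obtain c where c: "c <: V" "bil V a c = 1" using V.nondeg_ex[OF aD(1,2)] by auto
 \<comment> \<open>A projection with kernel the line of \<open>a\<close>. Passing from
   \<open>v\<close> to \<open>v + a\<close> changes \<open>q v\<close> and \<open>q (p v)\<close> by
   the same amount, by \<open>pb\<close> and because \<open>a\<close> and \<open>b\<close> have the
   same norm; this is the condition for realizing \<open>p\<close>.\<close>
 define \<pi> where "\<pi> v = v \<oplus>\<^bsub>V\<^esub> (bil V v c \<odot>\<^bsub>V\<^esub> a)" for v
 have \<pi>: "\<pi>\<in>lin_maps V V"
  by (rule linI[OF V.f2v_axioms V.f2v_axioms]) (use aD c in "auto simp: \<pi>_def V.bil_simps V.smult_plus V.ac")
 have ker: "{v\<in>carrier V. \<pi> v = \<zero>\<^bsub>V\<^esub>} = {\<zero>\<^bsub>V\<^esub>, a}"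
 proof (intro equalityI subsetI)
  fix v assume "v\<in>{v\<in>carrier V. \<pi> v = \<zero>\<^bsub>V\<^esub>}"
  then have "v <: V" "v = bil V v c \<odot>\<^bsub>V\<^esub> a" using aD by (auto simp: \<pi>_def)
  then show "v\<in>{\<zero>\<^bsub>V\<^esub>, a}" using aD V.smult_bit[of a "bil V v c"] by (auto split: if_splits)
 next
  fix v assume "v\<in>{\<zero>\<^bsub>V\<^esub>, a}"
  then show "v\<in>{v\<in>carrier V. \<pi> v = \<zero>\<^bsub>V\<^esub>}" using aD c by (auto simp: \<pi>_def)
 qed
 have "\<exists>t. tmor V W t & (ALL v:carrier V. eps_mor V W t v = p v) & dm V W t = {v\<in>carrier V. \<pi> v = \<zero>\<^bsub>V\<^esub>}"
 proof (rule Tq_realize[OF V p(1) \<pi>])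
  fix v assume v: "v <: V"
  show "qf V v + qf W (p v) = qf V (\<pi> v) + qf W (p (\<pi> v))"
  proof (cases "bil V v c = 0")
   case False
   then have "\<pi> v = v \<oplus>\<^bsub>V\<^esub> a" "p (\<pi> v) = p v \<oplus>\<^bsub>W\<^esub> b" using aD v p lin_add[OF p(1), of v a] by (auto simp: \<pi>_def)
   then show ?thesis using pb[OF v] aD bD by (simp add: V.qf_add W.qf_add algebra_simps)
  qed (use aD v in "simp add: \<pi>_def")
  assume "p v = \<zero>\<^bsub>W\<^esub>" "\<pi> v = \<zero>\<^bsub>V\<^esub>"
  then show "v = \<zero>\<^bsub>V\<^esub>" using ker v p(2) bD by auto
 qed
 then show ?thesis using ker by simp
qed

text \<open>Realized with \<open>p\<close> and \<open>\<pi>\<close> both the identity. The functor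
  \<open>iota\<close> cannot distinguish this morphism from the identity, whereas it kills every
  fibre.\<close>

lemma zero_mor:
 fixes V :: "'a qsp"
 assumes "ndsp V"
 shows "\<exists>t. tmor V V t & (ALL v:carrier V. eps_mor V V t v = v) & dm V V t = {\<zero>\<^bsub>V\<^esub>}"
proof -
 interpret V: ndsp V by fact
 have "\<exists>t. tmor V V t & (ALL v:carrier V. eps_mor V V t v = v) & dm V V t = {v\<in>carrier V. v = \<zero>\<^bsub>V\<^esub>}"
  using Tq_realize[of V V "%v. v" "%v. v"] assms lin_id[OF V.f2v_axioms] by simp
 moreover have "{v\<in>carrier V. v = \<zero>\<^bsub>V\<^esub>} = {\<zero>\<^bsub>V\<^esub>}" by auto
 ultimately show ?thesis by simp
qed

lemma fmor_pt:
 assumes "tmor V W t" "a\<in>al V" "f <: free_mod (carrier V)"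
 shows "fmor mx.TF V W t (mx.tz V f a) = (if a\<in>dm V W t then mx.tz W (free_map (Some \<circ> eps_mor V W t) f) (eps_mor V W t a) else \<zero>\<^bsub>fob mx.TF W\<^esub>)"
 using mx.fmor_tz[OF assms(1,2)] assms(3) by (simp add: PF_def)

lemma push_cube:
 assumes "tmor V W t"
 shows "set ls \<subseteq> carrier V ==> v <: V ==> free_map (Some \<circ> eps_mor V W t) (fc V ls v) = fc W (map (eps_mor V W t) ls) (eps_mor V W t v)"
proof (induction ls arbitrary: v)
 case Nil
 have "fc V [] v = gen v" "fc W [] (eps_mor V W t v) = gen (eps_mor V W t v)" by (simp_all add: fc_def fun_eq_iff)
 then show ?case by (simp add: free_map_gen)
next
 case (Cons l ls)
 interpret tmor V W t by fact
 have L: "free_map (Some \<circ> eps_mor V W t)\<in>lin_maps (free_mod (carrier V)) (free_mod (carrier W))"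
  by (rule free_map_lin) auto
 have m: "fc V ls v <: free_mod (carrier V)" "fc V ls (v \<oplus>\<^bsub>V\<^esub> l) <: free_mod (carrier V)"
  using V.fc_mem Cons.prems by auto
 have "free_map (Some \<circ> eps_mor V W t) (fc V (l # ls) v) = (%w. free_map (Some \<circ> eps_mor V W t) (fc V ls v) w + free_map (Some \<circ> eps_mor V W t) (fc V ls (v \<oplus>\<^bsub>V\<^esub> l)) w)"
  using lin_add[OF L m] by (simp add: V.fc_Cons free_simps)
 then show ?case using Cons eps_add[of v l] by (simp add: W.fc_Cons o_def)
qed

lemma fmor_cube:
 assumes tm: "tmor V W t" and a: "a\<in>al V" and v: "v <: V" and ls: "set ls \<subseteq> carrier V"
 shows "fmor mx.TF V W t (mx.tz V (fc V (a # ls) v) a) = (if a\<in>dm V W t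
  then mx.tz W (fc W (eps_mor V W t a # map (eps_mor V W t) ls) (eps_mor V W t v)) (eps_mor V W t a) else \<zero>\<^bsub>fob mx.TF W\<^esub>)"
proof -
 interpret tmor V W t by fact
 have s: "set (a # ls) \<subseteq> carrier V" using ls alD a by auto
 show ?thesis using fmor_pt[OF tm a V.fc_mem[OF s v]] push_cube[OF tm s v] by simp
qed

lemma span_subfunctor:
 fixes S :: "'a qsp => 'u set"
 assumes F: "is_functor Tq F" and S: "!!V. ndsp V ==> G V \<subseteq> carrier (fob F V) & S V = vspan (fob F V) (G V)"
  and m: "!!V W t g. tmor V W t ==> g\<in>G V ==> fmor F V W t g\<in>S W"
 shows "subfunctor Tq F S"
 unfolding subfunctor_def
proof (intro conjI ballI)
 fix V :: "'a qsp" assume "V\<in>Obj Tq"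
 have f: "f2v (fob F V)" if "ndsp V" for V :: "'a qsp" using is_functorD(1)[OF F] that unfolding Tq_ndsp by blast
 have V: "ndsp V" using \<open>V\<in>Obj Tq\<close> unfolding Tq_ndsp .
 show s: "submodule (S V) F2 (fob F V)" using S[OF V] f2v.vspan_sub[OF f[OF V]] by simp
 fix W :: "'a qsp" and t assume W: "W\<in>Obj Tq" and t: "t\<in>Hom Tq V W"
 have W': "ndsp W" using W unfolding Tq_ndsp .
 have sW: "submodule (S W) F2 (fob F W)" using S[OF W'] f2v.vspan_sub[OF f[OF W']] by simp
 have tm: "tmor V W t" using tmorI \<open>V\<in>Obj Tq\<close> W t by blast
 show "fmor F V W t ` S V \<subseteq> S W"
 proof (rule image_subsetI)
  fix z assume "z\<in>S V"
  then have "z\<in>vspan (fob F V) (G V)" using S[OF V] by simp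
  then show "fmor F V W t z\<in>S W"
   using lin_vspan[OF f[OF V] f[OF W'] is_functorD(2)[OF F \<open>V\<in>Obj Tq\<close> W t] _ sW] S[OF V] m[OF tm] by blast
 qed
qed

section \<open>\<open>Mix\<close>, \<open>\<Sigma>\<close> and the filtration as functors\<close>

abbreviation "Fx \<equiv> PF_iso D"

lemma Fx_functor: "is_functor Tq Fx"
 unfolding PF_iso_eq by (rule mx.TF_functor)

lemma Mix_subfunctor: "subfunctor Tq Fx (Mix_sub D x)"
proof (rule span_subfunctor[OF Fx_functor, of "%V. {mx.tz V (gen w) a | w a. w <: V & a\<in>al V & bil V w a = 1}"])
 fix V :: "'a qsp" assume "ndsp V"
 then interpret V: lineV D x V by (rule lineVI)
 show "{mx.tz V (gen w) a | w a. w <: V & a\<in>al V & bil V w a = 1} \<subseteq> carrier (fob Fx V) &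
   Mix_sub D x V = vspan (fob Fx V) {mx.tz V (gen w) a | w a. w <: V & a\<in>al V & bil V w a = 1}"
  using V.Mix_eq_vspan unfolding PF_iso_eq by auto
next
 fix V W :: "'a qsp" and t g assume t: "tmor V W t" and g: "g\<in>{mx.tz V (gen w) a | w a. w <: V & a\<in>al V & bil V w a = 1}"
 interpret t: tmor V W t by fact
 interpret V: lineV D x V by (rule lineVI[OF t.V.ndsp_axioms])
 interpret W: lineV D x W by (rule lineVI[OF t.W.ndsp_axioms])
 obtain w a where w: "g = mx.tz V (gen w) a" "w <: V" "a\<in>al V" "bil V w a = 1" using g by auto
 have "fmor Fx V W t g = (if a\<in>dm V W t then mx.tz W (gen (eps_mor V W t w)) (eps_mor V W t a) else \<zero>\<^bsub>fob mx.TF W\<^esub>)"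
  using fmor_pt[OF t w(3), of "gen w"] w unfolding PF_iso_eq by (simp add: free_map_gen)
 moreover have "mx.tz W (gen (eps_mor V W t w)) (eps_mor V W t a)\<in>W.MS" if a: "a\<in>dm V W t"
 proof (rule W.gen_in_MS)
  have "bil W (eps_mor V W t a) (eps_mor V W t w) = 1"
   using t.dm_bil[OF a w(2)] w(2,4) t.V.bil_sym[of w a] t.dm_carrier[OF a] by simp
  then show "bil W (eps_mor V W t w) (eps_mor V W t a) = 1"
   using t.W.bil_sym[of "eps_mor V W t a" "eps_mor V W t w"] t.dm_carrier[OF a] w(2) by simp
  show "eps_mor V W t a\<in>al W" by (rule eps_al[OF t w(3) a])
 qed (use w in simp)
 moreover have "\<zero>\<^bsub>fob mx.TF W\<^esub>\<in>W.MS" using W.MS_sub by (simp add: W.mx.T.sub_iff)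
 ultimately show "fmor Fx V W t g\<in>Mix_sub D x W" unfolding W.Mix_eq by simp
qed

text \<open>By \<open>dm_bil\<close> pairings with \<open>a\<close> are preserved even for vectors
  outside \<open>dm\<close>. So a cube over \<open>a\<close> is sent to a cube over the image of
  \<open>a\<close>, whose directions may have become dependent.\<close>

lemma cube_image:
 assumes t: "tmor V W t" and a: "a\<in>al V" "a\<in>dm V W t" and v: "v <: V" "bil V v a = 1" and ls: "lineV.orth V a ls"
 shows "eps_mor V W t a\<in>al W" "bil W (eps_mor V W t v) (eps_mor V W t a) = 1" "lineV.orth W (eps_mor V W t a) (map (eps_mor V W t) ls)"
proof -
 interpret t: tmor V W t by fact
 interpret V: lineV D x V by (rule lineVI[OF t.V.ndsp_axioms])
 interpret W: lineV D x W by (rule lineVI[OF t.W.ndsp_axioms])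
 show "eps_mor V W t a\<in>al W" by (rule eps_al[OF t a])
 have e: "bil W (eps_mor V W t u) (eps_mor V W t a) = bil V u a" if "u <: V" for u
  using t.dm_bil[OF a(2) that] t.W.bil_sym[of "eps_mor V W t a" "eps_mor V W t u"] t.V.bil_sym[of a u] t.dm_carrier[OF a(2)] that by simp
 show "bil W (eps_mor V W t v) (eps_mor V W t a) = 1" using e v by simp
 show "W.orth (eps_mor V W t a) (map (eps_mor V W t) ls)" using ls e unfolding V.orth_def W.orth_def by auto
qed

lemma k_subfunctor: "subfunctor Tq Fx (ks d)"
proof (rule span_subfunctor[OF Fx_functor, of "%V. lineV.cgen D x V d"])
 fix V :: "'a qsp" assume "ndsp V"
 then interpret V: lineV D x V by (rule lineVI)
 show "V.cgen d \<subseteq> carrier (fob Fx V) & ks d V = vspan (fob Fx V) (V.cgen d)"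
  using V.cgen_carrier V.KS_eq_cgen V.k_sub_eq unfolding PF_iso_eq by simp
next
 fix V W :: "'a qsp" and t g assume t: "tmor V W t" and g: "g\<in>lineV.cgen D x V d"
 interpret t: tmor V W t by fact
 interpret V: lineV D x V by (rule lineVI[OF t.V.ndsp_axioms])
 interpret W: lineV D x W by (rule lineVI[OF t.W.ndsp_axioms])
 obtain a v ls where c: "g = mx.tz V (fc V (a # ls) v) a" "a\<in>al V" "v <: V" "bil V v a = 1" "V.orth a ls" "length ls = d"
  using g unfolding V.cgen_def by auto
 have z: "\<zero>\<^bsub>fob mx.TF W\<^esub>\<in>W.KS d" using W.KS_sub by (simp add: W.mx.T.sub_iff)
 have "fmor mx.TF V W t g\<in>W.KS d"
 proof (cases "a\<in>dm V W t")
  case True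
  note i = cube_image[OF t c(2) True c(3-5)]
  show ?thesis using fmor_cube[OF t c(2,3), of ls] c True W.cube_KS[OF i(1) _ i(2,3), of d] unfolding V.orth_def by simp
 next
  case False
  then show ?thesis using fmor_cube[OF t c(2,3), of ls] c z unfolding V.orth_def by simp
 qed
 then show "fmor Fx V W t g\<in>ks d W" unfolding PF_iso_eq W.k_sub_eq .
qed

lemma Sigma_k0: "sub_eq Tq (Sigma_sub D x) (ks 0)"
 unfolding sub_eq_def
proof
 fix V :: "'a qsp" assume "V\<in>Obj Tq"
 then interpret V: lineV D x V by (rule lineVO)
 show "Sigma_sub D x V = ks 0 V" using V.Sigma_eq V.k_sub_eq V.KS_0 by simp
qed

lemma subfunctor_cong: "sub_eq Tq S T ==> subfunctor Tq F S \<longleftrightarrow> subfunctor Tq F T"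
 unfolding sub_eq_def subfunctor_def by (simp cong: ball_cong)

lemma Sigma_sub_Fx: "subfunctor Tq Fx (Sigma_sub D x)"
 using k_subfunctor subfunctor_cong[OF Sigma_k0] by blast

lemma Mix_sfun: "sfun Tq Fx (Mix_sub D x)"
 by unfold_locales (rule Fx_functor Mix_subfunctor)+

lemma Mix_functor: "is_functor Tq Mx"
 unfolding Mix_def by (rule sfun.sub_functor[OF Mix_sfun])

lemma Sigma_Mix: "subfunctor Tq Mx (Sigma_sub D x)"
 unfolding Mix_def sfun.subfunctor_sub[OF Mix_sfun] sub_le_def
proof (intro conjI ballI Sigma_sub_Fx)
 fix V :: "'a qsp" assume "V\<in>Obj Tq"
 then interpret V: lineV D x V by (rule lineVO)
 show "Sigma_sub D x V \<subseteq> Mix_sub D x V" using V.Sigma_eq V.Mix_eq V.SS_MS by simp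
qed

lemma Sigma_sfun: "sfun Tq Mx (Sigma_sub D x)"
 by unfold_locales (rule Mix_functor Sigma_Mix)+

lemma Sigma_functor: "is_functor Tq (Sg)"
 unfolding Sigma_fun_def by (rule sfun.sub_functor[OF Sigma_sfun])

lemma Sigma_fmor [simp]: "fmor (Sg) = fmor mx.TF" "fmor Mx = fmor mx.TF"
 unfolding Sigma_fun_def Mix_def by (simp_all add: PF_iso_eq)

lemma subfunctor_Sigma: "subfunctor Tq (Sg) S \<longleftrightarrow> subfunctor Tq Fx S & sub_le Tq S (Sigma_sub D x)"
proof -
 have "sub_le Tq S (Sigma_sub D x) ==> sub_le Tq S (Mix_sub D x)"
  using Sigma_Mix unfolding Mix_def sfun.subfunctor_sub[OF Mix_sfun] sub_le_def by blast
 then show ?thesis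
  unfolding Sigma_fun_def sfun.subfunctor_sub[OF Sigma_sfun] unfolding Mix_def sfun.subfunctor_sub[OF Mix_sfun] by blast
qed

lemma k_Sigma: "subfunctor Tq (Sg) (ks d)"
 unfolding subfunctor_Sigma sub_le_def
proof (intro conjI ballI k_subfunctor)
 fix V :: "'a qsp" assume "V\<in>Obj Tq"
 then interpret V: lineV D x V by (rule lineVO)
 show "ks d V \<subseteq> Sigma_sub D x V" using V.Sigma_eq V.k_sub_eq V.KS_SS by simp
qed

section \<open>From one nonzero pairing to all cubes\<close>

lemma single_fibre:
 assumes t: "tmor V W t" and a: "a\<in>al V" "dm V W t = {\<zero>\<^bsub>V\<^esub>, a}" and z: "z <: fob mx.TF V"
 shows "fmor mx.TF V W t z = mx.tz W (free_map (Some \<circ> eps_mor V W t) (mx.cz V a z)) (eps_mor V W t a)"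
proof -
 interpret t: tmor V W t by fact
 interpret V: lineV D x V by (rule lineVI[OF t.V.ndsp_axioms])
 interpret W: lineV D x W by (rule lineVI[OF t.W.ndsp_axioms])
 have cm: "mx.cz V b z <: free_mod (carrier V)" for b using V.mx.cz_mem[OF z] by simp
 let ?X = "%b. mx.tz W (free_map (Some \<circ> eps_mor V W t) (mx.cz V a z)) (eps_mor V W t a)"
 have X: "?X b <: fob mx.TF W" for b
  using lin_closed[OF mx.fmor_TF_lin[OF t], of "mx.tz V (mx.cz V a z) a"] V.mx.tz_mem[OF _ a(1)] cm a fmor_pt[OF t a(1) cm] by simp
 have "fmor mx.TF V W t z = fmor mx.TF V W t (finsum (fob mx.TF V) (%b. mx.tz V (mx.cz V b z) b) (al V))"
  using V.mx.decompV[OF z] by simp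
 also have "\<dots> = finsum (fob mx.TF W) (%b. fmor mx.TF V W t (mx.tz V (mx.cz V b z) b)) (al V)"
  by (rule lin_finsum[OF V.mx.T.f2v_axioms W.mx.T.f2v_axioms mx.fmor_TF_lin[OF t]]) (use cm in simp)
 also have "\<dots> = finsum (fob mx.TF W) (%b. if a = b then ?X b else \<zero>\<^bsub>fob mx.TF W\<^esub>) (al V)"
  by (rule W.mx.T.finsum_cong') (use cm X alD(2) a in "auto simp: fmor_pt[OF t _ cm]")
 also have "\<dots> = ?X a" using W.mx.T.finsum_singleton[OF a(1) V.mx.finite_al', of ?X] X by simp
 finally show ?thesis .
qed

text \<open>Push the fibre \<open>f\<close> of \<open>z\<close> over \<open>a\<close> forward along
  \<open>p\<close> and along \<open>p + B(-, u) l\<close>, and add: each point \<open>w\<close>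
  contributes \<open>f w B(w, u)\<close> times the cube at \<open>p w\<close> with direction
  \<open>l\<close>. Repeating this along \<open>us\<close> and \<open>ls\<close> produces the weight
  \<open>mnl V us w\<close> and the directions \<open>ls\<close>. For the base map
  \<open>p w = B(w, a) v + B(w, c) b\<close>, the points \<open>w\<close> and \<open>w + a\<close>
  of the support go to \<open>v\<close> and \<open>v + b\<close> in some order, so
  \<open>half_sum\<close> supplies the weight \<open>B(w, c)\<close> and the direction
  \<open>b\<close>. All cubes are now equal to the one at \<open>v\<close>, and their total weight
  is the pairing of degree \<open>d + 1\<close>, which is 1.\<close>

lemma key:
 assumes S: "subfunctor Tq (Sg) S" and V: "ndsp V" and z: "z\<in>S V" "z \<notin> ks (Suc d) V" and W: "ndsp W"
 shows "ks d W \<subseteq> S W"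
proof -
 interpret V: lineV D x V by (rule lineVI[OF V])
 interpret W: lineV D x W by (rule lineVI[OF W])
 have S': "subfunctor Tq mx.TF S" and SV: "S V \<subseteq> V.SS"
  using S V.V.ndsp_axioms unfolding subfunctor_Sigma PF_iso_eq sub_le_def Tq_ndsp[symmetric] using V.Sigma_eq by auto
 have SW: "submodule (S W) F2 (fob mx.TF W)" using S' W Tq_ndsp unfolding subfunctor_def by blast
 have zS: "z\<in>V.SS" using z SV by auto
 obtain a c us where acu: "a\<in>al V" "c <: V" "bil V a c = 1" "V.orth a us" "length us = d" "pr V (mx.cz V a z) (mnl V (c # us)) = 1"
  using V.not_KS[OF zS, of d] z(2) unfolding V.k_sub_eq by blast
 let ?f = "mx.cz V a z"
 have fm: "?f <: free_mod (carrier V)" using V.mx.cz_mem[OF V.SSc[OF zS]] by simp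
 note aD = alD[OF acu(1)]
 have "mx.tz W (fc W (b # ls) v) b\<in>S W"
  if b: "b\<in>al W" and v: "v <: W" "bil W v b = 1" and ls: "W.orth b ls" "length ls = d" for b v ls
 proof -
  note bD = alD[OF b]
  \<comment> \<open>The first two summands secure what \<open>line_mor\<close> requires,
    \<open>p a = b\<close> and \<open>B (p w) b = B w a\<close>; the perturbation preserves both,
    because \<open>us\<close> is orthogonal to \<open>a\<close> and \<open>ls\<close> to
    \<open>b\<close>.\<close>
  define p where "p us ls w = ((bil V w a \<odot>\<^bsub>W\<^esub> v) \<oplus>\<^bsub>W\<^esub> (bil V w c \<odot>\<^bsub>W\<^esub> b)) \<oplus>\<^bsub>W\<^esub> pl V W us ls w" for us ls w
  have plm: "pl V W us ls w <: W" if "set ls \<subseteq> carrier W" for us ls w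
   using that
  proof (induction us arbitrary: ls)
   case (Cons u us)
   then show ?case by (cases ls) auto
  qed simp
  have pla: "pl V W us ls (w \<oplus>\<^bsub>V\<^esub> w') = pl V W us ls w \<oplus>\<^bsub>W\<^esub> pl V W us ls w'"
   if "set ls \<subseteq> carrier W" "set us \<subseteq> carrier V" "w <: V" "w' <: V" for us ls w w'
   using that(1,2)
  proof (induction us arbitrary: ls)
   case (Cons u us)
   then show ?case using that(3,4) plm by (cases ls) (auto simp: V.V.bil_simps W.V.smult_plus W.V.ac)
  qed simp
  have plb: "bil W (pl V W us ls w) b = 0" if "W.orth b ls" for us ls w
   using that
  proof (induction us arbitrary: ls)
   case (Cons u us)
   then show ?case using plm bD by (cases ls) (auto simp: W.V.bil_simps W.orth_def)
  qed (use bD in simp)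
  have plz: "pl V W us ls a = \<zero>\<^bsub>W\<^esub>" if "V.orth a us" "set ls \<subseteq> carrier W" for us ls
   using that
  proof (induction us arbitrary: ls)
   case (Cons u us)
   then have "bil V a u = 0" using aD V.V.bil_sym[of a u] by (simp add: V.orth_def)
   then show ?case using Cons by (cases ls) (auto simp: V.orth_def)
  qed simp
  have pm: "p us ls w <: W" if "set ls \<subseteq> carrier W" for us ls w
   using that plm v bD by (simp add: p_def)
  have pN: "(%w'. \<Sum>w\<in>carrier V. ?f w * gen (p us ls w) w')\<in>W.fib_sub (S W) b"
   if us: "V.orth a us" and ls: "W.orth b ls" for us ls
  proof -
   have usc: "set us \<subseteq> carrier V" and lsc: "set ls \<subseteq> carrier W" using us ls by (auto simp: V.orth_def W.orth_def)
   have pl: "p us ls\<in>lin_maps V W"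
    by (rule linI[OF V.V.f2v_axioms W.V.f2v_axioms pm[OF lsc]])
     (use aD bD v acu(2) plm[OF lsc] pla[OF lsc usc] in "simp add: p_def V.V.bil_simps W.V.smult_plus W.V.ac")
   have pa: "p us ls a = b" using plz[OF us lsc] aD acu(3) v bD by (simp add: p_def)
   have pb: "bil W (p us ls w) b = bil V w a" for w
    using plb[OF ls] plm[OF lsc] v bD by (simp add: p_def W.V.bil_simps)
   obtain t where t: "tmor V W t" "ALL v:carrier V. eps_mor V W t v = p us ls v" "dm V W t = {\<zero>\<^bsub>V\<^esub>, a}"
    using line_mor[OF V W acu(1) b pl pa pb] by blast
   have "fmor mx.TF V W t z\<in>S W" using S' z(1) tmor_hom[OF t(1)] unfolding subfunctor_def by blast
   then have 1: "mx.tz W (free_map (Some \<circ> eps_mor V W t) ?f) b\<in>S W"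
    using single_fibre[OF t(1) acu(1) t(3) V.SSc[OF zS]] t(2) aD pa by simp
   have 2: "free_map (Some \<circ> eps_mor V W t) ?f = (%w'. \<Sum>w\<in>carrier V. ?f w * gen (p us ls w) w')"
    unfolding fun_eq_iff free_map_push[OF V.V.finite_carrier fm] using t(2) by simp
   have "free_map (Some \<circ> eps_mor V W t) ?f <: free_mod (carrier W)"
    using lin_closed[OF free_map_lin fm, of "Some \<circ> eps_mor V W t"] t(2) pm[OF lsc] by auto
   then show ?thesis using 1 2 by (simp add: W.fib_sub_def)
  qed
  have N: "submodule (W.fib_sub (S W) b) F2 (free_mod (carrier W))" by (rule W.fib_sub[OF SW b])
  have Nadd: "(%w. g w + h w)\<in>W.fib_sub (S W) b" if "g\<in>W.fib_sub (S W) b" "h\<in>W.fib_sub (S W) b" for g h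
   using N that by (auto simp: f2v.sub_iff[OF f2v_free] free_simps)
  \<comment> \<open>The pairs from \<open>us1\<close>, \<open>ls1\<close> act as a weight and a
    direction, those from \<open>us2\<close>, \<open>ls2\<close> as a perturbation of the map. The
    base case is a pushforward of \<open>f\<close>; each step trades one weight and direction for
    the sum of the unperturbed and the perturbed map.\<close>
  have Y: "length us1 = length ls1 ==> V.orth a us1 ==> W.orth b ls1 ==> V.orth a us2 ==> W.orth b ls2 ==>
   (%w'. \<Sum>w\<in>carrier V. ?f w * mnl V us1 w * fc W ls1 (p us2 ls2 w) w')\<in>W.fib_sub (S W) b" for us1 ls1 us2 ls2
  proof (induction us1 arbitrary: ls1 us2 ls2)
   case Nil
   then show ?case using pN[OF Nil(4,5)] by (simp add: fc_def)
  next
   case (Cons u us1)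
   then obtain l ls1' where l: "ls1 = l # ls1'" by (cases ls1) auto
   have lc: "l <: W" "set ls2 \<subseteq> carrier W" using Cons.prems l by (auto simp: W.orth_def)
   have o: "V.orth a us1" "W.orth b ls1'" "V.orth a (u # us2)" "W.orth b (l # ls2)"
    using Cons.prems l by (auto simp: V.orth_def W.orth_def)
   have pc: "p (u # us2) (l # ls2) w = p us2 ls2 w \<oplus>\<^bsub>W\<^esub> (bil V w u \<odot>\<^bsub>W\<^esub> l)" for w
    using plm[OF lc(2)] lc v bD by (simp add: p_def W.V.ac)
   have h: "bil V w u * fc W (l # ls1') (p us2 ls2 w) w' = fc W ls1' (p us2 ls2 w) w' + fc W ls1' (p (u # us2) (l # ls2) w) w'" for w w'
    unfolding pc using pm[OF lc(2)] lc by (cases "bil V w u = 0") (simp_all add: W.V.fc_Cons)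
   have "?f w * mnl V (u # us1) w * fc W ls1 (p us2 ls2 w) w' = ?f w * mnl V us1 w * fc W ls1' (p us2 ls2 w) w' + ?f w * mnl V us1 w * fc W ls1' (p (u # us2) (l # ls2) w) w'" for w w'
   proof -
    have "?f w * mnl V (u # us1) w * fc W ls1 (p us2 ls2 w) w' = ?f w * mnl V us1 w * (bil V w u * fc W (l # ls1') (p us2 ls2 w) w')"
     unfolding l mnl_simps by (simp only: mult.assoc mult.commute mult.left_commute)
    then show ?thesis unfolding h by (simp only: distrib_left)
   qed
   then have "(%w'. \<Sum>w\<in>carrier V. ?f w * mnl V (u # us1) w * fc W ls1 (p us2 ls2 w) w') =
    (%w'. (\<Sum>w\<in>carrier V. ?f w * mnl V us1 w * fc W ls1' (p us2 ls2 w) w') + (\<Sum>w\<in>carrier V. ?f w * mnl V us1 w * fc W ls1' (p (u # us2) (l # ls2) w) w'))"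
    by (simp add: sum.distrib)
   then show ?case using Nadd[OF Cons.IH[of ls1' us2 ls2] Cons.IH[of ls1' "u # us2" "l # ls2"]] o Cons.prems l by simp
  qed
  have o0: "V.orth a []" "W.orth b []" by (simp_all add: V.orth_def W.orth_def)
  from Y[OF _ acu(4) ls(1) o0] acu(5) ls(2)
  have Yd: "(%w'. \<Sum>w\<in>carrier V. ?f w * mnl V us w * fc W ls (p [] [] w) w')\<in>W.fib_sub (S W) b" by simp
  have usc: "set us \<subseteq> carrier V" "ALL u:set us. bil V a u = 0" using acu(4) aD V.V.bil_sym by (auto simp: V.orth_def)
  \<comment> \<open>The weight agrees at \<open>w\<close> and \<open>w + a\<close>, so
    \<open>half_sum\<close> combines only the two cubes.\<close>
  have mnl_a: "mnl V us (w \<oplus>\<^bsub>V\<^esub> a) = mnl V us w" if "w <: V" for w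
   using usc aD that by (induction us) (auto simp: V.V.bil_simps)
  have "(\<Sum>w\<in>carrier V. ?f w * mnl V us w * fc W ls (p [] [] w) w') = fc W (b # ls) v w'" for w'
  proof -
   have "(\<Sum>w\<in>carrier V. ?f w * mnl V us w * fc W ls (p [] [] w) w') = (\<Sum>w\<in>carrier V. ?f w * (mnl V us w * fc W ls (v \<oplus>\<^bsub>W\<^esub> (bil V w c \<odot>\<^bsub>W\<^esub> b)) w'))"
   proof (rule sum.cong[OF refl])
    fix w assume w: "w <: V"
    show "?f w * mnl V us w * fc W ls (p [] [] w) w' = ?f w * (mnl V us w * fc W ls (v \<oplus>\<^bsub>W\<^esub> (bil V w c \<odot>\<^bsub>W\<^esub> b)) w')"
     using V.SSD(1)[OF zS acu(1) w] v bD by (cases "?f w = 0") (simp_all add: p_def)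
   qed
   also have "\<dots> = (\<Sum>w\<in>carrier V. bil V w c * ?f w * (mnl V us w * fc W ls (v \<oplus>\<^bsub>W\<^esub> (bil V w c \<odot>\<^bsub>W\<^esub> b)) w' +
     mnl V us (w \<oplus>\<^bsub>V\<^esub> a) * fc W ls (v \<oplus>\<^bsub>W\<^esub> (bil V (w \<oplus>\<^bsub>V\<^esub> a) c \<odot>\<^bsub>W\<^esub> b)) w'))"
    by (rule V.half_sum[OF zS acu(1-3)])
   also have "\<dots> = (\<Sum>w\<in>carrier V. ?f w * mnl V (c # us) w * fc W (b # ls) v w')"
   proof (rule sum.cong[OF refl])
    fix w assume w: "w <: V"
    show "bil V w c * ?f w * (mnl V us w * fc W ls (v \<oplus>\<^bsub>W\<^esub> (bil V w c \<odot>\<^bsub>W\<^esub> b)) w' +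
     mnl V us (w \<oplus>\<^bsub>V\<^esub> a) * fc W ls (v \<oplus>\<^bsub>W\<^esub> (bil V (w \<oplus>\<^bsub>V\<^esub> a) c \<odot>\<^bsub>W\<^esub> b)) w') = ?f w * mnl V (c # us) w * fc W (b # ls) v w'"
     using mnl_a[OF w] w aD acu(2,3) v bD
     by (cases "bil V w c = 0") (simp_all add: V.V.bil_simps W.V.fc_Cons algebra_simps)
   qed
   also have "\<dots> = pr V ?f (mnl V (c # us)) * fc W (b # ls) v w'" by (simp add: pr_def sum_distrib_right)
   finally show ?thesis using acu(6) by simp
  qed
  then show ?thesis using Yd by (simp add: W.fib_sub_def)
 qed
 then have "W.cgen d \<subseteq> S W" unfolding W.cgen_def by auto
 then show ?thesis unfolding W.k_sub_eq W.KS_eq_cgen by (rule W.mx.T.vspan_least[OF SW])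
qed

text \<open>The cube at \<open>c\<close> with directions \<open>a\<close> and the first components
  of a dual system has pairing 1 with the product of the dual forms, which has degree
  \<open>d + 1\<close>.\<close>

lemma k_strict: "\<exists>V. ndsp V & (EX z:ks d V. z \<notin> ks (Suc d) V)"
proof -
 obtain V a c ps where V: "ndsp V" "a\<in>al V" "c <: V" "bil V a c = 1" "dual V (ps @ [(a, c), (c, a)])" "length ps = d"
  using big[of d] by blast
 interpret V: lineV D x V by (rule lineVI[OF V(1)])
 have aD: "a <: V" using alD V by simp
 have dps: "dual V ps" by (rule V.dual_append[OF V(5)])
 have o: "bil V b c = 0" "bil V b a = 0" "bil V a c' = 0" "b <: V" "c' <: V" if "(b, c')\<in>set ps" for b c'
  using V.dual_append_orth[OF V(5) that, of a c] V.dual_append_orth[OF V(5) that, of c a] V.V.dual_mem[OF dps that] by auto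
 have d2: "dual V ((a, c) # ps)" using V o dps aD by auto
 let ?ls = "map fst ps" and ?us = "map snd ps"
 have ls: "V.orth a ?ls" unfolding V.orth_def using o by force
 have lsc: "set (a # ?ls) \<subseteq> carrier V" "set (c # ?us) \<subseteq> carrier V" using o aD V by auto
 have ca: "bil V c a = 1" using V.V.bil_sym V aD by metis
 let ?z = "mx.tz V (fc V (a # ?ls) c) a"
 have z: "?z\<in>V.KS d" by (rule V.cube_KS[OF V(2,3) ca ls]) (use V in simp)
 have p: "pr V (mx.cz V a ?z) (mnl V (c # ?us)) = 1"
  using V.cc_tt[OF V.fcm[OF ls V(3,2)] V(2)] V.V.pr_fc[OF lsc(1) V(3)] V.V.dd_dual[OF d2 V(3)] by simp
 have "?z \<notin> V.KS (Suc d)"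
 proof
  assume "?z\<in>V.KS (Suc d)"
  then have "\<forall>us. set us \<subseteq> carrier V & length us = Suc d --> pr V (mx.cz V a ?z) (mnl V us) = 0"
   using V(2) unfolding V.KS_def by fast
  then have "pr V (mx.cz V a ?z) (mnl V (c # ?us)) = 0" using lsc(2) V(6) by (auto simp del: mnl_simps)
  then show False using p by simp
 qed
 then show ?thesis using z V(1) unfolding V.k_sub_eq[symmetric] by blast
qed

section \<open>Classification of the subfunctors of \<open>\<Sigma>\<close>\<close>

lemma k_le: "d \<le> e ==> sub_le Tq (ks e) (ks d)"
 unfolding sub_le_def
proof
 fix V :: "'a qsp" assume de: "d \<le> e" and V: "V\<in>Obj Tq"
 interpret V: lineV D x V by (rule lineVO[OF V])
 show "ks e V \<subseteq> ks d V" unfolding V.k_sub_eq using lift_Suc_antimono_le[of V.KS, OF V.KS_Suc de] .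
qed

lemma k_top: "sub_eq Tq (ks 0) (sub_top (Sg))"
 unfolding sub_eq_def sub_top_def
proof
 fix V :: "'a qsp" assume "V\<in>Obj Tq"
 then interpret V: lineV D x V by (rule lineVO)
 show "ks 0 V = carrier (fob (Sg) V)" using V.k_sub_eq V.KS_0 by simp
qed

text \<open>Take the least \<open>d\<close> for which \<open>S\<close> is not contained in
  \<open>ks (Suc d)\<close>: \<open>key\<close> gives \<open>ks d\<close> inside \<open>S\<close>,
  and minimality gives the converse. If there is no such \<open>d\<close>, then \<open>S\<close>
  lies in every \<open>ks d\<close>, and their intersection is zero.\<close>

lemma sub_cases:
 assumes S: "subfunctor Tq (Sg) S"
 shows "sub_eq Tq S (sub_zero (Sg)) | (\<exists>d. sub_eq Tq S (ks d))"
proof -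
 define P where "P d \<longleftrightarrow> (\<exists>V. ndsp V & (EX z:S V. z \<notin> ks (Suc d) V))" for d
 have Sle: "S V \<subseteq> ks 0 V" if "ndsp V" for V
  using S Sigma_k0 that unfolding subfunctor_Sigma sub_le_def sub_eq_def Tq_ndsp[symmetric] by simp
 show ?thesis
 proof (cases "\<exists>d. P d")
  case False
  have "S V = sub_zero (Sg) V" if V: "ndsp V" for V
  proof -
   interpret V: lineV D x V by (rule lineVI[OF V])
   have k: "S V \<subseteq> V.KS d" for d
    using False V Sle[OF V] unfolding P_def V.k_sub_eq[symmetric] by (cases d) blast+
   have "submodule (S V) F2 (fob mx.TF V)"
    using subfunctor_mod[of Tq Fx S V] S V unfolding subfunctor_Sigma PF_iso_eq Tq_ndsp by simp
   then have "\<zero>\<^bsub>fob mx.TF V\<^esub>\<in>S V" by (simp add: V.mx.T.sub_iff)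
   moreover have "z = \<zero>\<^bsub>fob mx.TF V\<^esub>" if "z\<in>S V" for z by (rule V.KS_inter) (use k that in blast)
   ultimately have "S V = {\<zero>\<^bsub>fob mx.TF V\<^esub>}" by blast
   then show ?thesis by (simp add: sub_zero_def)
  qed
  then have "sub_eq Tq S (sub_zero (Sg))" unfolding sub_eq_def by (intro ballI) (simp only: Tq_ndsp)
  then show ?thesis ..
 next
  case True
  define d where "d = (LEAST d. P d)"
  have "P d" unfolding d_def using True by (rule LeastI_ex)
  then obtain V z where V: "ndsp V" "z\<in>S V" "z \<notin> ks (Suc d) V" by (auto simp: P_def)
  have "ks d W \<subseteq> S W" if "ndsp W" for W by (rule key[OF S V that])
  moreover have "S W \<subseteq> ks d W" if W: "ndsp W" for W
  proof (cases d)
   case (Suc e)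
   then have "\<not> P e" unfolding d_def using not_less_Least[of e P] by simp
   then show ?thesis using W Suc by (auto simp: P_def)
  qed (use Sle[OF W] in simp)
  ultimately have "sub_eq Tq S (ks d)" unfolding sub_eq_def by (intro ballI equalityI) (simp_all only: Tq_ndsp)
  then show ?thesis by blast
 qed
qed

lemma k_proper: "d < e ==> \<not> sub_le Tq (ks d) (ks e)"
proof
 assume de: "d < e" and le: "sub_le Tq (ks d) (ks e)"
 obtain V z where V: "ndsp V" "z\<in>ks d V" "z \<notin> ks (Suc d) V" using k_strict by blast
 have o: "V\<in>Obj Tq" unfolding Tq_ndsp by (rule V(1))
 have "z\<in>ks e V" "ks e V \<subseteq> ks (Suc d) V"
  using le k_le[of "Suc d" e] de V(2) o unfolding sub_le_def by auto
 then show False using V(3) by blast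
qed

lemma zero_le: "subfunctor Tq (Sg) S ==> sub_le Tq (sub_zero (Sg)) S"
proof -
 assume S: "subfunctor Tq (Sg) S"
 show ?thesis
  unfolding sub_le_def sub_zero_def
 proof
  fix V :: "'a qsp" assume V: "V\<in>Obj Tq"
  then have "submodule (S V) F2 (fob (Sg) V)" using S unfolding subfunctor_def by blast
  then show "{\<zero>\<^bsub>fob (Sg) V\<^esub>} \<subseteq> S V" using f2v.sub_iff[OF is_functorD(1)[OF Sigma_functor V]] by simp
 qed
qed

lemma k_not_zero: "\<not> sub_le Tq (ks d) (sub_zero (Sg))"
 using k_proper[of d "Suc d"] zero_le[OF k_Sigma[of "Suc d"]] unfolding sub_le_def by (meson lessI subset_trans)

lemma uni: "uniserial Tq (Sg)"
 unfolding uniserial_def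
proof (intro conjI allI impI Sigma_functor)
 fix S T assume S: "subfunctor Tq (Sg) S" and T: "subfunctor Tq (Sg) T"
 have e: "sub_eq Tq S S' ==> sub_le Tq S S'" "sub_eq Tq S S' ==> sub_le Tq S' S" for S S' :: "'a qsp => (('a => bit) \<times> (('a => 'a) => bit) => bit) set set"
  by (auto simp: sub_eq_def sub_le_def)
 have tr: "sub_le Tq A B ==> sub_le Tq B C ==> sub_le Tq A C" for A B C :: "'a qsp => (('a => bit) \<times> (('a => 'a) => bit) => bit) set set"
  unfolding sub_le_def by (meson subset_trans)
 from sub_cases[OF S] show "sub_le Tq S T | sub_le Tq T S"
 proof
  assume "sub_eq Tq S (sub_zero (Sg))"
  then show ?thesis using e(1) tr zero_le[OF T] by blast
 next
  assume "\<exists>d. sub_eq Tq S (ks d)"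
  then obtain d where d: "sub_eq Tq S (ks d)" by blast
  from sub_cases[OF T] show ?thesis
  proof
   assume "sub_eq Tq T (sub_zero (Sg))"
   then show ?thesis using e(1) tr zero_le[OF S] by blast
  next
   assume "\<exists>d. sub_eq Tq T (ks d)"
   then obtain d' where d': "sub_eq Tq T (ks d')" by blast
   show ?thesis using e[OF d] e[OF d'] k_le[of d d'] k_le[of d' d] tr by (meson nat_le_linear)
  qed
 qed
qed

section \<open>Composition series, head and the infinitude of \<open>Mix\<close>\<close>

abbreviation "subk d \<equiv> subfun Sg (ks d)"

lemma subk_sfun: "sfun Tq (Sg) (ks d)"
 by unfold_locales (rule Sigma_functor k_Sigma)+

lemma subk_Suc: "subfunctor Tq (subk d) (ks (Suc d))"
 unfolding sfun.subfunctor_sub[OF subk_sfun] using k_Sigma k_le[of d "Suc d"] by simp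

lemma subk_Suc_sfun: "sfun Tq (subk d) (ks (Suc d))"
 by unfold_locales (rule sfun.sub_functor[OF subk_sfun] subk_Suc)+

lemma top_subk: "sub_eq Tq S (sub_top (subfun (Sg) T)) \<longleftrightarrow> sub_eq Tq S T"
 by (simp add: sub_eq_def sub_top_def)

lemma sub_eq_le: "sub_eq Tq S T \<longleftrightarrow> sub_le Tq S T & sub_le Tq T S"
 unfolding sub_eq_def sub_le_def by blast

lemma sub_le_trans: "sub_le Tq A B ==> sub_le Tq B C ==> sub_le Tq A C"
 unfolding sub_le_def by (meson subset_trans)

lemma k_simple: "simple_functor Tq (quotfun (subk d) (ks (Suc d)))"
 unfolding sfun.simple_quot_iff[OF subk_Suc_sfun Tq_closed]
proof (intro conjI allI impI)
 show "\<not> sub_eq Tq (ks (Suc d)) (sub_top (subk d))"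
  unfolding top_subk using k_proper[of d "Suc d"] by (simp add: sub_eq_le)
 fix T assume T: "subfunctor Tq (subk d) T" "sub_le Tq (ks (Suc d)) T"
 then have T': "subfunctor Tq (Sg) T" "sub_le Tq T (ks d)" unfolding sfun.subfunctor_sub[OF subk_sfun] by auto
 have "\<not> sub_eq Tq T (sub_zero (Sg))"
  using sub_le_trans[OF T(2), of "sub_zero (Sg)"] k_not_zero[of "Suc d"] unfolding sub_eq_le by blast
 then obtain e where e: "sub_eq Tq T (ks e)" using sub_cases[OF T'(1)] by blast
 then have "sub_le Tq (ks e) (ks d)" "sub_le Tq (ks (Suc d)) (ks e)"
  using T(2) T'(2) unfolding sub_eq_def sub_le_def by simp_all
 then have "d \<le> e" "e \<le> Suc d" using k_proper[of e d] k_proper[of "Suc d" e] by (auto simp: not_less[symmetric])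
 then have "e = d | e = Suc d" by auto
 then show "sub_eq Tq T (ks (Suc d)) | sub_eq Tq T (sub_top (subk d))" using e unfolding top_subk by auto
qed

lemma k_series: "composition_series Tq (Sg) \<infinity> (%d. ks d)"
 unfolding composition_series_def
proof (intro conjI allI impI k_top k_Sigma k_simple)
 show "sub_le Tq (ks (Suc i)) (ks i)" for i by (rule k_le) simp
 show "sub_eq Tq (%X. \<Inter>i\<in>{i. enat i \<le> \<infinity>}. ks i X) (sub_zero (Sg))"
  unfolding sub_eq_def
 proof
  fix V :: "'a qsp" assume V: "V\<in>Obj Tq"
  then interpret V: lineV D x V by (rule lineVO)
  have "(\<Inter>i. V.KS i) = {\<zero>\<^bsub>fob mx.TF V\<^esub>}"
  proof
   show "(\<Inter>i. V.KS i) \<subseteq> {\<zero>\<^bsub>fob mx.TF V\<^esub>}" using V.KS_inter by auto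
   show "{\<zero>\<^bsub>fob mx.TF V\<^esub>} \<subseteq> (\<Inter>i. V.KS i)" using V.KS_sub V.mx.T.sub_iff by auto
  qed
  then show "(\<Inter>i\<in>{i. enat i \<le> \<infinity>}. ks i V) = sub_zero (Sg) V"
   by (simp add: V.k_sub_eq sub_zero_def)
 qed
qed

text \<open>By the classification every subfunctor properly contained in \<open>ks d\<close> lies in
  \<open>ks (Suc d)\<close>; simplicity of the quotient leaves no room between \<open>T\<close> and
  \<open>S\<close>.\<close>

lemma series_step:
 assumes T: "subfunctor Tq (Sg) T" and S: "subfunctor Tq (Sg) S" "sub_eq Tq S (ks d)" "sub_le Tq T S"
  and s: "simple_functor Tq (quotfun (subfun (Sg) S) T)"
 shows "sub_eq Tq T (ks (Suc d))"
proof -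
 have sf: "sfun Tq (Sg) S" by unfold_locales (rule Sigma_functor S)+
 have sT: "subfunctor Tq (subfun (Sg) S) T" unfolding sfun.subfunctor_sub[OF sf] using T S by simp
 have q: "sfun Tq (subfun (Sg) S) T" by unfold_locales (rule sfun.sub_functor[OF sf] sT)+
 note q' = s[unfolded sfun.simple_quot_iff[OF q Tq_closed]]
 have pr: "\<not> sub_eq Tq T (ks d)"
  using conjunct1[OF q'] S(2) unfolding top_subk unfolding sub_eq_def by simp
 have kS: "subfunctor Tq (subfun (Sg) S) (ks (Suc d))"
  unfolding sfun.subfunctor_sub[OF sf] using k_Sigma k_le[of d "Suc d"] S(2) unfolding sub_eq_def sub_le_def by simp
 have le: "sub_le Tq T (ks (Suc d))"
 proof -
  from sub_cases[OF T] show ?thesis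
  proof
   assume "sub_eq Tq T (sub_zero (Sg))"
   then show ?thesis using zero_le[OF k_Sigma] unfolding sub_eq_def sub_le_def by simp
  next
   assume "\<exists>e. sub_eq Tq T (ks e)"
   then obtain e where e: "sub_eq Tq T (ks e)" by blast
   then have "sub_le Tq (ks e) (ks d)" using S unfolding sub_eq_def sub_le_def by simp
   then have "d \<le> e" using k_proper[of e d] by (auto simp: not_less[symmetric])
   moreover have "e ~= d" using e pr by auto
   ultimately have "Suc d \<le> e" by simp
   then show ?thesis using e k_le unfolding sub_eq_def sub_le_def by simp
  qed
 qed
 from conjunct2[OF q', rule_format, OF kS le] show ?thesis
 proof
  assume "sub_eq Tq (ks (Suc d)) T"
  then show ?thesis unfolding sub_eq_le by simp
 next
  assume "sub_eq Tq (ks (Suc d)) (sub_top (subfun (Sg) S))"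
  then have "sub_le Tq (ks d) (ks (Suc d))" using S(2) unfolding top_subk unfolding sub_eq_def sub_le_def by simp
  then show ?thesis using k_proper[of d "Suc d"] by simp
 qed
qed

lemma series_unique:
 assumes "composition_series Tq (Sg) N S"
 shows "N = \<infinity> & (\<forall>d. sub_eq Tq (S d) (ks d))"
proof -
 note c = assms[unfolded composition_series_def]
 have k: "enat d \<le> N ==> sub_eq Tq (S d) (ks d)" for d
 proof (induction d)
  case 0
  then show ?case using c k_top unfolding sub_eq_def sub_le_def by simp
 next
  case (Suc d)
  then have lt: "enat d < N" using Suc_ile_eq by blast
  then have "sub_eq Tq (S d) (ks d)" using Suc by simp
  then show ?case
   using series_step[of "S (Suc d)" "S d" d] c Suc.prems lt by (meson less_imp_le)
 qed
 \<comment> \<open>A series of finite length \<open>n\<close> would end with \<open>ks n\<close>,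
   which is not zero.\<close>
 have "N = \<infinity>"
 proof (rule ccontr)
  assume "N ~= \<infinity>"
  then obtain n where n: "N = enat n" by auto
  have "sub_le Tq (ks n) (sub_zero (Sg))"
   unfolding sub_le_def
  proof
   fix V :: "'a qsp" assume V: "V\<in>Obj Tq"
   have "ks n V \<subseteq> S i V" if "enat i \<le> N" for i
    using k[OF that] k_le[of i n] that n V unfolding sub_eq_def sub_le_def by auto
   then have "ks n V \<subseteq> (\<Inter>i\<in>{i. enat i \<le> N}. S i V)" by auto
   then show "ks n V \<subseteq> sub_zero (Sg) V" using c V unfolding sub_eq_def by auto
  qed
  then show False using k_not_zero by blast
 qed
 then show ?thesis using k by simp
qed

lemma Sigma_radical: "sub_eq Tq (radical Tq (Sg)) (ks 1)"
proof -
 let ?M = "maximal_subfunctor Tq (Sg)"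
 have top: "sub_eq Tq T (sub_top (Sg)) \<longleftrightarrow> sub_eq Tq T (ks 0)" for T
  using k_top unfolding sub_eq_def sub_le_def by simp
 have 1: "sub_eq Tq S (ks 1)" if "?M S" for S
 proof -
  have S: "subfunctor Tq (Sg) S" "\<not> sub_eq Tq S (ks 0)"
   "!!T. subfunctor Tq (Sg) T ==> sub_le Tq S T ==> sub_eq Tq T S | sub_eq Tq T (ks 0)"
   using that unfolding maximal_subfunctor_def top by auto
  have le: "sub_le Tq S (ks 1)"
  proof -
   from sub_cases[OF S(1)] show ?thesis
   proof
    assume "sub_eq Tq S (sub_zero (Sg))"
    then show ?thesis using zero_le[OF k_Sigma] unfolding sub_eq_def sub_le_def by simp
   next
    assume "\<exists>d. sub_eq Tq S (ks d)"
    then obtain d where d: "sub_eq Tq S (ks d)" by blast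
    then have "1 \<le> d" using S(2) by (cases d) auto
    then show ?thesis using d k_le unfolding sub_eq_def sub_le_def by simp
   qed
  qed
  from S(3)[OF k_Sigma le] show ?thesis
   using k_proper[of 0 1] unfolding sub_eq_le by auto
 qed
 have 2: "?M (ks 1)"
  unfolding maximal_subfunctor_def top
 proof (intro conjI allI impI k_Sigma)
  show "\<not> sub_eq Tq (ks 1) (ks 0)" using k_proper[of 0 1] unfolding sub_eq_le by simp
  fix T assume T: "subfunctor Tq (Sg) T" "sub_le Tq (ks 1) T"
  have "\<not> sub_eq Tq T (sub_zero (Sg))"
   using sub_le_trans[OF T(2), of "sub_zero (Sg)"] k_not_zero[of 1] unfolding sub_eq_le by blast
  then obtain e where e: "sub_eq Tq T (ks e)" using sub_cases[OF T(1)] by blast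
  then have "sub_le Tq (ks 1) (ks e)" using T(2) unfolding sub_eq_def sub_le_def by simp
  then have "e = 0 | e = 1" using k_proper[of 1 e] by (cases e) (auto simp: not_less[symmetric])
  then show "sub_eq Tq T (ks 1) | sub_eq Tq T (ks 0)" using e by auto
 qed
 show ?thesis
  unfolding sub_eq_def radical_def
 proof
  fix V :: "'a qsp" assume V: "V\<in>Obj Tq"
  \<comment> \<open>A subfunctor is constrained on objects of \<open>Tq\<close> only, so several
    families may be maximal; at the object \<open>V\<close> they all have the value of
    \<open>ks 1\<close>.\<close>
  have "{S V | S. ?M S} = {ks 1 V}" using 1 2 V unfolding sub_eq_def by blast
  moreover have "ks 1 V \<subseteq> carrier (fob (Sg) V)"
   using sfun.Sc[OF subk_sfun V] .
  ultimately show "carrier (fob (Sg) V) \<inter> \<Inter> {S V | S. ?M S} = ks 1 V" by auto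
 qed
qed

text \<open>In a finite composition series of \<open>Mix\<close>, some simple quotient would contain a nonzero \<open>k_d \<Sigma>\<close>.\<close>

lemma Mix_infinite: "infinite_functor Tq Mx"
 unfolding infinite_functor_def
proof (intro conjI Mix_functor notI)
 assume "\<exists>n S. composition_series Tq Mx (enat n) S"
 then obtain n S where c: "composition_series Tq Mx (enat n) S" by blast
 note c = c[unfolded composition_series_def]
 have Ssub: "subfunctor Tq Mx (S i)" if "i \<le> n" for i using c that by simp
 have f2: "f2v (fob Mx V)" if "V\<in>Obj Tq" for V using is_functorD(1)[OF Mix_functor that] .
 have sm: "submodule (S i V) F2 (fob Mx V)" if "i \<le> n" "V\<in>Obj Tq" for i V
  by (rule subfunctor_mod[OF Ssub[OF that(1)] that(2)])
 have Sg: "submodule (Sigma_sub D x V) F2 (fob Mx V)" if "V\<in>Obj Tq" for V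
  by (rule subfunctor_mod[OF Sigma_Mix that])
 have km: "submodule (ks d V) F2 (fob Mx V)" if V: "V\<in>Obj Tq" for V d
 proof -
  interpret V: lineV D x V by (rule lineVO[OF V])
  show ?thesis using V.KS_sub[of d] V.KS_SS[of d] V.SS_MS f2v.sub_iff[OF f2[OF V]]
   unfolding V.k_sub_eq V.fob_Mix V.mx.T.sub_iff by auto
 qed
 have dec: "S i V \<subseteq> S j V" if "j \<le> i" "i \<le> n" "V\<in>Obj Tq" for i j V
  using that
 proof (induction i)
  case (Suc i)
  have "S (Suc i) V \<subseteq> S i V" using c Suc.prems by (simp add: sub_le_def Suc_le_eq)
  then show ?case using Suc by (cases "j = Suc i") auto
 qed simp
 \<comment> \<open>The trace of the series on \<open>\<Sigma>\<close>. It goes from all of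
   \<open>\<Sigma>\<close> to zero, and by the classification each of its terms is zero or some
   \<open>ks d\<close>.\<close>
 define I where "I i V = S i V \<inter> Sigma_sub D x V" for i V
 have Isub: "subfunctor Tq (Sg) (I i)" if i: "i \<le> n" for i
  unfolding Sigma_fun_def sfun.subfunctor_sub[OF Sigma_sfun] sub_le_def
 proof (intro conjI ballI)
  show "subfunctor Tq Mx (I i)"
   unfolding subfunctor_def
  proof (intro conjI ballI)
   fix V :: "'a qsp" assume V: "V\<in>Obj Tq"
   show "submodule (I i V) F2 (fob Mx V)"
    using sm[OF i V] Sg[OF V] unfolding f2v.sub_iff[OF f2[OF V]] I_def by auto
   fix W t assume W: "W\<in>Obj Tq" "t\<in>Hom Tq V W"
   have "fmor Mx V W t ` S i V \<subseteq> S i W" "fmor Mx V W t ` Sigma_sub D x V \<subseteq> Sigma_sub D x W"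
    using subfunctorD[OF Ssub[OF i] V W] subfunctorD[OF Sigma_Mix V W] by auto
   then show "fmor Mx V W t ` I i V \<subseteq> I i W" unfolding I_def by blast
  qed
 qed (simp add: I_def)
 have I0: "sub_eq Tq (I 0) (Sigma_sub D x)"
 proof -
  have "Sigma_sub D x V \<subseteq> S 0 V" if "V\<in>Obj Tq" for V
   using c that Sg[OF that] f2v.sub_iff[OF f2[OF that]] unfolding sub_eq_def sub_top_def by auto
  then show ?thesis by (auto simp: sub_eq_def I_def)
 qed
 have Sn: "S n V = {\<zero>\<^bsub>fob Mx V\<^esub>}" if V: "V\<in>Obj Tq" for V
 proof -
  have "S n V \<subseteq> (\<Inter>i\<in>{i. enat i \<le> enat n}. S i V)" using dec[of _ n V] V by auto
  then have "S n V \<subseteq> {\<zero>\<^bsub>fob Mx V\<^esub>}" using c V unfolding sub_eq_def sub_zero_def by auto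
  then show ?thesis using sm[OF le_refl V] f2v.sub_iff[OF f2[OF V]] by auto
 qed
 have z: "\<zero>\<^bsub>fob (Sg) V\<^esub> = \<zero>\<^bsub>fob Mx V\<^esub>" for V by (simp add: Sigma_fun_def)
 define Z where "Z i \<longleftrightarrow> sub_eq Tq (I i) (sub_zero (Sg))" for i
 have "Z n" unfolding Z_def sub_eq_def sub_zero_def I_def z
  using Sn Sg f2v.sub_iff[OF f2] by auto
 moreover have "\<not> Z 0"
  using k_not_zero[of 0] I0 Sigma_k0 unfolding Z_def sub_eq_def sub_le_def by auto
 ultimately obtain i where i: "i < n" "\<not> Z i" "Z (Suc i)"
  using ex_least_nat_less[of Z n] by blast
 obtain d where d: "sub_eq Tq (I i) (ks d)" using sub_cases[OF Isub[of i]] i unfolding Z_def by auto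
 have sim: "simple_functor Tq (quotfun (subfun Mx (S i)) (S (Suc i)))" and le: "sub_le Tq (S (Suc i)) (S i)" using c i(1) by auto
 have sfi: "sfun Tq Mx (S i)" by unfold_locales (use Mix_functor Ssub i in auto)
 have sfq: "sfun Tq (subfun Mx (S i)) (S (Suc i))"
  by unfold_locales (use sfun.sub_functor[OF sfi] sfun.subfunctor_sub[OF sfi] Ssub[of "Suc i"] i le in auto)
 \<comment> \<open>Lies between \<open>S (Suc i)\<close> and \<open>S i\<close>, so by simplicity it
   is one of them. In the first case \<open>ks (Suc d)\<close> lies in the trace of
   \<open>S (Suc i)\<close>, which is zero; in the second \<open>ks d\<close> turns out to be
   contained in \<open>ks (Suc d)\<close>.\<close>
 define T where "T V = {y \<oplus>\<^bsub>fob Mx V\<^esub> s | y s. y\<in>ks (Suc d) V & s\<in>S (Suc i) V}" for V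
 have kI: "ks (Suc d) V \<subseteq> S i V" if "V\<in>Obj Tq" for V
  using d k_le[of d "Suc d"] that unfolding sub_eq_def sub_le_def I_def by fastforce
 have T: "subfunctor Tq (subfun Mx (S i)) T"
  unfolding sfun.subfunctor_sub[OF sfi]
 proof
  show "sub_le Tq T (S i)"
   unfolding sub_le_def
  proof
   fix V :: "'a qsp" assume V: "V\<in>Obj Tq"
   show "T V \<subseteq> S i V"
   proof -
    have "S (Suc i) V \<subseteq> S i V" using le V unfolding sub_le_def by blast
    moreover have "y \<oplus>\<^bsub>fob Mx V\<^esub> s\<in>S i V" if "y\<in>S i V" "s\<in>S i V" for y s
     using that sm[of i V] V i unfolding f2v.sub_iff[OF f2[OF V]] by (simp only: less_imp_le)
    ultimately show ?thesis using kI[OF V] unfolding T_def by blast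
   qed
  qed
  show "subfunctor Tq Mx T"
   unfolding subfunctor_def
  proof (intro conjI ballI)
   fix V :: "'a qsp" assume V: "V\<in>Obj Tq"
   interpret M: f2v "fob Mx V" by (rule f2[OF V])
   note a = km[OF V, of "Suc d", unfolded M.sub_iff]
   have b: "S (Suc i) V \<subseteq> carrier (fob Mx V)" "\<zero>\<^bsub>fob Mx V\<^esub>\<in>S (Suc i) V"
    "ALL p:S (Suc i) V. ALL q:S (Suc i) V. p \<oplus>\<^bsub>fob Mx V\<^esub> q\<in>S (Suc i) V"
    using sm[of "Suc i" V] i V unfolding M.sub_iff by auto
   show "submodule (T V) F2 (fob Mx V)"
    unfolding M.sub_iff
   proof (intro conjI ballI)
    show "T V \<subseteq> carrier (fob Mx V)" unfolding T_def using a b by auto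
    have "\<zero>\<^bsub>fob Mx V\<^esub> = \<zero>\<^bsub>fob Mx V\<^esub> \<oplus>\<^bsub>fob Mx V\<^esub> \<zero>\<^bsub>fob Mx V\<^esub>" by simp
    then show "\<zero>\<^bsub>fob Mx V\<^esub>\<in>T V" unfolding T_def using a b by blast
    fix p q assume "p\<in>T V" "q\<in>T V"
    then obtain y s y' s' where *: "p = y \<oplus>\<^bsub>fob Mx V\<^esub> s" "q = y' \<oplus>\<^bsub>fob Mx V\<^esub> s'"
     "y\<in>ks (Suc d) V" "y'\<in>ks (Suc d) V" "s\<in>S (Suc i) V" "s'\<in>S (Suc i) V" unfolding T_def by auto
    then have m: "y <: fob Mx V" "y' <: fob Mx V" "s <: fob Mx V" "s' <: fob Mx V"
     using a b by auto
    have "p \<oplus>\<^bsub>fob Mx V\<^esub> q = (y \<oplus>\<^bsub>fob Mx V\<^esub> y') \<oplus>\<^bsub>fob Mx V\<^esub> (s \<oplus>\<^bsub>fob Mx V\<^esub> s')"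
     using m * by (simp only: M.ac M.a_closed)
    then show "p \<oplus>\<^bsub>fob Mx V\<^esub> q\<in>T V" unfolding T_def using * a b by blast
   qed
   fix W t assume W: "W\<in>Obj Tq" "t\<in>Hom Tq V W"
   note L = is_functorD(2)[OF Mix_functor V W]
   have kk: "fmor Mx V W t ` ks (Suc d) V \<subseteq> ks (Suc d) W"
    using subfunctorD[OF k_Sigma[of "Suc d"] V W] by simp
   have ss: "fmor Mx V W t ` S (Suc i) V \<subseteq> S (Suc i) W"
    using subfunctorD[OF Ssub[of "Suc i"] V W] i by auto
   show "fmor Mx V W t ` T V \<subseteq> T W"
   proof (rule image_subsetI)
    fix p assume "p\<in>T V"
    then obtain y s where *: "p = y \<oplus>\<^bsub>fob Mx V\<^esub> s" "y\<in>ks (Suc d) V" "s\<in>S (Suc i) V" unfolding T_def by auto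
    then have "fmor Mx V W t p = fmor Mx V W t y \<oplus>\<^bsub>fob Mx W\<^esub> fmor Mx V W t s"
     using lin_add[OF L, of y s] a b by auto
    then show "fmor Mx V W t p\<in>T W" unfolding T_def using kk ss * by blast
   qed
  qed
 qed
 have ST: "sub_le Tq (S (Suc i)) T"
  unfolding sub_le_def
 proof (intro ballI subsetI)
  fix V :: "'a qsp" and s assume V: "V\<in>Obj Tq" "s\<in>S (Suc i) V"
  interpret M: f2v "fob Mx V" by (rule f2[OF V(1)])
  have "s <: fob Mx V" "\<zero>\<^bsub>fob Mx V\<^esub>\<in>ks (Suc d) V"
   using sm[of "Suc i" V] km[OF V(1)] i V unfolding M.sub_iff by auto
  then show "s\<in>T V" unfolding T_def using V(2) M.l_zero[of s] by force
 qed
 from conjunct2[OF sim[unfolded sfun.simple_quot_iff[OF sfq Tq_closed]], rule_format, OF T ST] show False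
 proof
  assume e: "sub_eq Tq T (S (Suc i))"
  have "sub_le Tq (ks (Suc d)) (I (Suc i))"
   unfolding sub_le_def
  proof (intro ballI subsetI)
   fix V :: "'a qsp" and y assume V: "V\<in>Obj Tq" "y\<in>ks (Suc d) V"
   interpret M: f2v "fob Mx V" by (rule f2[OF V(1)])
   have "y <: fob Mx V" "\<zero>\<^bsub>fob Mx V\<^esub>\<in>S (Suc i) V"
    using sm[of "Suc i" V] km[OF V(1), of "Suc d"] i V unfolding M.sub_iff by auto
   then have "y\<in>T V" unfolding T_def using V(2) M.r_zero[of y] by force
   then have "y\<in>S (Suc i) V" using e V by (simp add: sub_eq_def)
   moreover have "y\<in>Sigma_sub D x V" using k_Sigma[of "Suc d"] V unfolding subfunctor_Sigma sub_le_def by blast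
   ultimately show "y\<in>I (Suc i) V" by (simp add: I_def)
  qed
  then show False using i(3) k_not_zero[of "Suc d"] unfolding Z_def sub_eq_def sub_le_def by auto
 next
  assume e: "sub_eq Tq T (sub_top (subfun Mx (S i)))"
  have "sub_le Tq (ks d) (ks (Suc d))"
   unfolding sub_le_def
  proof (intro ballI subsetI)
   fix V :: "'a qsp" and w assume V: "V\<in>Obj Tq" "w\<in>ks d V"
   interpret M: f2v "fob Mx V" by (rule f2[OF V(1)])
   have wI: "w\<in>I i V" using d V by (simp add: sub_eq_def)
   then have "w\<in>T V" using e V by (simp add: sub_eq_def sub_top_def I_def)
   then obtain y s where *: "w = y \<oplus>\<^bsub>fob Mx V\<^esub> s" "y\<in>ks (Suc d) V" "s\<in>S (Suc i) V" unfolding T_def by auto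
   have yS: "y\<in>Sigma_sub D x V" using k_Sigma[of "Suc d"] V *(2) unfolding subfunctor_Sigma sub_le_def by blast
   have g: "Sigma_sub D x V \<subseteq> carrier (fob Mx V)" "!!p q. p\<in>Sigma_sub D x V ==> q\<in>Sigma_sub D x V ==> p \<oplus>\<^bsub>fob Mx V\<^esub> q\<in>Sigma_sub D x V"
    using Sg[OF V(1)] unfolding M.sub_iff by auto
   have sc: "s <: fob Mx V" using sm[of "Suc i" V] i V *(3) unfolding M.sub_iff by auto
   have yc: "y <: fob Mx V" using g yS by auto
   \<comment> \<open>Thus \<open>s\<close> is a sum of two elements of \<open>\<Sigma>\<close>;
     being also in \<open>S (Suc i)\<close> it must vanish.\<close>
   have "y \<oplus>\<^bsub>fob Mx V\<^esub> w = s" using * sc yc by simp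
   then have "s\<in>Sigma_sub D x V" using g(2)[OF yS] wI by (auto simp: I_def)
   then have "s\<in>I (Suc i) V" using *(3) by (simp add: I_def)
   then have "s = \<zero>\<^bsub>fob Mx V\<^esub>" using i(3) V(1) unfolding Z_def sub_eq_def sub_zero_def z by auto
   then show "w\<in>ks (Suc d) V" using * yc by simp
  qed
  then show False using k_proper[of d "Suc d"] by simp
 qed
qed

section \<open>The exact sequence for \<open>Mix\<close>\<close>

lemma swap_nat:
 assumes t: "tmor V W t" and z: "z\<in>Mix_sub D x V"
 shows "swap_map D x W (fmor mx.TF V W t z) = fmor mx.TF V W t (swap_map D x V z)"
proof -
 interpret t: tmor V W t by fact
 interpret V: lineV D x V by (rule lineVI[OF t.V.ndsp_axioms])
 interpret W: lineV D x W by (rule lineVI[OF t.W.ndsp_axioms])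
 have L: "fmor mx.TF V W t\<in>lin_maps (fob mx.TF V) (fob mx.TF W)" by (rule mx.fmor_TF_lin[OF t])
 have MM: "fmor mx.TF V W t y\<in>W.MS" if "y\<in>V.MS" for y
  using Mix_subfunctor tmor_hom[OF t] that unfolding subfunctor_def PF_iso_eq V.Mix_eq[symmetric] W.Mix_eq[symmetric] by blast
 have G: "{mx.tz V (gen w) a | w a. w <: V & a\<in>al V & bil V w a = 1} \<subseteq> carrier (fob mx.TF V)" by auto
 have "z\<in>vspan (fob mx.TF V) {mx.tz V (gen w) a | w a. w <: V & a\<in>al V & bil V w a = 1}" using z V.Mix_eq_vspan by simp
 then show ?thesis using G
 proof (induction rule: V.mx.T.vspan_induct)
  case zero
  then show ?case using lin_zero[OF V.mx.T.f2v_axioms W.mx.T.f2v_axioms L] by (simp add: V.swap_zero W.swap_zero)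
 next
  case (add s z)
  then obtain w a where s: "s = mx.tz V (gen w) a" "w <: V" "a\<in>al V" "bil V w a = 1" by auto
  have m: "s\<in>V.MS" "z\<in>V.MS" using s V.gen_in_MS add V.Mix_eq V.Mix_eq_vspan by auto
  have ac: "a <: V" using alD s by simp
  have fs: "fmor mx.TF V W t (mx.tz V (gen u) a) = (if a\<in>dm V W t then mx.tz W (gen (eps_mor V W t u)) (eps_mor V W t a) else \<zero>\<^bsub>fob mx.TF W\<^esub>)"
   if "u <: V" for u
   using fmor_pt[OF t s(3), of "gen u"] that by (simp add: free_map_gen)
  have sg: "swap_map D x W (fmor mx.TF V W t s) = fmor mx.TF V W t (swap_map D x V s)"
  proof (cases "a\<in>dm V W t")
   case True
   have o: "V.orth a []" by (simp add: V.orth_def)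
   note i = cube_image[OF t s(3) True s(2,4) o]
   show ?thesis
    unfolding s(1) V.swap_gen[OF s(2-4)] using fs[OF s(2)] fs[of "w \<oplus>\<^bsub>V\<^esub> a"] s(2) ac True
     W.swap_gen[OF t.eps_mem[OF s(2)] i(1,2)] t.eps_add[OF s(2) ac] by simp
  next
   case False
   then show ?thesis
    unfolding s(1) V.swap_gen[OF s(2-4)] using fs[OF s(2)] fs[of "w \<oplus>\<^bsub>V\<^esub> a"] s(2) ac W.swap_zero by simp
  qed
  have c: "s <: fob mx.TF V" "z <: fob mx.TF V" "swap_map D x V s <: fob mx.TF V" "swap_map D x V z <: fob mx.TF V"
   using m V.swap_mem V.MSc by auto
  show ?case
   using add.IH sg by (simp add: lin_add[OF L c(1,2)] lin_add[OF L c(3,4)] V.swap_add[OF m] W.swap_add[OF MM[OF m(1)] MM[OF m(2)]])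
 qed
qed

text \<open>The projection is \<open>1 + \<tau>\<close>, where \<open>\<tau>\<close> is the swap.\<close>

lemma Sigma_exact: "\<exists>p. short_exact Tq (Sg) Mx (Sg) (%V z. z) p"
proof
 let ?p = "%V z. z \<oplus>\<^bsub>fob mx.TF V\<^esub> swap_map D x V z"
 have V: "lineV D x V" if "V\<in>Obj Tq" for V using that by (rule lineVO)
 have pc: "mx.cz V a (?p V z) w = mx.cz V a z w + mx.cz V a z (w \<oplus>\<^bsub>V\<^esub> a)"
  if "V\<in>Obj Tq" "z\<in>Mix_sub D x V" "a\<in>al V" "w <: V" for V z a w
 proof -
  interpret V: lineV D x V by (rule V[OF that(1)])
  have z: "z\<in>V.MS" using that V.Mix_eq by simp
  show ?thesis using V.swap_cc[OF z that(3,4)] V.MSc[OF z] V.MSc[OF V.swap_mem[OF z]] by simp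
 qed
 have pS: "?p V z\<in>Sigma_sub D x V" if X: "V\<in>Obj Tq" and zz: "z\<in>Mix_sub D x V" for V z
 proof -
  interpret V: lineV D x V by (rule V[OF X])
  have z: "z\<in>V.MS" using zz V.Mix_eq by simp
  have "?p V z\<in>V.MS" using V.MS_sub z V.swap_mem[OF z] by (auto simp: V.mx.T.sub_iff)
  moreover have "mx.cz V a (?p V z) (w \<oplus>\<^bsub>V\<^esub> a) = mx.cz V a (?p V z) w" if "a\<in>al V" "w <: V" for a w
   using pc[OF X zz that(1)] alD(1)[OF that(1)] that(2) by (simp add: V.V.a_assoc add.commute)
  ultimately show ?thesis unfolding V.Sigma_eq V.SS_def by simp
 qed
 show "short_exact Tq (Sg) Mx (Sg) (%V z. z) ?p"
  unfolding short_exact_def nat_trans_def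
 proof (intro conjI ballI Sigma_functor Mix_functor)
  fix V :: "'a qsp" assume X: "V\<in>Obj Tq"
  interpret V: lineV D x V by (rule V[OF X])
  note Mf = V.mx.T.f2v_sub[OF V.MS_sub] and Sf = V.mx.T.f2v_sub[OF V.SS_sub]
  have MSm: "V.MS = Mix_sub D x V" using V.Mix_eq by simp
  have cM: "carrier (fob Mx V) = Mix_sub D x V" and cS: "carrier (fob (Sg) V) = Sigma_sub D x V"
   using V.Mix_eq V.Sigma_eq by simp_all
  show "(%z. z)\<in>lin_maps (fob (Sg) V) (fob Mx V)"
   unfolding V.fob_Sigma V.fob_Mix by (rule linI[OF Sf Mf]) (use V.SS_MS in auto)
  show "?p V\<in>lin_maps (fob Mx V) (fob (Sg) V)"
   unfolding V.fob_Sigma V.fob_Mix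
  proof (rule linI[OF Mf Sf])
   fix y z assume yz: "y <: fob mx.TF V\<lparr>carrier := V.MS\<rparr>" "z <: fob mx.TF V\<lparr>carrier := V.MS\<rparr>"
   then show "?p V y <: fob mx.TF V\<lparr>carrier := V.SS\<rparr>" using pS[OF X, of y] V.Sigma_eq V.Mix_eq by simp
   have m: "y\<in>V.MS" "z\<in>V.MS" using yz by simp_all
   show "?p V (y \<oplus>\<^bsub>fob mx.TF V\<lparr>carrier := V.MS\<rparr>\<^esub> z) = ?p V y \<oplus>\<^bsub>fob mx.TF V\<lparr>carrier := V.SS\<rparr>\<^esub> ?p V z"
    using m V.MSc[OF m(1)] V.MSc[OF m(2)] V.MSc[OF V.swap_mem[OF m(1)]] V.MSc[OF V.swap_mem[OF m(2)]]
    by (simp add: V.swap_add[OF m] V.mx.T.ac)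
  qed
  show "inj_on (%z. z) (carrier (fob (Sg) V))" by simp
  have ker: "?p V z = \<zero>\<^bsub>fob (Sg) V\<^esub> \<longleftrightarrow> z\<in>Sigma_sub D x V" if z: "z\<in>Mix_sub D x V" for z
  proof -
   have m: "z\<in>V.MS" using z V.Mix_eq by simp
   have "?p V z = \<zero>\<^bsub>fob (Sg) V\<^esub> \<longleftrightarrow> z = swap_map D x V z"
    using V.MSc[OF m] V.MSc[OF V.swap_mem[OF m]] by simp
   then show ?thesis using z unfolding Sigma_sub_def by auto
  qed
  show "(%z. z) ` carrier (fob (Sg) V) = {z\<in>carrier (fob Mx V). ?p V z = \<zero>\<^bsub>fob (Sg) V\<^esub>}"
   unfolding cM cS using ker by (auto simp: Sigma_sub_def)
  show "?p V ` carrier (fob Mx V) = carrier (fob (Sg) V)"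
  proof
   show "?p V ` carrier (fob Mx V) \<subseteq> carrier (fob (Sg) V)" unfolding cM cS using pS[OF X] by auto
   have img: "submodule (?p V ` V.MS) F2 (fob mx.TF V)"
    unfolding V.mx.T.sub_iff
   proof (intro conjI ballI)
    show "?p V ` V.MS \<subseteq> carrier (fob mx.TF V)" using V.MSc V.swap_mem by auto
    have "?p V \<zero>\<^bsub>fob mx.TF V\<^esub> = \<zero>\<^bsub>fob mx.TF V\<^esub>" "\<zero>\<^bsub>fob mx.TF V\<^esub>\<in>V.MS" using V.swap_zero V.MS_sub by (simp_all add: V.mx.T.sub_iff)
    then show "\<zero>\<^bsub>fob mx.TF V\<^esub>\<in>?p V ` V.MS" by force
    fix p q assume "p\<in>?p V ` V.MS" "q\<in>?p V ` V.MS"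
    then obtain y z where m: "y\<in>V.MS" "z\<in>V.MS" "p = ?p V y" "q = ?p V z" by auto
    then have "p \<oplus>\<^bsub>fob mx.TF V\<^esub> q = ?p V (y \<oplus>\<^bsub>fob mx.TF V\<^esub> z)"
     using V.MSc[OF m(1)] V.MSc[OF m(2)] V.MSc[OF V.swap_mem[OF m(1)]] V.MSc[OF V.swap_mem[OF m(2)]]
     by (simp add: V.swap_add[OF m(1,2)] V.mx.T.ac)
    moreover have "y \<oplus>\<^bsub>fob mx.TF V\<^esub> z\<in>V.MS" using V.MS_sub m by (simp add: V.mx.T.sub_iff)
    ultimately show "p \<oplus>\<^bsub>fob mx.TF V\<^esub> q\<in>?p V ` V.MS" by blast
   qed
   \<comment> \<open>Surjectivity: a cube with the single direction \<open>a\<close> is the image of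
     either of its two points, and these cubes span \<open>\<Sigma>\<close>.\<close>
   have "V.cgen 0 \<subseteq> ?p V ` V.MS"
   proof
    fix g assume "g\<in>V.cgen 0"
    then obtain a v where g: "g = mx.tz V (fc V [a] v) a" "a\<in>al V" "v <: V" "bil V v a = 1" unfolding V.cgen_def by auto
    have ac: "a <: V" using alD g by simp
    have "g = mx.tz V (gen v) a \<oplus>\<^bsub>fob mx.TF V\<^esub> mx.tz V (gen (v \<oplus>\<^bsub>V\<^esub> a)) a"
     using V.tt_add[OF g(2), of "gen v" "gen (v \<oplus>\<^bsub>V\<^esub> a)"] g ac by (simp add: V.V.fc_Cons fc_Nil)
    then have "g = ?p V (mx.tz V (gen v) a)" using V.swap_gen[OF g(3,2,4)] by simp
    then show "g\<in>?p V ` V.MS" using V.gen_in_MS[OF g(3,2,4)] by blast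
   qed
   then have "V.KS 0 \<subseteq> ?p V ` V.MS" unfolding V.KS_eq_cgen by (rule V.mx.T.vspan_least[OF img])
   then show "carrier (fob (Sg) V) \<subseteq> ?p V ` carrier (fob Mx V)" using V.KS_0 by simp
  qed
  fix W t z assume W: "W\<in>Obj Tq" "t\<in>Hom Tq V W"
  note tm = tmorI[OF X W]
  show "z <: fob (Sg) V ==> fmor (Sg) V W t z = fmor Mx V W t z" by simp
  assume "z <: fob Mx V"
  then have z: "z\<in>Mix_sub D x V" "z\<in>V.MS" using V.Mix_eq by simp_all
  show "?p W (fmor Mx V W t z) = fmor (Sg) V W t (?p V z)"
   using swap_nat[OF tm z(1)] lin_add[OF mx.fmor_TF_lin[OF tm] V.MSc[OF z(2)] V.MSc[OF V.swap_mem[OF z(2)]]] by simp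
 qed
qed

end

section \<open>The functors \<open>L\<close> and the quotients of the filtration\<close>

lemma tuples_eps [simp]: "tuples n (eps_obj V) = tuples n V"
 by (simp add: tuples_def)

lemma Ext_simps [simp]: "fob (Ext n) W = ext_mod n W" "fmor (Ext n) U W f = pres_map (tuples n W) (ext_rel n W) (map f)"
 by (simp_all add: Ext_def)

lemma (in fibV) lin_eqT:
 assumes Q: "f2v Q" and f: "f\<in>lin_maps (fob TF V) Q" "g\<in>lin_maps (fob TF V) Q"
  and eq: "!!m a. m <: Mo V ==> a\<in>al V ==> f (tz V m a) = g (tz V m a)" and z: "z <: fob TF V"
 shows "f z = g z"
proof -
 interpret Q: f2v Q by fact
 have m: "tz V (cz V a z) a <: fob TF V" if "a\<in>al V" for a using that z by simp
 have 1: "h z = finsum Q (%a. h (tz V (cz V a z) a)) (al V)" if h: "h\<in>lin_maps (fob TF V) Q" for h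
  using lin_finsum[OF T.f2v_axioms Q h, of "al V" "%a. tz V (cz V a z) a"] m decompV[OF z] by simp
 have "finsum Q (%a. f (tz V (cz V a z) a)) (al V) = finsum Q (%a. g (tz V (cz V a z) a)) (al V)"
  by (rule Q.finsum_cong') (use eq z m lin_closed[OF f(2)] in auto)
 then show ?thesis unfolding 1[OF f(1)] 1[OF f(2)] .
qed

text \<open>A map on the quotient is obtained from an additive relation \<open>R\<close>, which
  avoids checking that values on generators respect the relations between them. If
  \<open>R z y\<close> and \<open>R z y'\<close>, adding gives \<open>R 0 (y + y')\<close>, so
  uniqueness at zero suffices; existence is needed on the generators \<open>A\<close>, surjectivity
  on the generators \<open>B\<close>.\<close>

lemma relation_iso:
 assumes F: "is_functor C F" and G: "is_functor C G" and S: "subfunctor C F S"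
  and cc: "closed_cat C"
  and carr: "!!X z y. X\<in>Obj C ==> R X z y ==> z <: fob F X & y <: fob G X"
  and zero0: "!!X. X\<in>Obj C ==> R X \<zero>\<^bsub>fob F X\<^esub> \<zero>\<^bsub>fob G X\<^esub>"
  and add0: "!!X z y z' y'. X\<in>Obj C ==> R X z y ==> R X z' y' ==> R X (z \<oplus>\<^bsub>fob F X\<^esub> z') (y \<oplus>\<^bsub>fob G X\<^esub> y')"
  and uniq: "!!X y. X\<in>Obj C ==> R X \<zero>\<^bsub>fob F X\<^esub> y ==> y = \<zero>\<^bsub>fob G X\<^esub>"
  and A: "!!X. X\<in>Obj C ==> A X \<subseteq> carrier (fob F X) & vspan (fob F X) (A X) = carrier (fob F X)"
  and AR: "!!X g. X\<in>Obj C ==> g\<in>A X ==> \<exists>y. R X g y & (ALL Y:Obj C. ALL m:Hom C X Y. R Y (fmor F X Y m g) (fmor G X Y m y))"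
  and B: "!!X. X\<in>Obj C ==> B X \<subseteq> carrier (fob G X) & vspan (fob G X) (B X) = carrier (fob G X)"
  and BR: "!!X b. X\<in>Obj C ==> b\<in>B X ==> \<exists>z. R X z b"
  and ker: "!!X z. X\<in>Obj C ==> z <: fob F X ==> R X z \<zero>\<^bsub>fob G X\<^esub> \<longleftrightarrow> z\<in>S X"
 shows "fun_iso C (quotfun F S) G"
proof -
 define \<phi> where "\<phi> X z = (THE y. R X z y)" for X z
 have f2: "f2v (fob F X)" "f2v (fob G X)" if "X\<in>Obj C" for X using is_functorD(1)[OF F that] is_functorD(1)[OF G that] .
 have un: "y = y'" if X: "X\<in>Obj C" and R: "R X z y" "R X z y'" for X z y y'
 proof -
  interpret FX: f2v "fob F X" by (rule f2[OF X])
  interpret GX: f2v "fob G X" by (rule f2[OF X])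
  have "y \<oplus>\<^bsub>fob G X\<^esub> y' = \<zero>\<^bsub>fob G X\<^esub>" using uniq[OF X] add0[OF X R] carr[OF X R(1)] by simp
  then show ?thesis using carr[OF X R(1)] carr[OF X R(2)] by simp
 qed
 \<comment> \<open>The value is constructed together with its compatibility with all morphisms out
   of \<open>X\<close>, as both pass to sums of generators; naturality then follows from
   uniqueness.\<close>
 have ex: "\<exists>y. R X z y & (ALL Y:Obj C. ALL m:Hom C X Y. R Y (fmor F X Y m z) (fmor G X Y m y))"
  if X: "X\<in>Obj C" and z: "z <: fob F X" for X z
 proof -
  interpret FX: f2v "fob F X" by (rule f2[OF X])
  interpret GX: f2v "fob G X" by (rule f2[OF X])
  have "z\<in>vspan (fob F X) (A X)" "A X \<subseteq> carrier (fob F X)" using A[OF X] z by auto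
  then show ?thesis
  proof (induction rule: FX.vspan_induct)
   case zero
   have "fmor F X Y m \<zero>\<^bsub>fob F X\<^esub> = \<zero>\<^bsub>fob F Y\<^esub>" "fmor G X Y m \<zero>\<^bsub>fob G X\<^esub> = \<zero>\<^bsub>fob G Y\<^esub>" if "Y\<in>Obj C" "m\<in>Hom C X Y" for Y m
    using lin_zero[OF f2(1)[OF X] f2(1)[OF that(1)] is_functorD(2)[OF F X that]]
     lin_zero[OF f2(2)[OF X] f2(2)[OF that(1)] is_functorD(2)[OF G X that]] .
   then show ?case using zero0 X by (intro exI[of _ "\<zero>\<^bsub>fob G X\<^esub>"]) simp
  next
   case (add s z)
   obtain y where y: "R X s y" "!!Y m. Y\<in>Obj C ==> m\<in>Hom C X Y ==> R Y (fmor F X Y m s) (fmor G X Y m y)"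
    using AR[OF X add(1)] by blast
   obtain y' where y': "R X z y'" "!!Y m. Y\<in>Obj C ==> m\<in>Hom C X Y ==> R Y (fmor F X Y m z) (fmor G X Y m y')"
    using add(3) by blast
   note c = carr[OF X y(1)] carr[OF X y'(1)]
   have "R Y (fmor F X Y m (s \<oplus>\<^bsub>fob F X\<^esub> z)) (fmor G X Y m (y \<oplus>\<^bsub>fob G X\<^esub> y'))" if "Y\<in>Obj C" "m\<in>Hom C X Y" for Y m
    using add0[OF that(1) y(2)[OF that] y'(2)[OF that]] c
    by (simp add: lin_add[OF is_functorD(2)[OF F X that]] lin_add[OF is_functorD(2)[OF G X that]])
   then show ?case using add0[OF X y(1) y'(1)] by (intro exI[of _ "y \<oplus>\<^bsub>fob G X\<^esub> y'"]) simp
  qed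
 qed
 have \<phi>: "R X z (\<phi> X z)" if X: "X\<in>Obj C" and z: "z <: fob F X" for X z
  unfolding \<phi>_def using ex[OF X z] un[OF X] by (metis theI')
 have \<phi>_eq: "\<phi> X z = y" if "X\<in>Obj C" "R X z y" for X z y
  using un[OF that(1) \<phi>[OF that(1)] that(2)] carr[OF that] by simp
 have nat: "nat_trans C F G \<phi>"
  unfolding nat_trans_def
 proof (intro conjI ballI F G)
  fix X assume X: "X\<in>Obj C"
  show "\<phi> X\<in>lin_maps (fob F X) (fob G X)"
  proof (rule linI[OF f2[OF X]])
   fix y z assume yz: "y <: fob F X" "z <: fob F X"
   then show "\<phi> X y <: fob G X" using carr[OF X \<phi>[OF X]] by simp
   show "\<phi> X (y \<oplus>\<^bsub>fob F X\<^esub> z) = \<phi> X y \<oplus>\<^bsub>fob G X\<^esub> \<phi> X z" by (rule \<phi>_eq[OF X add0[OF X \<phi>[OF X yz(1)] \<phi>[OF X yz(2)]]])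
  qed
  fix Y m z assume Y: "Y\<in>Obj C" "m\<in>Hom C X Y" and z: "z <: fob F X"
  obtain y where y: "R X z y" "R Y (fmor F X Y m z) (fmor G X Y m y)" using ex[OF X z] Y by blast
  show "\<phi> Y (fmor F X Y m z) = fmor G X Y m (\<phi> X z)" unfolding \<phi>_eq[OF X y(1)] by (rule \<phi>_eq[OF Y(1) y(2)])
 qed
 have "epi C F S G \<phi>"
 proof (unfold_locales)
  show "is_functor C F" "subfunctor C F S" "nat_trans C F G \<phi>" by (rule F S nat)+
  fix X z assume X: "X\<in>Obj C" and z: "z <: fob F X"
  show "\<phi> X z = \<zero>\<^bsub>fob G X\<^esub> \<longleftrightarrow> z\<in>S X" using ker[OF X z] \<phi>[OF X z] \<phi>_eq[OF X] by metis
 next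
  fix X assume X: "X\<in>Obj C"
  interpret FX: f2v "fob F X" by (rule f2[OF X])
  interpret GX: f2v "fob G X" by (rule f2[OF X])
  show "carrier (fob G X) \<subseteq> \<phi> X ` carrier (fob F X)"
  proof
   fix y assume "y <: fob G X"
   then have "y\<in>vspan (fob G X) (B X)" "B X \<subseteq> carrier (fob G X)" using B[OF X] by auto
   then have "\<exists>z. R X z y"
   proof (induction rule: GX.vspan_induct)
    case zero
    then show ?case using zero0[OF X] by blast
   next
    case (add s y)
    then show ?case using BR[OF X add(1)] add0[OF X] by blast
   qed
   then obtain z where "R X z y" by blast
   then show "y\<in>\<phi> X ` carrier (fob F X)" using \<phi>_eq[OF X] carr[OF X] by (metis image_eqI)
  qed
 qed
 then show ?thesis by (rule epi.kernel_iso[OF _ cc])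
qed

section \<open>The maps \<open>mu\<close>, \<open>nu\<close> and the spaces \<open>L\<close> in
  fibres\<close>

context lineV
begin

lemma f2v_eps: "f2v (eps_obj V)"
 by (rule eps_obj_Ef[OF V.ndsp_axioms])

sublocale X: ext "eps_obj V"
 unfolding ext_def by (rule f2v_eps)

abbreviation "\<Lambda> n \<equiv> fob (ex.TF n) V"
abbreviation "bw n ls \<equiv> wedge n (eps_obj V) ls"
abbreviation "et n y a \<equiv> ex.tz n V y a"
abbreviation "ec n a z \<equiv> ex.cz n V a z"
abbreviation "\<psi> u w \<equiv> B w u"

lemma psi_add: "u <: V ==> addfun (eps_obj V) (\<psi> u)"
 by (simp add: addfun_def V.bil_add_l)

lemma ext_gen_eq: "ext_gen n D V vs (lm V a) = et n (bw n vs) a"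
 by (simp add: ext_gen_def ex.tz_def ik_simps iota_def)

lemma fibre_map:
 assumes f: "f\<in>lin_maps (\<Lambda> n) (\<Lambda> m)" and G: "!!a. a\<in>al V ==> G a\<in>lin_maps (X.E n) (X.E m)"
  and eq: "!!a vs. a\<in>al V ==> vs\<in>tuples n V ==> f (et n (bw n vs) a) = et m (G a (bw n vs)) a"
  and a: "a\<in>al V" and z: "z <: \<Lambda> n"
 shows "ec m a (f z) = G a (ec n a z)"
proof (rule ex.lin_eqT[OF X.f2v_E _ _ _ z])
 have L: "(%z. ec m b z)\<in>lin_maps (\<Lambda> m) (X.E m)" for m b using ex.cz_lin[of m b] by simp
 show "(%z. ec m a (f z))\<in>lin_maps (\<Lambda> n) (X.E m)" by (rule lin_comp[OF f L])
 show "(%z. G a (ec n a z))\<in>lin_maps (\<Lambda> n) (X.E m)" by (rule lin_comp[OF L G[OF a]])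
 fix y b assume y: "y <: ex.Mo n V" and b: "b\<in>al V"
 have T: "(%y. et k y b)\<in>lin_maps (X.E k) (\<Lambda> k)" for k using ex.tz_lin[OF b, of k] by simp
 have fy: "f (et n y b) = et m (G b y) b"
  by (rule X.ext_lin_eq[OF ex.T.f2v_axioms lin_comp[OF T f] lin_comp[OF G[OF b] T]]) (use eq[OF b] y in auto)
 have m: "y <: X.E n" "G b y <: X.E m" using y lin_closed[OF G[OF b]] by auto
 show "ec m a (f (et n y b)) = G a (ec n a (et n y b))"
  using fy m ex.cz_tz[of y n b a] ex.cz_tz[of "G b y" m b a] b lin_zero[OF X.f2v_E X.f2v_E G[OF a]] by simp
qed

text \<open>\<open>tenfree_lift\<close> provides a map with the values demanded in the definition,
  which justifies the choice operator; by \<open>fibre_map\<close> any such map is right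
  multiplication by \<open>a\<close> in the fibre over \<open>a\<close>.\<close>

lemma mu:
 shows "mu n D x V\<in>lin_maps (\<Lambda> n) (\<Lambda> (Suc n))"
  and "a\<in>al V ==> z <: \<Lambda> n ==> ec (Suc n) a (mu n D x V z) = X.wr n a (ec n a z)"
proof -
 have wrl: "X.wr n a\<in>lin_maps (X.E n) (X.E (Suc n))" if "a\<in>al V" for a
  using X.wr_lin[of a n] alD(1)[OF that] by simp
 have g: "X.wr n (h x)\<in>lin_maps (X.E n) (X.E (Suc n))" if "h\<in>qhom D V" for h using that wrl by (auto simp: ex.qhD)
 obtain f where f: "f\<in>lin_maps (\<Lambda> n) (\<Lambda> (Suc n))"
  "!!y a. y <: X.E n ==> a\<in>al V ==> f (et n y a) = et (Suc n) (X.wr n a y) a"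
  using tenfree_lift[OF ex.tenfree[of n] ex.tenfree[of "Suc n"], of "%h. X.wr n (h x)"] g ex.lmV
  unfolding ex.fobT ex.tz_def by fastforce
 have "f\<in>lin_maps (fob (Ext_iso n D) V) (fob (Ext_iso (Suc n) D) V) &
   (ALL vs:tuples n V. ALL h:qhom D V. f (ext_gen n D V vs h) = ext_gen (Suc n) D V (vs @ [h x]) h)"
  unfolding ex.qhD Ext_iso_eq using f X.wr_w alD(1) by (auto simp: ext_gen_eq)
 then have "\<exists>m. m\<in>lin_maps (fob (Ext_iso n D) V) (fob (Ext_iso (Suc n) D) V) &
   (ALL vs:tuples n V. ALL h:qhom D V. m (ext_gen n D V vs h) = ext_gen (Suc n) D V (vs @ [h x]) h)" by (intro exI[of _ f])
 note mu0 = someI_ex[OF this, folded mu_def]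
 have mu: "mu n D x V\<in>lin_maps (\<Lambda> n) (\<Lambda> (Suc n))"
  "!!vs a. vs\<in>tuples n V ==> a\<in>al V ==> mu n D x V (et n (bw n vs) a) = et (Suc n) (bw (Suc n) (vs @ [a])) a"
  using mu0 unfolding ex.qhD Ext_iso_eq by (auto simp: ext_gen_eq)
 show "mu n D x V\<in>lin_maps (\<Lambda> n) (\<Lambda> (Suc n))" by (rule mu(1))
 show "a\<in>al V ==> z <: \<Lambda> n ==> ec (Suc n) a (mu n D x V z) = X.wr n a (ec n a z)"
  by (rule fibre_map[OF mu(1) wrl]) (use mu(2) X.wr_w alD(1) in auto)
qed

text \<open>The sum over omitted factors in the definition is the contraction with
  \<open>B(-, a)\<close>, by \<open>conl_finsum\<close>; the choice is then justified as for
  \<open>mu\<close>.\<close>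

lemma nu:
 shows "nu n D x V\<in>lin_maps (\<Lambda> (Suc n)) (\<Lambda> n)"
  and "a\<in>al V ==> z <: \<Lambda> (Suc n) ==> ec n a (nu n D x V z) = X.con n (\<psi> a) (ec (Suc n) a z)"
proof -
 have cl: "X.con n (\<psi> a)\<in>lin_maps (X.E (Suc n)) (X.E n)" if "a\<in>al V" for a
  by (rule X.con_lin[OF psi_add[OF alD(1)[OF that]]])
 have g: "X.con n (\<psi> (h x))\<in>lin_maps (X.E (Suc n)) (X.E n)" if "h\<in>qhom D V" for h using that cl by (auto simp: ex.qhD)
 obtain f where f: "f\<in>lin_maps (\<Lambda> (Suc n)) (\<Lambda> n)"
  "!!y a. y <: X.E (Suc n) ==> a\<in>al V ==> f (et (Suc n) y a) = et n (X.con n (\<psi> a) y) a"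
  using tenfree_lift[OF ex.tenfree[of "Suc n"] ex.tenfree[of n], of "%h. X.con n (\<psi> (h x))"] g ex.lmV
  unfolding ex.fobT ex.tz_def by fastforce
 let ?S = "%vs h. finsum (fob (Ext_iso n D) V) (%i. B (vs ! i) (h x) \<odot>\<^bsub>fob (Ext_iso n D) V\<^esub>
       ext_gen n D V (take i vs @ drop (Suc i) vs) h) {..n}"
 have S: "?S vs (lm V a) = et n (X.con n (\<psi> a) (bw (Suc n) vs)) a" if vs: "vs\<in>tuples (Suc n) V" and a: "a\<in>al V" for vs a
 proof -
  have T: "(%y. et n y a)\<in>lin_maps (X.E n) (\<Lambda> n)" using ex.tz_lin[OF a, of n] by simp
  have l: "length vs = Suc n" "set vs \<subseteq> carrier V" using vs by (auto simp: tuples_def)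
  have tm: "take i vs @ drop (Suc i) vs\<in>tuples n V" if "i \<le> n" for i
   using that l by (auto simp: tuples_def dest!: in_set_takeD in_set_dropD)
  have "X.con n (\<psi> a) (bw (Suc n) vs) = finsum (X.E n) (%i. \<psi> a (vs ! i) \<odot>\<^bsub>X.E n\<^esub> bw n (take i vs @ drop (Suc i) vs)) {..n}"
   using X.con_w[OF psi_add[OF alD(1)[OF a]], of vs n] X.conl_finsum[of "[]" vs n "\<psi> a"] vs l by (simp add: lessThan_Suc_atMost)
  then have "et n (X.con n (\<psi> a) (bw (Suc n) vs)) a =
   et n (finsum (X.E n) (%i. \<psi> a (vs ! i) \<odot>\<^bsub>X.E n\<^esub> bw n (take i vs @ drop (Suc i) vs)) {..n}) a" by simp
  also have "\<dots> = finsum (\<Lambda> n) (%i. et n (\<psi> a (vs ! i) \<odot>\<^bsub>X.E n\<^esub> bw n (take i vs @ drop (Suc i) vs)) a) {..n}"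
   by (rule lin_finsum[OF X.f2v_E ex.T.f2v_axioms T]) (use tm in auto)
  also have "\<dots> = finsum (\<Lambda> n) (%i. \<psi> a (vs ! i) \<odot>\<^bsub>\<Lambda> n\<^esub> et n (bw n (take i vs @ drop (Suc i) vs)) a) {..n}"
   by (rule ex.T.finsum_cong') (use tm a lin_smult[OF T] in auto)
  finally show ?thesis by (simp add: ext_gen_eq Ext_iso_eq)
 qed
 have "f\<in>lin_maps (fob (Ext_iso (Suc n) D) V) (fob (Ext_iso n D) V) &
   (ALL vs:tuples (Suc n) V. ALL h:qhom D V. f (ext_gen (Suc n) D V vs h) = ?S vs h)"
  using f S unfolding ex.qhD Ext_iso_eq[symmetric] by (auto simp: ext_gen_eq)
 then have "\<exists>m. m\<in>lin_maps (fob (Ext_iso (Suc n) D) V) (fob (Ext_iso n D) V) &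
   (ALL vs:tuples (Suc n) V. ALL h:qhom D V. m (ext_gen (Suc n) D V vs h) = ?S vs h)" by (intro exI[of _ f])
 note nu0 = someI_ex[OF this, folded nu_def]
 have nu: "nu n D x V\<in>lin_maps (\<Lambda> (Suc n)) (\<Lambda> n)"
  "!!vs a. vs\<in>tuples (Suc n) V ==> a\<in>al V ==> nu n D x V (et (Suc n) (bw (Suc n) vs) a) = et n (X.con n (\<psi> a) (bw (Suc n) vs)) a"
  using nu0 S unfolding ex.qhD Ext_iso_eq[symmetric] by (auto simp: ext_gen_eq)
 show "nu n D x V\<in>lin_maps (\<Lambda> (Suc n)) (\<Lambda> n)" by (rule nu(1))
 show "a\<in>al V ==> z <: \<Lambda> (Suc n) ==> ec n a (nu n D x V z) = X.con n (\<psi> a) (ec (Suc n) a z)"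
  by (rule fibre_map[OF nu(1) cl]) (use nu(2) in auto)
qed

lemma L_iff: "z\<in>Ls (Suc d) V \<longleftrightarrow> z <: \<Lambda> (Suc d) &
 (ALL a:al V. X.wr (Suc d) a (ec (Suc d) a z) = \<zero>\<^bsub>X.E (Suc (Suc d))\<^esub> & X.con d (\<psi> a) (ec (Suc d) a z) = \<zero>\<^bsub>X.E d\<^esub>)"
proof (cases "z <: \<Lambda> (Suc d)")
 case True
 have z: "y = \<zero>\<^bsub>\<Lambda> n\<^esub> \<longleftrightarrow> (ALL a:al V. ec n a y = \<zero>\<^bsub>X.E n\<^esub>)" if "y <: \<Lambda> n" for n y
  using ex.cz_eqI[OF that, of "\<zero>\<^bsub>\<Lambda> n\<^esub>"] ex.cz_zero[of n] by auto
 show ?thesis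
  unfolding L_sub_def K_sub_def Ext_iso_eq diff_Suc_1 mem_Collect_eq
  using True z[OF lin_closed[OF mu(1) True]] z[OF lin_closed[OF nu(1) True]] mu(2)[OF _ True] nu(2)[OF _ True] by auto
qed (simp add: L_sub_def K_sub_def Ext_iso_eq)

lemma L_sub: "submodule (Ls (Suc d) V) F2 (\<Lambda> (Suc d))"
proof -
 have "z\<in>Ls (Suc d) V \<longleftrightarrow> z <: \<Lambda> (Suc d) & mu (Suc d) D x V z = \<zero>\<^bsub>\<Lambda> (Suc (Suc d))\<^esub> & nu d D x V z = \<zero>\<^bsub>\<Lambda> d\<^esub>" for z
  by (simp add: L_sub_def K_sub_def Ext_iso_eq)
 then show ?thesis
  unfolding ex.T.sub_iff
  using lin_add[OF mu(1)] lin_add[OF nu(1)] lin_zero[OF ex.T.f2v_axioms ex.T.f2v_axioms mu(1)] lin_zero[OF ex.T.f2v_axioms ex.T.f2v_axioms nu(1)]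
  by auto
qed

text \<open>The counterparts of the cubes in \<open>cgen\<close>: the directions are kept,
  \<open>a\<close> included, and the base point is forgotten.\<close>

definition lgen :: "nat => _ set" where
 "lgen d = {et (Suc d) (bw (Suc d) (a # ls)) a | a ls. a\<in>al V & orth a ls & length ls = d}"

lemma wa_mem: "a\<in>al V ==> orth a ls ==> length ls = d ==> bw (Suc d) (a # ls) <: X.E (Suc d)"
 using alD(1)[of a V] by (intro X.w_mem) (simp add: orth_def)

lemma lgen_carrier: "lgen d \<subseteq> carrier (\<Lambda> (Suc d))"
 using wa_mem unfolding lgen_def by auto

lemma lgenI: "a\<in>al V ==> orth a ls ==> length ls = d ==>
 et (Suc d) (bw (Suc d) (a # ls)) a\<in>vspan (\<Lambda> (Suc d)) (lgen d)"
 by (rule subsetD[OF ex.T.vspan_incl], unfold lgen_def) blast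

lemma wa_L:
 assumes a: "a\<in>al V" and ls: "orth a ls" "length ls = d"
 shows "X.wr (Suc d) a (bw (Suc d) (a # ls)) = \<zero>\<^bsub>X.E (Suc (Suc d))\<^esub>" "X.con d (\<psi> a) (bw (Suc d) (a # ls)) = \<zero>\<^bsub>X.E d\<^esub>"
proof -
 have ac: "a <: V" and lc: "set ls \<subseteq> carrier V" "ALL l:set ls. B l a = 0" using alD a ls by (auto simp: orth_def)
 show "X.wr (Suc d) a (bw (Suc d) (a # ls)) = \<zero>\<^bsub>X.E (Suc (Suc d))\<^esub>"
  using X.wr_w[of a "a # ls" "Suc d"] X.w_alt[of "[]" a ls "[]" "Suc (Suc d)"] ac lc ls by simp
 show "X.con d (\<psi> a) (bw (Suc d) (a # ls)) = \<zero>\<^bsub>X.E d\<^esub>"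
  using X.con_w[OF psi_add[OF ac], of "a # ls" d] X.conl_kill[of "[]" "a # ls" d "\<psi> a"] ac lc ls by simp
qed

text \<open>With \<open>B a c = 1\<close>, an element \<open>y\<close> killed by \<open>- \<and> a\<close> is \<open>u \<and> a\<close> for the contraction \<open>u\<close> of \<open>y\<close>
  with \<open>c\<close>, and an element killed by the contraction with \<open>a\<close> is fixed by the projection to the
  orthogonal of \<open>a\<close> along \<open>c\<close>.\<close>

lemma fibre_L:
 assumes a: "a\<in>al V" and y: "y <: X.E (Suc d)"
  and wr: "X.wr (Suc d) a y = \<zero>\<^bsub>X.E (Suc (Suc d))\<^esub>" and con: "X.con d (\<psi> a) y = \<zero>\<^bsub>X.E d\<^esub>"
 shows "y\<in>vspan (X.E (Suc d)) {bw (Suc d) (a # ls) | ls. orth a ls & length ls = d}"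
proof -
 note aD = alD[OF a]
 obtain c where c: "c <: V" "B a c = 1" using V.nondeg_ex[OF aD(1,2)] by auto
 let ?G = "{bw (Suc d) (a # ls) | ls. orth a ls & length ls = d}"
 have Gs: "submodule (vspan (X.E (Suc d)) ?G) F2 (X.E (Suc d))"
  by (rule X.E.vspan_sub) (use wa_mem[OF a] in auto)
 define u where "u = X.con d (\<psi> c) y"
 have um: "u <: X.E d" unfolding u_def by (rule lin_closed[OF X.con_lin[OF psi_add[OF c(1)]] y])
 have wrl: "X.wr n b\<in>lin_maps (X.E n) (X.E (Suc n))" if "b <: V" for n b using X.wr_lin[of b n] that by simp
 have yu: "y = X.wr d a u"
 proof -
  have cl: "X.con (Suc d) (\<psi> c)\<in>lin_maps (X.E (Suc (Suc d))) (X.E (Suc d))" by (rule X.con_lin[OF psi_add[OF c(1)]])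
  have "X.con (Suc d) (\<psi> c) (X.wr (Suc d) a y) = X.wr d a u \<oplus>\<^bsub>X.E (Suc d)\<^esub> (B a c \<odot>\<^bsub>X.E (Suc d)\<^esub> y)"
   unfolding u_def by (rule X.con_wr[OF psi_add[OF c(1)] _ y]) (use aD in simp)
  then have "\<zero>\<^bsub>X.E (Suc d)\<^esub> = X.wr d a u \<oplus>\<^bsub>X.E (Suc d)\<^esub> y"
   using wr lin_zero[OF X.f2v_E X.f2v_E cl] c y by simp
  then show ?thesis using lin_closed[OF wrl[OF aD(1)] um] y X.E.add_eq_zero_iff by metis
 qed
 \<comment> \<open>Since \<open>B c a = 1\<close>, this maps into the orthogonal of
   \<open>a\<close>; it fixes \<open>a\<close>. By \<open>w_map\<close> it acts on wedges as the
   identity plus contraction with \<open>B(-, a)\<close> followed by multiplication by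
   \<open>c\<close>.\<close>
 define T where "T v = v \<oplus> (\<psi> a v \<odot> c)" for v
 have T: "T\<in>lin_maps (eps_obj V) (eps_obj V)"
  unfolding lin_maps_eps by (rule linI[OF V.f2v_axioms V.f2v_axioms]) (use aD c in "auto simp: T_def V.bil_simps V.smult_plus V.ac")
 define P where "P n = pres_map (tuples n (eps_obj V)) (ext_rel n (eps_obj V)) (map T)" for n
 have P: "P n\<in>lin_maps (X.E n) (X.E n)" "vs\<in>tuples n V ==> P n (bw n vs) = bw n (map T vs)" for n vs
  using ext_map(1)[OF f2v_eps f2v_eps T, of n] ext_map(2)[OF f2v_eps f2v_eps T, of vs n] unfolding P_def by simp_all
 have "P (Suc d) y = y \<oplus>\<^bsub>X.E (Suc d)\<^esub> X.wr d c (X.con d (\<psi> a) y)"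
 proof (rule X.ext_lin_eq[OF X.f2v_E P(1) _ _ y])
  have l: "(%y. X.wr d c (X.con d (\<psi> a) y))\<in>lin_maps (X.E (Suc d)) (X.E (Suc d))"
   by (rule lin_comp[OF X.con_lin[OF psi_add[OF aD(1)]] wrl[OF c(1)]])
  show "(%y. y \<oplus>\<^bsub>X.E (Suc d)\<^esub> X.wr d c (X.con d (\<psi> a) y))\<in>lin_maps (X.E (Suc d)) (X.E (Suc d))"
   by (rule linI[OF X.f2v_E X.f2v_E]) (use lin_closed[OF l] lin_add[OF l] in "auto simp: X.E.ac")
  fix vs assume vs: "vs\<in>tuples (Suc d) (eps_obj V)"
  show "P (Suc d) (bw (Suc d) vs) = bw (Suc d) vs \<oplus>\<^bsub>X.E (Suc d)\<^esub> X.wr d c (X.con d (\<psi> a) (bw (Suc d) vs))"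
   using P(2)[of vs "Suc d"] X.w_map[of c "[]" vs d "\<psi> a"] X.con_w[OF psi_add[OF aD(1)] vs] vs c
   by (simp add: T_def[abs_def])
 qed
 then have "P (Suc d) y = y" using con lin_zero[OF X.f2v_E X.f2v_E wrl[OF c(1)]] y by simp
 \<comment> \<open>Applying \<open>P\<close> to the product of \<open>u\<close> with
   \<open>a\<close> replaces the factors of \<open>u\<close> by vectors orthogonal to
   \<open>a\<close>, which exhibits \<open>y\<close> as a combination of the generators.\<close>
 then have "y = P (Suc d) (X.wr d a u)" using yu by simp
 also have "\<dots>\<in>vspan (X.E (Suc d)) ?G"
 proof (rule lin_vspan[OF X.f2v_E X.f2v_E lin_comp[OF wrl[OF aD(1)] P(1)] _ Gs, of "bw d ` tuples d V"])
  show "bw d ` tuples d V \<subseteq> carrier (X.E d)" by auto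
  show "u\<in>vspan (X.E d) (bw d ` tuples d V)" using X.ext_span[of d] um by simp
  show "(%z. P (Suc d) (X.wr d a z)) ` bw d ` tuples d V \<subseteq> vspan (X.E (Suc d)) ?G"
   unfolding image_image
  proof (rule image_subsetI)
   fix us assume us: "us\<in>tuples d V"
   then have uc: "set us \<subseteq> carrier V" "length us = d" by (auto simp: tuples_def)
   have Tc: "T v <: V" "B (T v) a = 0" if "v <: V" for v
    using that aD c V.bil_sym[of c a] by (auto simp: T_def V.bil_simps)
   have Ta: "T a = a" using aD c by (simp add: T_def)
   have o: "orth a (map T us)" using uc Tc by (auto simp: orth_def)
   have "P (Suc d) (X.wr d a (bw d us)) = bw (Suc d) (map T us @ [a])"
    using X.wr_w[of a us d] P(2)[of "us @ [a]" "Suc d"] us uc aD Ta by simp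
   also have "\<dots> = bw (Suc d) (a # map T us)"
    using X.w_move[of "[]" a "map T us" "[]" "Suc d"] o uc aD by (simp add: orth_def)
   finally show "P (Suc d) (X.wr d a (bw d us))\<in>vspan (X.E (Suc d)) ?G"
    using o uc by (auto intro!: subsetD[OF X.E.vspan_incl])
  qed
 qed
 finally show ?thesis .
qed

lemma L_eq: "Ls (Suc d) V = vspan (\<Lambda> (Suc d)) (lgen d)"
proof
 have ls: "submodule (vspan (\<Lambda> (Suc d)) (lgen d)) F2 (\<Lambda> (Suc d))" by (rule ex.T.vspan_sub[OF lgen_carrier])
 show "vspan (\<Lambda> (Suc d)) (lgen d) \<subseteq> Ls (Suc d) V"
 proof (rule ex.T.vspan_least[OF L_sub])
  show "lgen d \<subseteq> Ls (Suc d) V"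
  proof
   fix g assume "g\<in>lgen d"
   then obtain a ls where g: "g = et (Suc d) (bw (Suc d) (a # ls)) a" "a\<in>al V" "orth a ls" "length ls = d"
    unfolding lgen_def by auto
   have "ec (Suc d) b g = (if b = a then bw (Suc d) (a # ls) else \<zero>\<^bsub>X.E (Suc d)\<^esub>)" for b
    using ex.cz_tz[of "bw (Suc d) (a # ls)" "Suc d" a b] wa_mem[OF g(2-4)] g by simp
   moreover have "X.wr (Suc d) b \<zero>\<^bsub>X.E (Suc d)\<^esub> = \<zero>\<^bsub>X.E (Suc (Suc d))\<^esub>" "X.con d (\<psi> b) \<zero>\<^bsub>X.E (Suc d)\<^esub> = \<zero>\<^bsub>X.E d\<^esub>" if "b\<in>al V" for b
    using lin_zero[OF X.f2v_E X.f2v_E X.wr_lin[of b "Suc d"]] lin_zero[OF X.f2v_E X.f2v_E X.con_lin[OF psi_add[of b]]] alD(1)[OF that] by auto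
   ultimately show "g\<in>Ls (Suc d) V"
    unfolding L_iff using wa_L[OF g(2-4)] subsetD[OF lgen_carrier \<open>g\<in>lgen d\<close>] by auto
  qed
 qed
 show "Ls (Suc d) V \<subseteq> vspan (\<Lambda> (Suc d)) (lgen d)"
 proof
  fix z assume z: "z\<in>Ls (Suc d) V"
  then have zc: "z <: \<Lambda> (Suc d)" unfolding L_iff by simp
  show "z\<in>vspan (\<Lambda> (Suc d)) (lgen d)"
  proof (rule ex.sub_decomp[OF ls zc])
   fix a assume a: "a\<in>al V"
   have T: "(%y. et (Suc d) y a)\<in>lin_maps (X.E (Suc d)) (\<Lambda> (Suc d))" using ex.tz_lin[OF a, of "Suc d"] by simp
   have m: "ec (Suc d) a z <: X.E (Suc d)" using ex.cz_mem[OF zc, of a] by simp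
   have "ec (Suc d) a z\<in>vspan (X.E (Suc d)) {bw (Suc d) (a # ls) | ls. orth a ls & length ls = d}"
    by (rule fibre_L[OF a m]) (use z a in "auto simp: L_iff")
   then show "et (Suc d) (ec (Suc d) a z) a\<in>vspan (\<Lambda> (Suc d)) (lgen d)"
   proof (rule lin_vspan[OF X.f2v_E ex.T.f2v_axioms T _ ls, rotated 2])
    show "{bw (Suc d) (a # ls) | ls. orth a ls & length ls = d} \<subseteq> carrier (X.E (Suc d))" using wa_mem[OF a] by auto
    show "(%y. et (Suc d) y a) ` {bw (Suc d) (a # ls) | ls. orth a ls & length ls = d} \<subseteq> vspan (\<Lambda> (Suc d)) (lgen d)"
     using lgenI[OF a] by auto
   qed
  qed
 qed
qed

text \<open>A complete dual system gives a triangular system whose vectors span and whose forms are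
  the \<open>B(-, c)\<close>, so \<open>hat_inj_aux\<close> applies.\<close>

lemma hat_inj:
 assumes y: "y <: X.E n" and h: "!!us. length us = n ==> set us \<subseteq> carrier V ==> X.hat (map \<psi> us) y = 0"
 shows "y = \<zero>\<^bsub>X.E n\<^esub>"
proof -
 obtain ps where ps: "dual V ps" "!!v. v <: V ==> xp V ps v = v" using V.dual_extend[of "[]"] by auto
 let ?qs = "map (%(b, c). (b, \<psi> c)) ps"
 have tri: "dual V rs ==> X.tri (map (%(b, c). (b, \<psi> c)) rs)" for rs
  by (induction rs) (auto simp: psi_add)
 have fs: "fst ` set ?qs = fst ` set ps" by force
 have pc: "fst ` set ps \<subseteq> carrier V" "snd ` set ps \<subseteq> carrier V" using V.dual_mem[OF ps(1)] by auto
 have "vspan (eps_obj V) (fst ` set ps) = carrier (eps_obj V)"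
 proof
  show "vspan (eps_obj V) (fst ` set ps) \<subseteq> carrier (eps_obj V)" by (rule X.vspan_carrier) (use pc in simp)
  show "carrier (eps_obj V) \<subseteq> vspan (eps_obj V) (fst ` set ps)"
  proof
   fix v assume "v <: eps_obj V"
   then have v: "v <: V" by simp
   let ?N = "vspan (eps_obj V) (fst ` set ps)"
   have N: "\<zero>\<in>?N" "!!p q. p\<in>?N ==> q\<in>?N ==> p \<oplus> q\<in>?N"
    using X.vspan_sub[of "fst ` set ps"] pc unfolding X.sub_iff by auto
   have "dual V rs ==> fst ` set rs \<subseteq> ?N ==> xp V rs v\<in>?N" for rs
   proof (induction rs)
    case (Cons r rs)
    obtain b c where r: "r = (b, c)" by force
    have "b <: V" "b\<in>?N" using Cons.prems r by auto
    then have "B v c \<odot> b\<in>?N" using N(1) by (simp add: V.smult_bit)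
    then show ?case using Cons N(2) r by simp
   qed (use N in simp)
   then show "v\<in>?N" using ps v X.vspan_incl[of "fst ` set ps"] by metis
  qed
 qed
 then have S: "X.Sp n (fst ` set ?qs) = carrier (X.E n)" unfolding fs by (intro X.Sp_all) (use pc in auto)
 show ?thesis
 proof (rule X.hat_inj_aux[OF tri[OF ps(1)]])
  show "y\<in>X.Sp n (fst ` set ?qs)" unfolding S by (rule y)
  fix fs assume f: "length fs = n" "set fs \<subseteq> snd ` set ?qs"
  moreover have "snd ` set ?qs = \<psi> ` snd ` set ps" by force
  ultimately have "fs\<in>map \<psi> ` lists (snd ` set ps)" unfolding lists_image[symmetric] by (simp add: lists_eq_set)
  then obtain us where "fs = map \<psi> us" "set us \<subseteq> snd ` set ps" by (auto simp: lists_eq_set)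
  then show "X.hat fs y = 0" using h[of us] f pc by auto
 qed
qed

section \<open>Comparing pairings with values of alternating forms\<close>

lemma hat_dd:
 "set us \<subseteq> carrier V ==> set ls \<subseteq> carrier V ==> v <: V ==> length us = n ==> length ls = n ==>
  X.hat (map \<psi> us) (bw n ls) = dd V ls (mnl V us) v"
 using V.dd_mono_hat[OF X.ext_axioms] by simp

text \<open>The isomorphism \<open>k_d \<Sigma> / k_(d+1) \<Sigma> \<rightarrow> L\<^sup>d\<^sup>+\<^sup>1\<close> as a relation: the value of an alternating form of
  degree \<open>d + 1\<close> on the right is the pairing with the corresponding polynomial function on the left.\<close>

definition lrel :: "nat => _ => _ => bool" where
 "lrel d z y \<longleftrightarrow> z\<in>KS d & y\<in>Ls (Suc d) V &
   (ALL a:al V. \<forall>us. set us \<subseteq> carrier V --> length us = Suc d -->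
    X.hat (map \<psi> us) (ec (Suc d) a y) = pr V (cc a z) (mnl V us))"

lemma hat_psi_zero: "set us \<subseteq> carrier V ==> length us = n ==> X.hat (map \<psi> us) \<zero>\<^bsub>X.E n\<^esub> = 0"
 using X.hat_zero[of "map \<psi> us"] psi_add by auto

lemma hat_psi_add: "set us \<subseteq> carrier V ==> length us = n ==> y <: X.E n ==> z <: X.E n ==>
 X.hat (map \<psi> us) (y \<oplus>\<^bsub>X.E n\<^esub> z) = X.hat (map \<psi> us) y + X.hat (map \<psi> us) z"
 using X.hat_add[of "map \<psi> us" y z] psi_add by auto

lemma pr_cc_zero: "pr V (cc a \<zero>\<^bsub>\<Gamma>\<^esub>) F = 0"
 by (simp add: pr_def)

lemma pr_cc_add: "y <: \<Gamma> ==> z <: \<Gamma> ==> pr V (cc a (y \<oplus>\<^bsub>\<Gamma>\<^esub> z)) F = pr V (cc a y) F + pr V (cc a z) F"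
 by (simp add: pr_def distrib_right sum.distrib)

lemma lrel_zero: "lrel d \<zero>\<^bsub>\<Gamma>\<^esub> \<zero>\<^bsub>\<Lambda> (Suc d)\<^esub>"
 using KS_sub[of d] L_sub[of d] ex.cz_zero[of "Suc d"] hat_psi_zero pr_cc_zero
 unfolding lrel_def mx.T.sub_iff ex.T.sub_iff by simp

lemma lrel_add:
 assumes "lrel d z y" "lrel d z' y'"
 shows "lrel d (z \<oplus>\<^bsub>\<Gamma>\<^esub> z') (y \<oplus>\<^bsub>\<Lambda> (Suc d)\<^esub> y')"
proof -
 have m: "z\<in>KS d" "z'\<in>KS d" "y\<in>Ls (Suc d) V" "y'\<in>Ls (Suc d) V" using assms by (auto simp: lrel_def)
 then have c: "z <: \<Gamma>" "z' <: \<Gamma>" "y <: \<Lambda> (Suc d)" "y' <: \<Lambda> (Suc d)"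
  using KSc[of d] by (auto simp: L_iff)
 have e: "ec (Suc d) a y <: X.E (Suc d)" "ec (Suc d) a y' <: X.E (Suc d)"
  "ec (Suc d) a (y \<oplus>\<^bsub>\<Lambda> (Suc d)\<^esub> y') = ec (Suc d) a y \<oplus>\<^bsub>X.E (Suc d)\<^esub> ec (Suc d) a y'" for a
  using ex.cz_mem[OF c(3), of a] ex.cz_mem[OF c(4), of a] ex.cz_add[OF c(3,4), of a] by simp_all
 have "z \<oplus>\<^bsub>\<Gamma>\<^esub> z'\<in>KS d" "y \<oplus>\<^bsub>\<Lambda> (Suc d)\<^esub> y'\<in>Ls (Suc d) V"
  using KS_sub[of d] L_sub[of d] m unfolding mx.T.sub_iff ex.T.sub_iff by auto
 then show ?thesis using assms e c unfolding lrel_def by (simp add: hat_psi_add pr_cc_add)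
qed

lemma lrel_uniq: "lrel d \<zero>\<^bsub>\<Gamma>\<^esub> y ==> y = \<zero>\<^bsub>\<Lambda> (Suc d)\<^esub>"
proof -
 assume r: "lrel d \<zero>\<^bsub>\<Gamma>\<^esub> y"
 then have y: "y <: \<Lambda> (Suc d)" by (simp add: lrel_def L_iff)
 have "ec (Suc d) a y = \<zero>\<^bsub>X.E (Suc d)\<^esub>" if "a\<in>al V" for a
  by (rule hat_inj) (use r that ex.cz_mem[OF y, of a] pr_cc_zero in "auto simp: lrel_def")
 then show ?thesis using ex.cz_eqI[OF y, of "\<zero>\<^bsub>\<Lambda> (Suc d)\<^esub>"] ex.cz_zero[of "Suc d"] by simp
qed

lemma lgen_L: "a\<in>al V ==> orth a ls ==> length ls = d ==> et (Suc d) (bw (Suc d) (a # ls)) a\<in>Ls (Suc d) V"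
 unfolding L_eq by (rule lgenI)

text \<open>Both sides equal the iterated difference of \<open>mnl V us\<close> along
  \<open>a # ls\<close> at \<open>v\<close>: the pairing by \<open>pr_fc\<close>, the exterior value
  by \<open>dd_mono_hat\<close>.\<close>

lemma lrel_cube:
 assumes a: "a\<in>al V" and v: "v <: V" "B v a = 1" and ls: "orth a ls" "length ls = d"
 shows "lrel d (tt (fc V (a # ls) v) a) (et (Suc d) (bw (Suc d) (a # ls)) a)"
 unfolding lrel_def
proof (intro conjI ballI allI impI)
 show "tt (fc V (a # ls) v) a\<in>KS d" by (rule cube_KS[OF a v ls(1)]) (use ls in simp)
 show "et (Suc d) (bw (Suc d) (a # ls)) a\<in>Ls (Suc d) V" by (rule lgen_L[OF a ls])
 fix b us assume b: "b\<in>al V" and us: "set us \<subseteq> carrier V" "length us = Suc d"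
 have lc: "set (a # ls) \<subseteq> carrier V" using ls alD a by (auto simp: orth_def)
 have e: "ec (Suc d) b (et (Suc d) (bw (Suc d) (a # ls)) a) = (if b = a then bw (Suc d) (a # ls) else \<zero>\<^bsub>X.E (Suc d)\<^esub>)"
  using ex.cz_tz[of "bw (Suc d) (a # ls)" "Suc d" a b] wa_mem[OF a ls] a by simp
 show "X.hat (map \<psi> us) (ec (Suc d) b (et (Suc d) (bw (Suc d) (a # ls)) a)) = pr V (cc b (tt (fc V (a # ls) v) a)) (mnl V us)"
  unfolding e cc_tt[OF fcm[OF ls(1) v(1) a] a]
  using hat_dd[OF us(1) lc v(1) us(2)] ls V.pr_fc[OF lc v(1), of "mnl V us"] hat_psi_zero[OF us] pr_zero by auto
qed

lemma lrel_ker: "z\<in>KS d ==> lrel d z \<zero>\<^bsub>\<Lambda> (Suc d)\<^esub> \<longleftrightarrow> z\<in>KS (Suc d)"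
proof -
 assume z: "z\<in>KS d"
 then have "z\<in>SS" using KS_SS by auto
 moreover have "\<zero>\<^bsub>\<Lambda> (Suc d)\<^esub>\<in>Ls (Suc d) V" using L_sub[of d] by (simp add: ex.T.sub_iff)
 ultimately show ?thesis
  using z ex.cz_zero[of "Suc d"] hat_psi_zero[of _ "Suc d"] unfolding lrel_def KS_def[of "Suc d"] by (auto simp del: mnl_simps)
qed

text \<open>For \<open>d = 0\<close>: the pairing of \<open>z\<close> with the linear form \<open>B(-, u)\<close> over \<open>a\<close> is \<open>B(a, u)\<close> times a constant.\<close>

definition hrel :: "_ => (('a => 'a) => bit) => bool" where
 "hrel z g \<longleftrightarrow> z\<in>SS & g <: free_mod (qhom D V) &
   (ALL a:al V. ALL u:carrier V. B a u * g (lm V a) = pr V (cc a z) (mnl V [u]))"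

lemma f2v_free_add: "g <: free_mod S ==> g' <: free_mod S ==> (%h. g h + g' h) <: free_mod S"
proof -
 interpret F: f2v "free_mod S" by (rule f2v_free)
 show "g <: free_mod S ==> g' <: free_mod S ==> ?thesis" using F.a_closed[of g g'] by (simp add: free_simps(3))
qed

lemma hrel_zero: "hrel \<zero>\<^bsub>\<Gamma>\<^esub> (%_. 0)"
 using SS_sub pr_cc_zero unfolding hrel_def mx.T.sub_iff by (simp add: free_simps)

lemma hrel_add: "hrel z g ==> hrel z' g' ==> hrel (z \<oplus>\<^bsub>\<Gamma>\<^esub> z') (%h. g h + g' h)"
proof -
 assume r: "hrel z g" "hrel z' g'"
 then have m: "z\<in>SS" "z'\<in>SS" "g <: free_mod (qhom D V)" "g' <: free_mod (qhom D V)" by (auto simp: hrel_def)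
 have "z \<oplus>\<^bsub>\<Gamma>\<^esub> z'\<in>SS" using SS_sub m unfolding mx.T.sub_iff by simp
 moreover have "(%h. g h + g' h) <: free_mod (qhom D V)"
  using f2v_free_add[OF m(3,4)] .
 ultimately show ?thesis
  using r SSc[OF m(1)] SSc[OF m(2)] unfolding hrel_def by (simp add: pr_cc_add distrib_left del: mnl_simps)
qed

lemma hrel_uniq: "hrel \<zero>\<^bsub>\<Gamma>\<^esub> g ==> g = (%_. 0)"
proof
 fix h assume r: "hrel \<zero>\<^bsub>\<Gamma>\<^esub> g"
 show "g h = 0"
 proof (cases "h\<in>qhom D V")
  case True
  then obtain a where a: "a\<in>al V" "h = lm V a" by (auto simp: ex.qhD)
  obtain u where "u <: V" "B a u = 1" using V.nondeg_ex[OF alD(1,2)[OF a(1)]] by auto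
  then show ?thesis using r a pr_cc_zero unfolding hrel_def by fastforce
 qed (use r in "auto simp: hrel_def free_simps")
qed

lemma hrel_cube:
 assumes a: "a\<in>al V" and v: "v <: V" "B v a = 1"
 shows "hrel (tt (fc V [a] v) a) (gen (lm V a))"
 unfolding hrel_def
proof (intro conjI ballI)
 have o: "orth a []" by (simp add: orth_def)
 show "tt (fc V [a] v) a\<in>SS" by (rule cube_SS[OF a v o])
 show "gen (lm V a) <: free_mod (qhom D V)" using a by (simp add: ex.qhD)
 fix b u assume b: "b\<in>al V" and u: "u <: V"
 have ac: "a <: V" using alD a by simp
 have "pr V (fc V [a] v) (mnl V [u]) = B a u"
  using V.pr_fc[of "[a]" v "mnl V [u]"] ac v u by (simp add: V.bil_simps)
 then show "B b u * gen (lm V a) (lm V b) = pr V (cc b (tt (fc V [a] v) a)) (mnl V [u])"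
  unfolding cc_tt[OF fcm[OF o v(1) a] a] using pr_zero by (simp add: gen_def del: mnl_simps)
qed

lemma hrel_ker: "z\<in>SS ==> hrel z (%_. 0) \<longleftrightarrow> z\<in>KS 1"
proof -
 assume z: "z\<in>SS"
 have "(%_. 0) <: free_mod (qhom D V)" by (simp add: free_simps)
 moreover have "(\<forall>us. set us \<subseteq> carrier V --> length us = 1 --> P us) \<longleftrightarrow> (ALL u:carrier V. P [u])" for P :: "'a list => bool"
  by (auto simp: length_Suc_conv)
 ultimately show ?thesis using z unfolding hrel_def KS_def by (auto simp del: mnl_simps)
qed

lemma fob_L: "fob (Lf n) V = (\<Lambda> n)\<lparr>carrier := Ls n V\<rparr>"
 by (simp add: L_fun_def Ext_iso_eq)

lemma fob_k: "fob (subfun Sg (ks d)) V = \<Gamma>\<lparr>carrier := KS d\<rparr>"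
 by (simp add: k_sub_eq)

end

lemma free_span: "vspan (free_mod S) (gen ` S) = carrier (free_mod S)"
proof -
 interpret F: f2v "free_mod S" by (rule f2v_free)
 have g: "gen ` S \<subseteq> carrier (free_mod S)" by auto
 have N: "submodule (vspan (free_mod S) (gen ` S)) F2 (free_mod S)" by (rule F.vspan_sub[OF g])
 have "v\<in>vspan (free_mod S) (gen ` S)" if "v <: free_mod S" for v
  using that
 proof (induction rule: free_induct)
  case zero
  then show ?case using N unfolding F.sub_iff by simp
 next
  case (add s v)
  have "gen s\<in>vspan (free_mod S) (gen ` S)" using subsetD[OF F.vspan_incl] add(1) by blast
  then show ?case using N add(3) unfolding F.sub_iff by blast
 qed
 then show ?thesis using F.vspan_carrier[OF g] by auto
qed

section \<open>The quotients of the filtration as functors\<close>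

context line
begin

lemma fmor_wedge:
 assumes t: "tmor V W t" and a: "a\<in>al V" and vs: "vs\<in>tuples n V"
 shows "fmor (ex.TF n) V W t (ex.tz n V (wedge n (eps_obj V) vs) a) = (if a\<in>dm V W t
  then ex.tz n W (wedge n (eps_obj W) (map (eps_mor V W t) vs)) (eps_mor V W t a) else \<zero>\<^bsub>fob (ex.TF n) W\<^esub>)"
proof -
 interpret t: tmor V W t by fact
 interpret V: lineV D x V by (rule lineVI[OF t.V.ndsp_axioms])
 interpret W: lineV D x W by (rule lineVI[OF t.W.ndsp_axioms])
 have m: "wedge n (eps_obj V) vs <: fob (Ext n) (eps_obj V)" using vs by simp
 have T: "eps_mor V W t\<in>lin_maps (eps_obj V) (eps_obj W)" using t.eps_lin by simp
 show ?thesis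
  using ex.fmor_tz[OF t a m] ext_map(2)[OF V.f2v_eps W.f2v_eps T, of vs n] vs by simp
qed

lemma L_subfunctor: "subfunctor Tq (Ext_iso (Suc d) D) (Ls (Suc d))"
 unfolding Ext_iso_eq
proof (rule span_subfunctor[OF ex.TF_functor, of "%V. lineV.lgen D x V d"])
 fix V :: "'a qsp" assume "ndsp V"
 then interpret V: lineV D x V by (rule lineVI)
 show "V.lgen d \<subseteq> carrier (fob (ex.TF (Suc d)) V) & Ls (Suc d) V = vspan (fob (ex.TF (Suc d)) V) (V.lgen d)"
  using V.lgen_carrier V.L_eq by simp
next
 fix V W :: "'a qsp" and t g assume t: "tmor V W t" and g: "g\<in>lineV.lgen D x V d"
 interpret t: tmor V W t by fact
 interpret V: lineV D x V by (rule lineVI[OF t.V.ndsp_axioms])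
 interpret W: lineV D x W by (rule lineVI[OF t.W.ndsp_axioms])
 obtain a ls where c: "g = ex.tz (Suc d) V (wedge (Suc d) (eps_obj V) (a # ls)) a" "a\<in>al V" "V.orth a ls" "length ls = d"
  using g unfolding V.lgen_def by auto
 have ac: "a <: V" "a ~= \<zero>\<^bsub>V\<^esub>" using alD c by auto
 have s: "a # ls\<in>tuples (Suc d) V" using c ac by (simp add: V.orth_def)
 have z: "\<zero>\<^bsub>fob (ex.TF (Suc d)) W\<^esub>\<in>Ls (Suc d) W" using W.L_sub[of d] by (simp add: W.ex.T.sub_iff)
 show "fmor (ex.TF (Suc d)) V W t g\<in>Ls (Suc d) W"
 proof (cases "a\<in>dm V W t")
  case True
  obtain v where v: "v <: V" "bil V a v = 1" using t.V.nondeg_ex[OF ac] by auto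
  then have "bil V v a = 1" using t.V.bil_sym[of v a] ac by simp
  note i = cube_image[OF t c(2) True v(1) this c(3)]
  show ?thesis using fmor_wedge[OF t c(2) s] True W.lgen_L[OF i(1,3), of d] c by simp
 qed (use fmor_wedge[OF t c(2) s] z c in simp)
qed

lemma L_sfun: "sfun Tq (Ext_iso (Suc d) D) (Ls (Suc d))"
 by unfold_locales (rule ex.TF_functor[folded Ext_iso_eq] L_subfunctor)+

lemma L_functor: "is_functor Tq (Lf (Suc d))"
 unfolding L_fun_def by (rule sfun.sub_functor[OF L_sfun])

lemma L_fmor [simp]: "fmor (Lf n) = fmor (ex.TF n)"
 by (simp add: L_fun_def Ext_iso_eq)

text \<open>A cube over \<open>a\<close> with directions \<open>a # ls\<close> corresponds to the
  wedge of \<open>a # ls\<close> over \<open>a\<close>. A morphism either kills both, when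
  \<open>a\<close> is outside \<open>dm\<close>, or applies the same linear map to the directions of
  both.\<close>

lemma quot_L: "fun_iso Tq (quotfun (subk d) (ks (Suc d))) (Lf (Suc d))"
proof (rule relation_iso[where R = "%V. lineV.lrel D x V d" and A = "%V. lineV.cgen D x V d" and B = "%V. lineV.lgen D x V d",
   OF sfun.sub_functor[OF subk_sfun] L_functor subk_Suc Tq_closed])
 fix V :: "'a qsp" assume V: "V\<in>Obj Tq"
 then interpret V: lineV D x V by (rule lineVO)
 show "V.lrel d z y ==> z <: fob (subk d) V & y <: fob (Lf (Suc d)) V" for z y
  unfolding V.fob_L V.fob_k by (simp add: V.lrel_def)
 show "V.lrel d \<zero>\<^bsub>fob (subk d) V\<^esub> \<zero>\<^bsub>fob (Lf (Suc d)) V\<^esub>"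
  unfolding V.fob_L V.fob_k using V.lrel_zero by simp
 show "V.lrel d z y ==> V.lrel d z' y' ==> V.lrel d (z \<oplus>\<^bsub>fob (subk d) V\<^esub> z') (y \<oplus>\<^bsub>fob (Lf (Suc d)) V\<^esub> y')" for z y z' y'
  unfolding V.fob_L V.fob_k using V.lrel_add by simp
 show "V.lrel d \<zero>\<^bsub>fob (subk d) V\<^esub> y ==> y = \<zero>\<^bsub>fob (Lf (Suc d)) V\<^esub>" for y
  unfolding V.fob_L V.fob_k using V.lrel_uniq by simp
 show "V.cgen d \<subseteq> carrier (fob (subk d) V) & vspan (fob (subk d) V) (V.cgen d) = carrier (fob (subk d) V)"
  unfolding V.fob_k using V.cgen_KS[of d] V.mx.T.vspan_in_sub[OF V.KS_sub V.cgen_KS, of d] V.KS_eq_cgen[of d] by simp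
 have l: "V.lgen d \<subseteq> Ls (Suc d) V" unfolding V.L_eq by (rule V.ex.T.vspan_incl)
 show "V.lgen d \<subseteq> carrier (fob (Lf (Suc d)) V) & vspan (fob (Lf (Suc d)) V) (V.lgen d) = carrier (fob (Lf (Suc d)) V)"
  unfolding V.fob_L using l V.ex.T.vspan_in_sub[OF V.L_sub l] V.L_eq[of d] by simp
 show "z <: fob (subk d) V ==> V.lrel d z \<zero>\<^bsub>fob (Lf (Suc d)) V\<^esub> \<longleftrightarrow> z\<in>ks (Suc d) V" for z
  unfolding V.fob_L V.fob_k V.k_sub_eq using V.lrel_ker[of z d] by simp
 show "\<exists>z. V.lrel d z b" if "b\<in>V.lgen d" for b
 proof -
  obtain a ls where b: "b = ex.tz (Suc d) V (wedge (Suc d) (eps_obj V) (a # ls)) a" "a\<in>al V" "V.orth a ls" "length ls = d"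
   using \<open>b\<in>V.lgen d\<close> unfolding V.lgen_def by auto
  obtain v where v: "v <: V" "bil V a v = 1" using V.V.nondeg_ex[OF alD(1,2)[OF b(2)]] by auto
  then have "bil V v a = 1" using V.V.bil_sym[of v a] alD(1)[OF b(2)] by simp
  then show ?thesis using V.lrel_cube[OF b(2) v(1) _ b(3,4)] b(1) by blast
 qed
 fix g assume "g\<in>V.cgen d"
 then obtain a v ls where c: "g = mx.tz V (fc V (a # ls) v) a" "a\<in>al V" "v <: V" "bil V v a = 1" "V.orth a ls" "length ls = d"
  unfolding V.cgen_def by auto
 have lc: "set ls \<subseteq> carrier V" using c by (simp add: V.orth_def)
 have s: "a # ls\<in>tuples (Suc d) V" using c alD lc by simp
 let ?y = "ex.tz (Suc d) V (wedge (Suc d) (eps_obj V) (a # ls)) a"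
 have "lineV.lrel D x W d (fmor (subk d) V W t g) (fmor (Lf (Suc d)) V W t ?y)" if W: "W\<in>Obj Tq" "t\<in>Hom Tq V W" for W t
 proof -
  note t = tmorI[OF V W]
  interpret W: lineV D x W by (rule lineVO[OF W(1)])
  have "W.lrel d (fmor mx.TF V W t g) (fmor (ex.TF (Suc d)) V W t ?y)"
  proof (cases "a\<in>dm V W t")
   case True
   note i = cube_image[OF t c(2) True c(3-5)]
   have "eps_mor V W t v <: W" using tmor.eps_mem[OF t c(3)] .
   then show ?thesis
    using fmor_cube[OF t c(2,3) lc] fmor_wedge[OF t c(2) s] True W.lrel_cube[OF i(1) _ i(2,3), of d] c by simp
  qed (use fmor_cube[OF t c(2,3) lc] fmor_wedge[OF t c(2) s] W.lrel_zero[of d] c in simp)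
  then show ?thesis by simp
 qed
 then show "\<exists>y. V.lrel d g y & (ALL W:Obj Tq. ALL t:Hom Tq V W. lineV.lrel D x W d (fmor (subk d) V W t g) (fmor (Lf (Suc d)) V W t y))"
  using V.lrel_cube[OF c(2-6)] c(1) by blast
qed

text \<open>Simplicity is inherited from the quotient of the filtration, where it comes from the
  classification of subfunctors.\<close>

lemma L_simple: "simple_functor Tq (Lf (Suc d))"
 by (rule simple_iso[OF k_simple quot_L])

text \<open>Modulo \<open>ks 1\<close> a fibre over \<open>a\<close> retains a single bit, its
  pairing with \<open>B(-, c)\<close> for any \<open>c\<close> with \<open>B a c = 1\<close>; these
  bits are the coefficients of an element of \<open>F2[al V]\<close>.\<close>

lemma head_iso: "fun_iso Tq (quotfun (Sg) (ks 1)) ik"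
proof (rule relation_iso[where R = "lineV.hrel D x" and A = "%V. lineV.cgen D x V 0" and B = "%V. gen ` qhom D V",
   OF Sigma_functor ik_functor k_Sigma Tq_closed])
 fix V :: "'a qsp" assume V: "V\<in>Obj Tq"
 then interpret V: lineV D x V by (rule lineVO)
 show "V.hrel z y ==> z <: fob (Sg) V & y <: fob ik V" for z y
  by (simp add: V.hrel_def ik_simps)
 show "V.hrel \<zero>\<^bsub>fob (Sg) V\<^esub> \<zero>\<^bsub>fob ik V\<^esub>"
  using V.hrel_zero by (simp add: ik_simps)
 show "V.hrel z y ==> V.hrel z' y' ==> V.hrel (z \<oplus>\<^bsub>fob (Sg) V\<^esub> z') (y \<oplus>\<^bsub>fob ik V\<^esub> y')" for z y z' y'
  using V.hrel_add by (simp add: ik_simps free_simps)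
 show "V.hrel \<zero>\<^bsub>fob (Sg) V\<^esub> y ==> y = \<zero>\<^bsub>fob ik V\<^esub>" for y
  using V.hrel_uniq by (simp add: ik_simps)
 show "V.cgen 0 \<subseteq> carrier (fob (Sg) V) & vspan (fob (Sg) V) (V.cgen 0) = carrier (fob (Sg) V)"
  using V.cgen_KS[of 0] V.mx.T.vspan_in_sub[OF V.KS_sub V.cgen_KS, of 0] V.KS_eq_cgen[of 0] V.KS_0 by simp
 show "gen ` qhom D V \<subseteq> carrier (fob ik V) & vspan (fob ik V) (gen ` qhom D V) = carrier (fob ik V)"
  unfolding ik_simps using free_span[of "qhom D V"] by (intro conjI image_subsetI) simp_all
 show "z <: fob (Sg) V ==> V.hrel z \<zero>\<^bsub>fob ik V\<^esub> \<longleftrightarrow> z\<in>ks 1 V" for z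
  unfolding V.k_sub_eq using V.hrel_ker[of z] by (simp add: ik_simps)
 show "\<exists>z. V.hrel z b" if "b\<in>gen ` qhom D V" for b
 proof -
  obtain a where b: "b = gen (lm V a)" "a\<in>al V" using \<open>b\<in>gen ` qhom D V\<close> by (auto simp: V.ex.qhD)
  obtain v where v: "v <: V" "bil V a v = 1" using V.V.nondeg_ex[OF alD(1,2)[OF b(2)]] by auto
  then have "bil V v a = 1" using V.V.bil_sym[of v a] alD(1)[OF b(2)] by simp
  then show ?thesis using V.hrel_cube[OF b(2) v(1)] b(1) by blast
 qed
 fix g assume "g\<in>V.cgen 0"
 then obtain a v where c: "g = mx.tz V (fc V [a] v) a" "a\<in>al V" "v <: V" "bil V v a = 1"
  unfolding V.cgen_def by auto
 have "lineV.hrel D x W (fmor (Sg) V W t g) (fmor ik V W t (gen (lm V a)))" if W: "W\<in>Obj Tq" "t\<in>Hom Tq V W" for W t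
 proof -
  note t = tmorI[OF V W]
  interpret W: lineV D x W by (rule lineVO[OF W(1)])
  show ?thesis
  proof (cases "a\<in>dm V W t")
   case True
   have o: "V.orth a []" by (simp add: V.orth_def)
   note i = cube_image[OF t c(2) True c(3,4) o]
   have "eps_mor V W t v <: W" using tmor.eps_mem[OF t c(3)] .
   then show ?thesis
    using fmor_cube[OF t c(2,3), of "[]"] ik_gen[OF t c(2)] True W.hrel_cube[OF i(1) _ i(2)] c by simp
  qed (use fmor_cube[OF t c(2,3), of "[]"] ik_gen[OF t c(2)] W.hrel_zero c in simp)
 qed
 then show "\<exists>y. V.hrel g y & (ALL W:Obj Tq. ALL t:Hom Tq V W. lineV.hrel D x W (fmor (Sg) V W t g) (fmor ik V W t y))"
  using V.hrel_cube[OF c(2-4)] c(1) by blast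
qed

text \<open>A long dual system supplies the directions, and the value 1 on the dual forms shows that
  the wedge is nonzero. Orthogonality of \<open>ls\<close> to \<open>c\<close> is recorded for
  \<open>not_kappa\<close>, where a projection to the plane of \<open>a\<close> and \<open>c\<close>
  has to kill them.\<close>

lemma L_witness:
 obtains V a c ls where "ndsp V" "a\<in>al V" "c <: V" "bil V a c = 1" "length ls = d" "lineV.orth V a ls"
  "!!l. l\<in>set ls ==> bil V l c = 0"
  "ex.tz (Suc d) V (wedge (Suc d) (eps_obj V) (a # ls)) a\<in>Ls (Suc d) V"
  "ex.tz (Suc d) V (wedge (Suc d) (eps_obj V) (a # ls)) a ~= \<zero>\<^bsub>fob (ex.TF (Suc d)) V\<^esub>"
proof -
 obtain V a c ps where V: "ndsp V" "a\<in>al V" "c <: V" "bil V a c = 1" "dual V (ps @ [(a, c), (c, a)])" "length ps = d"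
  using big[of d] by blast
 interpret V: lineV D x V by (rule lineVI[OF V(1)])
 have aD: "a <: V" using alD V by simp
 have dps: "dual V ps" by (rule V.dual_append[OF V(5)])
 have o: "bil V b c = 0" "bil V b a = 0" "bil V a c' = 0" "b <: V" "c' <: V" if "(b, c')\<in>set ps" for b c'
  using V.dual_append_orth[OF V(5) that, of a c] V.dual_append_orth[OF V(5) that, of c a] V.V.dual_mem[OF dps that] by auto
 have d2: "dual V ((a, c) # ps)" using V o dps aD by auto
 let ?ls = "map fst ps" and ?us = "map snd ps"
 have ls: "V.orth a ?ls" "length ?ls = d" unfolding V.orth_def using o V(6) by force+
 have lc: "bil V l c = 0" if "l\<in>set ?ls" for l using that o by auto
 have lsc: "set (a # ?ls) \<subseteq> carrier V" "set (c # ?us) \<subseteq> carrier V" using o aD V by auto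
 let ?z = "ex.tz (Suc d) V (wedge (Suc d) (eps_obj V) (a # ?ls)) a"
 have w: "wedge (Suc d) (eps_obj V) (a # ?ls) <: V.X.E (Suc d)" by (rule V.wa_mem[OF V(2) ls])
 have h: "V.X.hat (map (%u w. bil V w u) (c # ?us)) (wedge (Suc d) (eps_obj V) (a # ?ls)) = 1"
  using V.hat_dd[of "c # ?us" "a # ?ls" c "Suc d"] lsc V V.V.dd_dual[OF d2 V(3)] by (simp del: dd.simps mnl_simps V.X.hat.simps)
 have "?z ~= \<zero>\<^bsub>fob (ex.TF (Suc d)) V\<^esub>"
 proof
  assume "?z = \<zero>\<^bsub>fob (ex.TF (Suc d)) V\<^esub>"
  then have "wedge (Suc d) (eps_obj V) (a # ?ls) = \<zero>\<^bsub>V.X.E (Suc d)\<^esub>"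
   using V.ex.cz_tz[of "wedge (Suc d) (eps_obj V) (a # ?ls)" "Suc d" a a] V.ex.cz_zero[of "Suc d" a] w V(2) by simp
  then show False using h V.hat_psi_zero[of "c # ?us" "Suc d"] lsc V(6) by (simp del: V.X.hat.simps)
 qed
 then show ?thesis using that[OF V(1-4) ls(2,1) lc V.lgen_L[OF V(2) ls]] by blast
qed

text \<open>A functor \<open>iota F\<close> sends the morphism of \<open>zero_mor\<close> to the
  identity, because its projection is the identity map; \<open>L\<close> sends it to zero, because
  no nonzero vector lies in its \<open>dm\<close>.\<close>

lemma not_iota:
 fixes F :: "('a fsp, 'a => 'a, 'v) vfun"
 shows "\<not> (is_functor Ef F & fun_iso Tq (iota F) (Lf (Suc d)))"
proof
 assume h: "is_functor Ef F & fun_iso Tq (iota F) (Lf (Suc d))"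
 then obtain \<eta> where n: "nat_trans Tq (iota F) (Lf (Suc d)) \<eta>"
  and b: "!!X. X\<in>Obj Tq ==> bij_betw (\<eta> X) (carrier (fob (iota F) X)) (carrier (fob (Lf (Suc d)) X))"
  unfolding fun_iso_def by blast
 obtain V a c ls where V: "ndsp V" "a\<in>al V" "c <: V" "bil V a c = 1" "length ls = d" "lineV.orth V a ls"
  and z: "ex.tz (Suc d) V (wedge (Suc d) (eps_obj V) (a # ls)) a\<in>Ls (Suc d) V"
   "ex.tz (Suc d) V (wedge (Suc d) (eps_obj V) (a # ls)) a ~= \<zero>\<^bsub>fob (ex.TF (Suc d)) V\<^esub>" (is "?z ~= _")
  using L_witness[of d] by metis
 interpret V: lineV D x V by (rule lineVI[OF V(1)])
 have o: "V\<in>Obj Tq" unfolding Tq_ndsp by (rule V(1))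
 have s: "a # ls\<in>tuples (Suc d) V" using V alD(1)[OF V(2)] by (simp add: V.orth_def)
 obtain t where t: "tmor V V t" "ALL v:carrier V. eps_mor V V t v = v" "dm V V t = {\<zero>\<^bsub>V\<^esub>}" using zero_mor[OF V(1)] by blast
 have e: "eps_mor V V t = Idm Ef (eps_obj V)"
  unfolding Ef_def using t(2) tmor.eps_ext[OF t(1)] by (auto simp: fun_eq_iff extensional_def)
 have "?z\<in>\<eta> V ` carrier (fob (iota F) V)" using b[OF o] z(1) unfolding bij_betw_def V.fob_L by simp
 then obtain y where y0: "?z = \<eta> V y" "y <: fob (iota F) V" by (rule imageE)
 note y = y0(2) y0(1)[symmetric]
 have "fmor (iota F) V V t y = y"
  using is_functorD(3)[of Ef F "eps_obj V" y] h eps_obj_Ef(1)[OF V(1)] y e by (simp add: iota_def)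
 moreover have "\<eta> V (fmor (iota F) V V t y) = fmor (Lf (Suc d)) V V t (\<eta> V y)"
  using n o tmor_hom[OF t(1)] y(1) unfolding nat_trans_def by blast
 moreover have "a \<notin> dm V V t" using t alD V by auto
 ultimately show False using y z fmor_wedge[OF t(1) V(2) s] by simp
qed

text \<open>Two endomorphisms of \<open>V\<close> with \<open>dm\<close> the line of
  \<open>a\<close>, both fixing \<open>a\<close>, have the same span and so the same image under
  \<open>kappa G\<close>. One is the identity on vectors and fixes the witness, the other projects
  to the plane of \<open>a\<close> and \<open>c\<close> and kills it.\<close>

lemma not_kappa:
 fixes G :: "('a qsp, 'a triple set, 'v) vfun"
 assumes d: "d > 0"
 shows "\<not> fun_iso Tq (kappa G) (Lf (Suc d))"
proof
 assume "fun_iso Tq (kappa G) (Lf (Suc d))"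
 then obtain \<eta> where n: "nat_trans Tq (kappa G) (Lf (Suc d)) \<eta>"
  and b: "!!X. X\<in>Obj Tq ==> bij_betw (\<eta> X) (carrier (fob (kappa G) X)) (carrier (fob (Lf (Suc d)) X))"
  unfolding fun_iso_def by blast
 obtain V a c ls where V: "ndsp V" "a\<in>al V" "c <: V" "bil V a c = 1" "length ls = d" "lineV.orth V a ls"
  and lc: "!!l. l\<in>set ls ==> bil V l c = 0"
  and z: "ex.tz (Suc d) V (wedge (Suc d) (eps_obj V) (a # ls)) a\<in>Ls (Suc d) V"
   "ex.tz (Suc d) V (wedge (Suc d) (eps_obj V) (a # ls)) a ~= \<zero>\<^bsub>fob (ex.TF (Suc d)) V\<^esub>" (is "?z ~= _")
  using L_witness[of d] by metis
 interpret V: lineV D x V by (rule lineVI[OF V(1)])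
 have o: "V\<in>Obj Tq" unfolding Tq_ndsp by (rule V(1))
 note aD = alD[OF V(2)]
 have la: "set ls \<subseteq> carrier V" "!!l. l\<in>set ls ==> bil V l a = 0" using V(6) by (auto simp: V.orth_def)
 have s: "a # ls\<in>tuples (Suc d) V" using V(5) la aD by simp
 obtain t where t: "tmor V V t" "ALL v:carrier V. eps_mor V V t v = v" "dm V V t = {\<zero>\<^bsub>V\<^esub>, a}"
  using line_mor[OF V(1,1,2,2) lin_id[OF V.V.f2v_axioms]] by blast
 \<comment> \<open>The orthogonal projection to the hyperbolic plane of \<open>a\<close> and
   \<open>c\<close>: each of the two vectors reads off the coefficient of the other.\<close>
 define p where "p v = (bil V v c \<odot>\<^bsub>V\<^esub> a) \<oplus>\<^bsub>V\<^esub> (bil V v a \<odot>\<^bsub>V\<^esub> c)" for v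
 have p: "p\<in>lin_maps V V"
  by (rule linI[OF V.V.f2v_axioms V.V.f2v_axioms]) (use aD V in "auto simp: p_def V.V.bil_simps V.V.smult_plus V.V.ac")
 have pa: "p a = a" using aD V by (simp add: p_def)
 have "bil V (p w) a = bil V w a" if "w <: V" for w
  using that aD V V.V.bil_sym[of c a] by (simp add: p_def V.V.bil_simps)
 then obtain t' where t': "tmor V V t'" "ALL v:carrier V. eps_mor V V t' v = p v" "dm V V t' = {\<zero>\<^bsub>V\<^esub>, a}"
  using line_mor[OF V(1,1,2,2) p pa] by blast
 have "restrict (eps_mor V V t) {\<zero>\<^bsub>V\<^esub>, a} = restrict (eps_mor V V t') {\<zero>\<^bsub>V\<^esub>, a}"
  using t(2) t'(2) pa aD lin_zero[OF V.V.f2v_axioms V.V.f2v_axioms p] by (auto simp: fun_eq_iff)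
 then have same: "cospan_to_span V V t = cospan_to_span V V t'"
  unfolding tmor.cospan_to_span_eq[OF t(1)] tmor.cospan_to_span_eq[OF t'(1)] t(3) t'(3) by simp
 have "?z\<in>\<eta> V ` carrier (fob (kappa G) V)" using b[OF o] z(1) unfolding bij_betw_def V.fob_L by simp
 then obtain y where y0: "?z = \<eta> V y" "y <: fob (kappa G) V" by (rule imageE)
 note y = y0(2) y0(1)[symmetric]
 have "fmor (Lf (Suc d)) V V s ?z = \<eta> V (fmor (kappa G) V V s y)" if "tmor V V s" for s
  using n o tmor_hom[OF that] y unfolding nat_trans_def by metis
 then have "fmor (ex.TF (Suc d)) V V t ?z = fmor (ex.TF (Suc d)) V V t' ?z" using t(1) t'(1) same by (simp add: kappa_def)
 moreover have "fmor (ex.TF (Suc d)) V V t ?z = ?z"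
 proof -
  have "map (eps_mor V V t) ls = ls" using t(2) la by (intro map_idI) auto
  then show ?thesis using fmor_wedge[OF t(1) V(2) s] t aD by simp
 qed
 moreover have "fmor (ex.TF (Suc d)) V V t' ?z = \<zero>\<^bsub>fob (ex.TF (Suc d)) V\<^esub>"
 proof -
  \<comment> \<open>Here \<open>d > 0\<close> enters: there must be a direction besides
    \<open>a\<close> for the projection to annihilate.\<close>
  obtain l ls' where l: "ls = l # ls'" using d V(5) by (cases ls) auto
  have "eps_mor V V t' l = \<zero>\<^bsub>V\<^esub>" using t'(2) la lc[of l] l aD V by (simp add: p_def)
  moreover have "set (map (eps_mor V V t') ls') \<subseteq> carrier V" using tmor.eps_mem[OF t'(1)] la l by auto
  ultimately have "wedge (Suc d) (eps_obj V) (map (eps_mor V V t') (a # ls)) = \<zero>\<^bsub>V.X.E (Suc d)\<^esub>"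
   using V.X.w_zero[of "[a]" "map (eps_mor V V t') ls'" "Suc d"] l V(5) t'(2) pa aD by simp
  then show ?thesis using fmor_wedge[OF t'(1) V(2) s] t' pa aD V.ex.tz_zero[OF V(2), of "Suc d"] by simp
 qed
 ultimately show False using z by simp
qed

end

theorem mainTheorem1:
  fixes D :: "'a::infinite qsp" and x :: 'a and \<alpha> :: bit
  assumes "line_qspace D x \<alpha>"
  shows
   "subfunctor Tq (PF_iso D) (Mix_sub D x) \<and>
    infinite_functor Tq (Mix D x) \<and>
    subfunctor Tq (Mix D x) (Sigma_sub D x) \<and>
    (\<exists>p. short_exact Tq (Sigma_fun D x) (Mix D x) (Sigma_fun D x) (\<lambda>V z. z) p) \<and>
    uniserial Tq (Sigma_fun D x) \<and>
    composition_series Tq (Sigma_fun D x) \<infinity> (\<lambda>d. k_sub d D x) \<and>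
    (\<forall>N S. composition_series Tq (Sigma_fun D x) N S \<longrightarrow>
       N = \<infinity> \<and> (\<forall>d. sub_eq Tq (S d) (k_sub d D x))) \<and>
    sub_eq Tq (radical Tq (Sigma_fun D x)) (k_sub 1 D x) \<and>
    fun_iso Tq (quotfun (Sigma_fun D x) (k_sub 1 D x)) (kappa (iso_fun D)) \<and>
    simple_functor Sp (iso_fun D) \<and>
    (\<forall>d>0.
       fun_iso Tq (quotfun (subfun (Sigma_fun D x) (k_sub d D x)) (k_sub (d + 1) D x))
         (L_fun (d + 1) D x) \<and>
       simple_functor Tq (L_fun (d + 1) D x) \<and>
       \<not> (\<exists>F :: ('a fsp, 'a \<Rightarrow> 'a, 'v) vfun. is_functor Ef F \<and> fun_iso Tq (iota F) (L_fun (d + 1) D x)) \<and>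
       \<not> (\<exists>G :: ('a qsp, 'a triple set, 'w) vfun. is_functor Sp G \<and> fun_iso Tq (kappa G) (L_fun (d + 1) D x)) \<and>
       subfunctor Tq (Ext_iso (d + 1) D) (L_sub (d + 1) D x))"
proof -
 have "qf D x = \<alpha>" using assms by (simp add: line_qspace_def)
 then interpret line D x using assms by unfold_locales simp
 show ?thesis
  unfolding Suc_eq_plus1[symmetric]
  by (intro conjI allI impI; (elim exE conjE)?)
   (use Mix_subfunctor Mix_infinite Sigma_Mix Sigma_exact uni k_series series_unique Sigma_radical head_iso iso_simple
    quot_L L_simple not_iota not_kappa L_subfunctor in blast)+
qed

end
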